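(* Let $T>0$. Assume that $b\in L^1(0,T;W^{1,1}_{loc})$ is a vector field satisfying $$\frac{|b(t,x)|}{1+|x|}\in L^1(0,T;L^1)+L^1(0,T;L^\infty)$$ and $$\operatorname{div} b\in L^1(0,T;L^\infty)+L^1\left(0,T;\operatorname{Exp}\left(\tfrac{L}{\log L}\right)\right).$$ Then for each $u_0\in L^\infty$ there exists a unique weak solution $u\in L^\infty(0,T;L^\infty)$ of the transport problem $$\begin{cases}\dfrac{\partial u}{\partial t}+b\cdot\nabla u=0 & \text{in }(0,T)\times\mathbb{R}^n,\\ u(0,\cdot)=u_0 & \text{in }\mathbb{R}^n.\end{cases}$$
   Context: All function spaces in the space variable are over $\mathbb{R}^n$ (e.g. $L^p=L^p(\mathbb{R}^n)$), $b=b(t,x)$ takes values in $\mathbb{R}^n$, and $\operatorname{div}$, $\nabla$ are with respect to $x$. $L^q(0,T;X)$ denotes the usual space of (classes of) functions $t\mapsto f(t,\cdot)\in X$ whose $X$-norm is in $L^q(0,T)$; for local spaces such as $W^{1,1}_{loc}$ this is required on every ball of $\mathbb{R}^n$. For spaces $A,B$, $A+B$ is the set of sums $a+b'$ with $a\in A$, $b'\in B$. Orlicz space: let $\log^+t:=\max\{1,\log t\}$ and $P(t)=\exp\left\{\frac{t}{\log^+t}\right\}-1$ for $t\ge0$. Then $\operatorname{Exp}(\frac{L}{\log L})$ is the set of measurable $f$ on $\mathbb{R}^n$ for which $$\|f\|_{\operatorname{Exp}(\frac{L}{\log L})}=\inf\left\{\lambda>0:\int_{\mathbb{R}^n}P\left(\frac{|f(x)|}{\lambda}\right)dx\le1\right\}$$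 is finite. Weak solution: $u\in L^1(0,T;L^1_{loc})$ is a weak solution of the problem if for each $\varphi\in C^\infty([0,T]\times\mathbb{R}^n)$ with compact support in $[0,T)\times\mathbb{R}^n$, $$-\int_0^T\int_{\mathbb{R}^n}u\,\frac{\partial\varphi}{\partial t}\,dx\,dt-\int_{\mathbb{R}^n}u_0\,\varphi(0,\cdot)\,dx-\int_0^T\int_{\mathbb{R}^n}u\,\operatorname{div}(b\varphi)\,dx\,dt=0.$$ *)

theory Defs
  imports "HOL-Analysis.Analysis" "HOL-Probability.Essential_Supremum"
begin

section \<open>Smooth functions and test functions\<close>

primrec iterated_derivative ::
  "'a list \<Rightarrow> ('a::euclidean_space \<Rightarrow> 'b::real_normed_vector) \<Rightarrow> 'a \<Rightarrow> 'b" where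
  "iterated_derivative [] f = f"
| "iterated_derivative (v # vs) f = (\<lambda>x. frechet_derivative (iterated_derivative vs f) (at x) v)"

definition smooth :: "('a::euclidean_space \<Rightarrow> 'b::real_normed_vector) \<Rightarrow> bool" where
  "smooth f \<longleftrightarrow> (\<forall>vs. iterated_derivative vs f differentiable_on UNIV)"

definition test_function :: "'a::euclidean_space set \<Rightarrow> ('a \<Rightarrow> real) \<Rightarrow> bool" where
  "test_function \<Omega> \<phi> \<longleftrightarrow> smooth \<phi> \<and>
     compact (closure {x. \<phi> x \<noteq> 0}) \<and> closure {x. \<phi> x \<noteq> 0} \<subseteq> \<Omega>"

(* C^\<infinity> functions on the closed strip [0,T] x R^n are taken to be the restrictions of smooth
   functions on R x R^n. Only the values on the strip enter the support condition, and the support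
   may meet {0} x R^n. *)
definition spacetime_test_function :: "real \<Rightarrow> (real \<times> 'a::euclidean_space \<Rightarrow> real) \<Rightarrow> bool" where
  "spacetime_test_function T \<phi> \<longleftrightarrow> smooth \<phi> \<and>
     (let S = closure {p \<in> {0..T} \<times> UNIV. \<phi> p \<noteq> 0} in compact S \<and> S \<subseteq> {0..<T} \<times> UNIV)"


section \<open>Weak derivatives and weak divergence\<close>

definition locally_integrable ::
  "'a::euclidean_space set \<Rightarrow> ('a \<Rightarrow> 'b::euclidean_space) \<Rightarrow> bool" where
  "locally_integrable \<Omega> f \<longleftrightarrow> (\<forall>K. compact K \<longrightarrow> K \<subseteq> \<Omega> \<longrightarrow> f absolutely_integrable_on K)"

definition has_weak_partial ::
  "'a::euclidean_space set \<Rightarrow> 'a \<Rightarrow> ('a \<Rightarrow> 'b::euclidean_space) \<Rightarrow> ('a \<Rightarrow> 'b) \<Rightarrow> bool" where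
  "has_weak_partial \<Omega> i f g \<longleftrightarrow> locally_integrable \<Omega> f \<and> locally_integrable \<Omega> g \<and>
     (\<forall>\<phi>. test_function \<Omega> \<phi> \<longrightarrow>
        (LINT x:\<Omega>|lebesgue. frechet_derivative \<phi> (at x) i *\<^sub>R f x)
          = - (LINT x:\<Omega>|lebesgue. \<phi> x *\<^sub>R g x))"

(* frechet_derivative \<phi> (at x) (f x) is the scalar product of f x with the gradient of \<phi> at x. *)
definition has_weak_div ::
  "('a::euclidean_space \<Rightarrow> 'a) \<Rightarrow> ('a \<Rightarrow> real) \<Rightarrow> bool" where
  "has_weak_div f d \<longleftrightarrow> locally_integrable UNIV f \<and> locally_integrable UNIV d \<and>
     (\<forall>\<phi>. test_function UNIV \<phi> \<longrightarrow>
        (LINT x|lebesgue. frechet_derivative \<phi> (at x) (f x))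
          = - (LINT x|lebesgue. \<phi> x * d x))"

definition spacetime :: "real \<Rightarrow> (real \<times> 'a::euclidean_space) measure" where
  "spacetime T = lebesgue_on ({0<..<T} \<times> UNIV)"

(* The divergence in x of a time-dependent field: a jointly measurable representative, which is
   unique up to null sets of (0,T) x R^n. Unspecified if there is none; fields in
   L^1(0,T;W^{1,1}_loc) and their products with test functions do have one. *)
definition weak_div ::
  "real \<Rightarrow> (real \<Rightarrow> 'a::euclidean_space \<Rightarrow> 'a) \<Rightarrow> real \<Rightarrow> 'a \<Rightarrow> real" where
  "weak_div T b = (SOME d. (\<lambda>(t, x). d t x) \<in> borel_measurable (spacetime T) \<and>
     (AE t in lebesgue_on {0<..<T}. has_weak_div (b t) (d t)))"


section \<open>Norms of functions of the space variable\<close>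

(* A space X is represented by its extended norm, which is \<infinity> on the functions outside X. *)

definition L1_norm ::
  "'a::euclidean_space set \<Rightarrow> ('a \<Rightarrow> 'b::euclidean_space) \<Rightarrow> ennreal" where
  "L1_norm \<Omega> f = (if f \<in> borel_measurable (lebesgue_on \<Omega>)
     then \<integral>\<^sup>+x. ennreal (norm (f x)) \<partial>lebesgue_on \<Omega> else \<infinity>)"

definition Linf_norm :: "('a::euclidean_space \<Rightarrow> 'b::euclidean_space) \<Rightarrow> ennreal" where
  "Linf_norm f = (if f \<in> borel_measurable lebesgue
     then esssup lebesgue (\<lambda>x. ennreal (norm (f x))) else \<infinity>)"

(* The weak gradient g is unique up to null sets, so the infimum only serves to select it, and to
   give the value \<infinity> if it does not exist. *)
definition W11_norm ::
  "'a::euclidean_space set \<Rightarrow> ('a \<Rightarrow> 'b::euclidean_space) \<Rightarrow> ennreal" where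
  "W11_norm \<Omega> f = Inf {L1_norm \<Omega> f + (\<Sum>i\<in>Basis. L1_norm \<Omega> (g i)) | g.
     \<forall>i\<in>Basis. has_weak_partial \<Omega> i f (g i)}"

definition log_plus :: "real \<Rightarrow> real" where
  "log_plus t = max 1 (ln t)"

definition orlicz_P :: "real \<Rightarrow> real" where
  "orlicz_P t = exp (t / log_plus t) - 1"

definition ExpL_logL_norm :: "('a::euclidean_space \<Rightarrow> real) \<Rightarrow> ennreal" where
  "ExpL_logL_norm f = (if f \<in> borel_measurable lebesgue
     then Inf {ennreal l | l. l > 0 \<and> (\<integral>\<^sup>+x. ennreal (orlicz_P (\<bar>f x\<bar> / l)) \<partial>lebesgue) \<le> 1}
     else \<infinity>)"

definition Linf :: "('a::euclidean_space \<Rightarrow> 'b::euclidean_space) set" where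
  "Linf = {f. Linf_norm f < \<infinity>}"


section \<open>Function spaces in space and time\<close>

(* Elements are functions on (0,T) x R^n rather than classes. Measurability is joint Lebesgue
   measurability in (t,x), not strong (Bochner) measurability into the possibly non-separable X. *)

definition L1_time ::
  "real \<Rightarrow> (('a::euclidean_space \<Rightarrow> 'b::euclidean_space) \<Rightarrow> ennreal) \<Rightarrow> (real \<Rightarrow> 'a \<Rightarrow> 'b) set" where
  "L1_time T N = {f. (\<lambda>(t, x). f t x) \<in> borel_measurable (spacetime T) \<and>
     (\<lambda>t. N (f t)) \<in> borel_measurable (lebesgue_on {0<..<T}) \<and>
     (\<integral>\<^sup>+t. N (f t) \<partial>lebesgue_on {0<..<T}) < \<infinity>}"

definition Linf_time ::
  "real \<Rightarrow> (('a::euclidean_space \<Rightarrow> 'b::euclidean_space) \<Rightarrow> ennreal) \<Rightarrow> (real \<Rightarrow> 'a \<Rightarrow> 'b) set" where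
  "Linf_time T N = {f. (\<lambda>(t, x). f t x) \<in> borel_measurable (spacetime T) \<and>
     (\<lambda>t. N (f t)) \<in> borel_measurable (lebesgue_on {0<..<T}) \<and>
     esssup (lebesgue_on {0<..<T}) (\<lambda>t. N (f t)) < \<infinity>}"

definition L1_time_loc ::
  "real \<Rightarrow> ('a set \<Rightarrow> ('a::euclidean_space \<Rightarrow> 'b::euclidean_space) \<Rightarrow> ennreal)
     \<Rightarrow> (real \<Rightarrow> 'a \<Rightarrow> 'b) set" where
  "L1_time_loc T N = {f. \<forall>c r. f \<in> L1_time T (N (ball c r))}"

definition sum_space ::
  "(real \<Rightarrow> 'a \<Rightarrow> 'b::plus) set \<Rightarrow> (real \<Rightarrow> 'a \<Rightarrow> 'b) set \<Rightarrow> (real \<Rightarrow> 'a \<Rightarrow> 'b) set" where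
  "sum_space A B = {\<lambda>t x. f t x + g t x | f g. f \<in> A \<and> g \<in> B}"


section \<open>Weak solutions of the transport problem\<close>

(* For u in L^\<infinity>(0,T;L^\<infinity>), u0 in L^\<infinity> and b in L^1(0,T;W^{1,1}_loc) all integrands below
   are integrable, so the convention that a divergent integral is 0 plays no role. *)
definition weak_solution ::
  "real \<Rightarrow> (real \<Rightarrow> 'a::euclidean_space \<Rightarrow> 'a) \<Rightarrow> ('a \<Rightarrow> real) \<Rightarrow> (real \<Rightarrow> 'a \<Rightarrow> real) \<Rightarrow> bool" where
  "weak_solution T b u0 u \<longleftrightarrow> u \<in> L1_time_loc T L1_norm \<and>
     (\<forall>\<phi>. spacetime_test_function T \<phi> \<longrightarrow>
        - (LINT t:{0<..<T}|lebesgue. LINT x|lebesgue. u t x * deriv (\<lambda>s. \<phi> (s, x)) t)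
        - (LINT x|lebesgue. u0 x * \<phi> (0, x))
        - (LINT t:{0<..<T}|lebesgue. LINT x|lebesgue.
             u t x * weak_div T (\<lambda>t x. \<phi> (t, x) *\<^sub>R b t x) t x) = 0)"

end

(* Uniqueness. The square of a difference w of two bounded weak solutions solves the same
   transport equation (DiPerna-Lions): mollify in x, and control the commutator by the L^1
   continuity of translations of the weak gradient of b. Testing with the square of the weight
   p(x) = (1 + |x|^2/R^2)^-(n+1), whose logarithmic gradient compensates the growth of b, one finds
   for Y = int w^2 p^2 that dY <= a(t) (s Y + s exp(-s / ln s)) dt + (error -> 0 as R -> oo) for all
   s >= e^2; the last term is Young's inequality for the Orlicz function P. Choosing s ~ 2 k ln k
   while Y is between exp(-k-1) and exp(-k), passing each such level takes a part 1 / (k ln k) of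
   the integral of a. Since the sum of 1 / (k ln k) diverges (Osgood), Y = 0.
   Existence. For test functions f, the integral of |f(0,x)| is at most that of
   |f_t + div(b f)|: this is the renormalised backward equation for sqrt(f^2 + d^2) - d, d -> 0.
   Hence -(f_t + div(b f)) |-> int u0 f(0,.) is bounded in the L^1 norm, and Hahn-Banach with the
   duality of L^1 and L^oo yields u. *)
theory Submission
  imports Defs "HOL-Probability.Probability"
begin

text \<open>The hypotheses give a weak gradient of b only for almost every t and on one ball at a
  time, with no measurability jointly in t and x. The proof therefore never integrates a gradient in
  time: gradients enter through the bounds \<open>M k t\<close>, which are integrable in t, while
  the one quantity that has to be jointly measurable, the divergence, is recovered as a limit of
  difference quotients. The exponent n+1 makes p^2 integrable, and (1+|x|) |grad p| is at most 3
  (n+1) p for R >= 1. In the bound for dY the part of |b| / (1+|x|) that is L^1 in x is multiplied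
  by a factor that is at most 3 and tends to 0 pointwise as R -> oo; this is the source of the
  vanishing error. The size s ~ 2 k ln k is what makes s / ln s >= k, so that exp(-s / ln s) is no
  larger than the level exp(-k). In the existence half the function that is renormalised is itself a
  test function, so the chain rule holds outright and no commutator appears.\<close>

abbreviation nn_lborel (binder "NN " 10) where "nn_lborel f \<equiv> nn_integral lborel f"
abbreviation integral_lborel (binder "LL " 60) where "integral_lborel f \<equiv> integral\<^sup>L lborel f"
abbreviation ae_lborel (binder "AL " 10) where "ae_lborel P \<equiv> almost_everywhere lborel P"
abbreviation "ilb \<equiv> integrable lborel"
abbreviation "ind \<equiv> indicator"
abbreviation "ib r \<equiv> indicator (ball 0 r)"
abbreviation "iT T \<equiv> indicator {0<..<T}"
abbreviation "bm \<equiv> borel_measurable borel"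
abbreviation "bm2 \<equiv> borel_measurable (borel \<Otimes>\<^sub>M borel)"
lemmas ibd = Bochner_Integration.integrable_bound
lemmas iadd = Bochner_Integration.integrable_add and idiff = Bochner_Integration.integrable_diff and imr = integrable_mult_right
lemmas ladd = Bochner_Integration.integral_add and ldiff = Bochner_Integration.integral_diff
lemmas lcong = Bochner_Integration.integral_cong and ldct = integral_dominated_convergence

section \<open>Smooth functions\<close>

text \<open>Membership in \<open>X\<close> passes to all iterated derivatives by induction on the
  list of directions. Smoothness is shown below by naming a class of functions that is closed under
  directional derivatives, without computing any higher derivative.\<close>

lemma smooth_coinduct:
 assumes X: "X f"
 and step: "!!g. X g ==> EX g'. (ALL x. (g has_derivative g' x) (at x)) & (ALL v. X (%x. g' x v))"
 shows "smooth f"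
proof -
 have "X (iterated_derivative vs f)" for vs
 proof (induction vs)
 case (Cons v vs)
 then obtain g' where g': "!!x. (iterated_derivative vs f has_derivative g' x) (at x)"
 "X (%x. g' x v)" using step by blast
 have "frechet_derivative (iterated_derivative vs f) (at x) = g' x" for x
 using g'(1) frechet_derivative_at by metis
 then show ?case using g'(2) by simp
 qed (simp add: X)
 then show ?thesis
 unfolding smooth_def differentiable_on_def
 by (metis UNIV_I step differentiable_def)
qed

lemma smooth_has_derivative:
 "smooth f ==> (f has_derivative frechet_derivative f (at x)) (at x)"
 using frechet_derivative_works unfolding smooth_def differentiable_on_def
 by (metis UNIV_I iterated_derivative.simps(1))

lemma iterated_derivative_append:
 "iterated_derivative vs (iterated_derivative ws f) = iterated_derivative (vs @ ws) f"
 by (induction vs) auto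

lemma smooth_frechet_derivative: "smooth f ==> smooth (%x. frechet_derivative f (at x) v)"
 using iterated_derivative_append[of _ "[v]" f] unfolding smooth_def by auto

lemma smooth_continuous: "smooth f ==> continuous_on S f"
 by (meson continuous_at_imp_continuous_on has_derivative_continuous smooth_has_derivative)

lemma smooth_from_derivative:
 assumes "!!x. (f has_derivative f' x) (at x)" "!!v. smooth (%x. f' x v)"
 shows "smooth f"
proof (rule smooth_coinduct[where X="%g. g = f \<or> smooth g"])
 fix g assume "g = f \<or> smooth g"
 then show "EX g'. (ALL x. (g has_derivative g' x) (at x)) & (ALL v. (%x. g' x v) = f \<or> smooth (%x. g' x v))"
 proof
 assume "g = f" then show ?thesis using assms by (intro exI[of _ f']) auto
 next
 assume "smooth g" then show ?thesis
 using smooth_has_derivative smooth_frechet_derivative by (intro exI[of _ "%x. frechet_derivative g (at x)"]) auto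
 qed
qed simp

lemma smooth_const [simp]: "smooth (%x. c)"
 by (rule smooth_coinduct[where X="%g. EX c. g = (%x. c)"]) (auto intro!: exI[of _ "%x v. 0"])

lemma smooth_bounded_linear: "bounded_linear f ==> smooth f"
 by (rule smooth_from_derivative[where f'="%x. f"])
 (auto intro: bounded_linear_imp_has_derivative)

lemma smooth_add: "smooth f ==> smooth g ==> smooth (%x. f x + g x)"
proof (rule smooth_coinduct[where X="%h. EX f g. smooth f & smooth g & h = (%x. f x + g x)"], blast, clarify)
 fix f g :: "'a => 'b" assume "smooth f" "smooth g"
 then show "EX g'. (ALL x. ((%x. f x + g x) has_derivative g' x) (at x)) &
  (ALL v. EX fa ga. smooth fa & smooth ga & (%x. g' x v) = (%x. fa x + ga x))"
 by (intro exI[of _ "%x v. frechet_derivative f (at x) v + frechet_derivative g (at x) v"])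
 (auto intro!: has_derivative_add smooth_has_derivative smooth_frechet_derivative)
qed

text \<open>Products of two smooth functions are not closed under differentiation, but finite sums
  of such products are, by the product rule. This is the class for the coinduction.\<close>

inductive mult_closure :: "('a::euclidean_space => real) => bool" where
 prod: "smooth f ==> smooth g ==> mult_closure (%x. f x * g x)"
| sum: "mult_closure f ==> mult_closure g ==> mult_closure (%x. f x + g x)"

lemma smooth_mult:
 fixes f g :: "'a::euclidean_space => real"
 assumes "smooth f" "smooth g"
 shows "smooth (%x. f x * g x)"
proof (rule smooth_coinduct[where X=mult_closure])
 show "mult_closure (%x. f x * g x)" using assms by (rule prod)
 fix h :: "'a => real" assume "mult_closure h"
 then show "EX h'. (ALL x. (h has_derivative h' x) (at x)) & (ALL v. mult_closure (%x. h' x v))"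
 proof induction
 case (prod f g)
 then show ?case
 by (intro exI[of _ "%x v. f x * frechet_derivative g (at x) v + frechet_derivative f (at x) v * g x"])
  (auto intro!: has_derivative_mult smooth_has_derivative mult_closure.intros smooth_frechet_derivative)
 next
 case (sum f g)
 then obtain f' g' where "ALL x. (f has_derivative f' x) (at x)" "ALL v. mult_closure (%x. f' x v)"
 "ALL x. (g has_derivative g' x) (at x)" "ALL v. mult_closure (%x. g' x v)" by blast
 then show ?case
 by (intro exI[of _ "%x v. f' x v + g' x v"]) (auto intro!: has_derivative_add mult_closure.sum)
 qed
qed

lemma smooth_cmult: "smooth f ==> smooth (%x. c * f x)" for f :: "'a::euclidean_space => real"
 by (rule smooth_mult) auto

lemma smooth_diff: "smooth f ==> smooth g ==> smooth (%x. f x - g x)"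
 for f :: "'a::euclidean_space => real"
 using smooth_add[of f "%x. (-1) * g x"] smooth_cmult[of g "-1"] by simp

lemma smooth_affine:
 assumes "smooth f" "bounded_linear L"
 shows "smooth (%x. f (c + L x))"
proof (rule smooth_coinduct[where X="%h. EX f. smooth f & h = (%x. f (c + L x))"], use assms in blast, clarify)
 fix f :: "'a => 'b" assume f: "smooth f"
 have "((%x. f (c + L x)) has_derivative (%v. frechet_derivative f (at (c + L x)) (L v))) (at x)" for x
 by (rule has_derivative_compose[of "%x. c + L x" L])
 (auto intro!: derivative_eq_intros bounded_linear_imp_has_derivative assms smooth_has_derivative f)
 then show "EX g'. (ALL x. ((%x. f (c + L x)) has_derivative g' x) (at x)) &
   (ALL v. EX fa. smooth fa & (%x. g' x v) = (%x. fa (c + L x)))"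
 by (intro exI[of _ "%x v. frechet_derivative f (at (c + L x)) (L v)"])
 (use f smooth_frechet_derivative in blast)
qed

lemma smooth_linear_compose: "smooth f ==> bounded_linear L ==> smooth (%x. f (L x))"
 using smooth_affine[of f L 0] by simp

text \<open>The chain rule turns h(f) into h'(f) times a derivative of f, so the class for the
  coinduction has to admit a smooth factor \<open>g\<close> next to \<open>h (f x)\<close>, and
  sums.\<close>

inductive comp_closure :: "('a::euclidean_space => real) => ('a => real) => bool" for f where
 comp: "smooth h ==> smooth g ==> comp_closure f (%x. h (f x) * g x)"
| sum: "comp_closure f g ==> comp_closure f h ==> comp_closure f (%x. g x + h x)"

lemma smooth_compose:
 fixes f :: "'a::euclidean_space => real" and h :: "real => real"
 assumes h: "smooth h" and f: "smooth f"
 shows "smooth (%x. h (f x))"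
proof (rule smooth_coinduct[where X="comp_closure f"])
 show "comp_closure f (%x. h (f x))" using comp[OF h smooth_const[of 1], of f] by simp
 fix g :: "'a => real" assume "comp_closure f g"
 then show "EX g'. (ALL x. (g has_derivative g' x) (at x)) & (ALL v. comp_closure f (%x. g' x v))"
 proof induction
 case (comp h g)
 \<comment> \<open>A linear map on the reals is multiplication by its value at 1. This separates the
   factor h'(f x), again a smooth function of f x, from the direction v.\<close>
 have lin: "frechet_derivative h (at s) v = frechet_derivative h (at s) 1 * v" for s v
 using linear_scale[OF has_derivative_linear[OF smooth_has_derivative[OF comp(1), of s]], of v 1]
 by (simp add: mult.commute)
 have 1: "((%x. h (f x)) has_derivative
 (%v. frechet_derivative h (at (f x)) (frechet_derivative f (at x) v))) (at x)" for x
 by (rule has_derivative_compose[OF smooth_has_derivative[OF f]]) (rule smooth_has_derivative[OF comp(1)])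
 have 2: "((%x. h (f x) * g x) has_derivative (%v. h (f x) * frechet_derivative g (at x) v +
  frechet_derivative h (at (f x)) 1 * (frechet_derivative f (at x) v * g x))) (at x)" for x
 using has_derivative_mult[OF 1 smooth_has_derivative[OF comp(2)], of x]
 by (subst (asm) lin) (simp add: mult.assoc)
 show ?case
 by (intro exI[of _ "%x v. h (f x) * frechet_derivative g (at x) v +
  frechet_derivative h (at (f x)) 1 * (frechet_derivative f (at x) v * g x)"])
 (use comp f 2 in \<open>auto intro!: comp_closure.intros smooth_frechet_derivative smooth_mult\<close>)
 next
 case (sum g h)
 then obtain f' g' where "ALL x. (g has_derivative f' x) (at x)" "ALL v. comp_closure f (%x. f' x v)"
 "ALL x. (h has_derivative g' x) (at x)" "ALL v. comp_closure f (%x. g' x v)" by blast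
 then show ?case
 by (intro exI[of _ "%x v. f' x v + g' x v"]) (auto intro!: has_derivative_add comp_closure.sum)
 qed
qed

section \<open>The flat function exp(-1/s)\<close>

definition expinv :: "real => real" where
 "expinv s = (if s > 0 then exp (- (1 / s)) else 0)"

text \<open>Used with u = 1/s as s decreases to 0, where it says that \<open>expinv\<close> and all
  its derivatives are flat at 0.\<close>

lemma poly_exp_tendsto_0: "((%u::real. poly p u * exp (- u)) \<longlongrightarrow> 0) at_top"
proof -
 have "((%u::real. coeff p i * (u ^ i / exp u)) \<longlongrightarrow> 0) at_top" for i
 using tendsto_mult[OF tendsto_const[of "coeff p i"] tendsto_power_div_exp_0[of i]] by simp
 then have "((%u::real. \<Sum>i\<le>degree p. coeff p i * (u ^ i / exp u)) \<longlongrightarrow> (\<Sum>i\<le>degree p. 0)) at_top"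
 by (intro tendsto_sum)
 then show ?thesis by (simp add: poly_altdef sum_distrib_right exp_minus divide_inverse mult.assoc)
qed

lemma smooth_expinv: "smooth expinv"
proof -
 define H :: "real poly => real => real" where
 "H p s = (if s > 0 then poly p (1 / s) * exp (- (1 / s)) else 0)" for p s
 \<comment> \<open>With u = 1/s one has u' = -u^2, hence the derivative of p(u) exp(-u) is u^2 (p(u)
   - p'(u)) exp(-u). So the functions \<open>H p\<close> are closed under differentiation.\<close>
 have der: "(H p has_real_derivative H ([:0,0,1:] * (p - pderiv p)) s) (at s)" for p s
 proof (rule linorder_cases[of s 0])
 assume "s < 0"
 moreover have "((%_. 0) has_real_derivative 0) (at s)" by simp
 ultimately show ?thesis unfolding H_def
 by (auto intro: has_field_derivative_transform_within_open[where S="{..<0}" and f="%_. 0::real"])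
 next
 assume s: "s > 0"
 have *: "((%s. poly p (1 / s) * exp (- (1 / s))) has_real_derivative
  poly ([:0,0,1:] * (p - pderiv p)) (1 / s) * exp (- (1 / s))) (at s)"
 using s by (auto intro!: derivative_eq_intros DERIV_chain2[OF poly_DERIV] simp: field_simps power2_eq_square)
 have "(H p has_real_derivative poly ([:0,0,1:] * (p - pderiv p)) (1 / s) * exp (- (1 / s))) (at s)"
 by (rule has_field_derivative_transform_within_open[OF *, where S="{0<..}"]) (auto simp: H_def s)
 then show ?thesis using s by (simp add: H_def)
 next
 assume s: "s = 0"
 have "((%h. H p h / h) \<longlongrightarrow> 0) (at_right 0)"
 proof -
 \<comment> \<open>At 0 the difference quotient of \<open>H p\<close> has the same shape again,
   since division by h multiplies the polynomial by u = 1/h.\<close>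
 have "((%h. poly (p * [:0,1:]) (inverse h) * exp (- (inverse h))) \<longlongrightarrow> 0) (at_right (0::real))"
  by (rule filterlim_compose[OF poly_exp_tendsto_0 filterlim_inverse_at_top_right])
 then show ?thesis
  by (rule Lim_transform_eventually)
  (auto simp: H_def eventually_at_filter field_simps intro!: always_eventually)
 qed
 moreover have "((%h. H p h / h) \<longlongrightarrow> 0) (at_left 0)"
 by (rule Lim_transform_eventually[OF tendsto_const])
  (auto simp: H_def eventually_at_filter)
 ultimately have "((%h. H p h / h) \<longlongrightarrow> 0) (at 0)"
 by (simp add: filterlim_at_split)
 then show ?thesis using s by (simp add: DERIV_def H_def)
 qed
 have X: "expinv = H 1" by (auto simp: expinv_def H_def)
 define H2 where "H2 = (%c p s. c * H p s)"
 show ?thesis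
 proof (rule smooth_coinduct[where X="%h. EX c p. h = (%s. c * H p s)"])
 show "EX c p. expinv = (%s. c * H p s)" unfolding X by (intro exI[of _ 1]) auto
 fix g assume "EX c p. g = (%s. c * H p s)"
 then obtain c p where g: "g = (%s. c * H p s)" by blast
 let ?q = "[:0,0,1:] * (p - pderiv p)"
 have "(g has_derivative (%v. c * (H ?q x * v))) (at x)" for x
 unfolding g using has_derivative_mult_right[OF der[unfolded has_field_derivative_def], of c] by simp
 then show "EX g'. (ALL x. (g has_derivative g' x) (at x)) & (ALL v. EX c p. (%x. g' x v) = (%s. c * H p s))"
 by (intro exI[of _ "%x v. c * (H ?q x * v)"]) (auto intro!: exI[of _ "c * _"] exI[of _ ?q])
 qed
qed

lemma smooth_norm_square: "smooth (%x::'a::euclidean_space. x \<bullet> x)"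
proof (rule smooth_from_derivative[where f'="%x v. 2 * (x \<bullet> v)"])
 show "((%x::'a. x \<bullet> x) has_derivative (%v. 2 * (x \<bullet> v))) (at x)" for x :: 'a
 by (auto intro!: derivative_eq_intros simp: inner_commute)
 show "smooth (%x::'a. 2 * (x \<bullet> v))" for v
 by (intro smooth_cmult smooth_bounded_linear bounded_linear_inner_left)
qed

section \<open>Translation invariance and continuity of translations in the mean\<close>

lemma lborel_distr_shift: "distr lborel borel (%x. x + h) = (lborel :: 'a::euclidean_space measure)"
proof -
 have "(%x. x + h) = (+) h" by (auto simp: add.commute)
 then show ?thesis using lborel_distr_plus[of h] by simp
qed

lemma lborel_distr_reflect: "distr lborel borel (%x. h - x) = (lborel :: 'a::euclidean_space measure)"
 by (subst lborel_affine[of "-1" h]) (auto simp: density_1)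

lemma lborel_integrable_shift:
 fixes f :: "'a::euclidean_space => 'b::{banach, second_countable_topology}"
 assumes "f : bm"
 shows "ilb (%x. f (x + h)) \<longleftrightarrow> ilb f"
 using integrable_distr_eq[of "%x. x + h" lborel borel f] assms by (simp add: lborel_distr_shift)

lemma lborel_integral_shift:
 fixes f :: "'a::euclidean_space => 'b::{banach, second_countable_topology}"
 assumes "f : bm"
 shows "(LL x. f (x + h)) = (LL x. f x)"
 using integral_distr[of "%x. x + h" lborel borel f] assms by (simp add: lborel_distr_shift)

lemma lborel_integrable_reflect:
 fixes f :: "'a::euclidean_space => 'b::{banach, second_countable_topology}"
 assumes "f : bm"
 shows "ilb (%x. f (h - x)) \<longleftrightarrow> ilb f"
 using integrable_distr_eq[of "%x. h - x" lborel borel f] assms by (simp add: lborel_distr_reflect)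

lemma lborel_integral_reflect:
 fixes f :: "'a::euclidean_space => 'b::{banach, second_countable_topology}"
 assumes "f : bm"
 shows "(LL x. f (h - x)) = (LL x. f x)"
 using integral_distr[of "%x. h - x" lborel borel f] assms by (simp add: lborel_distr_reflect)

text \<open>By induction on integrable functions: indicators, sums, dominated limits. An indicator
  of A is compared with that of an open U around A of small excess, because for open U the indicator
  of the intersection of U with its translates converges pointwise to that of U.\<close>

lemma translation_continuous_seq:
 fixes f :: "'a::euclidean_space => 'b::euclidean_space"
 assumes "ilb f" "h \<longlonglongrightarrow> 0"
 shows "(%n. LL x. norm (f (x + h n) - f x)) \<longlonglongrightarrow> 0"
 using assms(1)
proof (induction rule: integrable_induct)
 case (base A c)
 have A[measurable]: "A : sets borel" using base by simp
 show ?case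
 proof (rule LIMSEQ_I)
 fix e :: real assume "e > 0"
 \<comment> \<open>Four errors of size \<open>e'\<close> are added below: two from the excess U - A,
   two from the overlap of U with its translate.\<close>
 define e' where "e' = e / (4 * (norm c + 1))"
 have e': "e' > 0" using \<open>e > 0\<close> by (simp add: e'_def add_nonneg_pos)
 obtain U where U: "open U" "A \<subseteq> U" "emeasure lborel (U - A) < ennreal e'"
 using outer_regular_lborel[OF A, of e'] e' by auto
 have [measurable]: "U : sets borel" using U by simp
 have "emeasure lborel U <= emeasure lborel A + emeasure lborel (U - A)"
 using emeasure_subadditive[of A lborel "U - A"] U(2) by (simp add: Un_absorb1 Un_Diff_cancel)
 also have "... < \<infinity>" using U(3) base(2)
 by (metis ennreal_add_eq_top ennreal_less_top infinity_ennreal_def less_trans top.not_eq_extremum)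
 finally have Ufin: "emeasure lborel U < \<infinity>" .
 have iA: "ilb (indicat_real A)" using base by (simp add: integrable_indicator_iff)
 have iU: "ilb (indicat_real U)" using Ufin by (simp add: integrable_indicator_iff)
 have iUA: "ilb (indicat_real (U - A))"
 using U(3) by (simp add: integrable_indicator_iff) (meson ennreal_less_top less_trans infinity_ennreal_def)
 have sA: "ilb (%x. indicat_real A (x + k))"
 and sU: "ilb (%x. indicat_real U (x + k))"
 and sUA: "ilb (%x. indicat_real (U - A) (x + k))" for k
 using iA iU iUA by (simp_all add: lborel_integrable_shift)
 have iUU: "ilb (%x. indicat_real U (x + k) * indicat_real U x)" for k
 by (rule ibd[OF iU]) (auto simp: indicator_def)
 have "(%n. LL x. indicat_real U (x + h n) * indicat_real U x) \<longlonglongrightarrow> (LL x. indicat_real U x)"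
 proof (rule ldct[OF _ _ iU])
 show "AL x. (%n. indicat_real U (x + h n) * indicat_real U x) \<longlonglongrightarrow> indicat_real U x"
 proof (rule AE_I2)
  fix x
  show "(%n. indicat_real U (x + h n) * indicat_real U x) \<longlonglongrightarrow> indicat_real U x"
  proof (cases "x : U")
  case True
  have "(%n. x + h n) \<longlonglongrightarrow> x" using tendsto_add[OF tendsto_const assms(2), of x] by simp
  then have "eventually (%n. x + h n : U) sequentially"
   using U(1) True topological_tendstoD by blast
  then have "eventually (%n. indicat_real U (x + h n) * indicat_real U x = 1) sequentially"
   by eventually_elim (use True in auto)
  then show ?thesis using True by (simp add: tendsto_eventually)
  qed simp
 qed
 qed (auto simp: indicator_def)
 then have "\<forall>\<^sub>F n in sequentially.
 dist (LL x. indicat_real U (x + h n) * indicat_real U x) (LL x. indicat_real U x) < e'"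
 using e' tendstoD by blast
 then obtain N where N: "!!n. n >= N ==>
 \<bar>(LL x. indicat_real U (x + h n) * indicat_real U x) - (LL x. indicat_real U x)\<bar> < e'"
 unfolding eventually_sequentially dist_real_def by blast
 have "norm ((LL x. norm (indicat_real A (x + h n) *\<^sub>R c - indicat_real A x *\<^sub>R c)) - 0) < e"
 if n: "n >= N" for n
 proof -
 \<comment> \<open>A change of the indicator of A between x and x + h forces one of the two points
   into U - A, or exactly one of them into U. The last bracket is the indicator of this second
   event.\<close>
 let ?B = "%x. indicat_real (U - A) (x + h n) + indicat_real (U - A) x
  + (indicat_real U (x + h n) + indicat_real U x - 2 * (indicat_real U (x + h n) * indicat_real U x))"
 have mUA: "(LL x. indicat_real (U - A) x) < e'"
 proof -
  have "emeasure lborel (U - A) ~= top" using U(3) by auto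
  then have "ennreal (measure lborel (U - A)) < ennreal e'"
  using U(3) by (simp add: emeasure_eq_ennreal_measure)
  then show ?thesis using e' by (simp add: ennreal_less_iff)
 qed
 have "(LL x. norm (indicat_real A (x + h n) *\<^sub>R c - indicat_real A x *\<^sub>R c))
  <= (LL x. norm c * ?B x)"
 proof (rule integral_mono)
  show "ilb (%x. norm (indicat_real A (x + h n) *\<^sub>R c - indicat_real A x *\<^sub>R c))"
  using sA iA by (intro integrable_norm idiff integrable_scaleR_left) auto
  show "ilb (%x. norm c * ?B x)"
  by (intro imr iadd idiff sUA iUA sU iU iUU)
  show "norm (indicat_real A (x + h n) *\<^sub>R c - indicat_real A x *\<^sub>R c) <= norm c * ?B x" for x
  using U(2) by (auto simp: indicator_def)
 qed
 also have "... = norm c * ((LL x. indicat_real (U - A) (x + h n)) + (LL x. indicat_real (U - A) x)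
  + ((LL x. indicat_real U (x + h n)) + (LL x. indicat_real U x) - 2 * (LL x. indicat_real U (x + h n) * indicat_real U x)))"
  by (simp only: integral_mult_right_zero ladd ldiff
   iadd idiff imr sUA iUA sU iU iUU)
 also have "(LL x. indicat_real (U - A) (x + h n)) = (LL x. indicat_real (U - A) x)"
  by (rule lborel_integral_shift) simp
 also have "(LL x. indicat_real U (x + h n)) = (LL x. indicat_real U x)"
  by (rule lborel_integral_shift) simp
 also have "norm c * ((LL x. indicat_real (U - A) x) + (LL x. indicat_real (U - A) x) +
  ((LL x. indicat_real U x) + (LL x. indicat_real U x) - 2 * (LL x. indicat_real U (x + h n) * indicat_real U x)))
  <= norm c * (4 * e')"
  using mUA N[OF n] by (intro mult_left_mono) auto
 also have "... < (norm c + 1) * (4 * e')" using e' by (intro mult_strict_right_mono) auto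
 also have "... = e"
 proof -
  have "norm c + 1 ~= 0" using norm_ge_zero[of c] by linarith
  moreover have "n * (4 * (e / (4 * n))) = e" if "n ~= 0" for n :: real using that by simp
  ultimately show ?thesis unfolding e'_def by blast
 qed
 finally show ?thesis by simp
 qed
 then show "EX no. \<forall>n\<ge>no. norm ((LL x. norm (indicat_real A (x + h n) *\<^sub>R c - indicat_real A x *\<^sub>R c)) - 0) < e"
 by blast
 qed
next
 case (add f g)
 have b: "f : bm" "g : bm" using add.hyps by auto
 have i: "ilb (%x. f (x + h n) - f x)" "ilb (%x. g (x + h n) - g x)" for n
 using add.hyps b by (simp_all add: lborel_integrable_shift)
 show ?case
 proof (rule tendsto_sandwich[OF _ _ tendsto_const])
 show "(%n. (LL x. norm (f (x + h n) - f x)) + (LL x. norm (g (x + h n) - g x))) \<longlonglongrightarrow> 0"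
 using tendsto_add[OF add.IH] by simp
 show "\<forall>\<^sub>F n in sequentially. (LL x. norm (f (x + h n) + g (x + h n) - (f x + g x))) <=
 (LL x. norm (f (x + h n) - f x)) + (LL x. norm (g (x + h n) - g x))"
 proof (rule always_eventually, rule allI)
 fix n
 have "(LL x. norm (f (x + h n) + g (x + h n) - (f x + g x))) <=
  (LL x. norm (f (x + h n) - f x) + norm (g (x + h n) - g x))"
 proof (rule integral_mono)
  show "ilb (%x. norm (f (x + h n) + g (x + h n) - (f x + g x)))"
  using integrable_norm[OF iadd[OF i]] by (simp add: algebra_simps)
  show "norm (f (x + h n) + g (x + h n) - (f x + g x)) <= norm (f (x + h n) - f x) + norm (g (x + h n) - g x)" for x
  by (metis add_diff_add norm_triangle_ineq)
 qed (intro iadd integrable_norm i)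
 also have "... = (LL x. norm (f (x + h n) - f x)) + (LL x. norm (g (x + h n) - g x))"
  by (intro ladd integrable_norm i)
 finally show "(LL x. norm (f (x + h n) + g (x + h n) - (f x + g x))) <=
 (LL x. norm (f (x + h n) - f x)) + (LL x. norm (g (x + h n) - g x))" .
 qed
 qed (simp add: always_eventually)
next
 case (lim f s)
 have b: "f : bm" "s i : bm" for i using lim.hyps by auto
 show ?case
 proof (rule LIMSEQ_I)
 fix e :: real assume "e > 0"
 have "(%i. LL x. norm (s i x - f x)) \<longlonglongrightarrow> (LINT x|(lborel::'a measure). 0)"
 proof (rule ldct[where w="%x. 3 * norm (f x)"])
 show "AL x. (%i. norm (s i x - f x)) \<longlonglongrightarrow> 0"
  using lim.hyps(2) by (auto intro!: tendsto_norm_zero LIM_zero)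
 show "AL x. norm (norm (s i x - f x)) <= 3 * norm (f x)" for i
 proof (rule AE_I2)
  fix x :: 'a
  have "norm (s i x) <= 2 * norm (f x)" using lim.hyps(3) by simp
  then show "norm (norm (s i x - f x)) <= 3 * norm (f x)"
  using norm_triangle_ineq4[of "s i x" "f x"] by simp
 qed
 qed (use lim.hyps b in auto)
 then have "\<forall>\<^sub>F i in sequentially. dist (LL x. norm (s i x - f x)) 0 < e / 4"
 using \<open>e > 0\<close> by (intro tendstoD) auto
 then obtain i where i: "(LL x. norm (s i x - f x)) < e / 4"
 unfolding eventually_sequentially dist_real_def by (metis abs_less_iff diff_zero order_refl)
 obtain N where "\<forall>n\<ge>N. norm ((LL x. norm (s i (x + h n) - s i x)) - 0) < e / 4"
 using LIMSEQ_D[OF lim.IH[of i], of "e / 4"] \<open>e > 0\<close> by auto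
 then have N: "!!n. n >= N ==> (LL x. norm (s i (x + h n) - s i x)) < e / 4"
 by (simp add: abs_less_iff)
 have "(LL x. norm (f (x + h n) - f x)) < e" if n: "n >= N" for n
 proof -
 have I: "ilb (%x. norm (s i x - f x))"
  using lim.hyps by (intro integrable_norm idiff)
 then have I2: "ilb (%x. norm (s i (x + h n) - f (x + h n)))"
  using lborel_integrable_shift[of "%x. norm (s i x - f x)"] b by simp
 have I3: "ilb (%x. norm (s i (x + h n) - s i x))"
  using lim.hyps b by (intro integrable_norm idiff) (simp_all add: lborel_integrable_shift)
 have "(LL x. norm (f (x + h n) - f x)) <=
  (LL x. norm (s i (x + h n) - f (x + h n)) + norm (s i (x + h n) - s i x) + norm (s i x - f x))"
 proof (rule integral_mono)
  show "ilb (%x. norm (f (x + h n) - f x))"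
  using lim.hyps b by (intro integrable_norm idiff) (simp_all add: lborel_integrable_shift)
  show "norm (f (x + h n) - f x) <= norm (s i (x + h n) - f (x + h n)) + norm (s i (x + h n) - s i x) + norm (s i x - f x)" for x
  using norm_triangle_ineq[of "s i (x + h n) - s i x" "s i x - f x"]
   norm_triangle_ineq4[of "s i (x + h n) - s i x + (s i x - f x)" "s i (x + h n) - f (x + h n)"] by simp
 qed (intro iadd I I2 I3)
 also have "... = (LL x. norm (s i (x + h n) - f (x + h n))) + (LL x. norm (s i (x + h n) - s i x)) + (LL x. norm (s i x - f x))"
  by (simp only: ladd iadd I I2 I3)
 also have "(LL x. norm (s i (x + h n) - f (x + h n))) = (LL x. norm (s i x - f x))"
  by (rule lborel_integral_shift[of "%x. norm (s i x - f x)"]) (use b in measurable)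
 finally show ?thesis using i N[OF n] \<open>e > 0\<close> by linarith
 qed
 then show "EX no. \<forall>n\<ge>no. norm ((LL x. norm (f (x + h n) - f x)) - 0) < e" by auto
 qed
qed

lemma translation_continuous:
 fixes f :: "'a::euclidean_space => 'b::euclidean_space"
 assumes "ilb f" "e > 0"
 shows "\<exists>d>0. ALL h. norm h <= d --> (LL x. norm (f (x + h) - f x)) < e"
proof (rule ccontr)
 assume "~ ?thesis"
 then have "ALL n. EX h. norm h <= 1 / real (Suc n) & ~ (LL x. norm (f (x + h) - f x)) < e"
 by (metis of_nat_0_less_iff zero_less_Suc zero_less_divide_1_iff)
 then obtain h where h: "!!n. norm (h n) <= 1 / real (Suc n)"
 "!!n. ~ (LL x. norm (f (x + h n) - f x)) < e" by metis
 have "h \<longlonglongrightarrow> 0"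
 by (rule Lim_null_comparison[OF _ LIMSEQ_inverse_real_of_nat]) (use h(1) in \<open>auto simp: inverse_eq_divide\<close>)
 from translation_continuous_seq[OF assms(1) this] have "\<forall>\<^sub>F n in sequentially. (LL x. norm (f (x + h n) - f x)) < e"
 using assms(2) by (rule order_tendstoD)
 then show False using h(2) by (auto simp: eventually_sequentially)
qed

section \<open>Continuously differentiable functions and their gradients\<close>

text \<open>The gradient is an explicit argument, so that products, compositions and translates
  carry their gradients along and none has to be selected afterwards.\<close>

definition C1 :: "('a::euclidean_space => real) => ('a => 'a) => bool" where
 "C1 f f' \<longleftrightarrow> (ALL x. (f has_derivative (%h. f' x \<bullet> h)) (at x)) & continuous_on UNIV f'"

text \<open>Weak identities are extended from smooth test functions to this class, because the
  truncated weight (max 0 (p - 1/n))^2 of the uniqueness proof is only C^1.\<close>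

definition C1c :: "('a::euclidean_space => real) => ('a => 'a) => bool" where
 "C1c f f' \<longleftrightarrow> C1 f f' & (EX r. ALL x. norm x >= r --> f x = 0 & f' x = 0)"

definition grad :: "('a::euclidean_space => real) => 'a => 'a" where
 "grad f x = (\<Sum>i\<in>Basis. frechet_derivative f (at x) i *\<^sub>R i)"

lemma C1I:
 assumes "!!x. (f has_derivative F x) (at x)" "!!x h. F x h = f' x \<bullet> h" "continuous_on UNIV f'"
 shows "C1 f f'"
proof -
 have "F x = (%h. f' x \<bullet> h)" for x using assms(2) by auto
 then show ?thesis using assms(1,3) unfolding C1_def by metis
qed

lemma C1_continuous: "C1 f f' ==> continuous_on S f"
 unfolding C1_def by (meson continuous_at_imp_continuous_on has_derivative_continuous)

lemma C1_continuous_grad: "C1 f f' ==> continuous_on S f'"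
 unfolding C1_def by (meson continuous_on_subset subset_UNIV)

lemma C1_borel: "C1 f f' ==> f : bm" "C1 f f' ==> f' : bm"
 using C1_continuous C1_continuous_grad borel_measurable_continuous_onI by blast+

lemma C1c_C1: "C1c f f' ==> C1 f f'"
 by (simp add: C1c_def)

lemma C1_frechet: "C1 f f' ==> frechet_derivative f (at x) = (%h. f' x \<bullet> h)"
 unfolding C1_def using frechet_derivative_at by metis

lemma C1_grad: "C1 f f' ==> grad f = f'"
 by (rule ext) (simp add: grad_def C1_frechet euclidean_representation)

lemma smooth_C1: assumes "smooth f" shows "C1 f (grad f)"
proof -
 have "frechet_derivative f (at x) h = grad f x \<bullet> h" for x h
 proof -
 have l: "linear (frechet_derivative f (at x))"
 using has_derivative_linear[OF smooth_has_derivative[OF assms]] .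
 have "frechet_derivative f (at x) h = frechet_derivative f (at x) (\<Sum>i\<in>Basis. (h \<bullet> i) *\<^sub>R i)"
 by (simp add: euclidean_representation)
 also have "... = (\<Sum>i\<in>Basis. (h \<bullet> i) * frechet_derivative f (at x) i)"
 by (simp add: linear_sum[OF l] linear_scale[OF l])
 also have "... = grad f x \<bullet> h"
 by (simp add: grad_def inner_sum_left mult.commute inner_commute[of h])
 finally show ?thesis .
 qed
 then have "frechet_derivative f (at x) = (%h. grad f x \<bullet> h)" for x by auto
 moreover have "continuous_on UNIV (grad f)"
 unfolding grad_def[abs_def]
 by (intro continuous_intros smooth_continuous smooth_frechet_derivative assms)
 ultimately show ?thesis unfolding C1_def using smooth_has_derivative[OF assms] by metis
qed

lemma grad_inner: "smooth f ==> grad f x \<bullet> h = frechet_derivative f (at x) h"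
 using C1_frechet[OF smooth_C1] by metis

lemma C1_zero_open:
 assumes "C1 f f'" "open S" "!!x. x : S ==> f x = 0" "x : S"
 shows "f' x = 0"
proof -
 have "((%x. 0) has_derivative (%h. f' x \<bullet> h)) (at x)"
 proof (rule has_derivative_transform_within_open)
 show "(f has_derivative (%h. f' x \<bullet> h)) (at x)" using assms(1) unfolding C1_def by blast
 qed (use assms in auto)
 then have "(%h. f' x \<bullet> h) = (%h. 0)"
 by (rule has_derivative_unique) (rule has_derivative_const)
 from fun_cong[OF this, of "f' x"] have "f' x \<bullet> f' x = 0" .
 then show ?thesis by simp
qed

lemma C1cI:
 fixes f :: "'a::euclidean_space => real"
 assumes "C1 f f'" "!!x. norm x >= r ==> f x = 0"
 shows "C1c f f'"
 unfolding C1c_def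
\<comment> \<open>The radius grows by 1 because vanishing of f yields vanishing of the gradient only
  on the open exterior of the ball.\<close>
proof (intro conjI exI[of _ "r + 1"] allI impI)
 show "C1 f f'" by fact
next
 fix x :: 'a assume x: "r + 1 <= norm x"
 then show "f x = 0" using assms(2) by simp
next
 fix x :: 'a assume x: "r + 1 <= norm x"
 have "open {x. norm x > r}" by (intro open_Collect_less continuous_intros)
 then show "f' x = 0" by (rule C1_zero_open[OF assms(1)]) (use x assms(2) in auto)
qed

lemma C1c_support:
 assumes "C1c f f'" obtains r where "r > 0" "!!x. norm x >= r ==> f x = 0" "!!x. norm x >= r ==> f' x = 0"
proof -
 from assms obtain r where "!!x. norm x >= r ==> f x = 0 & f' x = 0" unfolding C1c_def by blast
 then show ?thesis by (intro that[of "max r 1"]) auto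
qed

section \<open>Test functions and consequences of compact support\<close>

lemma test_function_smooth: "test_function \<Omega> f ==> smooth f"
 by (simp add: test_function_def)

lemma test_function_vanishes:
 assumes "test_function \<Omega> f" obtains r where "r > 0" "!!x. norm x >= r ==> f x = 0"
proof -
 have "bounded {x. f x ~= 0}"
 using assms bounded_subset[OF compact_imp_bounded closure_subset] unfolding test_function_def by blast
 then obtain r where "r > 0" "!!x. f x ~= 0 ==> norm x <= r" unfolding bounded_pos by blast
 then show ?thesis by (intro that[of "r + 1"]) force+
qed

lemma test_function_C1c:
 assumes "test_function \<Omega> f" shows "C1c f (grad f)"
 using test_function_vanishes[OF assms] C1cI smooth_C1 test_function_smooth[OF assms] by metis

lemma test_functionI:
 assumes "smooth f" "compact K" "K \<subseteq> \<Omega>" "!!x. x \<notin> K ==> f x = 0"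
 shows "test_function \<Omega> f"
proof -
 have "closure {x. f x ~= 0} \<subseteq> K" by (rule closure_minimal) (use assms compact_imp_closed in auto)
 then show ?thesis using assms compact_closure bounded_subset compact_imp_bounded closure_subset
 unfolding test_function_def by (metis order_trans)
qed

lemma compact_support_bounded:
 fixes f :: "'a::euclidean_space => 'b::real_normed_vector"
 assumes "continuous_on UNIV f" "!!x. norm x >= r ==> f x = 0"
 obtains C where "C >= 0" "!!x. norm (f x) <= C"
proof -
 have "compact (f ` cball 0 r)" by (intro compact_continuous_image continuous_on_subset[OF assms(1)]) auto
 then obtain C where C: "C > 0" "!!y. y : f ` cball 0 r ==> norm y <= C"
 using compact_imp_bounded bounded_pos by metis
 have "norm (f x) <= C" for x
 by (cases "norm x <= r") (use C assms(2)[of x] in auto)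
 then show ?thesis using that[of C] C(1) by simp
qed

lemma compact_support_uniformly_continuous:
 fixes f :: "'a::euclidean_space => 'b::real_normed_vector"
 assumes "continuous_on UNIV f" "!!x. norm x >= r ==> f x = 0" "e > 0"
 obtains d where "d > 0" "!!x h. norm h <= d ==> norm (f (x + h) - f x) <= e"
proof -
 have "uniformly_continuous_on (cball 0 (r + 1)) f"
 by (intro compact_uniformly_continuous continuous_on_subset[OF assms(1)]) auto
 then obtain d where d: "d > 0" "\<forall>x\<in>cball 0 (r + 1). \<forall>y\<in>cball 0 (r + 1). dist y x < d --> dist (f y) (f x) < e"
 using assms(3) unfolding uniformly_continuous_on_def by blast
 \<comment> \<open>A displacement of length at most 1 keeps both points in the ball of radius r + 1
   or both where f vanishes. The bound d / 2 gives the strict inequality that uniform continuity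
   asks for.\<close>
 have "norm (f (x + h) - f x) <= e" if h: "norm h <= min (d / 2) 1" for x h
 proof (cases "norm x <= r + 1 & norm (x + h) <= r + 1")
 case True
 then have "dist (f (x + h)) (f x) < e" using d(2)[rule_format, of x "x + h"] d(1) h True unfolding mem_cball_0 by (simp add: dist_norm)
 then show ?thesis by (simp add: dist_norm)
 next
 case False
 then have "norm x >= r" "norm (x + h) >= r"
 using h norm_triangle_ineq[of x h] norm_triangle_ineq4[of "x + h" h] by auto
 then show ?thesis using assms(2,3) by simp
 qed
 then show ?thesis using d(1) by (intro that[of "min (d/2) 1"]) auto
qed

lemma C1c_bounded:
 assumes "C1c f f'" obtains C where "C >= 0" "!!x. \<bar>f x\<bar> <= C" "!!x. norm (f' x) <= C"
proof -
 obtain r where r: "!!x. norm x >= r ==> f x = 0" "!!x. norm x >= r ==> f' x = 0"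
 using C1c_support[OF assms] by metis
 obtain A where "A >= 0" "!!x. norm (f x) <= A"
 using compact_support_bounded[of f r] C1_continuous[OF C1c_C1[OF assms]] r by metis
 moreover obtain B where "B >= 0" "!!x. norm (f' x) <= B"
 using compact_support_bounded[of f' r] C1_continuous_grad[OF C1c_C1[OF assms]] r by metis
 ultimately show ?thesis by (intro that[of "max A B"]) (auto simp: le_max_iff_disj)
qed

section \<open>Sums, products, compositions and reflections of C^1 functions\<close>

lemma C1_const: "C1 (%x. c) (%x. 0)"
 by (auto simp: C1_def)

lemma C1_add:
 assumes "C1 f f'" "C1 g g'" shows "C1 (%x. f x + g x) (%x. f' x + g' x)"
proof (rule C1I)
 show "((%x. f x + g x) has_derivative (%h. f' x \<bullet> h + g' x \<bullet> h)) (at x)" for x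
 using assms unfolding C1_def by (intro has_derivative_add) auto
 show "continuous_on UNIV (%x. f' x + g' x)"
 using assms by (intro continuous_intros C1_continuous_grad)
qed (simp add: inner_add_left)

lemma C1_mult:
 assumes "C1 f f'" "C1 g g'" shows "C1 (%x. f x * g x) (%x. f x *\<^sub>R g' x + g x *\<^sub>R f' x)"
proof (rule C1I)
 show "((%x. f x * g x) has_derivative (%h. f x * (g' x \<bullet> h) + (f' x \<bullet> h) * g x)) (at x)" for x
 using assms unfolding C1_def by (intro has_derivative_mult) auto
 show "continuous_on UNIV (%x. f x *\<^sub>R g' x + g x *\<^sub>R f' x)"
 using C1_continuous[OF assms(1)] C1_continuous[OF assms(2)] C1_continuous_grad[OF assms(1)] C1_continuous_grad[OF assms(2)]
 by (intro continuous_intros)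
qed (simp add: inner_add_left mult.commute)

lemma C1_cmult: "C1 f f' ==> C1 (%x. c * f x) (%x. c *\<^sub>R f' x)"
 using C1_mult[OF C1_const[of c]] by auto

lemma C1_compose:
 assumes "C1 f f'" "!!s. (be has_real_derivative be' s) (at s)" "continuous_on UNIV be'"
 shows "C1 (%x. be (f x)) (%x. be' (f x) *\<^sub>R f' x)"
proof (rule C1I)
 show "((%x. be (f x)) has_derivative (%h. be' (f x) * (f' x \<bullet> h))) (at x)" for x
 using has_derivative_compose[of f _ x UNIV be "(*) (be' (f x))"] assms unfolding C1_def has_field_derivative_def by auto
 have "continuous_on UNIV (%x. be' (f x))"
 by (rule continuous_on_compose2[OF assms(3) C1_continuous[OF assms(1)]]) auto
 then show "continuous_on UNIV (%x. be' (f x) *\<^sub>R f' x)"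
 by (intro continuous_intros C1_continuous_grad[OF assms(1)])
qed simp

lemma C1c_mult_left:
 assumes "C1c f f'" "C1 g g'" shows "C1c (%x. f x * g x) (%x. f x *\<^sub>R g' x + g x *\<^sub>R f' x)"
 using C1_mult[OF C1c_C1[OF assms(1)] assms(2)] assms(1) unfolding C1c_def by fastforce

lemma C1_reflect:
 assumes "C1 f f'" shows "C1 (%y. f (x - y)) (%y. - f' (x - y))"
proof (rule C1I)
 fix y
 have "((%y. x - y) has_derivative (%h. - h)) (at y)"
 by (auto intro!: derivative_eq_intros)
 moreover have "(f has_derivative (%h. f' (x - y) \<bullet> h)) (at (x - y))" using assms by (simp add: C1_def)
 ultimately show "((%y. f (x - y)) has_derivative (%h. f' (x - y) \<bullet> (- h))) (at y)"
 by (rule has_derivative_compose)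
 show "continuous_on UNIV (%y. - f' (x - y))"
 by (intro continuous_intros continuous_on_compose2[OF C1_continuous_grad[OF assms, of UNIV]]) auto
qed simp

lemma C1c_reflect:
 fixes f :: "'a::euclidean_space => real"
 assumes "C1c f f'" shows "C1c (%y. f (x - y)) (%y. - f' (x - y))"
proof -
 obtain r where r: "!!x. norm x >= r ==> f x = 0" using C1c_support[OF assms] by metis
 show ?thesis
 proof (rule C1cI[OF C1_reflect[OF C1c_C1[OF assms]]])
 fix y :: 'a assume "norm y >= r + norm x"
 then show "f (x - y) = 0" using norm_triangle_ineq4[of x "x - y"] by (intro r) auto
 qed
qed

lemma C1_taylor:
 assumes "C1 f f'" "!!k. norm k <= norm h ==> norm (f' (x + k) - f' x) <= e"
 shows "\<bar>f (x + h) - f x - f' x \<bullet> h\<bar> <= norm h * e"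
proof -
 have e: "e >= 0" using assms(2)[of 0] by simp
 have "norm (f (x + h) - f x - f' x \<bullet> (x + h - x)) <= norm (x + h - x) * e"
 proof (rule differentiable_bound_linearization[where S="cball x (norm h)" and f'="%y k. f' y \<bullet> k"])
 show "x + t *\<^sub>R (x + h - x) : cball x (norm h)" if "t : {0..1}" for t
 using that by (auto simp: dist_norm mult_left_le_one_le)
 show "(f has_derivative (\<bullet>) (f' y)) (at y within cball x (norm h))" for y
 using assms(1) unfolding C1_def by (auto intro: has_derivative_at_withinI)
 show "onorm ((\<bullet>) (f' y) - (\<bullet>) (f' x)) <= e" if "y : cball x (norm h)" for y
 unfolding fun_diff_def
 proof (rule onorm_bound[OF e])
 fix k
 have "norm (f' y \<bullet> k - f' x \<bullet> k) <= norm (f' y - f' x) * norm k"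
  by (simp add: inner_diff_left[symmetric] Cauchy_Schwarz_ineq2)
 also have "... <= e * norm k"
  using assms(2)[of "y - x"] that by (intro mult_right_mono) (auto simp: dist_norm norm_minus_commute)
 finally show "norm (f' y \<bullet> k - f' x \<bullet> k) <= e * norm k" .
 qed
 qed auto
 then show ?thesis by simp
qed

section \<open>Locally integrable functions and convolutions\<close>

text \<open>In contrast to \<open>locally_integrable\<close>, a Borel function is required. Fubini
  and translations then take place in \<open>lborel\<close> and its products, without
  completions.\<close>

definition loc_int :: "('a::euclidean_space => 'b::euclidean_space) => bool" where
 "loc_int f \<longleftrightarrow> f : bm & (ALL r. ilb (%x. ib r x *\<^sub>R f x))"

lemma loc_int_borel: "loc_int f ==> f : bm"
 by (simp add: loc_int_def)

lemma loc_int_norm: "loc_int f ==> ilb (%x. ib r x * norm (f x))"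
 unfolding loc_int_def using integrable_norm[of lborel "%x. ib r x *\<^sub>R f x"] by simp

lemma loc_intI:
 assumes "f : bm" "!!r. r > 0 ==> ilb (%x. ib r x * norm (f x))"
 shows "loc_int f"
 unfolding loc_int_def
proof (intro conjI allI assms)
 fix r :: real
 show "ilb (%x. ib r x *\<^sub>R f x)"
 by (rule ibd[OF assms(2)[of "max r 1"]])
 (use assms(1) in \<open>auto simp: indicator_def\<close>)
qed

lemma loc_int_integrable:
 fixes f :: "'a::euclidean_space => 'b::euclidean_space" and g :: "'a => 'c::euclidean_space"
 assumes "loc_int f" "g : bm"
 "!!x. norm (g x) <= C * norm (f x)" "!!x. norm x >= r ==> g x = 0"
 shows "ilb g"
proof (rule ibd[OF imr[OF loc_int_norm[OF assms(1), of r], of C]])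
 show "AL x. norm (g x) <= norm (C * (ib r x * norm (f x)))"
 proof (rule AE_I2)
 fix x show "norm (g x) <= norm (C * (ib r x * norm (f x)))"
 by (cases "norm x < r") (use assms(3)[of x] assms(4)[of x] abs_ge_self[of "C * norm (f x)"] in \<open>auto simp: indicator_def\<close>)
 qed
qed (use assms in auto)

lemma loc_int_bounded:
 fixes f :: "'a::euclidean_space => 'b::euclidean_space"
 assumes "f : bm" "!!x. norm (f x) <= K"
 shows "loc_int f"
proof (rule loc_intI[OF assms(1)])
 fix r :: real
 have "ilb (%x. K * indicat_real (ball (0::'a) r) x)"
 using emeasure_bounded_finite[of "ball (0::'a) r"] by (intro imr) (simp add: integrable_indicator_iff)
 then show "ilb (%x. indicat_real (ball 0 r) x * norm (f x))"
 by (rule ibd)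
 (use assms in \<open>auto simp: indicator_def intro!: AE_I2 order_trans[OF assms(2)]\<close>)
qed

lemma loc_int_mult_bounded:
 fixes f :: "'a::euclidean_space => 'b::euclidean_space" and g :: "'a => 'c::euclidean_space"
 assumes "loc_int f" "g : bm" "!!x. norm (g x) <= C * norm (f x)"
 shows "loc_int g"
proof (rule loc_intI[OF assms(2)])
 fix r :: real
 show "ilb (%x. indicat_real (ball 0 r) x * norm (g x))"
 by (rule ibd[OF imr[OF loc_int_norm[OF assms(1), of r], of C]])
 (use assms in \<open>auto simp: indicator_def intro!: AE_I2 order_trans[OF assms(3)]\<close>)
qed

lemma loc_int_add: "loc_int f ==> loc_int g ==> loc_int (%x. f x + g x)"
 unfolding loc_int_def by (auto simp: scaleR_add_right)

text \<open>The kernel \<open>k\<close> is the factor that may be vector-valued: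
  \<open>conv f k'\<close> with the gradient \<open>k'\<close> of \<open>k\<close> is the gradient
  of \<open>conv f k\<close>.\<close>

definition conv :: "('a::euclidean_space => real) => ('a => 'b::euclidean_space) => 'a => 'b" where
 "conv f k x = (LL y. f y *\<^sub>R k (x - y))"

lemma conv_integrable:
 fixes k :: "'a::euclidean_space => 'b::euclidean_space"
 assumes f: "loc_int f" and k: "k : bm" "!!x. norm (k x) <= C" "!!x. norm x >= r ==> k x = 0"
 shows "ilb (%y. f y *\<^sub>R k (x - y))"
proof (rule loc_int_integrable[OF f, where r="r + norm x" and C=C])
 show "(%y. f y *\<^sub>R k (x - y)) : bm"
 using loc_int_borel[OF f] k(1) by measurable
 show "norm (f y *\<^sub>R k (x - y)) <= C * norm (f y)" for y
 using k(2)[of "x - y"] by (simp add: mult.commute[of C] mult_left_mono)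
 show "f y *\<^sub>R k (x - y) = 0" if "r + norm x <= norm y" for y
 using that norm_triangle_ineq4[of x "x - y"] k(3)[of "x - y"] by auto
qed

lemma conv_continuous:
 fixes k :: "'a::euclidean_space => 'b::euclidean_space"
 assumes f: "loc_int f" and k: "continuous_on UNIV k" "!!x. norm x >= r ==> k x = 0"
 shows "continuous_on UNIV (conv f k)"
proof (rule continuous_at_imp_continuous_on, rule ballI, rule continuous_at_eps_delta[THEN iffD2], intro allI impI)
 fix x :: 'a and e :: real assume e: "e > 0"
 obtain C where C: "C >= 0" "!!x. norm (k x) <= C" using compact_support_bounded[OF k] by blast
 have kb: "k : bm" using k(1) by (rule borel_measurable_continuous_onI)
 \<comment> \<open>For points x' within distance 1 of x both translated kernels vanish outside the
   ball of radius \<open>R\<close>, so the mass of f on one fixed ball suffices.\<close>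
 define R where "R = norm x + r + 1"
 define I where "I = (LL y. ind (ball 0 R) y * norm (f y))"
 have I: "I >= 0" unfolding I_def by (rule integral_nonneg_AE) auto
 obtain d where d: "d > 0" "!!x h. norm h <= d ==> norm (k (x + h) - k x) <= e / (2 * (I + 1))"
 by (rule compact_support_uniformly_continuous[OF k(1), of r "e / (2 * (I + 1))"]) (use k(2) e I in auto)
 have "dist (conv f k x') (conv f k x) < e" if x': "dist x' x < min d 1" for x' :: 'a
 proof -
 define h where "h = x' - x"
 have h: "norm h <= d" "norm h <= 1" using x' by (auto simp: h_def dist_norm)
 have "norm (conv f k x' - conv f k x) = norm (LL y. f y *\<^sub>R (k (x' - y) - k (x - y)))"
 unfolding conv_def by (subst ldiff[symmetric])
  (auto simp: scaleR_diff_right intro!: conv_integrable[OF f kb C(2) k(2)])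
 also have "... <= (LL y. norm (f y *\<^sub>R (k (x' - y) - k (x - y))))"
 by (rule integral_norm_bound)
 also have "... <= (LL y. e / (2 * (I + 1)) * (ind (ball 0 R) y * norm (f y)))"
 proof (rule integral_mono)
 show "ilb (%y. norm (f y *\<^sub>R (k (x' - y) - k (x - y))))"
  using conv_integrable[OF f kb C(2) k(2), where x=x'] conv_integrable[OF f kb C(2) k(2), where x=x]
  by (auto simp: scaleR_diff_right intro!: integrable_norm)
 show "norm (f y *\<^sub>R (k (x' - y) - k (x - y))) <= e / (2 * (I + 1)) * (indicat_real (ball 0 R) y * norm (f y))" for y
 proof (cases "norm y < R")
  case True
  have "norm (k (x' - y) - k (x - y)) <= e / (2 * (I + 1))"
  using d(2)[OF h(1), of "x - y"] by (simp add: h_def algebra_simps)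
  then have "norm (f y) * norm (k (x' - y) - k (x - y)) <= norm (f y) * (e / (2 * (I + 1)))"
  by (intro mult_left_mono) auto
  then show ?thesis using True by (simp add: mult.commute)
 next
  case False
  have "norm (x - y) >= r" "norm (x' - y) >= r"
  using False h(2) norm_triangle_ineq2[of y x] norm_triangle_ineq2[of y x'] norm_triangle_ineq[of x h]
  unfolding R_def by (auto simp: norm_minus_commute h_def)
  then show ?thesis using k(2) False by simp
 qed
 qed (intro imr loc_int_norm f)
 also have "... = e / (2 * (I + 1)) * I" by (simp add: I_def)
 also have "... < e" using e I by (simp add: field_simps) (smt (verit) mult_nonneg_nonneg)
 finally show ?thesis by (simp add: dist_norm)
 qed
 then show "\<exists>d>0. ALL x'. dist x' x < d --> dist (conv f k x') (conv f k x) < e"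
 using d(1) by (intro exI[of _ "min d 1"]) auto
qed

lemma conv_inner:
 assumes f: "loc_int f" and k: "C1c k k'"
 shows "conv f k' x \<bullet> h = (LL y. f y * (k' (x - y) \<bullet> h))"
proof -
 obtain r where r: "!!x. norm x >= r ==> k' x = 0" using C1c_support[OF k] by metis
 obtain C where C: "!!x. norm (k' x) <= C" using C1c_bounded[OF k] by metis
 have "ilb (%y. f y *\<^sub>R k' (x - y))"
 by (rule conv_integrable[OF f C1_borel(2)[OF C1c_C1[OF k]] C r])
 then show ?thesis unfolding conv_def by (simp add: integral_inner_left[symmetric])
qed

text \<open>The first-order remainder of the kernel is at most |h| times the oscillation of
  \<open>k'\<close> at scale |h|, uniformly in the point, and it is integrated against the mass of f
  on a fixed ball.\<close>

lemma conv_C1: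
 fixes k :: "'a::euclidean_space => real"
 assumes f: "loc_int f" and k: "C1c k k'"
 shows "C1 (conv f k) (conv f k')"
 unfolding C1_def
proof (intro conjI allI)
 obtain r where r: "r > 0" "!!x. norm x >= r ==> k x = 0" "!!x. norm x >= r ==> k' x = 0"
 using C1c_support[OF k] by metis
 note kC = C1_continuous[OF C1c_C1[OF k], of UNIV] C1_continuous_grad[OF C1c_C1[OF k], of UNIV]
 note kb = C1_borel[OF C1c_C1[OF k]]
 show "continuous_on UNIV (conv f k')" using conv_continuous[OF f kC(2) r(3)] .
 fix x :: 'a
 obtain C where C: "C >= 0" "!!x. \<bar>k x\<bar> <= C" "!!x. norm (k' x) <= C" using C1c_bounded[OF k] by blast
 have i1: "ilb (%y. f y * k (z - y))" for z
 using conv_integrable[OF f kb(1), of C r z] C(2) r(2) by simp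
 have i2: "ilb (%y. f y * (k' (z - y) \<bullet> h))" for z h
 using integrable_inner_left[of h lborel "%y. f y *\<^sub>R k' (z - y)"] conv_integrable[OF f kb(2), of C r z] C(3) r(3) by simp
 define R where "R = norm x + r + 1"
 define I where "I = (LL y. ind (ball 0 R) y * norm (f y))"
 have I: "I >= 0" unfolding I_def by (rule integral_nonneg_AE) auto
 show "(conv f k has_derivative (\<bullet>) (conv f k' x)) (at x)"
 unfolding has_derivative_at_alt
 proof (intro conjI allI impI)
 show "bounded_linear ((\<bullet>) (conv f k' x))" by (rule bounded_linear_inner_right)
 fix e :: real assume e: "e > 0"
 obtain d where d: "d > 0" "!!x h. norm h <= d ==> norm (k' (x + h) - k' x) <= e / (I + 1)"
 by (rule compact_support_uniformly_continuous[OF kC(2), of r "e / (I + 1)"]) (use r(3) e I in auto)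
 have "norm (conv f k x' - conv f k x - conv f k' x \<bullet> (x' - x)) <= e * norm (x' - x)"
 if x': "norm (x' - x) < min d 1" for x' :: 'a
 proof -
 define h where "h = x' - x"
 have h: "norm h <= d" "norm h <= 1" and x'h: "x' = x + h" using x' by (auto simp: h_def)
 have eq: "conv f k x' - conv f k x - conv f k' x \<bullet> h = (LL y. f y * (k (x' - y) - k (x - y) - k' (x - y) \<bullet> h))"
  unfolding conv_inner[OF f k] unfolding conv_def real_scaleR_def
  by (simp add: right_diff_distrib i1 i2)
 have "norm (conv f k x' - conv f k x - conv f k' x \<bullet> h) <= (LL y. norm (f y * (k (x' - y) - k (x - y) - k' (x - y) \<bullet> h)))"
  unfolding eq by (rule integral_norm_bound)
 also have "... <= (LL y. (norm h * (e / (I + 1))) * (ind (ball 0 R) y * norm (f y)))"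
 proof (rule integral_mono)
  show "ilb (%y. norm (f y * (k (x' - y) - k (x - y) - k' (x - y) \<bullet> h)))"
  by (intro integrable_norm) (simp add: right_diff_distrib i1 i2)
  show "norm (f y * (k (x' - y) - k (x - y) - k' (x - y) \<bullet> h)) <= (norm h * (e / (I + 1))) * (indicat_real (ball 0 R) y * norm (f y))" for y
  proof (cases "norm y < R")
  case True
  have "\<bar>k ((x - y) + h) - k (x - y) - k' (x - y) \<bullet> h\<bar> <= norm h * (e / (I + 1))"
   by (rule C1_taylor[OF C1c_C1[OF k]]) (use d(2) h in force)
  then have "\<bar>k (x' - y) - k (x - y) - k' (x - y) \<bullet> h\<bar> <= norm h * (e / (I + 1))"
   by (simp add: x'h algebra_simps)
  then have "\<bar>f y\<bar> * \<bar>k (x' - y) - k (x - y) - k' (x - y) \<bullet> h\<bar> <= \<bar>f y\<bar> * (norm h * (e / (I + 1)))"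
   by (intro mult_left_mono) auto
  then show ?thesis using True by (simp add: abs_mult mult.commute)
  next
  case False
  have "norm (x - y) >= r" "norm (x' - y) >= r"
   using False h(2) norm_triangle_ineq2[of y x] norm_triangle_ineq2[of y x'] norm_triangle_ineq[of x h]
   unfolding R_def by (auto simp: norm_minus_commute h_def)
  then show ?thesis using r False by simp
  qed
 qed (intro imr loc_int_norm f)
 also have "... = (norm h * (e / (I + 1))) * I" by (simp add: I_def)
 also have "... = norm h * (e * (I / (I + 1)))" by simp
 also have "... <= norm h * (e * 1)" using e I by (intro mult_left_mono) auto
 finally show ?thesis by (simp add: h_def mult.commute)
 qed
 then show "\<exists>d>0. ALL y. norm (y - x) < d --> norm (conv f k y - conv f k x - conv f k' x \<bullet> (y - x)) <= e * norm (y - x)"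
 using d(1) by (intro exI[of _ "min d 1"]) auto
 qed
qed

section \<open>Mollifiers\<close>

lemma lborel_scale:
 fixes f :: "'a::euclidean_space => real"
 assumes "e > 0" and [measurable]: "f : bm"
 shows "(LL x. f (x /\<^sub>R e)) = e ^ DIM('a) * (LL x. f x)"
proof -
 have "(LL x. f (x /\<^sub>R e)) = (LINT x|density (distr lborel borel (%x::'a. 0 + e *\<^sub>R x)) (%_. ennreal (\<bar>e\<bar>^DIM('a))). f (x /\<^sub>R e))"
 using lborel_affine[of e "0::'a"] assms(1) by simp
 also have "... = (LINT x|distr lborel borel (%x::'a. 0 + e *\<^sub>R x). (\<bar>e\<bar>^DIM('a)) *\<^sub>R f (x /\<^sub>R e))"
 by (rule integral_density) auto
 also have "... = (LL x. (\<bar>e\<bar>^DIM('a)) *\<^sub>R f ((0 + e *\<^sub>R x) /\<^sub>R e))"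
 by (rule integral_distr) auto
 finally show ?thesis using assms(1) by simp
qed

definition bump :: "'a::euclidean_space => real" where
 "bump x = expinv (1 - x \<bullet> x)"

definition moll :: "real => 'a::euclidean_space => real" where
 "moll e x = bump (x /\<^sub>R e) / (e ^ DIM('a) * (LL x. bump (x::'a)))"

lemma smooth_bump: "smooth bump"
 unfolding bump_def[abs_def]
 by (intro smooth_compose[OF smooth_expinv] smooth_diff smooth_const smooth_norm_square)

lemma bump_nonneg: "bump x >= 0"
 by (simp add: bump_def expinv_def)

lemma bump_eq_0_iff: "bump x = 0 \<longleftrightarrow> norm x >= 1"
 by (simp add: bump_def expinv_def norm_eq_sqrt_inner not_less)

lemma test_function_bump: "test_function UNIV (bump :: 'a::euclidean_space => real)"
 by (rule test_functionI[of _ "cball 0 1"]) (auto simp: smooth_bump bump_eq_0_iff)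

lemma bump_mass: "(LL x. bump (x::'a::euclidean_space)) > 0"
proof -
 have c: "C1c (bump :: 'a => real) (grad bump)" by (rule test_function_C1c[OF test_function_bump])
 have i: "ilb (bump :: 'a => real)"
 proof -
 obtain C where "!!x::'a. \<bar>bump x\<bar> <= C" using C1c_bounded[OF c] by metis
 then show ?thesis
 by (intro loc_int_integrable[OF loc_int_bounded[of "%_::'a. 1::real" 1], of _ C 1])
  (auto simp: bump_eq_0_iff C1_borel(1)[OF C1c_C1[OF c]])
 qed
 \<comment> \<open>On the ball of radius 1/2 one has 1 - |x|^2 >= 3/4, which bounds the bump from
   below by a positive constant.\<close>
 have i2: "ilb (%x::'a. expinv (3/4) * indicat_real (ball 0 (1/2)) x)"
 using emeasure_bounded_finite[of "ball (0::'a) (1/2)"] by (intro imr) (simp add: integrable_indicator_iff)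
 have mono: "expinv s <= expinv t" if "s <= t" for s t
 using that by (auto simp: expinv_def frac_le)
 have "expinv (3/4) * measure lborel (ball (0::'a) (1/2)) = (LL x. expinv (3/4) * indicat_real (ball (0::'a) (1/2)) x)"
 by simp
 also have "... <= (LL x. bump (x::'a))"
 proof (rule integral_mono[OF i2 i])
 fix x :: 'a
 show "expinv (3/4) * indicat_real (ball 0 (1/2)) x <= bump x"
 proof (cases "norm x < 1/2")
 case True
 then have "x \<bullet> x <= (1/2)^2" unfolding power2_norm_eq_inner[symmetric] by (intro power_mono) auto
 then have "expinv (3/4) <= bump x" unfolding bump_def by (intro mono) (simp add: power2_eq_square)
 then show ?thesis using True by simp
 next
 case False then show ?thesis using bump_nonneg[of x] by (simp add: indicator_def)
 qed
 qed
 finally show ?thesis using content_ball_pos[of "1/2" "0::'a"]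
 by (smt (verit) expinv_def exp_gt_zero mult_pos_pos divide_pos_pos zero_less_numeral)
qed

lemma smooth_moll: "smooth (moll e :: 'a::euclidean_space => real)"
proof -
 have "smooth (%x::'a. inverse (e ^ DIM('a) * (LL x. bump (x::'a))) * bump (x /\<^sub>R e))"
 by (intro smooth_cmult smooth_linear_compose[OF smooth_bump] bounded_linear_scaleR_right)
 then show ?thesis by (simp add: moll_def[abs_def] divide_inverse mult.commute)
qed

lemma moll_nonneg: "e > 0 ==> moll e x >= 0" for x :: "'a::euclidean_space"
 unfolding moll_def using bump_mass[where 'a='a] by (intro divide_nonneg_nonneg mult_nonneg_nonneg bump_nonneg) (auto simp: less_imp_le)

lemma moll_zero: "e > 0 ==> norm x >= e ==> moll e x = 0"
 by (simp add: moll_def bump_eq_0_iff field_simps)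

lemma test_function_moll: "e > 0 ==> test_function UNIV (moll e)"
 by (rule test_functionI[of _ "cball 0 e"]) (auto simp: smooth_moll moll_zero)

lemma test_function_moll_reflect:
 assumes "e > 0" "cball x e \<subseteq> \<Omega>"
 shows "test_function \<Omega> (%y. moll e (x - y))"
proof (rule test_functionI[of _ "cball x e"])
 show "smooth (%y. moll e (x - y))"
 using smooth_affine[OF smooth_moll bounded_linear_minus[OF bounded_linear_ident], of e x] by simp
 show "moll e (x - y) = 0" if "y \<notin> cball x e" for y
 using that assms(1) by (intro moll_zero) (auto simp: dist_norm)
qed (use assms in auto)

lemma moll_C1c: "e > 0 ==> C1c (moll e) (grad (moll e))"
 by (rule test_function_C1c[OF test_function_moll])

lemma moll_borel [measurable]: "moll e : bm"
 using borel_measurable_continuous_onI[OF smooth_continuous[OF smooth_moll]] .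

lemma C1c_integrable:
 fixes f :: "'a::euclidean_space => real"
 assumes "C1c f f'" shows "ilb f" "ilb f'"
proof -
 obtain r where r: "!!x. norm x >= r ==> f x = 0" "!!x. norm x >= r ==> f' x = 0" using C1c_support[OF assms] by metis
 obtain C where C: "!!x. \<bar>f x\<bar> <= C" "!!x. norm (f' x) <= C" using C1c_bounded[OF assms] by metis
 have l: "loc_int (%_::'a. 1::real)" by (rule loc_int_bounded[of _ 1]) auto
 show "ilb f"
 by (rule loc_int_integrable[OF l, of _ C r]) (use r C C1_borel(1)[OF C1c_C1[OF assms]] in auto)
 show "ilb f'"
 by (rule loc_int_integrable[OF l, of _ C r]) (use r C C1_borel(2)[OF C1c_C1[OF assms]] in auto)
qed

lemma C1c_loc_int:
 assumes "C1c f f'" shows "loc_int f" "loc_int f'"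
 using C1c_bounded[OF assms] loc_int_bounded[OF C1_borel(1)[OF C1c_C1[OF assms]]]
 loc_int_bounded[OF C1_borel(2)[OF C1c_C1[OF assms]]] by (metis real_norm_def)+

lemma moll_integrable: "e > 0 ==> ilb (moll e)"
 by (rule C1c_integrable[OF moll_C1c])

lemma moll_integral: assumes "e > 0" shows "(LL x. moll e (x::'a::euclidean_space)) = 1"
proof -
 have [measurable]: "(bump :: 'a => real) : bm"
 using borel_measurable_continuous_onI[OF smooth_continuous[OF smooth_bump]] .
 show ?thesis unfolding moll_def
 using lborel_scale[OF assms, of "bump :: 'a => real"] bump_mass[where 'a='a] assms by simp
qed

lemma grad_moll:
 fixes x :: "'a::euclidean_space"
 assumes "e > 0"
 shows "grad (moll e) x = (1 / (e * (e ^ DIM('a) * (LL x. bump (x::'a))))) *\<^sub>R grad bump (x /\<^sub>R e)"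
proof -
 let ?c = "1 / (e ^ DIM('a) * (LL x. bump (x::'a)))"
 have "C1 (%x::'a. bump (x /\<^sub>R e)) (%x. (1 / e) *\<^sub>R grad bump (x /\<^sub>R e))"
 proof (rule C1I)
 fix x :: 'a
 have "((%x. x /\<^sub>R e) has_derivative (%h. h /\<^sub>R e)) (at x)" by (auto intro!: derivative_eq_intros)
 moreover have "(bump has_derivative (%h. grad bump (x /\<^sub>R e) \<bullet> h)) (at (x /\<^sub>R e))"
 using smooth_C1[OF smooth_bump] unfolding C1_def by blast
 ultimately show "((%x. bump (x /\<^sub>R e)) has_derivative (%h. grad bump (x /\<^sub>R e) \<bullet> (h /\<^sub>R e))) (at x)"
 by (rule has_derivative_compose)
 show "continuous_on UNIV (%x::'a. (1 / e) *\<^sub>R grad bump (x /\<^sub>R e))"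
 by (intro continuous_intros continuous_on_compose2[OF C1_continuous_grad[OF smooth_C1[OF smooth_bump], of UNIV]]) auto
 qed (simp add: divide_inverse)
 from C1_grad[OF C1_cmult[OF this, of ?c]]
 have "grad (%x::'a. ?c * bump (x /\<^sub>R e)) = (%x. ?c *\<^sub>R (1 / e) *\<^sub>R grad bump (x /\<^sub>R e))" .
 moreover have "(%x::'a. ?c * bump (x /\<^sub>R e)) = moll e" by (rule ext) (simp add: moll_def)
 ultimately show ?thesis by (simp add: mult.commute)
qed

lemma grad_moll_borel: "e > 0 ==> grad (moll e) : bm"
 by (rule C1_borel(2)[OF smooth_C1[OF smooth_moll]])

lemma grad_moll_zero: "e > 0 ==> norm x > e ==> grad (moll e) x = 0"
 by (rule C1_zero_open[OF smooth_C1[OF smooth_moll], of "{x. norm x > e}"])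
 (auto intro!: open_Collect_less continuous_intros moll_zero)

text \<open>The gradient of \<open>moll e\<close> has mass of order 1/e and lives on |x| <= e, so
  the factor |x| makes the bound uniform in e. The constant is the \<open>C\<close> of all
  commutator estimates.\<close>

lemma grad_moll_bound:
 obtains C where "C >= 0"
 "!!e. e > 0 ==> (LL x. norm x * norm (grad (moll e) (x::'a::euclidean_space))) <= C"
proof -
 define A where "A = (LL x. norm (grad bump (x::'a)))"
 define B where "B = (LL x. bump (x::'a))"
 have B: "B > 0" unfolding B_def by (rule bump_mass)
 have A: "A >= 0" unfolding A_def by simp
 have mb: "(grad bump :: 'a => 'a) : bm" by (rule C1_borel(2)[OF smooth_C1[OF smooth_bump]])
 have "(LL x. norm x * norm (grad (moll e) (x::'a))) <= A / B" if e: "e > 0" for e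
 proof -
 let ?c = "1 / (e * (e ^ DIM('a) * B))"
 have c: "?c > 0" using e B by simp
 have [measurable]: "(grad (moll e) :: 'a => 'a) : bm" by (rule grad_moll_borel[OF e])
 have i: "ilb (%x. e * norm (grad (moll e) (x::'a)))"
 by (intro imr integrable_norm C1c_integrable(2)[OF moll_C1c[OF e]])
 have le: "norm x * norm (grad (moll e) x) <= e * norm (grad (moll e) x)" for x :: 'a
 using grad_moll_zero[OF e, of x] by (cases "norm x > e") (auto intro: mult_right_mono)
 have "(LL x. norm x * norm (grad (moll e) (x::'a))) <= (LL x. e * norm (grad (moll e) (x::'a)))"
 by (rule integral_mono[OF ibd[OF i] i le]) (use le e in \<open>auto intro!: AE_I2\<close>)
 also have "... = e * ?c * (LL x. norm (grad bump ((x::'a) /\<^sub>R e)))"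
 unfolding grad_moll[OF e] B_def[symmetric] using c by simp
 also have "(LL x. norm (grad bump ((x::'a) /\<^sub>R e))) = e ^ DIM('a) * A"
 unfolding A_def by (rule lborel_scale[OF e, of "%x. norm (grad bump x)"]) (use mb in measurable)
 also have "e * ?c * (e ^ DIM('a) * A) = A / B" using e B by (simp add: field_simps)
 finally show ?thesis .
 qed
 then show ?thesis using that[of "A / B"] A B by simp
qed

section \<open>Smoothness of convolutions and approximation by test functions\<close>

lemma conv_commute:
 fixes f k :: "'a::euclidean_space => real"
 assumes [measurable]: "f : bm" "k : bm"
 shows "conv f k = conv k f"
proof
 fix x :: 'a
 have "(LL y. (%y. f y * k (x - y)) (x - y)) = (LL y. f y * k (x - y))"
 by (rule lborel_integral_reflect) measurable
 then show "conv f k x = conv k f x" by (simp add: conv_def mult.commute)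
qed

lemma test_function_frechet:
 assumes "test_function UNIV f" shows "test_function UNIV (%x. frechet_derivative f (at x) h)"
proof (rule test_functionI[of _ "closure {x. f x ~= 0}"])
 fix x assume "x \<notin> closure {x. f x ~= 0}"
 then have "grad f x = 0"
 by (intro C1_zero_open[OF smooth_C1, of f "- closure {x. f x ~= 0}"])
 (use assms closure_subset[of "{x. f x ~= 0}"] in \<open>auto simp: test_function_def\<close>)
 then show "frechet_derivative f (at x) h = 0"
 using grad_inner[of f x h] assms by (simp add: test_function_def)
qed (use assms smooth_frechet_derivative in \<open>auto simp: test_function_def\<close>)

text \<open>A directional derivative of \<open>conv f k\<close> is the convolution of f with the
  same derivative of \<open>k\<close>, which is a test function again; this class is the coinduction
  invariant.\<close>

lemma smooth_conv:
 fixes f :: "'a::euclidean_space => real"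
 assumes f: "loc_int f" and k: "test_function UNIV k"
 shows "smooth (conv f k)"
proof (rule smooth_coinduct[where X="%g. EX k. test_function UNIV k & g = conv f k"])
 show "EX ka. test_function UNIV ka & conv f k = conv f ka" using k by blast
 fix g assume "EX k. test_function UNIV k & g = conv f k"
 then obtain k where k: "test_function UNIV k" and g: "g = conv f k" by blast
 note c = test_function_C1c[OF k]
 have "conv f (grad k) x \<bullet> v = conv f (%x. frechet_derivative k (at x) v) x" for x v
 unfolding conv_inner[OF f c] grad_inner[OF test_function_smooth[OF k]] by (simp add: conv_def)
 then have "EX l. test_function UNIV l & (%x. conv f (grad k) x \<bullet> v) = conv f l" for v
 using test_function_frechet[OF k, of v] by (intro exI[of _ "%x. frechet_derivative k (at x) v"]) auto
 then show "EX g'. (ALL x. (g has_derivative g' x) (at x)) &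
   (ALL v. EX k. test_function UNIV k & (%x. g' x v) = conv f k)"
 using conv_C1[OF f c] unfolding g C1_def by (intro exI[of _ "%x v. conv f (grad k) x \<bullet> v"]) auto
qed

lemma moll_conv_close:
 fixes k :: "'a::euclidean_space => 'b::euclidean_space"
 assumes e: "e > 0" and k: "k : bm" "!!x. norm (k x) <= C"
 and close: "!!y. norm y <= e ==> norm (k (x - y) - k x) <= de"
 shows "norm (conv (moll e) k x - k x) <= de"
proof -
 have im: "ilb (%y. moll e y *\<^sub>R k x)"
 using moll_integrable[OF e] by (rule integrable_scaleR_left)
 have ik: "ilb (%y. moll e y *\<^sub>R k (x - y))"
 by (rule ibd[OF imr[OF moll_integrable[OF e], of C]])
 (use k in \<open>auto intro!: AE_I2 mult_mono order_trans[OF k(2)] simp: abs_mult mult.commute[of C] moll_nonneg[OF e] abs_ge_self\<close>)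
 have eq: "conv (moll e) k x - k x = (LL y. moll e y *\<^sub>R (k (x - y) - k x))"
 unfolding conv_def scaleR_diff_right using moll_integral[OF e, where 'a='a] moll_integrable[OF e]
 by (subst ldiff[OF ik im], subst integral_scaleR_left) auto
 have "norm (conv (moll e) k x - k x) <= (LL y. norm (moll e y *\<^sub>R (k (x - y) - k x)))"
 unfolding eq by (rule integral_norm_bound)
 also have "... <= (LL y. moll e (y::'a) * de)"
 proof (rule integral_mono)
 show "ilb (%y. norm (moll e y *\<^sub>R (k (x - y) - k x)))"
 unfolding scaleR_diff_right by (intro integrable_norm idiff ik im)
 show "ilb (%y. moll e (y::'a) * de)" using moll_integrable[OF e, where 'a='a] by simp
 show "norm (moll e y *\<^sub>R (k (x - y) - k x)) <= moll e y * de" for y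
 using close[of y] moll_zero[OF e, of y] moll_nonneg[OF e, of y]
 by (cases "norm y <= e") (auto intro: mult_left_mono)
 qed
 also have "... = de" using moll_integral[OF e, where 'a='a] by simp
 finally show ?thesis .
qed

text \<open>Mollification converges uniformly together with the gradient, since both f and
  \<open>f'\<close> are uniformly continuous. The common support allows dominated convergence when
  weak identities are extended to \<open>C1c\<close>.\<close>

lemma C1c_approx:
 fixes f :: "'a::euclidean_space => real"
 assumes f: "C1c f f'"
 obtains ph R where "!!n::nat. test_function UNIV (ph n)"
 "!!n x. norm x >= R ==> ph n x = 0" "!!n x. norm x >= R ==> grad (ph n) x = 0"
 "!!n x. \<bar>ph n x - f x\<bar> <= 1 / Suc n" "!!n x. norm (grad (ph n) x - f' x) <= 1 / Suc n"
proof -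
 obtain r where r: "r > 0" "!!x. norm x >= r ==> f x = 0" "!!x. norm x >= r ==> f' x = 0"
 using C1c_support[OF f] by metis
 obtain C where C: "!!x. norm (f x) <= C" "!!x. norm (f' x) <= C" using C1c_bounded[OF f] by (metis real_norm_def)
 note cont = C1_continuous[OF C1c_C1[OF f], of UNIV] C1_continuous_grad[OF C1c_C1[OF f], of UNIV]
 note b = C1_borel[OF C1c_C1[OF f]]
 \<comment> \<open>Mollification at scale e <= 1 spreads the support by at most 1; passing to the
   open exterior for the gradient costs another 1.\<close>
 have "EX ph. test_function UNIV ph & (ALL x. norm x >= r + 2 --> ph x = 0 & grad ph x = 0) &
 (ALL x. \<bar>ph x - f x\<bar> <= de & norm (grad ph x - f' x) <= de)" if de: "de > 0" for de
 proof -
 obtain d1 where d1: "d1 > 0" "!!x h. norm h <= d1 ==> norm (f (x + h) - f x) <= de"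
 by (rule compact_support_uniformly_continuous[OF cont(1), of r de]) (use r(2) de in auto)
 obtain d2 where d2: "d2 > 0" "!!x h. norm h <= d2 ==> norm (f' (x + h) - f' x) <= de"
 by (rule compact_support_uniformly_continuous[OF cont(2), of r de]) (use r(3) de in auto)
 define e where "e = min 1 (min d1 d2)"
 have e: "e > 0" "e <= 1" "e <= d1" "e <= d2" using d1 d2 by (auto simp: e_def)
 define ph where "ph = conv (moll e) f"
 have ph: "C1 ph (conv (moll e) f')" unfolding ph_def
 by (rule conv_C1[OF C1c_loc_int(1)[OF moll_C1c[OF e(1)]] f])
 have sm: "smooth ph" unfolding ph_def conv_commute[OF moll_borel b(1)]
 by (rule smooth_conv[OF C1c_loc_int(1)[OF f] test_function_moll[OF e(1)]])
 have z: "ph x = 0" if "norm x >= r + 1" for x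
 proof -
 have "moll e y *\<^sub>R f (x - y) = 0" for y
  using moll_zero[OF e(1), of y] r(2)[of "x - y"] e(2) that norm_triangle_ineq2[of x y] by (cases "norm y >= e") auto
 then show ?thesis unfolding ph_def conv_def by (simp only: Bochner_Integration.integral_zero)
 qed
 have tf: "test_function UNIV ph"
 by (rule test_functionI[of _ "cball 0 (r + 1)"]) (use sm z in auto)
 have gz: "grad ph x = 0" if "norm x >= r + 2" for x
 by (rule C1_zero_open[OF smooth_C1[OF sm], of "{x. norm x > r + 1}"])
  (use z that in \<open>auto intro!: open_Collect_less continuous_intros\<close>)
 have "norm (conv (moll e) f x - f x) <= de" for x
 by (rule moll_conv_close[OF e(1) b(1) C(1)]) (use d1(2)[of "- _" x] e in auto)
 moreover have "norm (conv (moll e) f' x - f' x) <= de" for x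
 by (rule moll_conv_close[OF e(1) b(2) C(2)]) (use d2(2)[of "- _" x] e in auto)
 ultimately show ?thesis using tf gz z C1_grad[OF ph] by (intro exI[of _ ph]) (auto simp: ph_def)
 qed
 then have "\<forall>n::nat. EX ph. test_function UNIV ph & (ALL x. norm x >= r + 2 --> ph x = 0 & grad ph x = 0) &
 (ALL x. \<bar>ph x - f x\<bar> <= 1 / Suc n & norm (grad ph x - f' x) <= 1 / Suc n)"
 by (metis of_nat_0_less_iff zero_less_Suc zero_less_divide_1_iff)
 then obtain ph where "!!n::nat. test_function UNIV (ph n) & (ALL x. norm x >= r + 2 --> ph n x = 0 & grad (ph n) x = 0) &
 (ALL x. \<bar>ph n x - f x\<bar> <= 1 / Suc n & norm (grad (ph n) x - f' x) <= 1 / Suc n)" by metis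
 then show ?thesis by (intro that[of ph "r + 2"]) auto
qed

section \<open>Mollification in the mean and the fundamental lemma\<close>

text \<open>By Fubini the error is an average of translation errors of f against |k|. The kernel may
  change sign and have any integral: integral 1 gives convergence of mollifications, integral 0
  makes \<open>conv f k\<close> itself small, as needed for commutators.\<close>

lemma kernel_close:
 fixes f k :: "'a::euclidean_space => real"
 assumes f: "ilb f" and k: "ilb k" "!!y. \<bar>k y\<bar> <= C" "!!y. norm y > e ==> k y = 0"
 and close: "!!h. norm h <= e ==> (LL x. norm (f (x + h) - f x)) <= de"
 shows "ilb (%x. conv f k x - (LL y. k y) * f x)"
 and "(LL x. \<bar>conv f k x - (LL y. k y) * f x\<bar>) <= de * (LL y. \<bar>k y\<bar>)"
proof -
 have [measurable]: "f : bm" "k : bm" using f k(1) by auto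
 have [measurable]: "f : borel_measurable lborel" "k : borel_measurable lborel" by auto
 let ?g = "%x y. k y * (f (x - y) - f x)"
 have ifs: "ilb (%y. f (x - y))" for x using f lborel_integrable_reflect[of f x] by simp
 have i1: "ilb (%y. k y * f (x - y))" for x
 by (rule ibd[OF imr[OF ifs[of x], of C]])
 (use k(2) in \<open>auto intro!: AE_I2 mult_mono order_trans[OF k(2)] simp: abs_mult\<close>)
 have i2: "ilb (%y. k y * f x)" for x using k(1) by simp
 have eq: "conv f k x - (LL y. k y) * f x = (LL y. ?g x y)" for x
 proof -
 have "conv f k x = (LL y. k y * f (x - y))"
 unfolding conv_commute[OF \<open>f : bm\<close> \<open>k : bm\<close>] by (simp add: conv_def)
 moreover have "(LL y. k y) * f x = (LL y. k y * f x)" using k(1) by simp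
 ultimately show ?thesis unfolding right_diff_distrib by (simp only: ldiff[OF i1 i2])
 qed
 have meas[measurable]: "(%x. LL y. ?g x y) : borel_measurable lborel" by measurable
 \<comment> \<open>For e >= 0 the case h = 0 of \<open>close\<close> shows de >= 0; for e < 0 the
   kernel is identically 0.\<close>
 have d0: "de >= 0 \<or> (ALL y. k y = 0)"
 proof (cases "e >= 0")
 case True then show ?thesis using close[of 0] by simp
 next
 case False then show ?thesis using k(3) by (metis norm_ge_zero not_le_imp_less order_less_le_trans)
 qed
 have "(NN x. ennreal (norm (LL y. ?g x y))) <= (NN x. (NN y. ennreal (norm (?g x y))))"
 unfolding right_diff_distrib
 by (intro nn_integral_mono integral_norm_bound_ennreal idiff i1 i2)
 also have "... = (NN y. (NN x. ennreal (norm (?g x y))))"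
 by (rule lborel_pair.Fubini') measurable
 also have "... <= (NN y. ennreal (de * \<bar>k y\<bar>))"
 proof (rule nn_integral_mono)
 fix y :: 'a
 show "(NN x. ennreal (norm (?g x y))) <= ennreal (de * \<bar>k y\<bar>)"
 proof (cases "norm y > e")
 case True then show ?thesis using k(3) by simp
 next
 case False
 have i: "ilb (%x. f (x - y))" using lborel_integrable_shift[of f "-y"] f by simp
 have "(NN x. ennreal (norm (?g x y))) = ennreal (LL x. norm (?g x y))"
  using f i by (intro nn_integral_eq_integral integrable_norm imr idiff) auto
 also have "(LL x. norm (?g x y)) = \<bar>k y\<bar> * (LL x. norm (f (x + (-y)) - f x))"
  by (simp add: abs_mult)
 also have "... <= \<bar>k y\<bar> * de" using close[of "-y"] False by (intro mult_left_mono) auto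
 finally show ?thesis by (simp add: mult.commute ennreal_leI)
 qed
 qed
 also have "... = ennreal (de * (LL y. \<bar>k y\<bar>))"
 using nn_integral_eq_integral[of lborel "%y. de * \<bar>k y\<bar>"] k(1) d0 by (auto simp: AE_I2)
 finally have le: "(NN x. ennreal (norm (LL y. ?g x y))) <= ennreal (de * (LL y. \<bar>k y\<bar>))" .
 have int: "ilb (%x. LL y. ?g x y)"
 by (rule integrableI_bounded[OF meas]) (use le le_less_trans in fastforce)
 then show "ilb (%x. conv f k x - (LL y. k y) * f x)" by (simp add: eq)
 have "ennreal (LL x. norm (LL y. ?g x y)) <= ennreal (de * (LL y. \<bar>k y\<bar>))"
 using le nn_integral_eq_integral[OF integrable_norm[OF int]] by (simp add: AE_I2)
 moreover have "0 <= de * (LL y. \<bar>k y\<bar>)" using d0 by auto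
 ultimately show "(LL x. \<bar>conv f k x - (LL y. k y) * f x\<bar>) <= de * (LL y. \<bar>k y\<bar>)"
 by (simp add: eq)
qed

text \<open>On a smaller concentric ball the mollified f vanishes, since the reflected mollifier is
  a test function there. As mollifications converge to f in L^1, f vanishes on every smaller
  ball.\<close>

lemma fundamental_lemma:
 fixes f :: "'a::euclidean_space => real"
 assumes f: "ilb (%x. ind (ball c r) x * f x)"
 and test: "!!ph. test_function (ball c r) ph ==> (LL x. ph x * f x) = 0"
 shows "AL x. x : ball c r --> f x = 0"
proof -
 define g where "g x = ind (ball c r) x * f x" for x
 have g: "ilb g" using f by (simp add: g_def[abs_def])
 then have gb[measurable]: "g : bm" by auto
 have *: "(LL x. ind (ball c s) x * \<bar>g x\<bar>) = 0" if s: "s < r" for s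
 proof (rule antisym[OF field_le_epsilon])
 fix de :: real assume de: "de > 0"
 obtain d where d: "d > 0" "!!h. norm h <= d ==> (LL x. norm (g (x + h) - g x)) < de"
 using translation_continuous[OF g de] by blast
 define e where "e = min d ((r - s) / 2)"
 have e: "e > 0" "e <= d" "e < r - s" using d s by (auto simp: e_def min_def)
 obtain C where C: "!!y::'a. \<bar>moll e y\<bar> <= C" using C1c_bounded[OF moll_C1c[OF e(1)]] by metis
 have close: "(LL x. norm (g (x + h) - g x)) <= de" if "norm h <= e" for h
 using d(2)[of h] that e by auto
 have z: "moll e y = 0" if "norm y > e" for y :: 'a using moll_zero[OF e(1), of y] that by simp
 note kc = kernel_close[OF g moll_integrable[OF e(1)] C z close, unfolded moll_integral[OF e(1)]]
 have cz: "conv g (moll e) x = 0" if x: "x : ball c s" for x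
 proof -
 have sub: "cball x e \<subseteq> ball c r" using x e s by (auto simp: dist_commute) (smt (verit) dist_triangle dist_commute)
 have "g y * moll e (x - y) = moll e (x - y) * f y" for y
  using sub moll_zero[OF e(1), of "x - y"] by (cases "y : cball x e") (auto simp: g_def dist_norm)
 then show ?thesis using test[OF test_function_moll_reflect[OF e(1) sub]] unfolding conv_def real_scaleR_def by (simp only:)
 qed
 have "(LL x. ind (ball c s) x * \<bar>g x\<bar>) <= (LL x. \<bar>conv g (moll e) x - 1 * g x\<bar>)"
 proof (rule integral_mono)
 show "ilb (%x. ind (ball c s) x * \<bar>g x\<bar>)"
  by (rule ibd[OF g]) (auto simp: indicator_def)
 show "ilb (%x. \<bar>conv g (moll e) x - 1 * g x\<bar>)" using kc(1) by (rule integrable_abs)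
 show "ind (ball c s) x * \<bar>g x\<bar> <= \<bar>conv g (moll e) x - 1 * g x\<bar>" for x
  using cz[of x] by (auto simp: indicator_def)
 qed
 also have "... <= de * (LL y. \<bar>moll e (y::'a)\<bar>)" by (rule kc(2))
 also have "... = de" using moll_nonneg[OF e(1), where 'a='a] moll_integral[OF e(1), where 'a='a] by simp
 finally show "(LL x. ind (ball c s) x * \<bar>g x\<bar>) <= 0 + de" by simp
 qed (auto intro!: integral_nonneg_AE)
 have "AL x. \<forall>n::nat. x : ball c (r - 1 / Suc n) --> g x = 0"
 unfolding AE_all_countable
 proof
 fix n :: nat
 have i: "ilb (%x. ind (ball c (r - 1 / Suc n)) x * \<bar>g x\<bar>)"
 by (rule ibd[OF g]) (auto simp: indicator_def)
 have "AL x. ind (ball c (r - 1 / Suc n)) x * \<bar>g x\<bar> = 0"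
 using integral_nonneg_eq_0_iff_AE[OF i] *[of "r - 1 / Suc n"] by auto
 then show "AL x. x : ball c (r - 1 / Suc n) --> g x = 0"
 by eventually_elim (auto simp: indicator_def)
 qed
 then show ?thesis
 proof eventually_elim
 case (elim x)
 show ?case
 proof
 assume x: "x : ball c r"
 then obtain n :: nat where "1 / Suc n < r - dist c x"
  using reals_Archimedean[of "r - dist c x"] by (auto simp: inverse_eq_divide)
 then show "f x = 0" using elim x by (auto simp: g_def dest!: spec[of _ n])
 qed
 qed
qed

lemma ball_borel [measurable]: "ball c r : sets borel"
 by simp

lemma fundamental_lemma_UNIV:
 fixes f :: "'a::euclidean_space => real"
 assumes f: "loc_int f" and test: "!!ph. test_function UNIV ph ==> (LL x. ph x * f x) = 0"
 shows "AL x. f x = 0"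
proof -
 have "AL x. \<forall>n::nat. x : ball 0 (real n) --> f x = 0"
 unfolding AE_all_countable
 proof
 fix n
 have "ilb (%x. ind (ball 0 (real n)) x * f x)" using f by (simp add: loc_int_def)
 moreover have "(LL x. ph x * f x) = 0" if "test_function (ball 0 (real n)) ph" for ph
 using that by (intro test) (auto simp: test_function_def)
 ultimately show "AL x. x : ball 0 (real n) --> f x = 0" by (rule fundamental_lemma)
 qed
 then show ?thesis
 proof eventually_elim
 case (elim x)
 obtain n :: nat where "norm x < n" using reals_Archimedean2 by blast
 then show ?case using elim by auto
 qed
qed

section \<open>Weak gradients and difference quotients\<close>

text \<open>All partial derivatives at once, for Borel representatives and C^1 test
  functions.\<close>

definition weak_grad :: "('a::euclidean_space => real) => ('a => 'a) => bool" where
 "weak_grad f G \<longleftrightarrow> loc_int f & loc_int G &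
 (ALL ps ps'. C1c ps ps' --> (LL x. f x *\<^sub>R ps' x) = - (LL x. ps x *\<^sub>R G x))"

lemma C1c_shift:
 fixes f :: "'a::euclidean_space => real"
 assumes "C1c f f'" shows "C1c (%x. f (x - a)) (%x. f' (x - a))"
 using C1c_reflect[OF C1c_reflect[OF assms, of 0], of a] by simp

text \<open>Each slice in x is a translate of g, so the iterated integral of the absolute value
  factorises. With h = 0 it is the integrability of a product p(s) g(x).\<close>

lemma integrable_shear:
 fixes g :: "'a::euclidean_space => real" and p :: "real => real"
 assumes p: "ilb p" and g: "ilb g"
 shows "integrable (lborel \<Otimes>\<^sub>M lborel) (%(s, x). p s * g (x + s *\<^sub>R h))"
proof (rule lborel_pair.Fubini_integrable)
 have [measurable]: "p : bm" "g : bm" using p g by auto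
 show "(%(s, x). p s * g (x + s *\<^sub>R h)) : borel_measurable (lborel \<Otimes>\<^sub>M lborel)" by measurable
 have i: "ilb (%x. g (x + k))" for k using g by (simp add: lborel_integrable_shift)
 have "(LL x. \<bar>g (x + k)\<bar>) = (LL x. \<bar>g x\<bar>)" for k
 using lborel_integral_shift[of "%x. \<bar>g x\<bar>" k] by simp
 then show "ilb (%s. LL x. norm (case (s, x) of (s, x) => p s * g (x + s *\<^sub>R h)))"
 using p by (simp add: abs_mult)
 show "AL s. ilb (%x. case (s, x) of (s, x) => p s * g (x + s *\<^sub>R h))"
 using i by (intro AE_I2) simp
qed

lemma C1_line:
 fixes f :: "'a::euclidean_space => real"
 assumes "C1 f f'"
 shows "f (x - h) - f x = - (LL s. ind {0..1} s * (f' (x - s *\<^sub>R h) \<bullet> h))"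
proof -
 have 1: "((%s. f (x - s *\<^sub>R h)) has_real_derivative (- (f' (x - s *\<^sub>R h) \<bullet> h))) (at s)" for s
 proof -
 have "((%s. x - s *\<^sub>R h) has_derivative (%t. - (t *\<^sub>R h))) (at s)"
 by (auto intro!: derivative_eq_intros)
 moreover have "(f has_derivative (%k. f' (x - s *\<^sub>R h) \<bullet> k)) (at (x - s *\<^sub>R h))"
 using assms by (simp add: C1_def)
 ultimately have "((%s. f (x - s *\<^sub>R h)) has_derivative (%t. f' (x - s *\<^sub>R h) \<bullet> (- (t *\<^sub>R h)))) (at s)"
 by (rule has_derivative_compose)
 moreover have "(%t. f' (x - s *\<^sub>R h) \<bullet> (- (t *\<^sub>R h))) = (*) (- (f' (x - s *\<^sub>R h) \<bullet> h))"
 by (rule ext) simp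
 ultimately show ?thesis unfolding has_field_derivative_def by (simp only:)
 qed
 have 2: "isCont (%s. - (f' (x - s *\<^sub>R h) \<bullet> h)) s" for s
 proof -
 have "continuous_on UNIV (%s. - (f' (x - s *\<^sub>R h) \<bullet> h))"
 by (intro continuous_intros continuous_on_compose2[OF C1_continuous_grad[OF assms, of UNIV]]) auto
 then show ?thesis by (simp add: continuous_on_eq_continuous_at)
 qed
 have "(LL s. (- (f' (x - s *\<^sub>R h) \<bullet> h)) * ind {0..1} s) = f (x - 1 *\<^sub>R h) - f (x - 0 *\<^sub>R h)"
 by (rule integral_FTC_Icc_real) (use 1 2 in auto)
 then show ?thesis by (simp add: mult.commute)
qed

text \<open>The fundamental theorem of calculus along a segment, for weak derivatives. Tested with
  \<open>ph\<close>, the difference moves to \<open>ph\<close>, where \<open>C1_line\<close>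
  applies; Fubini in s and the weak identity for the translates of \<open>ph\<close> move the
  gradient back to f. The fundamental lemma concludes.\<close>

lemma weak_grad_difference:
 fixes f :: "'a::euclidean_space => real"
 assumes wg: "weak_grad f G"
 shows "AL x. f (x + h) - f x = (LL s. ind {0..1} s * (G (x + s *\<^sub>R h) \<bullet> h))"
proof -
 define Gh where "Gh x = (LL s. ind {0..1::real} s * (G (x + s *\<^sub>R h) \<bullet> h))" for x
 have f: "loc_int f" and G: "loc_int G" using wg by (auto simp: weak_grad_def)
 have [measurable]: "f : bm" "G : bm" using f G by (auto simp: loc_int_def)
 have [measurable]: "Gh : bm" unfolding Gh_def[abs_def] by measurable
 have p: "ilb (indicat_real {0..1::real})"
 using integrable_real_indicator[of "{0..1::real}" lborel] by simp
 define N where "N = norm h"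
 define g where "g R x = ind (ball 0 R) x * norm (G x)" for R x
 have g: "ilb (g R)" for R using loc_int_norm[OF G] by (simp add: g_def[abs_def])
 have dom: "integrable (lborel \<Otimes>\<^sub>M lborel) (%(s, x). indicat_real {0..1} s * (ph x * (G (x + s *\<^sub>R h) \<bullet> h)))"
 if ph: "ph : bm" "!!x. \<bar>ph x\<bar> <= C" "!!x. norm x >= R ==> ph x = 0" for ph C R
 proof (rule ibd[OF imr[OF integrable_shear[OF p g, of "R + N" h], of "C * N"]])
 have [measurable]: "ph : bm" by fact
 show "(%(s, x). indicat_real {0..1} s * (ph x * (G (x + s *\<^sub>R h) \<bullet> h))) : borel_measurable (lborel \<Otimes>\<^sub>M lborel)"
 by measurable
 show "AE z in lborel \<Otimes>\<^sub>M lborel. norm (case z of (s, x) => indicat_real {0..1} s * (ph x * (G (x + s *\<^sub>R h) \<bullet> h)))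
 <= norm (C * N * (case z of (s, x) => indicat_real {0..1} s * g (R + N) (x + s *\<^sub>R h)))"
 proof (rule AE_I2, clarify)
 fix s :: real and x :: 'a
 have C: "C >= 0" using ph(2)[of 0] by linarith
 show "norm (indicat_real {0..1} s * (ph x * (G (x + s *\<^sub>R h) \<bullet> h))) <= norm (C * N * (indicat_real {0..1} s * g (R + N) (x + s *\<^sub>R h)))"
 proof (cases "s : {0..1} & norm x < R")
  case True
  then have "norm (s *\<^sub>R h) <= N" by (simp add: N_def mult_left_le_one_le)
  then have 1: "norm (x + s *\<^sub>R h) < R + N" using True norm_triangle_ineq[of x "s *\<^sub>R h"] by linarith
  have "\<bar>ph x\<bar> * \<bar>G (x + s *\<^sub>R h) \<bullet> h\<bar> <= C * (norm (G (x + s *\<^sub>R h)) * N)"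
  unfolding N_def by (intro mult_mono ph Cauchy_Schwarz_ineq2) (use C in auto)
  then show ?thesis using True 1 C by (simp add: g_def abs_mult N_def mult_ac)
 next
  case False then show ?thesis using ph(3)[of x] by (auto simp: indicator_def)
 qed
 qed
 qed
 have lG: "loc_int Gh"
 proof (rule loc_intI)
 fix R :: real
 have "integrable (lborel \<Otimes>\<^sub>M lborel) (%(s, x). indicat_real {0..1} s * (indicat_real (ball 0 R) x * (G (x + s *\<^sub>R h) \<bullet> h)))"
 by (rule dom[of _ 1 R]) (auto simp: indicator_def)
 from lborel_pair.integrable_snd[OF this]
 have "ilb (%x. indicat_real (ball 0 R) x * Gh x)"
 unfolding Gh_def by (simp add: mult.left_commute[of "indicat_real {0..1} _"])
 from integrable_norm[OF this] show "ilb (%x. indicat_real (ball 0 R) x * norm (Gh x))" by (simp add: abs_mult)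
 qed simp
 have fs: "loc_int (%x. f (x + h))"
 proof (rule loc_intI)
 fix R :: real
 have "ilb (%x. (%x. ind (ball 0 (R + N)) x * norm (f x)) (x + h))"
 using loc_int_norm[OF f] by (subst lborel_integrable_shift) auto
 then show "ilb (%x. indicat_real (ball 0 R) x * norm (f (x + h)))"
 proof (rule ibd)
 have "indicat_real (ball 0 R) x <= indicat_real (ball 0 (R + N)) (x + h)" for x
  using norm_triangle_ineq[of x h] by (auto simp: indicator_def N_def)
 then show "AL x. norm (indicat_real (ball 0 R) x * norm (f (x + h))) <= norm (indicat_real (ball 0 (R + N)) (x + h) * norm (f (x + h)))"
  by (intro AE_I2) (simp add: abs_mult mult_right_mono)
 qed measurable
 qed measurable
 have "AL x. (f (x + h) - f x) - Gh x = 0"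
 proof (rule fundamental_lemma_UNIV)
 show "loc_int (%x. (f (x + h) - f x) - Gh x)"
 using loc_int_add[OF fs loc_int_add[OF loc_int_mult_bounded[OF f, of "%x. - f x" 1] loc_int_mult_bounded[OF lG, of "%x. - Gh x" 1]]]
 by (simp add: algebra_simps)
 fix ph :: "'a => real" assume "test_function UNIV ph"
 then have c: "C1c ph (grad ph)" by (rule test_function_C1c)
 obtain R where R: "R > 0" "!!x. norm x >= R ==> ph x = 0" "!!x. norm x >= R ==> grad ph x = 0" using C1c_support[OF c] by metis
 obtain C where C: "C >= 0" "!!x. \<bar>ph x\<bar> <= C" "!!x. norm (grad ph x) <= C" using C1c_bounded[OF c] by metis
 have [measurable]: "ph : bm" "grad ph : bm" using C1_borel[OF C1c_C1[OF c]] by auto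
 have prod: "ilb (%x. ps x * g x)" if "loc_int g" "ps : bm" "!!x. \<bar>ps x\<bar> <= C" "!!x. norm x >= S ==> ps x = 0" for ps g :: "'a => real" and S
 by (rule loc_int_integrable[OF that(1), of _ C S]) (use that loc_int_borel[OF that(1)] in \<open>auto simp: abs_mult mult_right_mono\<close>)
 have sh: "ph (x - h) = 0" if "norm x >= R + N" for x
 using that norm_triangle_ineq2[of x h] by (intro R(2)) (simp add: N_def)
 have i1: "ilb (%x. ph x * f (x + h))" "ilb (%x. ph x * f x)" "ilb (%x. ph x * Gh x)"
 using prod[OF fs, of ph R] prod[OF f, of ph R] prod[OF lG, of ph R] C R by auto
 have i2: "ilb (%x. ph (x - h) * f x)" by (rule prod[OF f, of _ "R + N"]) (use C sh in auto)
 have "(LL x. ph x * f (x + h)) = (LL x. (%x. ph (x - h) * f x) (x + h))" by simp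
 also have "... = (LL x. ph (x - h) * f x)" by (rule lborel_integral_shift) measurable
 finally have "(LL x. ph x * f (x + h)) - (LL x. ph x * f x) = (LL x. (ph (x - h) - ph x) * f x)"
 by (simp add: left_diff_distrib i1 i2)
 also have "... = - (LL x. (LL s. ind {0..1} s * (grad ph (x - s *\<^sub>R h) \<bullet> h) * f x))"
 unfolding C1_line[OF C1c_C1[OF c]] by simp
 also have "(LL x. (LL s. ind {0..1} s * (grad ph (x - s *\<^sub>R h) \<bullet> h) * f x))
 = (LL s. (LL x. ind {0..1} s * (grad ph (x - s *\<^sub>R h) \<bullet> h) * f x))"
 proof (rule lborel_pair.Fubini_integral)
 show "integrable (lborel \<Otimes>\<^sub>M lborel) (%(s, x). ind {0..1} s * (grad ph (x - s *\<^sub>R h) \<bullet> h) * f x)"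
 proof (rule ibd[OF imr[OF integrable_shear[OF p loc_int_norm[OF f, of "R + N"], of 0], of "C * N"]])
  show "(%(s, x). indicat_real {0..1} s * (grad ph (x - s *\<^sub>R h) \<bullet> h) * f x) : borel_measurable (lborel \<Otimes>\<^sub>M lborel)"
  by measurable
  show "AE z in lborel \<Otimes>\<^sub>M lborel. norm (case z of (s, x) => indicat_real {0..1} s * (grad ph (x - s *\<^sub>R h) \<bullet> h) * f x)
  <= norm (C * N * (case z of (s, x) => indicat_real {0..1} s * (ind (ball 0 (R + N)) (x + s *\<^sub>R 0) * norm (f (x + s *\<^sub>R 0)))))"
  proof (rule AE_I2, clarify)
  fix s :: real and x :: 'a
  show "norm (indicat_real {0..1} s * (grad ph (x - s *\<^sub>R h) \<bullet> h) * f x) <= norm (C * N * (indicat_real {0..1} s * (indicat_real (ball 0 (R + N)) (x + s *\<^sub>R 0) * norm (f (x + s *\<^sub>R 0)))))"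
  proof (cases "s : {0..1} & norm x < R + N")
   case True
   have "\<bar>grad ph (x - s *\<^sub>R h) \<bullet> h\<bar> <= C * N"
   unfolding N_def by (rule order_trans[OF Cauchy_Schwarz_ineq2]) (use C in \<open>auto intro: mult_right_mono\<close>)
   then have "\<bar>grad ph (x - s *\<^sub>R h) \<bullet> h\<bar> * \<bar>f x\<bar> <= C * N * \<bar>f x\<bar>" by (intro mult_right_mono) auto
   then show ?thesis using True C by (simp add: abs_mult N_def)
  next
   case False
   show ?thesis
   proof (cases "s : {0..1}")
   case True
   then have "norm (s *\<^sub>R h) <= N" by (simp add: N_def mult_left_le_one_le)
   then have "norm (x - s *\<^sub>R h) >= R" using True False norm_triangle_ineq2[of x "s *\<^sub>R h"] by linarith
   then show ?thesis using R(3) by simp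
   qed simp
  qed
  qed
 qed
 qed
 \<comment> \<open>For fixed s the weak identity is tested with \<open>ph\<close> translated by s h,
   and the integral is then translated back.\<close>
 also have "(%s. (LL x. ind {0..1} s * (grad ph (x - s *\<^sub>R h) \<bullet> h) * f x))
  = (%s. - (LL x. ind {0..1} s * (ph x * (G (x + s *\<^sub>R h) \<bullet> h))))"
 proof
 fix s :: real
 note cs = C1c_shift[OF c, of "s *\<^sub>R h"]
 obtain S where S: "!!x. norm x >= S ==> ph (x - s *\<^sub>R h) = 0" "!!x. norm x >= S ==> grad ph (x - s *\<^sub>R h) = 0" using C1c_support[OF cs] by metis
 have ia: "ilb (%x. f x *\<^sub>R grad ph (x - s *\<^sub>R h))"
  by (rule loc_int_integrable[OF f, of _ C S]) (use S C in \<open>auto simp: mult.commute[of C] mult_left_mono\<close>)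
 have ib: "ilb (%x. ph (x - s *\<^sub>R h) *\<^sub>R G x)"
  by (rule loc_int_integrable[OF G, of _ C S]) (use S C in \<open>auto simp: mult_right_mono\<close>)
 have "(LL x. (grad ph (x - s *\<^sub>R h) \<bullet> h) * f x) = (LL x. f x *\<^sub>R grad ph (x - s *\<^sub>R h)) \<bullet> h"
  using ia by (simp add: integral_inner_left[symmetric] mult.commute)
 also have "... = - (LL x. ph (x - s *\<^sub>R h) *\<^sub>R G x) \<bullet> h"
  using wg cs unfolding weak_grad_def by auto
 also have "... = - (LL x. ph (x - s *\<^sub>R h) * (G x \<bullet> h))"
  using ib by (simp add: integral_inner_left[symmetric])
 also have "(LL x. ph (x - s *\<^sub>R h) * (G x \<bullet> h)) = (LL x. (%x. ph (x - s *\<^sub>R h) * (G x \<bullet> h)) (x + s *\<^sub>R h))"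
  by (rule lborel_integral_shift[symmetric]) measurable
 finally show "(LL x. ind {0..1} s * (grad ph (x - s *\<^sub>R h) \<bullet> h) * f x) = - (LL x. ind {0..1} s * (ph x * (G (x + s *\<^sub>R h) \<bullet> h)))"
  by (simp add: mult.assoc)
 qed
 also have "(LL s. - (LL x. ind {0..1} s * (ph x * (G (x + s *\<^sub>R h) \<bullet> h)))) =
 - (LL s. (LL x. ind {0..1} s * (ph x * (G (x + s *\<^sub>R h) \<bullet> h))))" by simp
 also have "(LL s. (LL x. ind {0..1} s * (ph x * (G (x + s *\<^sub>R h) \<bullet> h)))) =
  (LL x. (LL s. ind {0..1} s * (ph x * (G (x + s *\<^sub>R h) \<bullet> h))))"
 by (rule lborel_pair.Fubini_integral[symmetric], rule dom[of _ C R]) (use C R in auto)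
 also have "... = (LL x. ph x * Gh x)" unfolding Gh_def by (simp add: mult.left_commute[of "ind {0..1} _"])
 finally show "(LL x. ph x * (f (x + h) - f x - Gh x)) = 0"
 by (simp add: right_diff_distrib i1)
 qed
 then show ?thesis unfolding Gh_def by eventually_elim simp
qed

text \<open>For |h| <= 1 a cut-off at radius r + 1 is invisible from the ball of radius r, so the
  global continuity of translations applies to the cut-off function.\<close>

lemma loc_translation:
 fixes G :: "'a::euclidean_space => 'b::euclidean_space"
 assumes G: "loc_int G" and "de > 0"
 shows "\<exists>d>0. ALL h. norm h <= d --> (NN x. ennreal (ib r x * norm (G (x + h) - G x))) <= ennreal de"
proof -
 let ?g = "%x. indicat_real (ball 0 (r + 1)) x *\<^sub>R G x"
 have g: "ilb ?g" using G by (simp add: loc_int_def)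
 have [measurable]: "G : bm" using G by (simp add: loc_int_def)
 obtain d where d: "d > 0" "!!h. norm h <= d ==> (LL x. norm (?g (x + h) - ?g x)) < de"
 using translation_continuous[OF g \<open>de > 0\<close>] by blast
 have "(NN x. ennreal (ib r x * norm (G (x + h) - G x))) <= ennreal de" if h: "norm h <= min d 1" for h
 proof -
 have i: "ilb (%x. norm (?g (x + h) - ?g x))"
 using g lborel_integrable_shift[of ?g h] by (intro integrable_norm idiff) auto
 have "(NN x. ennreal (ib r x * norm (G (x + h) - G x))) <= (NN x. ennreal (norm (?g (x + h) - ?g x)))"
 proof (intro nn_integral_mono ennreal_leI)
 fix x show "ib r x * norm (G (x + h) - G x) <= norm (?g (x + h) - ?g x)"
  using h norm_triangle_ineq[of x h] by (auto simp: indicator_def)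
 qed
 also have "... = ennreal (LL x. norm (?g (x + h) - ?g x))" using i by (intro nn_integral_eq_integral) auto
 also have "... <= ennreal de" using d(2)[of h] h by (intro ennreal_leI) auto
 finally show ?thesis .
 qed
 then show ?thesis using d(1) by (intro exI[of _ "min d 1"]) auto
qed

text \<open>\<open>V\<close> is subtracted from the gradient along the whole segment. Used with V =
  G for the first-order remainder, where \<open>B\<close> is a modulus of continuity of G, and with
  V = 0 for the plain difference, where \<open>B\<close> is a local norm of G.\<close>

lemma difference_estimate:
 fixes f :: "'a::euclidean_space => real" and V :: "'a => 'a"
 assumes wg: "weak_grad f G" and [measurable]: "V : bm"
 and b: "!!s. s : {0..1} ==> (NN x. ennreal (ib r x * norm (G (x + s *\<^sub>R h) - V x))) <= B"
 shows "(NN x. ennreal (ib r x * \<bar>f (x + h) - f x - V x \<bullet> h\<bar>)) <= ennreal (norm h) * B"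
proof -
 have f: "loc_int f" and G: "loc_int G" using wg by (auto simp: weak_grad_def)
 have [measurable]: "f : bm" "G : bm" using f G by (auto simp: loc_int_def)
 have [measurable]: "ball (0::'a) r : sets borel" by simp
 let ?I = "%x. LL s. ind {0..1::real} s * ((G (x + s *\<^sub>R h) - V x) \<bullet> h)"
 have bd: "ennreal \<bar>f (x + h) - f x - V x \<bullet> h\<bar> <= (NN s. ennreal (ind {0..1} s * (norm (G (x + s *\<^sub>R h) - V x) * norm h)))"
 if eq: "f (x + h) - f x = (LL s. ind {0..1} s * (G (x + s *\<^sub>R h) \<bullet> h))" for x
 proof (cases "ilb (%s. ind {0..1} s * (G (x + s *\<^sub>R h) \<bullet> h))")
 case True
 have i2: "ilb (%s. ind {0..1::real} s * (V x \<bullet> h))" by simp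
 have "f (x + h) - f x - V x \<bullet> h = ?I x"
 unfolding eq inner_diff_left right_diff_distrib
 by (subst ldiff[OF True i2]) simp
 then have "ennreal \<bar>f (x + h) - f x - V x \<bullet> h\<bar> = ennreal (norm (?I x))" by simp
 also have "... <= (NN s. ennreal (norm (ind {0..1::real} s * ((G (x + s *\<^sub>R h) - V x) \<bullet> h))))"
 unfolding inner_diff_left right_diff_distrib
 by (intro integral_norm_bound_ennreal idiff True i2)
 also have "... <= (NN s. ennreal (ind {0..1} s * (norm (G (x + s *\<^sub>R h) - V x) * norm h)))"
 by (intro nn_integral_mono ennreal_leI) (auto simp: indicator_def Cauchy_Schwarz_ineq2)
 finally show ?thesis .
 next
 \<comment> \<open>If the integral along the segment diverges, its default value is harmless,
   because the right-hand side is infinite.\<close>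
 case False
 then have False2: "~ ilb (%s. ind {0..1} s * ((G (x + s *\<^sub>R h) - V x) \<bullet> h))"
 proof (rule contrapos_nn)
 assume "ilb (%s. ind {0..1} s * ((G (x + s *\<^sub>R h) - V x) \<bullet> h))"
 from iadd[OF this, of "%s. ind {0..1::real} s * (V x \<bullet> h)"]
 show "ilb (%s. ind {0..1} s * (G (x + s *\<^sub>R h) \<bullet> h))"
  by (simp add: inner_diff_left right_diff_distrib)
 qed
 have "(NN s. ennreal (norm (ind {0..1::real} s * ((G (x + s *\<^sub>R h) - V x) \<bullet> h)))) = \<infinity>"
 using False2 unfolding integrable_iff_bounded by (auto simp: not_less top_unique)
 moreover have "(NN s. ennreal (norm (ind {0..1::real} s * ((G (x + s *\<^sub>R h) - V x) \<bullet> h))))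
 <= (NN s. ennreal (ind {0..1} s * (norm (G (x + s *\<^sub>R h) - V x) * norm h)))"
 by (intro nn_integral_mono ennreal_leI) (auto simp: indicator_def Cauchy_Schwarz_ineq2)
 ultimately show ?thesis by (simp add: top_unique)
 qed
 have "(NN x. ennreal (ib r x * \<bar>f (x + h) - f x - V x \<bullet> h\<bar>))
 <= (NN x. (NN s. ennreal (ib r x * (ind {0..1} s * (norm (G (x + s *\<^sub>R h) - V x) * norm h)))))"
 proof (rule nn_integral_mono_AE, use weak_grad_difference[OF wg, of h] in eventually_elim)
 case (elim x)
 show ?case using bd[OF elim] by (cases "x : ball 0 r") auto
 qed
 also have "... = (NN s. (NN x. ennreal (ib r x * (ind {0..1} s * (norm (G (x + s *\<^sub>R h) - V x) * norm h)))))"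
 by (rule lborel_pair.Fubini') measurable
 also have "... <= (NN s. (ennreal (norm h) * B) * ind {0..1::real} s)"
 proof (rule nn_integral_mono)
 fix s :: real
 show "(NN x. ennreal (ib r x * (ind {0..1} s * (norm (G (x + s *\<^sub>R h) - V x) * norm h)))) <= (ennreal (norm h) * B) * ind {0..1} s"
 proof (cases "s : {0..1}")
 case True
 have "(NN x. ennreal (ib r x * (ind {0..1} s * (norm (G (x + s *\<^sub>R h) - V x) * norm h))))
  = (NN x. ennreal (norm h) * ennreal (ib r x * norm (G (x + s *\<^sub>R h) - V x)))"
  using True by (intro nn_integral_cong) (simp add: ennreal_mult'[symmetric] mult_ac)
 also have "... = ennreal (norm h) * (NN x. ennreal (ib r x * norm (G (x + s *\<^sub>R h) - V x)))"
  by (rule nn_integral_cmult) measurable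
 also have "... <= ennreal (norm h) * B" using b[OF True] by (intro mult_left_mono) auto
 finally show ?thesis using True by simp
 qed simp
 qed
 also have "... = ennreal (norm h) * B" by (simp add: nn_integral_cmult_indicator)
 finally show ?thesis .
qed

section \<open>The commutator estimate\<close>

lemma nn_integral_lborel_reflect:
 fixes g :: "'a::euclidean_space => ennreal"
 assumes [measurable]: "g : bm"
 shows "(NN y. g (x - y)) = (NN y. g y)"
 using nn_integral_distr[of "%y. x - y" lborel borel g] by (simp add: lborel_distr_reflect)

lemma nn_integral_lborel_shift:
 fixes g :: "'a::euclidean_space => ennreal"
 assumes [measurable]: "g : bm"
 shows "(NN y. g (y + x)) = (NN y. g y)"
 using nn_integral_distr[of "%y. y + x" lborel borel g] by (simp add: lborel_distr_shift)

text \<open>Split g at height N: below N the product costs N times the L^1 norm of q, above N the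
  rest of g is small in L^1 and q is at most M. So smallness in L^1 of a bounded q survives
  multiplication by a merely integrable g.\<close>

lemma vanish_product:
 fixes g :: "'a::euclidean_space => real"
 assumes g: "ilb g" "!!x. g x >= 0" "!!x. x \<notin> B ==> g x = 0"
 and [measurable]: "B : sets borel" and M: "M >= 0" and de: "de > 0"
 shows "\<exists>et>0. \<forall>q\<in>bm. (ALL x. \<bar>q x\<bar> <= M) -->
 (NN x. ennreal (ind B x * \<bar>q x\<bar>)) <= ennreal et --> (NN x. ennreal (g x * \<bar>q x\<bar>)) <= ennreal de"
proof -
 have [measurable]: "g : bm" using g(1) by auto
 have i: "ilb (%x. g x - min (g x) (real N))" for N :: nat
 by (rule ibd[OF g(1)]) (use g(2) in \<open>auto simp: min_def\<close>)
 have "(%N. LL x. g x - min (g x) (real N)) \<longlonglongrightarrow> (LINT x|(lborel::'a measure). 0)"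
 proof (rule ldct[OF _ _ g(1)])
 show "AL x. (%N. g x - min (g x) (real N)) \<longlonglongrightarrow> 0"
 proof (rule AE_I2, rule tendsto_eventually)
 fix x obtain N :: nat where "g x <= N" using real_arch_simple by blast
 then show "\<forall>\<^sub>F n in sequentially. g x - min (g x) (real n) = 0"
  by (intro eventually_sequentiallyI[of N]) (auto simp: min_def)
 qed
 qed (use g(2) in \<open>auto simp: min_def\<close>)
 then have "\<forall>\<^sub>F N in sequentially. (LL x. g x - min (g x) (real N)) < de / (2 * (M + 1))"
 using M de by (intro order_tendstoD(2)[where y=0]) auto
 then obtain N :: nat where N: "(LL x. g x - min (g x) (real N)) < de / (2 * (M + 1))"
 by (auto simp: eventually_sequentially)
 define et where "et = de / (2 * (real N + 1))"
 have "(NN x. ennreal (g x * \<bar>q x\<bar>)) <= ennreal de"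
 if [measurable]: "q : bm" and q: "!!x. \<bar>q x\<bar> <= M"
 "(NN x. ennreal (ind B x * \<bar>q x\<bar>)) <= ennreal et" for q
 proof -
 have "(NN x. ennreal (g x * \<bar>q x\<bar>))
 <= (NN x. ennreal N * ennreal (ind B x * \<bar>q x\<bar>) + ennreal M * ennreal (g x - min (g x) N))"
 proof (rule nn_integral_mono)
 fix x
 have "g x * \<bar>q x\<bar> = min (g x) N * \<bar>q x\<bar> + (g x - min (g x) N) * \<bar>q x\<bar>" by (simp add: left_diff_distrib)
 also have "min (g x) N * \<bar>q x\<bar> <= N * (ind B x * \<bar>q x\<bar>)"
  using g(2,3)[of x] by (cases "x : B") (auto intro: mult_right_mono)
 also have "(g x - min (g x) N) * \<bar>q x\<bar> <= M * (g x - min (g x) N)"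
  using q(1)[of x] by (simp add: mult.commute mult_right_mono)
 finally show "ennreal (g x * \<bar>q x\<bar>) <= ennreal N * ennreal (ind B x * \<bar>q x\<bar>) + ennreal M * ennreal (g x - min (g x) N)"
  using M by (simp add: ennreal_mult'[symmetric] ennreal_plus[symmetric] del: ennreal_plus)
 qed
 also have "... = ennreal N * (NN x. ennreal (ind B x * \<bar>q x\<bar>)) + ennreal M * (NN x. ennreal (g x - min (g x) N))"
 by (subst nn_integral_add) (simp_all add: nn_integral_cmult)
 also have "... <= ennreal N * ennreal et + ennreal M * ennreal (de / (2 * (M + 1)))"
 using N q(2) by (intro add_mono mult_left_mono) (auto simp: nn_integral_eq_integral[OF i] intro: ennreal_leI)
 also have "... = ennreal (N * et + M * (de / (2 * (M + 1))))"
 using M de by (simp add: ennreal_mult'[symmetric] ennreal_plus[symmetric] et_def del: ennreal_plus)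
 also have "... <= ennreal (de / 2 + de / 2)"
 using M de unfolding et_def by (intro ennreal_leI add_mono) (auto simp: field_simps)
 finally show ?thesis by simp
 qed
 then show ?thesis using de by (intro exI[of _ et]) (auto simp: et_def)
qed

text \<open>Convolution of f with the constant 1 is constant, so its gradient, the convolution of 1
  with \<open>f'\<close>, is 0.\<close>

lemma C1c_integral_zero:
 fixes f :: "'a::euclidean_space => real"
 assumes f: "C1c f f'" shows "(LL x. f' x) = 0"
proof -
 have l: "loc_int (%_::'a. 1::real)" by (rule loc_int_bounded[of _ 1]) auto
 have "conv (%_. 1) f x = (LL y. f y)" for x
 using lborel_integral_reflect[OF C1_borel(1)[OF C1c_C1[OF f]]] by (simp add: conv_def)
 then have "conv (%_. 1) f = (%x. LL y. f y)" by auto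
 then have "C1 (%x::'a. LL y. f y) (conv (%_. 1) f')" using conv_C1[OF l f] by simp
 from C1_grad[OF this] C1_grad[OF C1_const[of "LL y. f y", where 'a='a]]
 have "conv (%_. 1) f' 0 = 0" by metis
 then show ?thesis
 using lborel_integral_reflect[OF C1_borel(2)[OF C1c_C1[OF f]], of 0] by (simp add: conv_def)
qed

text \<open>The partial derivative in direction i of the function z_j rho(z), where rho is the
  mollifier \<open>moll e\<close>.\<close>

definition comm_kernel :: "'a::euclidean_space => 'a => real => 'a => real" where
 "comm_kernel i j e z = (j \<bullet> i) * moll e z + (z \<bullet> j) * (grad (moll e) z \<bullet> i)"

text \<open>As a derivative of a compactly supported function the kernel has integral 0, so
  convolution with it tends to 0; the uniform L^1 bound 1 + C keeps these convolutions bounded as e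
  tends to 0.\<close>

lemma comm_kernel:
 fixes i j :: "'a::euclidean_space"
 assumes e: "e > 0" and ij: "i : Basis" "j : Basis"
 and C: "(LL x. norm x * norm (grad (moll e) (x::'a))) <= C"
 shows "ilb (comm_kernel i j e)"
 and "(LL z. comm_kernel i j e z) = 0"
 and "(LL z. \<bar>comm_kernel i j e z\<bar>) <= 1 + C"
 and "EX B. ALL z. \<bar>comm_kernel i j e z\<bar> <= B"
 and "norm z > e ==> comm_kernel i j e z = 0"
 and "comm_kernel i j e : bm"
proof -
 have "C1 (%z::'a. z \<bullet> j) (%z. j)"
 by (rule C1I[where F="%z h. h \<bullet> j"]) (auto intro!: derivative_eq_intros simp: inner_commute)
 from C1c_mult_left[OF moll_C1c[OF e] this]
 have c: "C1c (%z. moll e z * (z \<bullet> j)) (%z. moll e z *\<^sub>R j + (z \<bullet> j) *\<^sub>R grad (moll e) z)" .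
 have eq: "comm_kernel i j e = (%z. (moll e z *\<^sub>R j + (z \<bullet> j) *\<^sub>R grad (moll e) z) \<bullet> i)"
 by (rule ext) (simp add: comm_kernel_def inner_add_left)
 show int: "ilb (comm_kernel i j e)" unfolding eq
 using C1c_integrable(2)[OF c] by (rule integrable_inner_left)
 have "(LL z. comm_kernel i j e z) = (LL z. moll e z *\<^sub>R j + (z \<bullet> j) *\<^sub>R grad (moll e) z) \<bullet> i"
 unfolding eq using C1c_integrable(2)[OF c] by (intro integral_inner_left)
 then show "(LL z. comm_kernel i j e z) = 0" using C1c_integral_zero[OF c] by simp
 have n: "norm i = 1" "norm j = 1" using ij by auto
 obtain B where B: "!!z. norm (moll e z *\<^sub>R j + (z \<bullet> j) *\<^sub>R grad (moll e) z) <= B" using C1c_bounded[OF c] by metis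
 have "\<bar>comm_kernel i j e z\<bar> <= B" for z
 unfolding eq using order_trans[OF Cauchy_Schwarz_ineq2] B n by (metis mult.right_neutral)
 then show "EX B. ALL z. \<bar>comm_kernel i j e z\<bar> <= B" by blast
 show "norm z > e ==> comm_kernel i j e z = 0"
 by (simp add: comm_kernel_def moll_zero[OF e] grad_moll_zero[OF e])
 show "comm_kernel i j e : bm" using int by simp
 obtain B' where B': "!!x. norm (grad (moll e) (x::'a)) <= B'" using C1c_bounded[OF moll_C1c[OF e]] by metis
 have i2: "ilb (%x::'a. norm x * norm (grad (moll e) x))"
 proof (rule loc_int_integrable[OF loc_int_bounded[of "%_::'a. 1::real" 1]])
 show "(%x::'a. norm x * norm (grad (moll e) x)) : bm" using grad_moll_borel[OF e] by measurable
 show "norm (norm x * norm (grad (moll e) x)) <= e * B' * norm (1::real)" for x :: 'a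
 using grad_moll_zero[OF e, of x] B'[of x] e by (cases "norm x > e") (auto intro!: mult_mono order_trans[OF norm_ge_zero B'])
 show "norm x * norm (grad (moll e) x) = 0" if "norm x >= e + 1" for x :: 'a using that grad_moll_zero[OF e, of x] by simp
 qed auto
 have "(LL z. \<bar>comm_kernel i j e z\<bar>) <= (LL z. moll e z + norm z * norm (grad (moll e) (z::'a)))"
 proof (rule integral_mono)
 show "ilb (%z. \<bar>comm_kernel i j e z\<bar>)" using int by simp
 show "ilb (%z::'a. moll e z + norm z * norm (grad (moll e) z))"
 by (intro iadd moll_integrable e i2)
 fix z :: 'a
 have "\<bar>j \<bullet> i\<bar> <= 1" "\<bar>z \<bullet> j\<bar> <= norm z" "\<bar>grad (moll e) z \<bullet> i\<bar> <= norm (grad (moll e) z)"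
 using Cauchy_Schwarz_ineq2[of j i] Cauchy_Schwarz_ineq2[of z j] Cauchy_Schwarz_ineq2[of "grad (moll e) z" i] n by auto
 then have "\<bar>j \<bullet> i\<bar> * moll e z <= 1 * moll e z" "\<bar>z \<bullet> j\<bar> * \<bar>grad (moll e) z \<bullet> i\<bar> <= norm z * norm (grad (moll e) z)"
 using moll_nonneg[OF e, of z] by (intro mult_right_mono mult_mono; simp)+
 then show "\<bar>comm_kernel i j e z\<bar> <= moll e z + norm z * norm (grad (moll e) z)"
 using moll_nonneg[OF e, of z] unfolding comm_kernel_def
 by (intro order_trans[OF abs_triangle_ineq] add_mono) (auto simp: abs_mult)
 qed
 also have "... = 1 + (LL z. norm z * norm (grad (moll e) (z::'a)))"
 using moll_integral[OF e, where 'a='a] by (simp add: moll_integrable[OF e] i2)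
 finally show "(LL z. \<bar>comm_kernel i j e z\<bar>) <= 1 + C" using C by simp
qed

text \<open>Taken with f = b_i and its gradient G and summed over i, this is the DiPerna-Lions
  commutator b . grad(w * rho) - (b . grad w) * rho, with all derivatives put on the kernel.\<close>

definition comm :: "('a::euclidean_space => real) => ('a => real) => ('a => 'a) => 'a => real => 'a => real" where
 "comm w f G i e x = (LL y. w y * ((G y \<bullet> i) * moll e (x - y) + (f x - f y) * (grad (moll e) (x - y) \<bullet> i)))"

text \<open>Replace G y by G x and f x - f y by its linearisation G x . (x - y). What remains is a
  combination of convolutions of w with \<open>comm_kernel\<close>, with coefficients G x; the
  replacement error is bounded using |w| <= K.\<close>

lemma comm_pointwise:
 fixes w f :: "'a::euclidean_space => real"
 assumes [measurable]: "w : bm" "f : bm" "G : bm"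
 and w: "!!x. \<bar>w x\<bar> <= K" and i: "i : Basis" and e: "e > 0"
 shows "ennreal \<bar>comm w f G i e x\<bar> <= ennreal K * (NN y. ennreal (norm (G y - G x) * moll e (x - y)
 + \<bar>f x - f y - G x \<bullet> (x - y)\<bar> * norm (grad (moll e) (x - y))))
 + (\<Sum>j\<in>Basis. ennreal (norm (G x) * \<bar>conv w (comm_kernel i j e) x\<bar>))"
proof -
 have K: "K >= 0" using w[of 0] by linarith
 note [measurable] = grad_moll_borel[OF e]
 let ?A = "%y. w y * ((G y \<bullet> i) * moll e (x - y) + (f x - f y) * (grad (moll e) (x - y) \<bullet> i))"
 let ?B = "%y. w y * ((G x \<bullet> i) * moll e (x - y) + (G x \<bullet> (x - y)) * (grad (moll e) (x - y) \<bullet> i))"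
 have lw: "loc_int w" by (rule loc_int_bounded[of _ K]) (use w in auto)
 have ki: "ilb (%y. w y * comm_kernel i j e (x - y))" if j: "j : Basis" for j
 proof -
 obtain B where "ALL z. \<bar>comm_kernel i j e z\<bar> <= B" using comm_kernel(4)[OF e i j order_refl] by blast
 then show ?thesis
 using conv_integrable[OF lw comm_kernel(6)[OF e i j order_refl], of B "e + 1" x] comm_kernel(5)[OF e i j order_refl] by auto
 qed
 have Beq: "?B y = (\<Sum>j\<in>Basis. (G x \<bullet> j) * (w y * comm_kernel i j e (x - y)))" for y
 proof -
 have "(\<Sum>j\<in>Basis. (G x \<bullet> j) * (w y * comm_kernel i j e (x - y)))
 = w y * ((\<Sum>j\<in>Basis. (G x \<bullet> j) * (i \<bullet> j)) * moll e (x - y) + (\<Sum>j\<in>Basis. (G x \<bullet> j) * ((x - y) \<bullet> j)) * (grad (moll e) (x - y) \<bullet> i))"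
 unfolding comm_kernel_def sum_distrib_right sum_distrib_left sum.distrib[symmetric]
 by (intro sum.cong refl) (simp add: algebra_simps inner_commute)
 then show ?thesis unfolding euclidean_inner[symmetric] by simp
 qed
 have iB: "ilb ?B" unfolding Beq by (intro Bochner_Integration.integrable_sum imr ki)
 have LB: "(LL y. ?B y) = (\<Sum>j\<in>Basis. (G x \<bullet> j) * conv w (comm_kernel i j e) x)"
 unfolding Beq conv_def by (subst Bochner_Integration.integral_sum) (auto intro!: imr ki)
 have LBb: "\<bar>LL y. ?B y\<bar> <= (\<Sum>j\<in>Basis. norm (G x) * \<bar>conv w (comm_kernel i j e) x\<bar>)"
 unfolding LB by (rule order_trans[OF sum_abs sum_mono]) (auto simp: abs_mult Basis_le_norm intro: mult_right_mono)
 show ?thesis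
 proof (cases "ilb ?A")
 case False
 then have "comm w f G i e x = 0" unfolding comm_def by (rule not_integrable_integral_eq)
 then show ?thesis by simp
 next
 case True
 have "comm w f G i e x = (LL y. ?A y - ?B y) + (LL y. ?B y)"
 unfolding comm_def by (simp add: True iB)
 then have "\<bar>comm w f G i e x\<bar> <= norm (LL y. ?A y - ?B y) + (\<Sum>j\<in>Basis. norm (G x) * \<bar>conv w (comm_kernel i j e) x\<bar>)"
 using LBb by simp
 then have "ennreal \<bar>comm w f G i e x\<bar> <= ennreal (norm (LL y. ?A y - ?B y)) + (\<Sum>j\<in>Basis. ennreal (norm (G x) * \<bar>conv w (comm_kernel i j e) x\<bar>))"
 by (subst sum_ennreal) (auto simp: ennreal_plus[symmetric] sum_nonneg simp del: ennreal_plus intro!: ennreal_leI)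
 also have "ennreal (norm (LL y. ?A y - ?B y)) <= (NN y. ennreal (norm (?A y - ?B y)))"
 by (intro integral_norm_bound_ennreal idiff True iB)
 also have "... <= (NN y. ennreal K * ennreal (norm (G y - G x) * moll e (x - y)
 + \<bar>f x - f y - G x \<bullet> (x - y)\<bar> * norm (grad (moll e) (x - y))))"
 proof (rule nn_integral_mono)
 fix y
 have n: "norm i = 1" using i by simp
 have "?A y - ?B y = w y * (((G y - G x) \<bullet> i) * moll e (x - y) + (f x - f y - G x \<bullet> (x - y)) * (grad (moll e) (x - y) \<bullet> i))"
  by (simp add: algebra_simps inner_diff_left)
 also have "norm ... = \<bar>w y\<bar> * \<bar>((G y - G x) \<bullet> i) * moll e (x - y) + (f x - f y - G x \<bullet> (x - y)) * (grad (moll e) (x - y) \<bullet> i)\<bar>"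
  by (simp add: abs_mult)
 also have "... <= K * (norm (G y - G x) * moll e (x - y) + \<bar>f x - f y - G x \<bullet> (x - y)\<bar> * norm (grad (moll e) (x - y)))"
  using moll_nonneg[OF e, of "x - y"] w[of y] K i
  by (intro mult_mono order_trans[OF abs_triangle_ineq] add_mono) (auto simp: abs_mult intro!: mult_right_mono mult_left_mono Basis_le_norm)
 finally show "ennreal (norm (?A y - ?B y)) <= ennreal K * ennreal (norm (G y - G x) * moll e (x - y)
 + \<bar>f x - f y - G x \<bullet> (x - y)\<bar> * norm (grad (moll e) (x - y)))"
  using K by (simp add: ennreal_mult'[symmetric] ennreal_leI)
 qed
 also have "... = ennreal K * (NN y. ennreal (norm (G y - G x) * moll e (x - y)
 + \<bar>f x - f y - G x \<bullet> (x - y)\<bar> * norm (grad (moll e) (x - y))))"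
 by (rule nn_integral_cmult) measurable
 finally show ?thesis by (simp add: add_right_mono)
 qed
qed

text \<open>With y = x - z and the x-integral taken first, the first term is a translation error of
  G. In the second, \<open>difference_estimate\<close> supplies a factor |z|, which is exactly what
  the integral of |grad rho(z)| needs to stay bounded.\<close>

lemma comm_remainder:
 fixes f :: "'a::euclidean_space => real"
 assumes wg: "weak_grad f G" and e: "e > 0"
 and C: "(LL x. norm x * norm (grad (moll e) (x::'a))) <= C"
 and D: "!!h. norm h <= e ==> (NN x. ennreal (ib r x * norm (G (x + h) - G x))) <= D"
 shows "(NN x. ennreal (ib r x) * (NN y. ennreal (norm (G y - G x) * moll e (x - y)
 + \<bar>f x - f y - G x \<bullet> (x - y)\<bar> * norm (grad (moll e) (x - y))))) <= ennreal (1 + C) * D"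
proof -
 have [measurable]: "f : bm" "G : bm" using wg by (auto simp: weak_grad_def loc_int_def)
 note [measurable] = grad_moll_borel[OF e]
 let ?T = "%x z. ib r x * norm (G (x - z) - G x) * moll e z
 + ib r x * \<bar>f (x - z) - f x - G x \<bullet> (- z)\<bar> * norm (grad (moll e) z)"
 have "(NN x. ennreal (ib r x) * (NN y. ennreal (norm (G y - G x) * moll e (x - y)
 + \<bar>f x - f y - G x \<bullet> (x - y)\<bar> * norm (grad (moll e) (x - y)))))
 = (NN x. (NN z. ennreal (?T x z)))"
 proof (rule nn_integral_cong)
 fix x
 have "(NN y. ennreal (norm (G y - G x) * moll e (x - y)
 + \<bar>f x - f y - G x \<bullet> (x - y)\<bar> * norm (grad (moll e) (x - y))))
 = (NN z. (%y. ennreal (norm (G y - G x) * moll e (x - y)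
 + \<bar>f x - f y - G x \<bullet> (x - y)\<bar> * norm (grad (moll e) (x - y)))) (x - z))"
 by (rule nn_integral_lborel_reflect[symmetric]) measurable
 also have "... = (NN z. ennreal (norm (G (x - z) - G x) * moll e z
 + \<bar>f (x - z) - f x - G x \<bullet> (- z)\<bar> * norm (grad (moll e) z)))"
 proof (rule nn_integral_cong)
 fix z :: 'a
 have "\<bar>f x - f (x - z) - G x \<bullet> z\<bar> = \<bar>f (x - z) - f x - G x \<bullet> (- z)\<bar>" by (simp add: abs_if)
 then show "(%y. ennreal (norm (G y - G x) * moll e (x - y)
 + \<bar>f x - f y - G x \<bullet> (x - y)\<bar> * norm (grad (moll e) (x - y)))) (x - z) = ennreal (norm (G (x - z) - G x) * moll e z
 + \<bar>f (x - z) - f x - G x \<bullet> (- z)\<bar> * norm (grad (moll e) z))" by simp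
 qed
 finally show "ennreal (ib r x) * (NN y. ennreal (norm (G y - G x) * moll e (x - y)
 + \<bar>f x - f y - G x \<bullet> (x - y)\<bar> * norm (grad (moll e) (x - y)))) = (NN z. ennreal (?T x z))"
 by (cases "x : ball 0 r") auto
 qed
 also have "... = (NN z. (NN x. ennreal (?T x z)))"
 by (rule lborel_pair.Fubini'[symmetric]) measurable
 also have "... <= (NN z. D * ennreal (moll e z + norm z * norm (grad (moll e) (z::'a))))"
 proof (rule nn_integral_mono)
 fix z :: 'a
 show "(NN x. ennreal (?T x z)) <= D * ennreal (moll e z + norm z * norm (grad (moll e) z))"
 proof (cases "norm z > e")
 case True
 then show ?thesis by (simp add: moll_zero[OF e] grad_moll_zero[OF e])
 next
 case False
 have m: "moll e z >= 0" by (rule moll_nonneg[OF e])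
 have "(NN x. ennreal (?T x z)) = (NN x. ennreal (ib r x * norm (G (x - z) - G x)) * ennreal (moll e z)
  + ennreal (ib r x * \<bar>f (x - z) - f x - G x \<bullet> (- z)\<bar>) * ennreal (norm (grad (moll e) z)))"
  using m by (intro nn_integral_cong) (simp add: ennreal_mult'[symmetric] ennreal_plus[symmetric] del: ennreal_plus)
 also have "... = (NN x. ennreal (ib r x * norm (G (x - z) - G x))) * ennreal (moll e z)
  + (NN x. ennreal (ib r x * \<bar>f (x - z) - f x - G x \<bullet> (- z)\<bar>)) * ennreal (norm (grad (moll e) z))"
  by (subst nn_integral_add) (auto simp: nn_integral_multc)
 also have "... <= D * ennreal (moll e z) + (ennreal (norm z) * D) * ennreal (norm (grad (moll e) z))"
 proof (intro add_mono mult_right_mono)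
  show "(NN x. ennreal (ib r x * norm (G (x - z) - G x))) <= D"
  using D[of "-z"] False by simp
  have "(NN x. ennreal (ib r x * \<bar>f (x + (-z)) - f x - G x \<bullet> (- z)\<bar>)) <= ennreal (norm (-z)) * D"
  proof (rule difference_estimate[OF wg])
  fix s :: real assume s: "s : {0..1}"
  then have "norm (s *\<^sub>R (- z)) <= e" using False mult_left_le_one_le[of "norm z" s] by simp
  then show "(NN x. ennreal (ib r x * norm (G (x + s *\<^sub>R (- z)) - G x))) <= D" by (rule D)
  qed simp
  then show "(NN x. ennreal (ib r x * \<bar>f (x - z) - f x - G x \<bullet> (- z)\<bar>)) <= ennreal (norm z) * D" by simp
 qed auto
 also have "... = D * ennreal (moll e z + norm z * norm (grad (moll e) z))"
  using m by (simp add: ennreal_plus ennreal_mult' distrib_left mult_ac)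
 finally show ?thesis .
 qed
 qed
 also have "... = D * (NN z. ennreal (moll e z + norm z * norm (grad (moll e) (z::'a))))"
 by (rule nn_integral_cmult) measurable
 also have "D * (NN z. ennreal (moll e z + norm z * norm (grad (moll e) (z::'a)))) <= D * ennreal (1 + C)"
 proof (rule mult_left_mono)
 obtain B' where B': "!!x. norm (grad (moll e) (x::'a)) <= B'" using C1c_bounded[OF moll_C1c[OF e]] by metis
 have i2: "ilb (%x::'a. norm x * norm (grad (moll e) x))"
 proof (rule loc_int_integrable[OF loc_int_bounded[of "%_::'a. 1::real" 1]])
 show "(%x::'a. norm x * norm (grad (moll e) x)) : bm" by measurable
 show "norm (norm x * norm (grad (moll e) x)) <= e * B' * norm (1::real)" for x :: 'a
  using grad_moll_zero[OF e, of x] B'[of x] e by (cases "norm x > e") (auto intro!: mult_mono order_trans[OF norm_ge_zero B'])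
 show "norm x * norm (grad (moll e) x) = 0" if "norm x >= e + 1" for x :: 'a using that grad_moll_zero[OF e, of x] by simp
 qed auto
 have "(NN z. ennreal (moll e z + norm z * norm (grad (moll e) (z::'a)))) = ennreal (LL z. moll e z + norm z * norm (grad (moll e) (z::'a)))"
 by (intro nn_integral_eq_integral iadd moll_integrable[OF e] i2) (auto simp: moll_nonneg[OF e])
 also have "(LL z. moll e z + norm z * norm (grad (moll e) (z::'a))) = 1 + (LL z. norm z * norm (grad (moll e) (z::'a)))"
 using moll_integral[OF e, where 'a='a] by (simp add: moll_integrable[OF e] i2)
 also have "ennreal (1 + (LL z. norm z * norm (grad (moll e) (z::'a)))) <= ennreal (1 + C)"
 using C by (intro ennreal_leI) simp
 finally show "(NN z. ennreal (moll e z + norm z * norm (grad (moll e) (z::'a)))) <= ennreal (1 + C)" .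
 qed simp
 finally show ?thesis by (simp only: mult.commute)
qed

section \<open>Convolutions of bounded functions with integrable kernels\<close>

lemma conv_borel [measurable]:
 fixes f :: "'a::euclidean_space => real" and k :: "'a => 'b::euclidean_space"
 assumes [measurable]: "f : bm" "k : bm"
 shows "conv f k : bm"
proof -
 have "(%x. LL y. f y *\<^sub>R k (x - y)) : borel_measurable lborel" by measurable
 then show ?thesis unfolding conv_def[abs_def] by simp
qed

lemma conv_bound:
 fixes w k :: "'a::euclidean_space => real"
 assumes w: "!!x. \<bar>w x\<bar> <= K" and k: "ilb k" "(LL y. \<bar>k y\<bar>) <= L"
 shows "\<bar>conv w k x\<bar> <= K * L"
proof -
 have K: "K >= 0" using w[of 0] by linarith
 have kb: "k : bm" using k(1) by auto
 have ik: "ilb (%y. k (x - y))" using k(1) lborel_integrable_reflect[OF kb, of x] by simp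
 show ?thesis
 proof (cases "ilb (%y. w y * k (x - y))")
 case True
 have "\<bar>conv w k x\<bar> <= (LL y. \<bar>w y * k (x - y)\<bar>)" unfolding conv_def using integral_norm_bound[of lborel "%y. w y * k (x - y)"] by simp
 also have "... <= (LL y. K * \<bar>k (x - y)\<bar>)"
 proof (rule integral_mono)
 show "ilb (%y. \<bar>w y * k (x - y)\<bar>)" using True by (rule integrable_abs)
 show "ilb (%y. K * \<bar>k (x - y)\<bar>)" using ik by (intro imr integrable_abs)
 qed (use w in \<open>auto simp: abs_mult intro: mult_right_mono\<close>)
 also have "... = K * (LL y. \<bar>k y\<bar>)"
 using lborel_integral_reflect[of "%y. \<bar>k y\<bar>" x] kb by simp
 also have "... <= K * L" using k(2) K by (rule mult_left_mono)
 finally show ?thesis .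
 next
 case False
 have "0 <= (LL y. \<bar>k y\<bar>)" by (intro integral_nonneg_AE) auto
 then have "0 <= K * L" using K k(2) by (intro mult_nonneg_nonneg) linarith+
 then show ?thesis using False by (simp add: conv_def not_integrable_integral_eq)
 qed
qed

text \<open>Local form of \<open>kernel_close\<close> for a w that is only bounded: for e <= 1 the
  values on the ball of radius r involve w on the ball of radius r + 1 only. The threshold
  \<open>e0\<close> serves all kernels of mass at most \<open>L\<close>.\<close>

lemma kernel_loc:
 fixes w :: "'a::euclidean_space => real"
 assumes [measurable]: "w : bm" and w: "!!x. \<bar>w x\<bar> <= K" and de: "de > 0" and L: "L >= 0"
 shows "\<exists>e0>0. ALL e k. 0 < e --> e <= e0 --> ilb k --> (EX B. ALL y. \<bar>k y\<bar> <= B) --> (ALL y. norm y > e --> k y = 0) -->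
 (LL y. \<bar>k y\<bar>) <= L -->
 (NN x. ennreal (ib r x * \<bar>conv w k x - (LL y. k y) * w x\<bar>)) <= ennreal de"
proof -
 define g where "g x = ind (ball 0 (r + 1)) x * w x" for x
 have g: "ilb g" using loc_int_bounded[of w K] w by (simp add: loc_int_def g_def[abs_def])
 obtain d where d: "d > 0" "!!h. norm h <= d ==> (LL x. norm (g (x + h) - g x)) < de / (L + 1)"
 using translation_continuous[OF g, of "de / (L + 1)"] de L by auto
 have main: "(NN x. ennreal (ib r x * \<bar>conv w k x - (LL y. k y) * w x\<bar>)) <= ennreal de"
 if e: "0 < e" "e <= min d 1" and k: "ilb k" "!!y. \<bar>k y\<bar> <= B" "!!y. norm y > e ==> k y = 0" "(LL y. \<bar>k y\<bar>) <= L" for e k B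
 proof -
 have close: "(LL x. norm (g (x + h) - g x)) <= de / (L + 1)" if "norm h <= e" for h
 using d(2)[of h] that e by auto
 note kc = kernel_close[OF g k(1,2,3) close]
 have "(NN x. ennreal (ib r x * \<bar>conv w k x - (LL y. k y) * w x\<bar>))
 <= (NN x. ennreal \<bar>conv g k x - (LL y. k y) * g x\<bar>)"
 proof (rule nn_integral_mono)
 fix x :: 'a
 show "ennreal (ib r x * \<bar>conv w k x - (LL y. k y) * w x\<bar>) <= ennreal \<bar>conv g k x - (LL y. k y) * g x\<bar>"
 proof (cases "x : ball 0 r")
  case True
  have "w y * k (x - y) = g y * k (x - y)" for y
  proof (cases "norm (x - y) > e")
  case False
  then have "norm y < r + 1" using True e norm_triangle_ineq4[of x "x - y"] by simp
  then show ?thesis by (simp add: g_def)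
  qed (simp add: k)
  then have "conv w k x = conv g k x" unfolding conv_def real_scaleR_def by (simp only:)
  moreover have "w x = g x" using True by (simp add: g_def)
  ultimately show ?thesis using True by simp
 qed simp
 qed
 also have "... = ennreal (LL x. \<bar>conv g k x - (LL y. k y) * g x\<bar>)"
 using kc(1) by (intro nn_integral_eq_integral) auto
 also have "... <= ennreal (de / (L + 1) * (LL y. \<bar>k y\<bar>))" using kc(2) by (intro ennreal_leI)
 also have "... <= ennreal (de / (L + 1) * L)" using k(4) de L by (intro ennreal_leI mult_left_mono) auto
 also have "... <= ennreal de" using de L by (intro ennreal_leI) (simp add: field_simps)
 finally show ?thesis .
 qed
 then show ?thesis using d(1)
 proof (intro exI[of _ "min d 1"] conjI allI impI, goal_cases)
 case (2 e k)
 then obtain B where "!!y. \<bar>k y\<bar> <= B" by blast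
 with 2 show ?case by (intro main[of e k B]) auto
 qed simp
qed

text \<open>A single time slice: \<open>G i\<close> is the gradient of the i-th component of b,
  \<open>d\<close> the divergence, and \<open>C\<close> the uniform constant of
  \<open>grad_moll_bound\<close>.\<close>

locale static =
 fixes w :: "'a::euclidean_space => real" and b :: "'a => 'a" and G :: "'a => 'a => 'a" and d :: "'a => real" and K C :: real
 assumes w_borel [measurable]: "w : bm" and w_bound: "!!x. \<bar>w x\<bar> <= K"
 and wg: "!!i. i : Basis ==> weak_grad (%x. b x \<bullet> i) (G i)"
 and d_borel [measurable]: "d : bm" and d_trace: "AL x. d x = (\<Sum>i\<in>Basis. G i x \<bullet> i)"
 and b_borel [measurable]: "b : bm"
 and C: "C >= 0" "!!e. e > 0 ==> (LL x. norm x * norm (grad (moll e) (x::'a))) <= C"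
begin

lemma K: "K >= 0" using w_bound[of 0] by linarith

lemma G_loc: "i : Basis ==> loc_int (G i)"
 and b_loc: "i : Basis ==> loc_int (%x. b x \<bullet> i)"
 using wg by (auto simp: weak_grad_def)

lemma G_borel [measurable]: "i : Basis ==> G i : bm"
 using G_loc by (auto simp: loc_int_def)

lemma w_loc: "loc_int w" by (rule loc_int_bounded[of _ K]) (use w_bound in auto)

lemma loc_int_sum: "(!!i. i : I ==> loc_int (f i)) ==> loc_int (%x. \<Sum>i\<in>I. f i x)"
 by (induction I rule: infinite_finite_induct) (auto intro: loc_int_add loc_int_bounded[of "%_. 0" 0])

lemma b_loc_int: "loc_int b"
proof -
 have "loc_int (%x. \<Sum>i\<in>Basis. \<bar>b x \<bullet> i\<bar>)"
 by (intro loc_int_sum) (rule loc_int_mult_bounded[OF b_loc, where C=1], auto)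
 then show ?thesis
 by (rule loc_int_mult_bounded[where C=1]) (auto intro: order_trans[OF norm_le_l1] abs_ge_self)
qed

lemma d_loc_int: "loc_int d"
proof (rule loc_intI)
 fix r :: real
 let ?t = "%x. \<Sum>i\<in>Basis. G i x \<bullet> i"
 have "loc_int ?t"
 by (intro loc_int_sum) (rule loc_int_mult_bounded[OF G_loc, where C=1], auto simp: Basis_le_norm)
 then have "ilb (%x. indicat_real (ball 0 r) x * norm (?t x))" by (rule loc_int_norm)
 then show "ilb (%x. indicat_real (ball 0 r) x * norm (d x))"
 by (rule integrable_cong_AE_imp) (use d_trace in \<open>auto elim!: eventually_mono\<close>)
qed simp

lemma weak_div: assumes ps: "C1c ps ps'" shows "(LL x. ps' x \<bullet> b x) = - (LL x. ps x * d x)"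
proof -
 obtain r where r: "!!x. norm x >= r ==> ps x = 0" "!!x. norm x >= r ==> ps' x = 0" using C1c_support[OF ps] by metis
 obtain A where A: "!!x. \<bar>ps x\<bar> <= A" "!!x. norm (ps' x) <= A" using C1c_bounded[OF ps] by metis
 note [measurable] = C1_borel[OF C1c_C1[OF ps]]
 have i1: "ilb (%x. (b x \<bullet> i) *\<^sub>R ps' x)" if "i : Basis" for i
 by (rule loc_int_integrable[OF b_loc[OF that], where C=A and r=r]) (use A r in \<open>auto simp: mult.commute[of A] mult_left_mono\<close>)
 have i2: "ilb (%x. ps x *\<^sub>R G i x)" if "i : Basis" for i
 by (rule loc_int_integrable[OF G_loc[OF that], where C=A and r=r]) (use A r that in \<open>auto simp: mult_right_mono\<close>)
 have "(LL x. ps' x \<bullet> b x) = (LL x. (\<Sum>i\<in>Basis. ((b x \<bullet> i) *\<^sub>R ps' x) \<bullet> i))"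
 by (intro lcong refl) (subst euclidean_inner, simp add: mult.commute)
 also have "... = (\<Sum>i\<in>Basis. (LL x. ((b x \<bullet> i) *\<^sub>R ps' x) \<bullet> i))"
 using i1 by (intro Bochner_Integration.integral_sum integrable_inner_left)
 also have "... = (\<Sum>i\<in>Basis. (LL x. (b x \<bullet> i) *\<^sub>R ps' x) \<bullet> i)"
 using i1 by (intro sum.cong refl integral_inner_left)
 also have "... = (\<Sum>i\<in>Basis. - (LL x. ps x *\<^sub>R G i x) \<bullet> i)"
 using wg ps unfolding weak_grad_def by (intro sum.cong) auto
 also have "... = - (\<Sum>i\<in>Basis. (LL x. (ps x *\<^sub>R G i x) \<bullet> i))"
 unfolding sum_negf[symmetric] inner_minus_left using i2
 by (intro sum.cong refl arg_cong[where f=uminus] integral_inner_left[symmetric])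
 also have "(\<Sum>i\<in>Basis. (LL x. (ps x *\<^sub>R G i x) \<bullet> i)) = (LL x. (\<Sum>i\<in>Basis. (ps x *\<^sub>R G i x) \<bullet> i))"
 using i2 by (intro Bochner_Integration.integral_sum[symmetric] integrable_inner_left) auto
 also have "... = (LL x. ps x * d x)"
 by (rule integral_cong_AE) (use d_trace in \<open>auto simp: sum_distrib_left elim!: eventually_mono\<close>)
 finally show ?thesis .
qed

text \<open>Formally the mollification of d w - div (b w) = - b . grad w, with the derivative moved
  to the kernel.\<close>

definition F :: "real => 'a => real" where
 "F e x = (LL y. w y * (d y * moll e (x - y) - b y \<bullet> grad (moll e) (x - y)))"

lemma integrable_conv3:
 fixes k :: "'a => 'a"
 assumes f: "loc_int f" and k: "k : bm" "!!x. norm (k x) <= B" "!!x. norm x >= r ==> k x = 0"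
 shows "ilb (%y. w y * (f y \<bullet> k (x - y)))"
proof (rule loc_int_integrable[OF f, where C="K * B" and r="r + norm x"])
 note [measurable] = loc_int_borel[OF f] k(1)
 show "(%y. w y * (f y \<bullet> k (x - y))) : bm" by measurable
 show "norm (w y * (f y \<bullet> k (x - y))) <= K * B * norm (f y)" for y
 proof -
 have "\<bar>w y\<bar> * \<bar>f y \<bullet> k (x - y)\<bar> <= K * (norm (f y) * B)"
 by (intro mult_mono w_bound order_trans[OF Cauchy_Schwarz_ineq2] k mult_left_mono) (use K in auto)
 then show ?thesis by (simp add: abs_mult mult_ac)
 qed
 show "w y * (f y \<bullet> k (x - y)) = 0" if "r + norm x <= norm y" for y
 using that norm_triangle_ineq4[of x "x - y"] k(3)[of "x - y"] by auto
qed

lemma integrable_conv2: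
 fixes k f :: "'a => real"
 assumes f: "loc_int f" and k: "k : bm" "!!x. norm (k x) <= B" "!!x. norm x >= r ==> k x = 0"
 shows "ilb (%y. w y * (f y * k (x - y)))"
proof -
 have "loc_int (%y. w y * f y)"
 by (rule loc_int_mult_bounded[OF f, where C=K]) (use w_bound loc_int_borel[OF f] in \<open>auto simp: abs_mult mult_right_mono\<close>)
 from conv_integrable[OF this k(1), of B r x] k show ?thesis by (simp add: mult.assoc)
qed

text \<open>Inserting b x next to b y under the integral separates the transport of the mollified
  function from the commutators; the divergence is distributed over them as the trace of the
  gradients.\<close>

lemma F_decomp:
 assumes e: "e > 0"
 shows "F e x = - (b x \<bullet> conv w (grad (moll e)) x) + (\<Sum>i\<in>Basis. comm w (%x. b x \<bullet> i) (G i) i e x)"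
proof -
 obtain A where A: "!!x. norm (moll e (x::'a)) <= A" "!!x. norm (grad (moll e) (x::'a)) <= A"
 using C1c_bounded[OF moll_C1c[OF e]] by (metis real_norm_def)
 have z: "moll e x = 0" "grad (moll e) x = 0" if "norm x >= e + 1" for x :: 'a
 using that moll_zero[OF e, of x] grad_moll_zero[OF e, of x] e by auto
 note mb = moll_borel grad_moll_borel[OF e]
 note [measurable] = mb
 have gi: "norm (grad (moll e) x \<bullet> i) <= A" if "i : Basis" for x i :: 'a
 using order_trans[OF Basis_le_norm[OF that] A(2)] by simp
 have i1: "ilb (%y. w y * ((G i y \<bullet> i) * moll e (x - y)))" if i: "i : Basis" for i
 proof (rule integrable_conv2[OF _ mb(1) A(1) z(1)])
 show "loc_int (%y. G i y \<bullet> i)"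
 by (rule loc_int_mult_bounded[OF G_loc[OF i], where C=1]) (use i in \<open>auto simp: Basis_le_norm\<close>)
 qed auto
 have i2: "ilb (%y. w y * ((b y \<bullet> i) * (grad (moll e) (x - y) \<bullet> i)))" if i: "i : Basis" for i
 by (rule integrable_conv2[OF b_loc[OF i], of "%z. grad (moll e) z \<bullet> i" A "e + 1"]) (use gi[OF i] z in auto)
 have i3: "ilb (%y. w y * ((b x \<bullet> i) * (grad (moll e) (x - y) \<bullet> i)))" if i: "i : Basis" for i
 proof -
 have "ilb (%y. w y *\<^sub>R (grad (moll e) (x - y) \<bullet> i))"
 by (rule conv_integrable[OF w_loc, of "%z. grad (moll e) z \<bullet> i" A "e + 1"]) (use gi[OF i] z in auto)
 from imr[OF this, of "b x \<bullet> i"] show ?thesis by (simp add: mult.left_commute)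
 qed
 have i23: "ilb (%y. w y * ((b x \<bullet> i - b y \<bullet> i) * (grad (moll e) (x - y) \<bullet> i)))" if i: "i : Basis" for i
 using idiff[OF i3 i2, OF i i] by (simp add: algebra_simps)
 have i4: "ilb (%y. w y * (d y * moll e (x - y)))"
 by (rule integrable_conv2[OF d_loc_int mb(1) A(1) z(1)])
 have i5: "ilb (%y. w y * (b y \<bullet> grad (moll e) (x - y)))"
 by (rule integrable_conv3[OF b_loc_int mb(2) A(2) z(2)])
 have i6: "ilb (%y. w y *\<^sub>R grad (moll e) (x - y))"
 by (rule conv_integrable[OF w_loc mb(2) A(2) z(2)])
 then have i6': "ilb (%y. w y * (b x \<bullet> grad (moll e) (x - y)))"
 using integrable_inner_right[of "b x" lborel "%y. w y *\<^sub>R grad (moll e) (x - y)"] by simp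
 have "(\<Sum>i\<in>Basis. comm w (%x. b x \<bullet> i) (G i) i e x) =
 (LL y. (\<Sum>i\<in>Basis. w y * ((G i y \<bullet> i) * moll e (x - y) + (b x \<bullet> i - b y \<bullet> i) * (grad (moll e) (x - y) \<bullet> i))))"
 unfolding comm_def
 by (rule Bochner_Integration.integral_sum[symmetric]) (simp add: distrib_left i1 i23)
 also have "... = (LL y. w y * (d y * moll e (x - y) - b y \<bullet> grad (moll e) (x - y)) + w y * (b x \<bullet> grad (moll e) (x - y)))"
 proof (rule integral_cong_AE)
 show "AL y. (\<Sum>i\<in>Basis. w y * ((G i y \<bullet> i) * moll e (x - y) + (b x \<bullet> i - b y \<bullet> i) * (grad (moll e) (x - y) \<bullet> i)))
 = w y * (d y * moll e (x - y) - b y \<bullet> grad (moll e) (x - y)) + w y * (b x \<bullet> grad (moll e) (x - y))"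
 using d_trace
 proof eventually_elim
 case (elim y)
 have "b z \<bullet> grad (moll e) (x - y) = (\<Sum>i\<in>Basis. (b z \<bullet> i) * (grad (moll e) (x - y) \<bullet> i))" for z
  by (rule euclidean_inner)
 then show ?case unfolding elim
  by (simp add: sum_distrib_left sum_distrib_right sum.distrib[symmetric] sum_subtractf[symmetric] algebra_simps)
 qed
 qed (use mb in measurable)
 also have "... = F e x + (LL y. w y * (b x \<bullet> grad (moll e) (x - y)))"
 unfolding F_def using i4 i5 i6' by (subst ladd) (auto simp: right_diff_distrib)
 also have "(LL y. w y * (b x \<bullet> grad (moll e) (x - y))) = b x \<bullet> conv w (grad (moll e)) x"
 unfolding conv_def using integral_inner_right[of "b x" lborel "%y. w y *\<^sub>R grad (moll e) (x - y)"] i6 by simp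
 finally show ?thesis by simp
qed

section \<open>Uniform bounds and limit of the commutators\<close>

lemma comm_integral:
 assumes i: "i : Basis" and e: "e > 0"
 and D: "!!h. norm h <= e ==> (NN x. ennreal (ib r x * norm (G i (x + h) - G i x))) <= D"
 shows "(NN x. ennreal (ib r x * \<bar>comm w (%x. b x \<bullet> i) (G i) i e x\<bar>))
 <= ennreal K * (ennreal (1 + C) * D)
 + (\<Sum>j\<in>Basis. \<integral>\<^sup>+x. ennreal (ib r x * norm (G i x) * \<bar>conv w (comm_kernel i j e) x\<bar>) \<partial>lborel)"
proof -
 note [measurable] = G_borel[OF i] grad_moll_borel[OF e]
 have [measurable]: "comm_kernel i j e : bm" if "j : Basis" for j
 using comm_kernel(6)[OF e i that order_refl] .
 let ?T = "%x. \<integral>\<^sup>+y. ennreal (norm (G i y - G i x) * moll e (x - y)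
 + \<bar>b x \<bullet> i - b y \<bullet> i - G i x \<bullet> (x - y)\<bar> * norm (grad (moll e) (x - y))) \<partial>lborel"
 have [measurable]: "?T : borel_measurable lborel" by measurable
 have "(NN x. ennreal (ib r x * \<bar>comm w (%x. b x \<bullet> i) (G i) i e x\<bar>))
 <= (NN x. ennreal K * (ennreal (ib r x) * ?T x)
 + (\<Sum>j\<in>Basis. ennreal (ib r x * norm (G i x) * \<bar>conv w (comm_kernel i j e) x\<bar>)))"
 proof (rule nn_integral_mono)
 fix x :: 'a
 have "ennreal \<bar>comm w (%x. b x \<bullet> i) (G i) i e x\<bar> <= ennreal K * ?T x
 + (\<Sum>j\<in>Basis. ennreal (norm (G i x) * \<bar>conv w (comm_kernel i j e) x\<bar>))"
 by (rule comm_pointwise) (use w_bound i e in auto)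
 then show "ennreal (ib r x * \<bar>comm w (%x. b x \<bullet> i) (G i) i e x\<bar>) <= ennreal K * (ennreal (ib r x) * ?T x)
 + (\<Sum>j\<in>Basis. ennreal (ib r x * norm (G i x) * \<bar>conv w (comm_kernel i j e) x\<bar>))"
 by (cases "x : ball 0 r") auto
 qed
 also have "... = ennreal K * (NN x. ennreal (ib r x) * ?T x)
 + (\<Sum>j\<in>Basis. \<integral>\<^sup>+x. ennreal (ib r x * norm (G i x) * \<bar>conv w (comm_kernel i j e) x\<bar>) \<partial>lborel)"
 by (subst nn_integral_add, measurable, subst nn_integral_cmult, measurable, subst nn_integral_sum) auto
 also have "... <= ennreal K * (ennreal (1 + C) * D)
 + (\<Sum>j\<in>Basis. \<integral>\<^sup>+x. ennreal (ib r x * norm (G i x) * \<bar>conv w (comm_kernel i j e) x\<bar>) \<partial>lborel)"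
 by (intro add_right_mono mult_left_mono comm_remainder[OF wg[OF i] e C(2)[OF e] D]) auto
 finally show ?thesis .
qed

lemma conv_kernel_bound:
 assumes "i : Basis" "j : Basis" "e > 0"
 shows "\<bar>conv w (comm_kernel i j e) x\<bar> <= K * (1 + C)"
 using comm_kernel[OF assms(3,1,2) C(2)[OF assms(3)]] by (intro conv_bound w_bound) auto

text \<open>A crude bound uniform in e <= 1, for use as a majorant in time. The translation error of
  \<open>G i\<close> is at most twice its local norm, and each of the n kernels contributes that
  norm once more, whence 2 + n.\<close>

lemma comm_bound:
 assumes i: "i : Basis" and e: "0 < e" "e <= 1"
 shows "(NN x. ennreal (ib r x * \<bar>comm w (%x. b x \<bullet> i) (G i) i e x\<bar>))
 <= ennreal (K * (1 + C) * (2 + DIM('a))) * (NN x. ennreal (ind (ball 0 (r + 1)) x * norm (G i x)))"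
proof -
 note [measurable] = G_borel[OF i]
 define N where "N = (NN x. ennreal (ind (ball 0 (r + 1)) x * norm (G i x)))"
 have "(NN x. ennreal (ib r x * norm (G i (x + h) - G i x))) <= ennreal 2 * N" if h: "norm h <= e" for h
 proof -
 have "(NN x. ennreal (ib r x * norm (G i (x + h) - G i x))) \<le>
 (NN x. ennreal (ind (ball 0 (r + 1)) (x + h) * norm (G i (x + h))) + ennreal (ind (ball 0 (r + 1)) x * norm (G i x)))"
 proof (rule nn_integral_mono)
 fix x :: 'a
 have "ib r x * norm (G i (x + h) - G i x) <= ind (ball 0 (r + 1)) (x + h) * norm (G i (x + h)) + ind (ball 0 (r + 1)) x * norm (G i x)"
  using h e norm_triangle_ineq[of x h] norm_triangle_ineq4[of "G i (x + h)" "G i x"] by (auto simp: indicator_def)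
 then show "ennreal (ib r x * norm (G i (x + h) - G i x)) <= ennreal (ind (ball 0 (r + 1)) (x + h) * norm (G i (x + h))) + ennreal (ind (ball 0 (r + 1)) x * norm (G i x))"
  by (simp add: ennreal_plus[symmetric] ennreal_leI del: ennreal_plus)
 qed
 also have "... = (NN x. (%x. ennreal (ind (ball 0 (r + 1)) x * norm (G i x))) (x + h)) + N"
 unfolding N_def by (subst nn_integral_add) auto
 also have "... = N + N" unfolding N_def by (subst nn_integral_lborel_shift) auto
 finally show ?thesis by (simp add: mult_2)
 qed
 note ci = comm_integral[OF i e(1) this]
 have "(\<Sum>j\<in>Basis. \<integral>\<^sup>+x. ennreal (ib r x * norm (G i x) * \<bar>conv w (comm_kernel i j e) x\<bar>) \<partial>lborel)
 <= (\<Sum>j\<in>(Basis :: 'a set). ennreal (K * (1 + C)) * N)"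
 proof (rule sum_mono)
 fix j :: 'a assume j: "j : Basis"
 have "(NN x. ennreal (ib r x * norm (G i x) * \<bar>conv w (comm_kernel i j e) x\<bar>))
 <= (NN x. ennreal (K * (1 + C)) * ennreal (ind (ball 0 (r + 1)) x * norm (G i x)))"
 proof (rule nn_integral_mono)
 fix x :: 'a
 have "(ib r x * norm (G i x)) * \<bar>conv w (comm_kernel i j e) x\<bar> <= (ind (ball 0 (r + 1)) x * norm (G i x)) * (K * (1 + C))"
  by (intro mult_mono conv_kernel_bound i j e) (auto simp: indicator_def)
 then show "ennreal (ib r x * norm (G i x) * \<bar>conv w (comm_kernel i j e) x\<bar>) <= ennreal (K * (1 + C)) * ennreal (ind (ball 0 (r + 1)) x * norm (G i x))"
  using K C by (subst ennreal_mult'[symmetric]) (auto simp: mult_ac intro!: ennreal_leI)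
 qed
 then show "(NN x. ennreal (ib r x * norm (G i x) * \<bar>conv w (comm_kernel i j e) x\<bar>)) <= ennreal (K * (1 + C)) * N"
 unfolding N_def by (subst (asm) nn_integral_cmult) auto
 qed
 also have "... = ennreal (K * (1 + C) * DIM('a)) * N"
 using K C by (simp add: ennreal_mult'' ennreal_of_nat_eq_real_of_nat mult_ac)
 finally have "(NN x. ennreal (ib r x * \<bar>comm w (%x. b x \<bullet> i) (G i) i e x\<bar>))
 <= ennreal K * (ennreal (1 + C) * (ennreal 2 * N)) + ennreal (K * (1 + C) * DIM('a)) * N"
 using ci order_trans add_left_mono by blast
 also have "... = ennreal (K * (1 + C) * (2 + DIM('a))) * N"
 proof -
 have "ennreal (K * (1 + C) * t) = ennreal K * ennreal (1 + C) * ennreal t" if "t >= 0" for t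
 using K C that by (subst ennreal_mult', simp, subst ennreal_mult') auto
 moreover have "ennreal (2 + DIM('a)) = ennreal 2 + ennreal (DIM('a))" by (subst ennreal_plus[symmetric]) auto
 ultimately show ?thesis by (simp only: distrib_left distrib_right mult.assoc of_nat_0_le_iff add_nonneg_nonneg zero_le_numeral)
 qed
 finally show ?thesis unfolding N_def .
qed

text \<open>The linearisation error tends to 0 by continuity of translations. The convolutions with
  kernels of integral 0 are bounded and tend to 0 in L^1, which \<open>vanish_product\<close>
  transfers to their products with the integrable \<open>G i\<close>.\<close>

lemma comm_vanish:
 assumes i: "i : Basis" and de: "de > 0"
 shows "\<exists>e0>0. ALL e. 0 < e --> e <= e0 -->
 (NN x. ennreal (ib r x * \<bar>comm w (%x. b x \<bullet> i) (G i) i e x\<bar>)) <= ennreal de"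
proof -
 note [measurable] = G_borel[OF i]
 \<comment> \<open>\<open>de1\<close> is the share of the linearisation error, and
   \<open>de2\<close> below the share of each of the n kernel terms.\<close>
 define de1 where "de1 = de / (2 * (K * (1 + C) + 1))"
 have KC: "K * (1 + C) >= 0" using K C by simp
 have d1: "de1 > 0" using de KC by (simp add: de1_def)
 define de2 where "de2 = de / (2 * DIM('a))"
 have d2: "de2 > 0" using de by (simp add: de2_def)
 obtain s where s: "s > 0" "!!h. norm h <= s ==> (NN x. ennreal (ib r x * norm (G i (x + h) - G i x))) <= ennreal de1"
 using loc_translation[OF G_loc[OF i] d1, of r] by blast
 have "ilb (%x. ib r x * norm (G i x))" by (rule loc_int_norm[OF G_loc[OF i]])
 from vanish_product[OF this, of "ball 0 r" "K * (1 + C)", OF _ _ _ KC d2]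
 obtain et where et: "et > 0" "!!q. q : bm ==> (ALL x. \<bar>q x\<bar> <= K * (1 + C)) ==>
 (NN x. ennreal (ib r x * \<bar>q x\<bar>)) <= ennreal et ==> (NN x. ennreal (ib r x * norm (G i x) * \<bar>q x\<bar>)) <= ennreal de2"
 by auto
 obtain e1 where e1: "e1 > 0" "!!e k. 0 < e ==> e <= e1 ==> ilb k ==> (EX B. ALL y. \<bar>k y\<bar> <= B) ==> (ALL y. norm y > e --> k y = 0) ==>
 (LL y. \<bar>k y\<bar>) <= 1 + C ==>
 (NN x. ennreal (ib r x * \<bar>conv w k x - (LL y. k y) * w x\<bar>)) <= ennreal et"
 using kernel_loc[OF w_borel w_bound et(1), of "1 + C" r] C by auto
 have "(NN x. ennreal (ib r x * \<bar>comm w (%x. b x \<bullet> i) (G i) i e x\<bar>)) <= ennreal de"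
 if e: "0 < e" "e <= min s e1" for e
 proof -
 have "(NN x. ennreal (ib r x * norm (G i x) * \<bar>conv w (comm_kernel i j e) x\<bar>)) <= ennreal de2" if j: "j : Basis" for j
 proof (rule et(2))
 note ck = comm_kernel[OF e(1) i j C(2)[OF e(1)]]
 show "conv w (comm_kernel i j e) : bm" using ck(6) by measurable
 show "ALL x. \<bar>conv w (comm_kernel i j e) x\<bar> <= K * (1 + C)" using conv_kernel_bound[OF i j e(1)] by blast
 show "(NN x. ennreal (ib r x * \<bar>conv w (comm_kernel i j e) x\<bar>)) <= ennreal et"
  using e1(2)[OF e(1) _ ck(1,4) _ ck(3)] ck(2,5) e(2) by auto
 qed
 then have "(\<Sum>j\<in>Basis. \<integral>\<^sup>+x. ennreal (ib r x * norm (G i x) * \<bar>conv w (comm_kernel i j e) x\<bar>) \<partial>lborel) <= (\<Sum>j\<in>(Basis::'a set). ennreal de2)"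
 by (rule sum_mono)
 also have "... = ennreal (DIM('a) * de2)" using d2 by (simp add: ennreal_mult' ennreal_of_nat_eq_real_of_nat)
 also have "DIM('a) * de2 = de / 2" by (simp add: de2_def)
 finally have 2: "(\<Sum>j\<in>Basis. \<integral>\<^sup>+x. ennreal (ib r x * norm (G i x) * \<bar>conv w (comm_kernel i j e) x\<bar>) \<partial>lborel) <= ennreal (de / 2)" .
 have "ennreal K * (ennreal (1 + C) * ennreal de1) = ennreal (K * (1 + C) * de1)"
 using K C d1 by (simp add: ennreal_mult' mult.assoc)
 also have "... <= ennreal (de / 2)" using KC de unfolding de1_def by (intro ennreal_leI) (simp add: field_simps)
 finally have 1: "ennreal K * (ennreal (1 + C) * ennreal de1) <= ennreal (de / 2)" .
 have "(NN x. ennreal (ib r x * \<bar>comm w (%x. b x \<bullet> i) (G i) i e x\<bar>)) <= ennreal (de / 2) + ennreal (de / 2)"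
 by (rule order_trans[OF comm_integral[OF i e(1), of r "ennreal de1"] add_mono[OF 1 2]]) (use s(2) e in auto)
 also have "... = ennreal de" using de by (subst ennreal_plus[symmetric]) auto
 finally show ?thesis .
 qed
 then show ?thesis using s(1) e1(1) by (intro exI[of _ "min s e1"]) auto
qed

end

lemma conv_moll_bound:
 fixes w :: "'a::euclidean_space => real"
 assumes "!!x. \<bar>w x\<bar> <= K" "e > 0" shows "\<bar>conv w (moll e) x\<bar> <= K"
proof -
 have "(LL y. \<bar>moll e (y::'a)\<bar>) <= 1"
 using moll_integral[OF assms(2), where 'a='a] moll_nonneg[OF assms(2), where 'a='a] by simp
 from conv_bound[of w K, OF assms(1) moll_integrable[OF assms(2)] this] show ?thesis by simp
qed

text \<open>The difference of the squares factors into a sum bounded by 2 K and a difference that is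
  small in L^1. Since h is only integrable, the product is handled by
  \<open>vanish_product\<close>.\<close>

lemma mollified_square_limit:
 fixes w :: "'a::euclidean_space => real"
 assumes [measurable]: "w : bm" and w: "!!x. \<bar>w x\<bar> <= K"
 and h: "ilb h" "!!x. norm x >= r ==> h x = 0" and de: "de > 0"
 shows "\<exists>e0>0. ALL e. 0 < e --> e <= e0 --> \<bar>(LL x. (conv w (moll e) x)^2 * h x) - (LL x. (w x)^2 * h x)\<bar> <= de"
proof -
 have K: "K >= 0" using w[of 0] by linarith
 have [measurable]: "h : bm" using h(1) by auto
 have ib: "ilb (%x. (q x)^2 * h x)" if [measurable]: "q : bm" and q: "!!x. \<bar>q x\<bar> <= K" for q
 proof (rule ibd[OF imr[OF h(1), of "K\<^sup>2"]])
 have "(q x)^2 <= K\<^sup>2" for x using power_mono[OF q[of x], of 2] by simp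
 then show "AL x. norm ((q x)^2 * h x) <= norm (K\<^sup>2 * h x)"
 by (intro AE_I2) (auto simp: abs_mult intro: mult_right_mono)
 qed measurable
 obtain et where et: "et > 0" "!!q. q : bm ==> (ALL x. \<bar>q x\<bar> <= 2 * K) ==>
 (NN x. ennreal (ib r x * \<bar>q x\<bar>)) <= ennreal et ==> (NN x. ennreal (\<bar>h x\<bar> * \<bar>q x\<bar>)) <= ennreal (de / (2 * K + 1))"
 using vanish_product[OF integrable_abs[OF h(1)], of "ball 0 r" "2 * K" "de / (2 * K + 1)"] h(2) K de by auto
 obtain e1 where e1: "e1 > 0" "!!e k. 0 < e ==> e <= e1 ==> ilb k ==> (EX B. ALL y. \<bar>k y\<bar> <= B) ==> (ALL y. norm y > e --> k y = 0) ==>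
 (LL y. \<bar>k y\<bar>) <= 1 ==>
 (NN x. ennreal (ib r x * \<bar>conv w k x - (LL y. k y) * w x\<bar>)) <= ennreal et"
 using kernel_loc[of w K et 1 r] w et(1) by auto
 have "\<bar>(LL x. (conv w (moll e) x)^2 * h x) - (LL x. (w x)^2 * h x)\<bar> <= de" if e: "0 < e" "e <= e1" for e
 proof -
 let ?w = "conv w (moll e)"
 have wb: "\<bar>?w x\<bar> <= K" for x by (rule conv_moll_bound[OF w e(1)])
 obtain B where B: "!!y. \<bar>moll e (y::'a)\<bar> <= B" using C1c_bounded[OF moll_C1c[OF e(1)]] by metis
 have "(NN x. ennreal (ib r x * \<bar>?w x - w x\<bar>)) <= ennreal et"
 proof -
 have "EX B. ALL y. \<bar>moll e (y::'a)\<bar> <= B" "\<forall>y::'a. norm y > e --> moll e y = 0" "(LL y. \<bar>moll e (y::'a)\<bar>) <= 1"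
  using B moll_zero[OF e(1), where 'a='a] moll_integral[OF e(1), where 'a='a] moll_nonneg[OF e(1), where 'a='a] by auto
 from e1(2)[OF e moll_integrable[OF e(1)] this] show ?thesis using moll_integral[OF e(1), where 'a='a] by simp
 qed
 moreover have "ALL x. \<bar>?w x - w x\<bar> <= 2 * K"
 proof
 fix x show "\<bar>?w x - w x\<bar> <= 2 * K" using wb[of x] w[of x] by linarith
 qed
 ultimately have *: "(NN x. ennreal (\<bar>h x\<bar> * \<bar>?w x - w x\<bar>)) <= ennreal (de / (2 * K + 1))"
 by (intro et(2)) measurable
 have i: "ilb (%x. (?w x)^2 * h x)" "ilb (%x. (w x)^2 * h x)"
 using ib wb w by auto
 have "ennreal \<bar>(LL x. (?w x)^2 * h x) - (LL x. (w x)^2 * h x)\<bar> = ennreal (norm (LL x. (?w x)^2 * h x - (w x)^2 * h x))"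
 using i by simp
 also have "... <= (NN x. ennreal (norm ((?w x)^2 * h x - (w x)^2 * h x)))"
 by (intro integral_norm_bound_ennreal idiff i)
 also have "... <= (NN x. ennreal (2 * K) * ennreal (\<bar>h x\<bar> * \<bar>?w x - w x\<bar>))"
 proof (rule nn_integral_mono)
 fix x
 have "(?w x)^2 * h x - (w x)^2 * h x = (?w x + w x) * (h x * (?w x - w x))" by (simp add: power2_eq_square algebra_simps)
 also have "norm ... = \<bar>?w x + w x\<bar> * (\<bar>h x\<bar> * \<bar>?w x - w x\<bar>)" by (simp add: abs_mult)
 also have "... <= (2 * K) * (\<bar>h x\<bar> * \<bar>?w x - w x\<bar>)"
  using wb[of x] w[of x] by (intro mult_right_mono order_trans[OF abs_triangle_ineq]) auto
 finally show "ennreal (norm ((?w x)^2 * h x - (w x)^2 * h x)) <= ennreal (2 * K) * ennreal (\<bar>h x\<bar> * \<bar>?w x - w x\<bar>)"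
  using K by (subst ennreal_mult'[symmetric]) (auto intro: ennreal_leI)
 qed
 also have "... = ennreal (2 * K) * (NN x. ennreal (\<bar>h x\<bar> * \<bar>?w x - w x\<bar>))" by (rule nn_integral_cmult) simp
 also have "... <= ennreal (2 * K) * ennreal (de / (2 * K + 1))" using * by (intro mult_left_mono) auto
 also have "... = ennreal (2 * K * (de / (2 * K + 1)))" using K by (subst ennreal_mult') auto
 also have "... <= ennreal de" using K de by (intro ennreal_leI) (simp add: field_simps)
 finally show ?thesis using de by (simp add: ennreal_le_iff)
 qed
 then show ?thesis using e1(1) by blast
qed

section \<open>Energy of the mollified function at a fixed time\<close>

context static
begin

text \<open>The formal time derivative of the integral of ph times the square of the mollified w, if
  the mollified w evolves with rate \<open>F e\<close>.\<close>

definition J :: "real => ('a => real) => real" where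
 "J e ph = 2 * (LL x. ph x * conv w (moll e) x * F e x)"

abbreviation "cm i e \<equiv> comm w (%x. b x \<bullet> i) (G i) i e"

lemma cm_borel [measurable]:
 assumes i: "i : Basis" and e: "e > 0" shows "cm i e : bm"
proof -
 note [measurable] = G_borel[OF i] grad_moll_borel[OF e]
 have "cm i e : borel_measurable lborel" unfolding comm_def[abs_def] by measurable
 then show ?thesis by simp
qed

lemma Gball_finite:
 assumes "i : Basis" shows "(NN x. ennreal (ib r x * norm (G i x))) < \<infinity>"
 using loc_int_norm[OF G_loc[OF assms], of r] unfolding integrable_iff_bounded by (simp add: abs_mult)

lemma cm_integrable:
 assumes i: "i : Basis" and e: "0 < e" "e <= 1"
 and g: "g : bm" "!!x. \<bar>g x\<bar> <= M" "!!x. norm x >= r ==> g x = 0"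
 shows "ilb (%x. g x * cm i e x)"
 and "ennreal \<bar>LL x. g x * cm i e x\<bar> <= ennreal M * (NN x. ennreal (ib r x * \<bar>cm i e x\<bar>))"
proof -
 note [measurable] = g(1) cm_borel[OF i e(1)]
 have M: "M >= 0" using g(2)[of 0] by linarith
 have le: "(NN x. ennreal (norm (g x * cm i e x))) <= ennreal M * (NN x. ennreal (ib r x * \<bar>cm i e x\<bar>))"
 proof -
 have "(NN x. ennreal (norm (g x * cm i e x))) <= (NN x. ennreal M * ennreal (ib r x * \<bar>cm i e x\<bar>))"
 proof (rule nn_integral_mono)
 fix x
 have "norm (g x * cm i e x) <= M * (ib r x * \<bar>cm i e x\<bar>)"
  using g(2,3)[of x] by (cases "norm x < r") (auto simp: abs_mult intro: mult_right_mono)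
 then show "ennreal (norm (g x * cm i e x)) <= ennreal M * ennreal (ib r x * \<bar>cm i e x\<bar>)"
  using M by (subst ennreal_mult'[symmetric]) (auto intro: ennreal_leI)
 qed
 also have "... = ennreal M * (NN x. ennreal (ib r x * \<bar>cm i e x\<bar>))"
 by (rule nn_integral_cmult) measurable
 finally show ?thesis .
 qed
 also have "... < \<infinity>"
 proof -
 have "(NN x. ennreal (ib r x * \<bar>cm i e x\<bar>)) < \<infinity>"
 by (rule le_less_trans[OF comm_bound[OF i e]]) (use Gball_finite[OF i] in \<open>simp add: ennreal_mult_less_top\<close>)
 then show ?thesis by (simp add: ennreal_mult_less_top)
 qed
 finally show int: "ilb (%x. g x * cm i e x)"
 by (intro integrableI_bounded) measurable
 show "ennreal \<bar>LL x. g x * cm i e x\<bar> <= ennreal M * (NN x. ennreal (ib r x * \<bar>cm i e x\<bar>))"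
 using order_trans[OF integral_norm_bound_ennreal[OF int] le] by simp
qed

lemma flux_integrable:
 assumes ph: "C1c ph ph'"
 shows "ilb (%x. ph x * d x)" "ilb (%x. ph' x \<bullet> b x)"
proof -
 obtain r where r: "!!x. norm x >= r ==> ph x = 0" "!!x. norm x >= r ==> ph' x = 0" using C1c_support[OF ph] by metis
 obtain A where A: "!!x. \<bar>ph x\<bar> <= A" "!!x. norm (ph' x) <= A" using C1c_bounded[OF ph] by metis
 note [measurable] = C1_borel[OF C1c_C1[OF ph]]
 show "ilb (%x. ph x * d x)"
 by (rule loc_int_integrable[OF d_loc_int, where C=A and r=r]) (use A r in \<open>auto simp: abs_mult mult_right_mono\<close>)
 show "ilb (%x. ph' x \<bullet> b x)"
 by (rule loc_int_integrable[OF b_loc_int, where C=A and r=r])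
 (use r in \<open>auto intro!: order_trans[OF Cauchy_Schwarz_ineq2 mult_right_mono[OF A(2) norm_ge_zero]]\<close>)
qed

text \<open>For the C^1 function w * rho the chain rule gives 2 (w * rho) b . grad(w * rho) = b .
  grad((w * rho)^2), and the weak divergence moves this derivative onto \<open>ph\<close>. Only the
  commutators remain.\<close>

lemma J_decomp:
 assumes ph: "C1c ph ph'" and e: "0 < e" "e <= 1"
 shows "J e ph = (LL x. (conv w (moll e) x)^2 * (ph x * d x + ph' x \<bullet> b x))
 + 2 * (\<Sum>i\<in>Basis. LL x. (ph x * conv w (moll e) x) * cm i e x)"
proof -
 let ?w = "conv w (moll e)" and ?g = "conv w (grad (moll e))"
 note [measurable] = C1_borel[OF C1c_C1[OF ph]] grad_moll_borel[OF e(1)]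
 have we: "C1 ?w ?g" by (rule conv_C1[OF w_loc moll_C1c[OF e(1)]])
 obtain r where r: "!!x. norm x >= r ==> ph x = 0" "!!x. norm x >= r ==> ph' x = 0" using C1c_support[OF ph] by metis
 obtain A where A: "A >= 0" "!!x. \<bar>ph x\<bar> <= A" "!!x. norm (ph' x) <= A" using C1c_bounded[OF ph] by metis
 have wb: "\<bar>?w x\<bar> <= K" for x by (rule conv_moll_bound[OF w_bound e(1)])
 \<comment> \<open>The product of \<open>ph\<close> with the square of w * rho is the C^1 function
   with which the weak divergence is tested; here the square gets renormalised.\<close>
 have c2: "C1c (%x. ph x * (?w x * ?w x)) (%x. ph x *\<^sub>R (?w x *\<^sub>R ?g x + ?w x *\<^sub>R ?g x) + (?w x * ?w x) *\<^sub>R ph' x)"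
 by (rule C1c_mult_left[OF ph C1_mult[OF we we]])
 have c1: "C1c (%x. ph x * ?w x) (%x. ph x *\<^sub>R ?g x + ?w x *\<^sub>R ph' x)"
 by (rule C1c_mult_left[OF ph we])
 have iA: "ilb (%x. (ph x * ?w x) * (b x \<bullet> ?g x))"
 proof -
 have "continuous_on UNIV (%x. (ph x * ?w x) *\<^sub>R ?g x)"
 using C1_continuous[OF C1c_C1[OF ph]] C1_continuous[OF we] C1_continuous_grad[OF we] by (intro continuous_intros)
 then obtain B where B: "!!x. norm ((ph x * ?w x) *\<^sub>R ?g x) <= B"
 by (rule compact_support_bounded[where r=r]) (use r in auto)
 have "ilb (%x. ((ph x * ?w x) *\<^sub>R ?g x) \<bullet> b x)"
 proof (rule loc_int_integrable[OF b_loc_int, where C=B and r=r])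
 show "norm (((ph x * ?w x) *\<^sub>R ?g x) \<bullet> b x) <= B * norm (b x)" for x
  using order_trans[OF Cauchy_Schwarz_ineq2 mult_right_mono[OF B norm_ge_zero]] by simp
 qed (use r in auto)
 then show ?thesis by (simp add: inner_commute)
 qed
 have iC: "ilb (%x. (ph x * ?w x) * cm i e x)" if "i : Basis" for i
 proof (rule cm_integrable(1)[OF that e, where M="A * K" and r=r])
 show "\<bar>ph x * ?w x\<bar> <= A * K" for x unfolding abs_mult by (intro mult_mono A wb) (use A in auto)
 qed (use r in auto)
 have iw: "ilb (%x. (?w x)^2 * h x)" if h: "ilb h" for h
 proof (rule ibd[OF imr[OF h, of "K\<^sup>2"]])
 have "(?w x)^2 <= K\<^sup>2" for x using power_mono[OF wb[of x], of 2] by simp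
 then show "AL x. norm ((?w x)^2 * h x) <= norm (K\<^sup>2 * h x)"
 by (intro AE_I2) (auto simp: abs_mult intro: mult_right_mono)
 qed (use h in measurable)
 note fi = flux_integrable[OF ph]
 have "(LL x. (ph x *\<^sub>R (?w x *\<^sub>R ?g x + ?w x *\<^sub>R ?g x) + (?w x * ?w x) *\<^sub>R ph' x) \<bullet> b x)
 = (LL x. 2 * ((ph x * ?w x) * (b x \<bullet> ?g x)) + (?w x)^2 * (ph' x \<bullet> b x))"
 by (intro lcong refl) (simp add: inner_add_left inner_commute power2_eq_square algebra_simps)
 also have "... = 2 * (LL x. (ph x * ?w x) * (b x \<bullet> ?g x)) + (LL x. (?w x)^2 * (ph' x \<bullet> b x))"
 by (subst ladd[OF imr[OF iA] iw[OF fi(2)]]) simp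
 finally have 1: "2 * (LL x. (ph x * ?w x) * (b x \<bullet> ?g x)) + (LL x. (?w x)^2 * (ph' x \<bullet> b x)) = - (LL x. (?w x)^2 * (ph x * d x))"
 using weak_div[OF c2] by (simp add: power2_eq_square mult_ac)
 have "J e ph = 2 * (LL x. - ((ph x * ?w x) * (b x \<bullet> ?g x)) + (\<Sum>i\<in>Basis. (ph x * ?w x) * cm i e x))"
 unfolding J_def F_decomp[OF e(1)]
 by (intro arg_cong[where f="(*) 2"] lcong refl) (simp only: distrib_left sum_distrib_left mult_minus_right)
 also have "... = 2 * (- (LL x. (ph x * ?w x) * (b x \<bullet> ?g x)) + (\<Sum>i\<in>Basis. LL x. (ph x * ?w x) * cm i e x))"
 by (subst ladd) (use iA iC in \<open>auto simp: Bochner_Integration.integral_sum\<close>)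
 also have "... = (LL x. (?w x)^2 * (ph x * d x)) + (LL x. (?w x)^2 * (ph' x \<bullet> b x))
 + 2 * (\<Sum>i\<in>Basis. LL x. (ph x * ?w x) * cm i e x)"
 using 1 by (simp add: algebra_simps)
 also have "(LL x. (?w x)^2 * (ph x * d x)) + (LL x. (?w x)^2 * (ph' x \<bullet> b x))
 = (LL x. (?w x)^2 * (ph x * d x + ph' x \<bullet> b x))"
 by (simp add: distrib_left iw[OF fi(1)] iw[OF fi(2)])
 finally show ?thesis .
qed

lemma J_limit:
 assumes ph: "C1c ph ph'" and de: "de > 0"
 shows "\<exists>e0>0. ALL e. 0 < e --> e <= e0 --> \<bar>J e ph - (LL x. (w x)^2 * (ph x * d x + ph' x \<bullet> b x))\<bar> <= de"
proof -
 obtain r where r: "!!x. norm x >= r ==> ph x = 0" "!!x. norm x >= r ==> ph' x = 0" using C1c_support[OF ph] by metis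
 obtain A where A: "A >= 0" "!!x. \<bar>ph x\<bar> <= A" "!!x. norm (ph' x) <= A" using C1c_bounded[OF ph] by metis
 note [measurable] = C1_borel[OF C1c_C1[OF ph]]
 let ?h = "%x. ph x * d x + ph' x \<bullet> b x"
 have "ilb ?h" using flux_integrable[OF ph] by simp
 from mollified_square_limit[OF w_borel w_bound this, of r "de/2"] r de
 obtain e1 where e1: "e1 > 0" "!!e. 0 < e ==> e <= e1 ==>
 \<bar>(LL x. (conv w (moll e) x)^2 * ?h x) - (LL x. (w x)^2 * ?h x)\<bar> <= de / 2" by auto
 define et where "et = de / (4 * real DIM('a) * (A * K + 1))"
 have AK: "A * K >= 0" using A K by simp
 have et: "et > 0" using de AK by (simp add: et_def add_nonneg_pos)
 have "\<forall>i\<in>Basis. \<exists>e0>0. ALL e. 0 < e --> e <= e0 --> (NN x. ennreal (ib r x * \<bar>cm i e x\<bar>)) <= ennreal et"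
 using comm_vanish[OF _ et] by blast
 then obtain E where E: "!!i. i : Basis ==> E i > 0" "!!i e. i : Basis ==> 0 < e ==> e <= E i ==> (NN x. ennreal (ib r x * \<bar>cm i e x\<bar>)) <= ennreal et"
 by metis
 \<comment> \<open>Below 1, as the decomposition requires, and below the thresholds of the square
   and of the n commutators.\<close>
 define e0 where "e0 = Min (insert 1 (insert e1 (E ` Basis)))"
 have e0: "e0 > 0" "e0 <= 1" "e0 <= e1" "!!i. i : Basis ==> e0 <= E i"
 using E(1) e1(1) by (auto simp: e0_def) (auto simp: e0_def min_le_iff_disj intro!: Min_le)
 have "\<bar>J e ph - (LL x. (w x)^2 * ?h x)\<bar> <= de" if e: "0 < e" "e <= e0" for e
 proof -
 let ?w = "conv w (moll e)"
 have wb: "\<bar>?w x\<bar> <= K" for x by (rule conv_moll_bound[OF w_bound e(1)])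
 have "\<bar>LL x. (ph x * ?w x) * cm i e x\<bar> <= A * K * et" if i: "i : Basis" for i
 proof -
 have "ennreal \<bar>LL x. (ph x * ?w x) * cm i e x\<bar> <= ennreal (A * K) * (NN x. ennreal (ib r x * \<bar>cm i e x\<bar>))"
 proof (rule cm_integrable(2)[OF i])
  show "\<bar>ph x * ?w x\<bar> <= A * K" for x unfolding abs_mult by (intro mult_mono A wb) (use A in auto)
 qed (use e e0 r in auto)
 also have "... <= ennreal (A * K) * ennreal et" using E(2)[OF i e(1)] e e0(4)[OF i] by (intro mult_left_mono) auto
 also have "... = ennreal (A * K * et)" using AK by (subst ennreal_mult') auto
 finally show ?thesis using AK et by (simp add: ennreal_le_iff)
 qed
 then have "\<bar>\<Sum>i\<in>Basis. LL x. (ph x * ?w x) * cm i e x\<bar> <= (\<Sum>i\<in>(Basis::'a set). A * K * et)"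
 by (intro order_trans[OF sum_abs] sum_mono)
 also have "... = DIM('a) * et * (A * K)" by simp
 also have "... <= DIM('a) * et * (A * K + 1)" using et by (intro mult_left_mono) auto
 also have "... = de / 4"
 proof -
 have m: "m * (de / (4 * m * q)) * q = de / 4" if "m ~= 0" "q ~= 0" for m q :: real using that by simp
 have "A * K + 1 ~= 0" using AK by linarith
 then show ?thesis unfolding et_def by (intro m) auto
 qed
 finally have "\<bar>\<Sum>i\<in>Basis. LL x. (ph x * ?w x) * cm i e x\<bar> <= de / 4" .
 moreover have "e <= 1" "e <= e1" using e e0 by auto
 ultimately show ?thesis using e1(2)[OF e(1)] unfolding J_decomp[OF ph e(1) \<open>e <= 1\<close>] by linarith
 qed
 then show ?thesis using e0(1) by blast
qed

text \<open>Independent of e, hence the majorant for letting e tend to 0 under the time integral.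
  The radius grows by 1 because translations of length at most 1 occur in
  \<open>comm_bound\<close>.\<close>

lemma J_bound:
 assumes ph: "C1c ph ph'" and e: "0 < e" "e <= 1"
 and A: "!!x. \<bar>ph x\<bar> <= A" "!!x. norm (ph' x) <= A"
 and r: "!!x. norm x >= r ==> ph x = 0" "!!x. norm x >= r ==> ph' x = 0"
 shows "ennreal \<bar>J e ph\<bar> <= ennreal (A * (K\<^sup>2 + 2 * K * (K * (1 + C) * (2 + DIM('a))))) *
 (NN x. ennreal (ind (ball 0 (r + 1)) x * (norm (b x) + (\<Sum>i\<in>Basis. norm (G i x)))))"
proof -
 note [measurable] = C1_borel[OF C1c_C1[OF ph]]
 have A0: "A >= 0" using A(1)[of 0] by linarith
 let ?w = "conv w (moll e)" and ?h = "%x. ph x * d x + ph' x \<bullet> b x"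
 have wb: "\<bar>?w x\<bar> <= K" for x by (rule conv_moll_bound[OF w_bound e(1)])
 let ?N = "\<integral>\<^sup>+x. ennreal (ind (ball 0 (r + 1)) x * (norm (b x) + (\<Sum>i\<in>Basis. norm (G i x)))) \<partial>lborel"
 let ?c = "K * (1 + C) * (2 + DIM('a))"
 have c: "?c >= 0" using K C by simp
 have "ennreal \<bar>LL x. (?w x)^2 * ?h x\<bar> <= (NN x. ennreal \<bar>(?w x)^2 * ?h x\<bar>)"
 proof (cases "ilb (%x. (?w x)^2 * ?h x)")
 case True from integral_norm_bound_ennreal[OF this] show ?thesis by simp
 qed (simp add: not_integrable_integral_eq)
 also have "... <= (NN x. ennreal (A * K\<^sup>2) * ennreal (ind (ball 0 (r + 1)) x * (norm (b x) + (\<Sum>i\<in>Basis. norm (G i x)))))"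
 proof (rule nn_integral_mono_AE, use d_trace in eventually_elim)
 case (elim x)
 have dx: "\<bar>d x\<bar> <= (\<Sum>i\<in>Basis. norm (G i x))" unfolding elim
 by (rule order_trans[OF sum_abs sum_mono]) (simp add: Basis_le_norm)
 have "\<bar>(?w x)^2 * ?h x\<bar> <= A * K\<^sup>2 * (ind (ball 0 (r + 1)) x * (norm (b x) + (\<Sum>i\<in>Basis. norm (G i x))))"
 proof (cases "norm x < r")
 case True
 have "\<bar>?h x\<bar> <= \<bar>ph x\<bar> * \<bar>d x\<bar> + norm (ph' x) * norm (b x)"
  using Cauchy_Schwarz_ineq2[of "ph' x" "b x"] by (intro order_trans[OF abs_triangle_ineq]) (simp add: abs_mult)
 also have "... <= A * (\<Sum>i\<in>Basis. norm (G i x)) + A * norm (b x)"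
  by (intro add_mono mult_mono A dx) (auto simp: A0)
 finally have 1: "\<bar>?h x\<bar> <= A * (norm (b x) + (\<Sum>i\<in>Basis. norm (G i x)))" by (simp add: distrib_left)
 have "(?w x)^2 <= K\<^sup>2" using power_mono[OF wb[of x], of 2] by simp
 then have "(?w x)^2 * \<bar>?h x\<bar> <= K\<^sup>2 * (A * (norm (b x) + (\<Sum>i\<in>Basis. norm (G i x))))"
  using 1 by (intro mult_mono) auto
 then show ?thesis using True by (simp add: abs_mult mult_ac)
 next
 case False then show ?thesis using r[of x] A0 by (auto intro!: mult_nonneg_nonneg add_nonneg_nonneg sum_nonneg)
 qed
 then show ?case using A0 by (subst ennreal_mult'[symmetric]) (auto intro: ennreal_leI)
 qed
 also have "... = ennreal (A * K\<^sup>2) * ?N"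
 by (rule nn_integral_cmult) measurable
 finally have 1: "ennreal \<bar>LL x. (?w x)^2 * ?h x\<bar> <= ennreal (A * K\<^sup>2) * ?N" .
 have "ennreal \<bar>2 * (\<Sum>i\<in>Basis. LL x. (ph x * ?w x) * cm i e x)\<bar> <= ennreal (2 * (\<Sum>i\<in>Basis. \<bar>LL x. (ph x * ?w x) * cm i e x\<bar>))"
 by (intro ennreal_leI) (simp add: abs_mult sum_abs)
 also have "... = ennreal 2 * (\<Sum>i\<in>Basis. ennreal \<bar>LL x. (ph x * ?w x) * cm i e x\<bar>)"
 by (subst ennreal_mult') (auto simp: sum_ennreal)
 also have "... <= ennreal 2 * (\<Sum>i\<in>Basis. ennreal (A * K) * (ennreal ?c * (NN x. ennreal (ind (ball 0 (r + 1)) x * norm (G i x)))))"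
 proof (intro mult_left_mono sum_mono)
 fix i :: 'a assume i: "i : Basis"
 have "ennreal \<bar>LL x. (ph x * ?w x) * cm i e x\<bar> <= ennreal (A * K) * (NN x. ennreal (ib r x * \<bar>cm i e x\<bar>))"
 proof (rule cm_integrable(2)[OF i e])
 show "\<bar>ph x * ?w x\<bar> <= A * K" for x unfolding abs_mult by (intro mult_mono A wb) (use A0 in auto)
 qed (use r in auto)
 also have "... <= ennreal (A * K) * (ennreal ?c * (NN x. ennreal (ind (ball 0 (r + 1)) x * norm (G i x))))"
 by (intro mult_left_mono comm_bound i e) auto
 finally show "ennreal \<bar>LL x. (ph x * ?w x) * cm i e x\<bar> <= ennreal (A * K) * (ennreal ?c * (NN x. ennreal (ind (ball 0 (r + 1)) x * norm (G i x))))" .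
 qed auto
 also have "... = ennreal (A * (2 * K * ?c)) * (\<Sum>i\<in>Basis. \<integral>\<^sup>+x. ennreal (ind (ball 0 (r + 1)) x * norm (G i x)) \<partial>lborel)"
 proof -
 have "ennreal (A * (2 * K * ?c)) = ennreal 2 * (ennreal (A * K) * ennreal ?c)"
 using A0 K c by (subst ennreal_mult'[symmetric], simp, subst ennreal_mult'[symmetric]) (auto simp: mult_ac)
 then show ?thesis by (simp only: sum_distrib_left mult.assoc)
 qed
 also have "(\<Sum>i\<in>Basis. \<integral>\<^sup>+x. ennreal (ind (ball 0 (r + 1)) x * norm (G i x)) \<partial>lborel) = (NN x. (\<Sum>i\<in>Basis. ennreal (ind (ball 0 (r + 1)) x * norm (G i x))))"
 by (rule nn_integral_sum[symmetric]) measurable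
 also have "... <= ?N"
 by (intro nn_integral_mono) (auto simp: sum_ennreal indicator_def intro!: ennreal_leI)
 finally have 2: "ennreal \<bar>2 * (\<Sum>i\<in>Basis. LL x. (ph x * ?w x) * cm i e x)\<bar> <= ennreal (A * (2 * K * ?c)) * ?N"
 by (simp add: mult_left_mono)
 have "ennreal \<bar>J e ph\<bar> <= ennreal \<bar>LL x. (?w x)^2 * ?h x\<bar> + ennreal \<bar>2 * (\<Sum>i\<in>Basis. LL x. (ph x * ?w x) * cm i e x)\<bar>"
 unfolding J_decomp[OF ph e] by (subst ennreal_plus[symmetric]) (auto simp only: abs_ge_zero intro!: ennreal_leI abs_triangle_ineq)
 also have "... <= ennreal (A * K\<^sup>2) * ?N + ennreal (A * (2 * K * ?c)) * ?N" by (rule add_mono[OF 1 2])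
 also have "... = (ennreal (A * K\<^sup>2) + ennreal (A * (2 * K * ?c))) * ?N" by (simp only: distrib_right)
 also have "ennreal (A * K\<^sup>2) + ennreal (A * (2 * K * ?c)) = ennreal (A * (K\<^sup>2 + 2 * K * ?c))"
 proof -
 have "A * (2 * K * ?c) >= 0" "A * K\<^sup>2 >= 0" by (intro mult_nonneg_nonneg A0 K c; simp)+
 then show ?thesis by (subst ennreal_plus[symmetric]) (simp_all only: distrib_left)
 qed
 finally show ?thesis .
qed

end

section \<open>Borel representatives\<close>

lemma cball_borel [measurable]: "cball c r : sets borel"
 by simp

lemma lebesgue_borel_rep:
 fixes f :: "'a::euclidean_space => 'b::euclidean_space"
 assumes "f : borel_measurable lebesgue"
 obtains f' where "f' : bm" "AL x. f x = f' x"
proof -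
 have "\<forall>i\<in>Basis. \<exists>h\<in>borel_measurable lborel. AL x. f x \<bullet> i = h x"
 using assms by (intro ballI completion_ex_borel_measurable_real) auto
 then obtain h where h: "!!i. i : Basis ==> h i : borel_measurable lborel" "!!i. i : Basis ==> AL x. f x \<bullet> i = h i x"
 by metis
 have "AL x. \<forall>i\<in>Basis. f x \<bullet> i = h i x" using h(2) by (intro AE_finite_allI) auto
 then have "AL x. f x = (\<Sum>i\<in>Basis. h i x *\<^sub>R i)"
 proof eventually_elim
 case (elim x)
 have "f x = (\<Sum>i\<in>Basis. (f x \<bullet> i) *\<^sub>R i)" by (simp add: euclidean_representation)
 also have "... = (\<Sum>i\<in>Basis. h i x *\<^sub>R i)" using elim by (intro sum.cong) auto
 finally show ?case .
 qed
 moreover have "(%x. \<Sum>i\<in>Basis. h i x *\<^sub>R i) : bm" using h(1) by auto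
 ultimately show ?thesis using that by blast
qed

lemma lebesgue_on_borel_rep:
 fixes f :: "'a::euclidean_space => 'b::euclidean_space"
 assumes "f : borel_measurable (lebesgue_on S)" and [measurable]: "S : sets borel"
 obtains f' where "f' : bm" "AL x. x : S --> f x = f' x" "!!x. x \<notin> S ==> f' x = 0"
proof -
 have "(%x. ind S x *\<^sub>R f x) : borel_measurable lebesgue"
 using assms by (subst (asm) borel_measurable_restrict_space_iff) auto
 then obtain h where [measurable]: "h : bm" and h: "AL x. ind S x *\<^sub>R f x = h x"
 by (rule lebesgue_borel_rep)
 have "AL x. x : S --> f x = ind S x *\<^sub>R h x" using h by eventually_elim auto
 then show ?thesis using that[of "%x. ind S x *\<^sub>R h x"] by auto
qed

lemma lebesgue_measurable_AE:
 fixes f :: "'a::euclidean_space => 'b::euclidean_space"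
 assumes "f' : bm" "AL x. f x = f' x"
 shows "f : borel_measurable lebesgue"
proof -
 have "f' : borel_measurable lebesgue" using assms(1) by (simp add: measurable_completion)
 moreover have "AE x in lebesgue. f' x = f x" using assms(2) by (simp add: AE_completion_iff eq_commute)
 ultimately show ?thesis
 by (rule borel_measurable_AE)
qed

lemma lebesgue_integral_AE:
 fixes f :: "'a::euclidean_space => 'b::euclidean_space"
 assumes "f' : bm" "AL x. f x = f' x"
 shows "(LINT x|lebesgue. f x) = (LL x. f' x)" "integrable lebesgue f \<longleftrightarrow> ilb f'"
proof -
 have m: "f : borel_measurable lebesgue" "f' : borel_measurable lebesgue" "f' : borel_measurable lborel"
 using lebesgue_measurable_AE[OF assms] assms(1) by (auto simp: measurable_completion)
 have ae: "AE x in lebesgue. f x = f' x" using assms(2) by (simp add: AE_completion_iff)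
 show "(LINT x|lebesgue. f x) = (LL x. f' x)"
 using integral_cong_AE[OF m(1,2) ae] integral_completion[OF m(3)] by simp
 show "integrable lebesgue f \<longleftrightarrow> ilb f'"
 using integrable_cong_AE[OF m(1,2) ae] integrable_completion[OF m(3)] by simp
qed

lemma AE_lebesgue_on_iff:
 fixes S :: "'a::euclidean_space set"
 assumes "S : sets borel"
 shows "(AE t in lebesgue_on S. P t) \<longleftrightarrow> (AL t. t : S --> P t)"
 using assms by (subst AE_restrict_space_iff) (auto simp: AE_completion_iff)

lemma nn_integral_lebesgue_on:
 fixes S :: "'a::euclidean_space set"
 assumes "S : sets borel"
 shows "(\<integral>\<^sup>+x. f x \<partial>lebesgue_on S) = (\<integral>\<^sup>+x\<in>S. f x \<partial>lborel)"
 using assms by (subst nn_integral_restrict_space) (auto simp: nn_integral_completion)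

lemma locally_integrable_rep:
 fixes f :: "'a::euclidean_space => 'b::euclidean_space"
 assumes f: "locally_integrable UNIV f"
 obtains f' where "loc_int f'" "AL x. f x = f' x"
proof -
 have i: "integrable lebesgue (%x. ind (cball 0 r) x *\<^sub>R f x)" for r
 using f unfolding locally_integrable_def set_integrable_def by auto
 have "f : borel_measurable lebesgue"
 proof (rule borel_measurable_LIMSEQ_metric)
 show "(%x. ind (cball 0 (real n)) x *\<^sub>R f x) : borel_measurable lebesgue" for n
 using i[of "real n"] by (rule borel_measurable_integrable)
 fix x :: 'a
 obtain N :: nat where "norm x <= N" using real_arch_simple by blast
 then show "(%n. ind (cball 0 (real n)) x *\<^sub>R f x) \<longlonglongrightarrow> f x"
 by (intro tendsto_eventually eventually_sequentiallyI[of N]) auto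
 qed
 then obtain f' where f'[measurable]: "f' : bm" and ae: "AL x. f x = f' x" by (rule lebesgue_borel_rep)
 have "loc_int f'"
 proof (rule loc_intI[OF f'])
 fix r :: real
 have ae2: "AL x. ind (cball 0 r) x *\<^sub>R f x = ind (cball 0 r) x *\<^sub>R f' x" using ae by eventually_elim simp
 have m2: "(%x. ind (cball 0 r) x *\<^sub>R f' x) : bm" by simp
 have "ilb (%x. ind (cball 0 r) x *\<^sub>R f' x)"
 using i lebesgue_integral_AE(2)[OF m2 ae2] by simp
 then show "ilb (%x. indicat_real (ball 0 r) x * norm (f' x))"
 by (rule ibd) (auto simp: indicator_def)
 qed
 then show ?thesis using that ae by blast
qed

lemma loc_int_locally_integrable:
 fixes f :: "'a::euclidean_space => 'b::euclidean_space"
 assumes f': "loc_int f'" and ae: "AL x. f x = f' x"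
 shows "locally_integrable UNIV f"
 unfolding locally_integrable_def set_integrable_def
proof (intro allI impI)
 fix K :: "'a set" assume K: "compact K"
 then have [measurable]: "K : sets borel" by (simp add: borel_compact)
 have [measurable]: "f' : bm" using f' by (simp add: loc_int_def)
 obtain r where r: "K \<subseteq> ball 0 r" using compact_imp_bounded[OF K] bounded_subset_ballD by blast
 have "ilb (%x. ind K x *\<^sub>R f' x)"
 by (rule loc_int_integrable[OF f', where C=1 and r=r]) (use r in \<open>auto simp: indicator_def\<close>)
 moreover have "AL x. ind K x *\<^sub>R f x = ind K x *\<^sub>R f' x" using ae by eventually_elim simp
 ultimately show "integrable lebesgue (%x. ind K x *\<^sub>R f x)"
 using lebesgue_integral_AE(2)[of "%x. ind K x *\<^sub>R f' x" "%x. ind K x *\<^sub>R f x"] by auto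
qed

text \<open>Counterpart of \<open>has_weak_div\<close> for Borel representatives and C^1 test
  functions.\<close>

definition wdiv :: "('a::euclidean_space => 'a) => ('a => real) => bool" where
 "wdiv b d \<longleftrightarrow> loc_int b & loc_int d &
 (ALL ps ps'. C1c ps ps' --> (LL x. ps' x \<bullet> b x) = - (LL x. ps x * d x))"

lemma wdiv_has_weak_div:
 fixes b :: "'a::euclidean_space => 'a"
 assumes w: "wdiv b' d'" and ae: "AL x. b x = b' x" "AL x. d x = d' x"
 shows "has_weak_div b d"
 unfolding has_weak_div_def
proof (intro conjI allI impI)
 have [measurable]: "b' : bm" "d' : bm" using w by (auto simp: wdiv_def loc_int_def)
 show "locally_integrable UNIV b" "locally_integrable UNIV d"
 using w ae loc_int_locally_integrable unfolding wdiv_def by blast+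
 fix ph :: "'a => real" assume ph: "test_function UNIV ph"
 note c = test_function_C1c[OF ph] note [measurable] = C1_borel[OF C1c_C1[OF c]]
 have "(LINT x|lebesgue. frechet_derivative ph (at x) (b x)) = (LL x. grad ph x \<bullet> b' x)"
 by (rule lebesgue_integral_AE(1)) (use ae in \<open>auto simp: grad_inner[OF test_function_smooth[OF ph], symmetric] elim!: eventually_mono\<close>)
 moreover have "(LINT x|lebesgue. ph x * d x) = (LL x. ph x * d' x)"
 by (rule lebesgue_integral_AE(1)) (use ae(2) in \<open>auto elim!: eventually_mono\<close>)
 ultimately show "(LINT x|lebesgue. frechet_derivative ph (at x) (b x)) = - (LINT x|lebesgue. ph x * d x)"
 using w c unfolding wdiv_def by simp
qed

lemma has_weak_div_unique:
 fixes b :: "'a::euclidean_space => 'a"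
 assumes "has_weak_div b d1" "has_weak_div b d2"
 shows "AL x. d1 x = d2 x"
proof -
 obtain e1 where e1: "loc_int e1" "AL x. d1 x = e1 x" using assms(1) locally_integrable_rep unfolding has_weak_div_def by blast
 obtain e2 where e2: "loc_int e2" "AL x. d2 x = e2 x" using assms(2) locally_integrable_rep unfolding has_weak_div_def by blast
 have [measurable]: "e1 : bm" "e2 : bm" using e1 e2 by (auto simp: loc_int_def)
 have "AL x. e1 x - e2 x = 0"
 proof (rule fundamental_lemma_UNIV)
 show "loc_int (%x. e1 x - e2 x)"
 using loc_int_add[OF e1(1) loc_int_mult_bounded[OF e2(1), of "%x. - e2 x" 1]] by simp
 fix ph :: "'a => real" assume ph: "test_function UNIV ph"
 note c = test_function_C1c[OF ph] note [measurable] = C1_borel[OF C1c_C1[OF c]]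
 obtain r where r: "!!x. norm x >= r ==> ph x = 0" using C1c_support[OF c] by metis
 obtain A where A: "!!x. \<bar>ph x\<bar> <= A" using C1c_bounded[OF c] by metis
 have i: "ilb (%x. ph x * e1 x)" "ilb (%x. ph x * e2 x)"
 using loc_int_integrable[OF e1(1), of "%x. ph x * e1 x" A r] loc_int_integrable[OF e2(1), of "%x. ph x * e2 x" A r] A r
 by (auto simp: abs_mult mult_right_mono)
 have "(LL x. ph x * e1 x) = (LINT x|lebesgue. ph x * d1 x)"
 by (rule lebesgue_integral_AE(1)[symmetric]) (use e1 in \<open>auto elim!: eventually_mono\<close>)
 moreover have "(LL x. ph x * e2 x) = (LINT x|lebesgue. ph x * d2 x)"
 by (rule lebesgue_integral_AE(1)[symmetric]) (use e2 in \<open>auto elim!: eventually_mono\<close>)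
 moreover have "(LINT x|lebesgue. ph x * d1 x) = (LINT x|lebesgue. ph x * d2 x)"
 using assms ph unfolding has_weak_div_def by (metis minus_equation_iff)
 ultimately show "(LL x. ph x * (e1 x - e2 x)) = 0" by (simp add: right_diff_distrib i)
 qed
 then show ?thesis using e1(2) e2(2) by eventually_elim simp
qed

lemma wdiv_mult:
 fixes b :: "'a::euclidean_space => 'a"
 assumes w: "wdiv b d" and ph: "C1c ph ph'"
 shows "wdiv (%x. ph x *\<^sub>R b x) (%x. ph x * d x + ph' x \<bullet> b x)"
 unfolding wdiv_def
proof (intro conjI allI impI)
 have b: "loc_int b" and d: "loc_int d" using w by (auto simp: wdiv_def)
 have [measurable]: "b : bm" "d : bm" using w by (auto simp: wdiv_def loc_int_def)
 note [measurable] = C1_borel[OF C1c_C1[OF ph]]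
 obtain A where A: "!!x. \<bar>ph x\<bar> <= A" "!!x. norm (ph' x) <= A" using C1c_bounded[OF ph] by metis
 show "loc_int (%x. ph x *\<^sub>R b x)" by (rule loc_int_mult_bounded[OF b, where C=A]) (use A in \<open>auto intro: mult_right_mono\<close>)
 show "loc_int (%x. ph x * d x + ph' x \<bullet> b x)"
 proof (rule loc_int_add)
 show "loc_int (%x. ph x * d x)" by (rule loc_int_mult_bounded[OF d, where C=A]) (use A in \<open>auto simp: abs_mult intro: mult_right_mono\<close>)
 show "loc_int (%x. ph' x \<bullet> b x)"
 by (rule loc_int_mult_bounded[OF b, where C=A]) (auto intro!: order_trans[OF Cauchy_Schwarz_ineq2 mult_right_mono[OF A(2) norm_ge_zero]])
 qed
 fix ps ps' assume ps: "C1c (ps :: 'a => real) ps'"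
 note [measurable] = C1_borel[OF C1c_C1[OF ps]]
 obtain B where B: "B >= 0" "!!x. \<bar>ps x\<bar> <= B" "!!x. norm (ps' x) <= B" using C1c_bounded[OF ps] by metis
 obtain r where r: "!!x. norm x >= r ==> ps x = 0" "!!x. norm x >= r ==> ps' x = 0" using C1c_support[OF ps] by metis
 have A0: "A >= 0" using A(1)[of 0] by linarith
 have i1: "ilb (%x. ph x * (ps' x \<bullet> b x))"
 proof (rule loc_int_integrable[OF b, where C="A * B" and r=r])
 show "norm (ph x * (ps' x \<bullet> b x)) <= A * B * norm (b x)" for x
 unfolding real_norm_def abs_mult mult.assoc
 by (intro mult_mono A order_trans[OF Cauchy_Schwarz_ineq2 mult_right_mono[OF B(3) norm_ge_zero]] A0) auto
 qed (use r in auto)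
 have i2: "ilb (%x. ps x * (ph' x \<bullet> b x))"
 proof (rule loc_int_integrable[OF b, where C="B * A" and r=r])
 show "norm (ps x * (ph' x \<bullet> b x)) <= B * A * norm (b x)" for x
 unfolding real_norm_def abs_mult mult.assoc
 by (intro mult_mono B order_trans[OF Cauchy_Schwarz_ineq2 mult_right_mono[OF A(2) norm_ge_zero]]) auto
 qed (use r in auto)
 have i3: "ilb (%x. ps x * (ph x * d x))"
 proof (rule loc_int_integrable[OF d, where C="B * A" and r=r])
 show "norm (ps x * (ph x * d x)) <= B * A * norm (d x)" for x
 unfolding real_norm_def abs_mult mult.assoc by (intro mult_mono A B mult_right_mono) auto
 qed (use r in auto)
 have "(LL x. (ps x *\<^sub>R ph' x + ph x *\<^sub>R ps' x) \<bullet> b x) = - (LL x. (ps x * ph x) * d x)"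
 using w C1c_mult_left[OF ps C1c_C1[OF ph]] unfolding wdiv_def by blast
 moreover have "(LL x. (ps x *\<^sub>R ph' x + ph x *\<^sub>R ps' x) \<bullet> b x) = (LL x. ps x * (ph' x \<bullet> b x)) + (LL x. ph x * (ps' x \<bullet> b x))"
 by (simp add: inner_add_left i1 i2)
 ultimately show "(LL x. ps' x \<bullet> (ph x *\<^sub>R b x)) = - (LL x. ps x * (ph x * d x + ph' x \<bullet> b x))"
 using i2 i3 by (simp add: distrib_left mult.assoc)
qed

text \<open>\<open>C1c_approx\<close> gives test functions that converge uniformly with their
  gradients and share a support, so both sides converge by dominated convergence.\<close>

lemma weak_gradI:
 fixes f :: "'a::euclidean_space => real"
 assumes f: "loc_int f" and G: "loc_int G"
 and test: "!!ph. test_function UNIV ph ==> (LL x. f x *\<^sub>R grad ph x) = - (LL x. ph x *\<^sub>R G x)"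
 shows "weak_grad f G"
 unfolding weak_grad_def
proof (intro conjI f G allI impI)
 fix ps ps' assume ps: "C1c (ps :: 'a => real) ps'"
 have [measurable]: "f : bm" "G : bm" using f G by (auto simp: loc_int_def)
 from C1c_approx[OF ps] obtain ph R where ph: "!!n::nat. test_function UNIV (ph n)"
 "!!n x. norm x >= R ==> ph n x = 0" "!!n x. norm x >= R ==> grad (ph n) x = 0"
 "!!n x. \<bar>ph n x - ps x\<bar> <= 1 / Suc n" "!!n x. norm (grad (ph n) x - ps' x) <= 1 / Suc n"
 by blast
 obtain A where A: "!!x. \<bar>ps x\<bar> <= A" "!!x. norm (ps' x) <= A" using C1c_bounded[OF ps] by metis
 note [measurable] = C1_borel[OF C1c_C1[OF ps]]
 have [measurable]: "ph n : bm" "grad (ph n) : bm" for n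
 using C1_borel[OF C1c_C1[OF test_function_C1c[OF ph(1)]]] by auto
 have l: "(%n. 1 / real (Suc n)) \<longlonglongrightarrow> 0" using LIMSEQ_inverse_real_of_nat by (simp add: inverse_eq_divide)
 have l1: "(%n. ph n x) \<longlonglongrightarrow> ps x" for x
 by (rule LIM_zero_cancel, rule Lim_null_comparison[OF _ l]) (use ph(4) in auto)
 have l2: "(%n. grad (ph n) x) \<longlonglongrightarrow> ps' x" for x
 by (rule LIM_zero_cancel, rule Lim_null_comparison[OF _ l]) (use ph(5) in auto)
 have b1: "\<bar>ph n x\<bar> <= A + 1" and b2: "norm (grad (ph n) x) <= A + 1" for n x
 proof -
 have "1 / real (Suc n) <= 1" by simp
 then show "\<bar>ph n x\<bar> <= A + 1" "norm (grad (ph n) x) <= A + 1"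
 using ph(4)[of n x] ph(5)[of n x] A[of x] norm_triangle_sub[of "grad (ph n) x" "ps' x"] by linarith+
 qed
 have dom: "ilb (%x. (A + 1) * (ind (ball 0 R) x * norm (h x)))" if "loc_int h" for h :: "'a => 'c::euclidean_space"
 by (intro imr loc_int_norm that)
 have "(%n. LL x. f x *\<^sub>R grad (ph n) x) \<longlonglongrightarrow> (LL x. f x *\<^sub>R ps' x)"
 proof (rule ldct[OF _ _ dom[OF f]])
 show "AL x. norm (f x *\<^sub>R grad (ph n) x) <= (A + 1) * (ind (ball 0 R) x * norm (f x))" for n
 proof (rule AE_I2)
 fix x show "norm (f x *\<^sub>R grad (ph n) x) <= (A + 1) * (ind (ball 0 R) x * norm (f x))"
  using ph(3)[of x n] b2[of n x] by (cases "norm x < R") (auto simp: mult.commute[of _ "\<bar>f x\<bar>"] mult_left_mono)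
 qed
 qed (auto intro!: tendsto_intros l2)
 moreover have "(%n. LL x. ph n x *\<^sub>R G x) \<longlonglongrightarrow> (LL x. ps x *\<^sub>R G x)"
 proof (rule ldct[OF _ _ dom[OF G]])
 show "AL x. norm (ph n x *\<^sub>R G x) <= (A + 1) * (ind (ball 0 R) x * norm (G x))" for n
 proof (rule AE_I2)
 fix x show "norm (ph n x *\<^sub>R G x) <= (A + 1) * (ind (ball 0 R) x * norm (G x))"
  using ph(2)[of x n] b1[of n x] by (cases "norm x < R") (auto simp: mult_right_mono)
 qed
 qed (auto intro!: tendsto_intros l1)
 ultimately show "(LL x. f x *\<^sub>R ps' x) = - (LL x. ps x *\<^sub>R G x)"
 unfolding test[OF ph(1)] using LIMSEQ_unique tendsto_minus by blast
qed

section \<open>Patching local weak derivatives\<close>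

lemma W11_norm_witness:
 fixes f :: "'a::euclidean_space => 'a"
 assumes fin: "W11_norm (ball 0 r) f < \<infinity>"
 and f': "f' : bm" "AL x. f x = f' x"
 shows "EX H. (\<forall>i\<in>Basis. ilb (H i) & (ALL x. x \<notin> ball 0 r --> H i x = 0) &
  (ALL ph. test_function (ball 0 r) ph --> (LL x. (grad ph x \<bullet> i) *\<^sub>R f' x) = - (LL x. ph x *\<^sub>R H i x)))
 & (NN x. ennreal (ib r x * (norm (f' x) + (\<Sum>i\<in>Basis. norm (H i x))))) <= W11_norm (ball 0 r) f + 1"
proof -
 let ?B = "ball (0::'a) r"
 note [measurable] = f'(1)
 let ?S = "{L1_norm ?B f + (\<Sum>i\<in>Basis. L1_norm ?B (g i)) | g. \<forall>i\<in>Basis. has_weak_partial ?B i f (g i)}"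
 have "Inf ?S < W11_norm ?B f + 1" using fin by (simp add: W11_norm_def[symmetric] ennreal_add_left_cancel_less[of _ 0 1, simplified])
 then obtain g where g: "!!i. i : Basis ==> has_weak_partial ?B i f (g i)"
 and n: "L1_norm ?B f + (\<Sum>i\<in>Basis. L1_norm ?B (g i)) < W11_norm ?B f + 1"
 unfolding Inf_less_iff by blast
 have lt: "L1_norm ?B f + (\<Sum>i\<in>Basis. L1_norm ?B (g i)) < \<infinity>" using n fin by (metis ennreal_add_eq_top ennreal_one_neq_top infinity_ennreal_def less_trans top.not_eq_extremum)
 have gfin: "L1_norm ?B (g i) < \<infinity>" if "i : Basis" for i
 proof -
 have "L1_norm ?B (g i) <= (\<Sum>i\<in>Basis. L1_norm ?B (g i))" using that by (intro member_le_sum) auto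
 also have "... < \<infinity>" using lt by (auto simp: less_top)
 finally show ?thesis .
 qed
 have "\<forall>i\<in>Basis. EX h. h : bm & (AL x. x : ?B --> g i x = h x) & (ALL x. x \<notin> ?B --> h x = 0)"
 proof
 fix i :: 'a assume i: "i : Basis"
 have "g i : borel_measurable (lebesgue_on ?B)"
 using gfin[OF i] unfolding L1_norm_def by (simp split: if_splits)
 then show "EX h. h : bm & (AL x. x : ?B --> g i x = h x) & (ALL x. x \<notin> ?B --> h x = 0)"
 by (rule lebesgue_on_borel_rep) auto
 qed
 from bchoice[OF this] obtain H where "\<forall>i\<in>Basis. H i : bm & (AL x. x : ?B --> g i x = H i x) & (ALL x. x \<notin> ?B --> H i x = 0)" by blast
 then have H: "!!i. i : Basis ==> H i : bm"
 "!!i. i : Basis ==> AL x. x : ?B --> g i x = H i x" "!!i x. i : Basis ==> x \<notin> ?B ==> H i x = 0" by auto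
 have nH: "L1_norm ?B (g i) = (NN x. ennreal (norm (H i x)))" if i: "i : Basis" for i
 proof -
 have "L1_norm ?B (g i) = (\<integral>\<^sup>+x. ennreal (norm (g i x)) \<partial>lebesgue_on ?B)"
 using gfin[OF i] unfolding L1_norm_def by (auto split: if_splits)
 also have "... = (\<integral>\<^sup>+x\<in>?B. ennreal (norm (g i x)) \<partial>lborel)" by (rule nn_integral_lebesgue_on) simp
 also have "... = (NN x. ennreal (norm (H i x)))"
 by (rule nn_integral_cong_AE) (use H(2)[OF i] H(3)[OF i] in \<open>auto simp: indicator_def elim!: eventually_mono\<close>)
 finally show ?thesis .
 qed
 have nf: "L1_norm ?B f = (NN x. ennreal (ind ?B x * norm (f' x)))"
 proof -
 have "L1_norm ?B f < \<infinity>" using lt by (auto simp: less_top)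
 then have "L1_norm ?B f = (\<integral>\<^sup>+x. ennreal (norm (f x)) \<partial>lebesgue_on ?B)"
 unfolding L1_norm_def by (auto split: if_splits)
 also have "... = (\<integral>\<^sup>+x\<in>?B. ennreal (norm (f x)) \<partial>lborel)" by (rule nn_integral_lebesgue_on) simp
 also have "... = (NN x. ennreal (ind ?B x * norm (f' x)))"
 by (rule nn_integral_cong_AE) (use f'(2) in \<open>auto simp: indicator_def elim!: eventually_mono\<close>)
 finally show ?thesis .
 qed
 have int: "ilb (H i)" if i: "i : Basis" for i
 using gfin[OF i] nH[OF i] H(1)[OF i] by (intro integrableI_bounded) auto
 have test: "(LL x. (grad ph x \<bullet> i) *\<^sub>R f' x) = - (LL x. ph x *\<^sub>R H i x)"
 if i: "i : Basis" and ph: "test_function ?B ph" for i ph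
 proof -
 note c = test_function_C1c[OF ph] note [measurable] = C1_borel[OF C1c_C1[OF c]] H(1)[OF i]
 have out: "ph x = 0" if "x \<notin> ?B" for x using ph that closure_subset[of "{x. ph x ~= 0}"] unfolding test_function_def by blast
 have gout: "grad ph x = 0" if "x \<notin> ?B" for x
 proof (rule C1_zero_open[OF C1c_C1[OF c], of "- closure {x. ph x ~= 0}"])
 show "x : - closure {x. ph x ~= 0}" using ph that unfolding test_function_def by blast
 show "ph y = 0" if "y : - closure {x. ph x ~= 0}" for y using that closure_subset[of "{x. ph x ~= 0}"] by blast
 qed auto
 have "(LL x. (grad ph x \<bullet> i) *\<^sub>R f' x) = (LINT x:?B|lebesgue. frechet_derivative ph (at x) i *\<^sub>R f x)"
 unfolding set_lebesgue_integral_def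
 proof (rule lebesgue_integral_AE(1)[symmetric])
 show "AL x. ind ?B x *\<^sub>R frechet_derivative ph (at x) i *\<^sub>R f x = (grad ph x \<bullet> i) *\<^sub>R f' x"
  using f'(2)
 proof eventually_elim
  case (elim x)
  then show ?case by (cases "x : ball 0 r") (simp_all add: gout grad_inner[OF test_function_smooth[OF ph], symmetric])
 qed
 qed measurable
 also have "... = - (LINT x:?B|lebesgue. ph x *\<^sub>R g i x)"
 using g[OF i] ph unfolding has_weak_partial_def by blast
 also have "(LINT x:?B|lebesgue. ph x *\<^sub>R g i x) = (LL x. ph x *\<^sub>R H i x)"
 unfolding set_lebesgue_integral_def
 proof (rule lebesgue_integral_AE(1))
 show "AL x. ind ?B x *\<^sub>R ph x *\<^sub>R g i x = ph x *\<^sub>R H i x"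
  using H(2)[OF i] by eventually_elim (use out in \<open>auto simp: indicator_def\<close>)
 qed measurable
 finally show ?thesis .
 qed
 have "(NN x. ennreal (ind ?B x * (norm (f' x) + (\<Sum>i\<in>Basis. norm (H i x)))))
 <= (NN x. ennreal (ind ?B x * norm (f' x)) + (\<Sum>i\<in>Basis. ennreal (norm (H i x))))"
 by (intro nn_integral_mono) (auto simp: indicator_def sum_nonneg sum_ennreal)
 also have "... = (NN x. ennreal (ind ?B x * norm (f' x))) + (\<Sum>i\<in>Basis. \<integral>\<^sup>+x. ennreal (norm (H i x)) \<partial>lborel)"
 proof -
 have m: "(%x. ennreal (norm (H i x))) : bm" if "i : Basis" for i using H(1)[OF that] by measurable
 have "(NN x. (\<Sum>i\<in>Basis. ennreal (norm (H i x)))) = (\<Sum>i\<in>Basis. \<integral>\<^sup>+x. ennreal (norm (H i x)) \<partial>lborel)"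
 by (rule nn_integral_sum) (use m in simp)
 then show ?thesis by (subst nn_integral_add) (auto simp del: sum_ennreal intro: m borel_measurable_sum)
 qed
 also have "... = L1_norm ?B f + (\<Sum>i\<in>Basis. L1_norm ?B (g i))" by (simp add: nf nH)
 also have "... <= W11_norm ?B f + 1" using n by simp
 finally have "(NN x. ennreal (ind ?B x * (norm (f' x) + (\<Sum>i\<in>Basis. norm (H i x))))) <= W11_norm ?B f + 1" .
 then show ?thesis using int H(3) test by (intro exI[of _ H]) blast
qed

lemma weak_partial_unique:
 fixes f :: "'a::euclidean_space => 'b::euclidean_space"
 assumes H1: "ilb H1" and H2: "ilb H2"
 and t: "!!ph. test_function (ball 0 r) ph ==> (LL x. ph x *\<^sub>R H1 x) = (LL x. ph x *\<^sub>R (H2 x :: 'b))"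
 shows "AL x. x : ball (0::'a) r --> H1 x = H2 x"
proof -
 have [measurable]: "H1 : bm" "H2 : bm" using H1 H2 by auto
 have "AL x. \<forall>j\<in>Basis. x : ball 0 r --> H1 x \<bullet> j - H2 x \<bullet> j = 0"
 proof (rule AE_finite_allI)
 fix j :: 'b assume j: "j : Basis"
 have "AL x. x : ball 0 r --> (H1 x \<bullet> j - H2 x \<bullet> j) = 0"
 proof (rule fundamental_lemma)
 have i: "ilb (%x. H1 x \<bullet> j - H2 x \<bullet> j)" using H1 H2 by auto
 show "ilb (%x. indicat_real (ball 0 r) x * (H1 x \<bullet> j - H2 x \<bullet> j))"
  by (rule ibd[OF i]) (auto simp: indicator_def)
 fix ph assume ph: "test_function (ball (0::'a) r) ph"
 note c = test_function_C1c[OF ph] note [measurable] = C1_borel[OF C1c_C1[OF c]]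
 obtain A where A: "!!x. \<bar>ph x\<bar> <= A" using C1c_bounded[OF c] by metis
 have ib: "ilb (%x. ph x *\<^sub>R H x)" if H: "ilb H" for H :: "'a => 'b"
 proof (rule ibd[OF imr[OF integrable_norm[OF H], of A]])
  show "AL x. norm (ph x *\<^sub>R H x) <= norm (A * norm (H x))"
  using A by (intro AE_I2) (auto intro!: order_trans[OF mult_right_mono[OF A norm_ge_zero]] simp: abs_mult mult_right_mono)
 qed (use H in measurable)
 have "(LL x. ph x *\<^sub>R H1 x) \<bullet> j = (LL x. ph x *\<^sub>R H2 x) \<bullet> j" using t[OF ph] by simp
 then have "(LL x. (ph x *\<^sub>R H1 x) \<bullet> j) = (LL x. (ph x *\<^sub>R H2 x) \<bullet> j)"
  using ib[OF H1] ib[OF H2] by (simp only: integral_inner_left)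
 moreover have "ilb (%x. (ph x *\<^sub>R H1 x) \<bullet> j)" "ilb (%x. (ph x *\<^sub>R H2 x) \<bullet> j)"
  using ib[OF H1] ib[OF H2] by (auto simp only: integrable_inner_left)
 ultimately show "(LL x. ph x * (H1 x \<bullet> j - H2 x \<bullet> j)) = 0" by (simp add: right_diff_distrib)
 qed
 then show "AL x. x : ball 0 r --> H1 x \<bullet> j - H2 x \<bullet> j = 0" .
 qed simp
 then show ?thesis
 proof eventually_elim
 case (elim x)
 show ?case
 proof
 assume "x : ball 0 r"
 then show "H1 x = H2 x" using elim by (intro euclidean_eqI[of "H1 x"]) simp
 qed
 qed
qed

text \<open>Gradients chosen on the balls of integer radius agree almost everywhere on the smaller
  ball of any two, by the fundamental lemma, so they can be glued. The factor n comes from passing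
  from partial derivatives of the vector field to gradients of its components.\<close>

lemma W11_loc_gradient:
 fixes f :: "'a::euclidean_space => 'a"
 assumes fin: "!!k::nat. W11_norm (ball 0 (real k)) f < \<infinity>"
 and f': "f' : bm" "AL x. f x = f' x"
 shows "EX G. (\<forall>j\<in>Basis. weak_grad (%x. f' x \<bullet> j) (G j)) &
 (\<forall>k::nat. (NN x. ennreal (ib (real k) x * (norm (f' x) + (\<Sum>j\<in>Basis. norm (G j x)))))
 <= ennreal (DIM('a)) * (W11_norm (ball 0 (real k)) f + 1))"
proof -
 note [measurable] = f'(1)
 define Q where "Q k H \<longleftrightarrow> (\<forall>i\<in>Basis. ilb (H i) & (ALL x. x \<notin> ball 0 (real k) --> H i x = 0) &
  (ALL ph. test_function (ball 0 (real k)) ph --> (LL x. (grad ph x \<bullet> i) *\<^sub>R f' x) = - (LL x. ph x *\<^sub>R H i x)))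
 & (NN x. ennreal (ib (real k) x * (norm (f' x) + (\<Sum>i\<in>Basis. norm (H i x))))) <= W11_norm (ball 0 (real k)) f + 1"
 for k :: nat and H :: "'a => 'a => 'a"
 have "ALL k. EX H. Q k H"
 unfolding Q_def by (intro allI W11_norm_witness[OF fin f'])
 from choice[OF this] obtain H where HQ: "!!k. Q k (H k)" by blast
 have H: "!!k i. i : Basis ==> ilb (H k i)"
 "!!k i ph. i : Basis ==> test_function (ball 0 (real k)) ph ==> (LL x. (grad ph x \<bullet> i) *\<^sub>R f' x) = - (LL x. ph x *\<^sub>R H k i x)"
 "!!k. (NN x. ennreal (ib (real k) x * (norm (f' x) + (\<Sum>i\<in>Basis. norm (H k i x))))) <= W11_norm (ball 0 (real k)) f + 1"
 using HQ unfolding Q_def by simp_all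
 have [measurable]: "H k i : bm" if "i : Basis" for k i using H(1)[OF that] by auto
 have uniq: "AL x. x : ball 0 (real k) --> H k i x = H l i x" if i: "i : Basis" and kl: "k <= l" for i k l
 proof (rule weak_partial_unique[OF H(1)[OF i] H(1)[OF i]])
 fix ph assume ph: "test_function (ball (0::'a) (real k)) ph"
 then have ph2: "test_function (ball (0::'a) (real l)) ph" using subset_ball[of "real k" "real l" "0::'a"] kl unfolding test_function_def by auto
 show "(LL x. ph x *\<^sub>R H k i x) = (LL x. ph x *\<^sub>R H l i x)"
 using H(2)[OF i ph] H(2)[OF i ph2] by simp
 qed
 have uniq_all: "AL x. \<forall>i\<in>Basis. ALL k l. k <= l --> x : ball 0 (real k) --> H k i x = H l i x"
 proof (rule AE_finite_allI)
 fix i :: 'a assume i: "i : Basis"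
 have "AL x. k <= l --> x : ball 0 (real k) --> H k i x = H l i x" for k l
 using uniq[OF i, of k l] by (cases "k <= l") auto
 then show "AL x. ALL k l. k <= l --> x : ball 0 (real k) --> H k i x = H l i x"
 by (simp add: AE_all_countable)
 qed simp
 \<comment> \<open>The least k such that x lies in the ball of radius k. It takes countably many
   values, so the glued function is measurable.\<close>
 define \<kappa> :: "'a => nat" where "\<kappa> x = nat \<lfloor>norm x\<rfloor> + 1" for x
 have \<kappa>: "x : ball 0 (real (\<kappa> x))" for x unfolding \<kappa>_def by simp linarith
 have \<kappa>_le: "\<kappa> x <= k" if "x : ball 0 (real k)" for x k
 proof -
 have "\<lfloor>norm x\<rfloor> < int k" using that by (simp add: floor_less_iff)
 then show ?thesis unfolding \<kappa>_def by (simp add: Suc_le_eq nat_less_iff)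
 qed
 have [measurable]: "\<kappa> : measurable borel (count_space UNIV)" unfolding \<kappa>_def[abs_def] by measurable
 define P where "P i x = H (\<kappa> x) i x" for i x
 have [measurable]: "P i : bm" if i: "i : Basis" for i
 unfolding P_def[abs_def] by (rule measurable_compose_countable) (use i in auto)
 have P: "AL x. \<forall>i\<in>Basis. ALL k. x : ball 0 (real k) --> P i x = H k i x"
 using uniq_all
 proof eventually_elim
 case (elim x)
 show ?case
 proof (intro ballI allI impI)
 fix i :: 'a and k :: nat assume "i : Basis" "x : ball 0 (real k)"
 then show "P i x = H k i x" unfolding P_def using elim \<kappa>[of x] \<kappa>_le[of x k] by blast
 qed
 qed
 have bound: "(NN x. ennreal (ib (real k) x * (norm (f' x) + (\<Sum>i\<in>Basis. norm (P i x))))) <= W11_norm (ball 0 (real k)) f + 1" for k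
 proof -
 have "(NN x. ennreal (ib (real k) x * (norm (f' x) + (\<Sum>i\<in>Basis. norm (P i x)))))
 = (NN x. ennreal (ib (real k) x * (norm (f' x) + (\<Sum>i\<in>Basis. norm (H k i x)))))"
 by (rule nn_integral_cong_AE) (use P in \<open>auto simp: indicator_def elim!: eventually_mono\<close>)
 then show ?thesis using H(3)[of k] by simp
 qed
 have fin2: "ilb (%x. ib (real k) x * (norm (f' x) + (\<Sum>i\<in>Basis. norm (P i x))))" for k
 proof (rule integrableI_bounded)
 have "W11_norm (ball 0 (real k)) f + 1 < \<infinity>" using fin[of k] by simp
 then show "(NN x. ennreal (norm (ib (real k) x * (norm (f' x) + (\<Sum>i\<in>Basis. norm (P i x)))))) < \<infinity>"
 using le_less_trans[OF bound[of k]] by (simp add: sum_nonneg abs_mult)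
 qed measurable
 have li: "loc_int h" if [measurable]: "h : bm" and h: "!!x. norm (h x) <= C * (norm (f' x) + (\<Sum>i\<in>Basis. norm (P i x)))" for h :: "'a => 'b::euclidean_space" and C
 proof (rule loc_intI)
 fix r :: real
 obtain k :: nat where k: "r <= k" using real_arch_simple by blast
 show "ilb (%x. indicat_real (ball 0 r) x * norm (h x))"
 proof (rule ibd[OF imr[OF fin2[of k], of C]])
 show "AL x. norm (indicat_real (ball 0 r) x * norm (h x)) <= norm (C * (ib (real k) x * (norm (f' x) + (\<Sum>i\<in>Basis. norm (P i x)))))"
  by (rule AE_I2) (use k in \<open>auto simp: indicator_def intro: order_trans[OF h abs_ge_self]\<close>)
 qed simp
 qed simp
 \<comment> \<open>Transposition of the Jacobian: \<open>P i\<close> is the derivative of the field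
   in direction i, \<open>G j\<close> the gradient of its j-th component.\<close>
 define G where "G j x = (\<Sum>i\<in>Basis. (P i x \<bullet> j) *\<^sub>R i)" for j x
 have G_inner: "G j x \<bullet> i = P i x \<bullet> j" if "i : Basis" for i j x
 unfolding G_def using that by (simp add: inner_sum_left inner_Basis if_distrib cong: if_cong)
 have G_norm: "norm (G j x) <= (\<Sum>i\<in>Basis. norm (P i x))" if "j : Basis" for j x
 proof -
 have "norm (G j x) <= (\<Sum>i\<in>Basis. \<bar>G j x \<bullet> i\<bar>)" by (rule norm_le_l1)
 also have "... <= (\<Sum>i\<in>Basis. norm (P i x))" using that by (intro sum_mono) (simp add: G_inner Basis_le_norm)
 finally show ?thesis .
 qed
 have [measurable]: "G j : bm" for j unfolding G_def[abs_def] by measurable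
 have lf: "loc_int (%x. f' x \<bullet> j)" if "j : Basis" for j
 by (rule li[of _ 1]) (auto intro: order_trans[OF Basis_le_norm[OF that]] simp: sum_nonneg)
 have lP: "loc_int (P i)" if "i : Basis" for i
 proof (rule li[of _ 1])
 show "norm (P i x) <= 1 * (norm (f' x) + (\<Sum>i\<in>Basis. norm (P i x)))" for x
 using member_le_sum[of i Basis "%i. norm (P i x)"] that by simp (smt (verit) norm_ge_zero)
 qed (use that in simp)
 have lG: "loc_int (G j)" if "j : Basis" for j
 by (rule li[of _ 1]) (use order_trans[OF G_norm[OF that]] in auto)
 have lf': "loc_int f'" by (rule li[of _ 1]) (auto simp: sum_nonneg)
 have wg: "weak_grad (%x. f' x \<bullet> j) (G j)" if j: "j : Basis" for j
 proof (rule weak_gradI[OF lf[OF j] lG[OF j]])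
 fix ph :: "'a => real" assume ph: "test_function UNIV ph"
 note c = test_function_C1c[OF ph] note [measurable] = C1_borel[OF C1c_C1[OF c]]
 obtain r where r: "!!x. norm x >= r ==> ph x = 0" "!!x. norm x >= r ==> grad ph x = 0" using C1c_support[OF c] by metis
 obtain A where A: "!!x. \<bar>ph x\<bar> <= A" "!!x. norm (grad ph x) <= A" using C1c_bounded[OF c] by metis
 obtain k :: nat where k: "r < k" using reals_Archimedean2 by blast
 have phk: "test_function (ball 0 (real k)) ph"
 by (rule test_functionI[of _ "cball 0 r"]) (use test_function_smooth[OF ph] k r in auto)
 have i1: "ilb (%x. (f' x \<bullet> j) *\<^sub>R grad ph x)"
 by (rule loc_int_integrable[OF lf[OF j], where C=A and r=r]) (use r A in \<open>auto simp: mult.commute[of A] mult_left_mono\<close>)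
 have i2: "ilb (%x. ph x *\<^sub>R G j x)"
 by (rule loc_int_integrable[OF lG[OF j], where C=A and r=r]) (use r A in \<open>auto simp: mult_right_mono\<close>)
 show "(LL x. (f' x \<bullet> j) *\<^sub>R grad ph x) = - (LL x. ph x *\<^sub>R G j x)"
 proof (rule euclidean_eqI)
 fix i :: 'a assume i: "i : Basis"
 have i3: "ilb (%x. (grad ph x \<bullet> i) *\<^sub>R f' x)"
 proof (rule loc_int_integrable[OF lf', where C=A and r=r])
  show "norm ((grad ph x \<bullet> i) *\<^sub>R f' x) <= A * norm (f' x)" for x
  using order_trans[OF Basis_le_norm[OF i] A(2)] by (auto intro: mult_right_mono)
 qed (use r in auto)
 have i4: "ilb (%x. ph x *\<^sub>R P i x)"
  by (rule loc_int_integrable[OF lP[OF i], where C=A and r=r]) (use r A i in \<open>auto simp: mult_right_mono\<close>)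
 have HP: "(LL x. ph x *\<^sub>R H k i x) = (LL x. ph x *\<^sub>R P i x)"
 proof (rule integral_cong_AE)
  show "AL x. ph x *\<^sub>R H k i x = ph x *\<^sub>R P i x"
  using P
  proof eventually_elim
  case (elim x)
  show ?case
  proof (cases "norm x < k")
   case True then show ?thesis using elim i by auto
  next
   case False then show ?thesis using r k by simp
  qed
  qed
 qed (use i in measurable)
 have "(LL x. (f' x \<bullet> j) *\<^sub>R grad ph x) \<bullet> i = (LL x. ((f' x \<bullet> j) *\<^sub>R grad ph x) \<bullet> i)"
  using i1 by (intro integral_inner_left[symmetric])
 also have "... = (LL x. ((grad ph x \<bullet> i) *\<^sub>R f' x) \<bullet> j)" by (simp add: mult.commute)
 also have "... = (LL x. (grad ph x \<bullet> i) *\<^sub>R f' x) \<bullet> j" using i3 by (intro integral_inner_left)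
 also have "... = - (LL x. ph x *\<^sub>R P i x) \<bullet> j" unfolding H(2)[OF i phk] HP by simp
 also have "... = - (LL x. (ph x *\<^sub>R P i x) \<bullet> j)" using i4 by (simp only: integral_inner_left inner_minus_left)
 also have "... = - (LL x. (ph x *\<^sub>R G j x) \<bullet> i)" using G_inner[OF i] by simp
 also have "... = (- (LL x. ph x *\<^sub>R G j x)) \<bullet> i" using i2 by (simp only: integral_inner_left inner_minus_left)
 finally show "(LL x. (f' x \<bullet> j) *\<^sub>R grad ph x) \<bullet> i = (- (LL x. ph x *\<^sub>R G j x)) \<bullet> i" .
 qed
 qed
 have "(NN x. ennreal (ib (real k) x * (norm (f' x) + (\<Sum>j\<in>Basis. norm (G j x)))))
 <= ennreal (DIM('a)) * (W11_norm (ball 0 (real k)) f + 1)" for k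
 proof -
 have "(NN x. ennreal (ib (real k) x * (norm (f' x) + (\<Sum>j\<in>Basis. norm (G j x)))))
 <= (NN x. ennreal (DIM('a)) * ennreal (ib (real k) x * (norm (f' x) + (\<Sum>i\<in>Basis. norm (P i x)))))"
 proof (rule nn_integral_mono)
 fix x :: 'a
 have "(\<Sum>j\<in>Basis. norm (G j x)) <= (\<Sum>j\<in>(Basis::'a set). (\<Sum>i\<in>Basis. norm (P i x)))" by (intro sum_mono G_norm)
 moreover have "norm (f' x) <= DIM('a) * norm (f' x)"
  using mult_right_mono[of 1 "real DIM('a)" "norm (f' x)"] DIM_positive[where 'a='a] by (simp add: Suc_le_eq)
 ultimately have "norm (f' x) + (\<Sum>j\<in>Basis. norm (G j x)) <= DIM('a) * (norm (f' x) + (\<Sum>i\<in>Basis. norm (P i x)))"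
  by (simp add: distrib_left)
 then have "ib (real k) x * (norm (f' x) + (\<Sum>j\<in>Basis. norm (G j x))) <= DIM('a) * (ib (real k) x * (norm (f' x) + (\<Sum>i\<in>Basis. norm (P i x))))"
  by (simp add: indicator_def)
 then show "ennreal (ib (real k) x * (norm (f' x) + (\<Sum>j\<in>Basis. norm (G j x)))) <= ennreal (DIM('a)) * ennreal (ib (real k) x * (norm (f' x) + (\<Sum>i\<in>Basis. norm (P i x))))"
  by (subst ennreal_mult'[symmetric]) (auto intro: ennreal_leI)
 qed
 also have "... = ennreal (DIM('a)) * (NN x. ennreal (ib (real k) x * (norm (f' x) + (\<Sum>i\<in>Basis. norm (P i x)))))"
 by (rule nn_integral_cmult) measurable
 also have "... <= ennreal (DIM('a)) * (W11_norm (ball 0 (real k)) f + 1)" by (intro mult_left_mono bound) simp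
 finally show ?thesis .
 qed
 then show ?thesis using wg by blast
qed

section \<open>A jointly measurable divergence\<close>

lemma tendsto_0_ennreal:
 fixes f :: "nat => ennreal"
 assumes "!!de::real. de > 0 ==> \<forall>\<^sub>F n in sequentially. f n <= ennreal de"
 shows "f \<longlonglongrightarrow> 0"
proof (rule order_tendstoI)
 fix a :: ennreal assume "0 < a"
 then obtain de where "0 < ennreal de" "ennreal de < a"
 using dense[of 0 a] by (metis ennreal_cases not_less_zero order_less_le_trans top.not_eq_extremum top_greatest linorder_not_less)
 then have "de > 0" "ennreal de < a" by auto
 then show "\<forall>\<^sub>F n in sequentially. f n < a"
 using assms[of de] by (auto elim!: eventually_mono intro: le_less_trans)
qed simp

text \<open>Jointly measurable in t and x together with the field, unlike gradients that are chosen
  for each t separately. This is the way to a jointly measurable divergence.\<close>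

definition diff_div :: "('a::euclidean_space => 'a) => real => 'a => real" where
 "diff_div f h x = (\<Sum>i\<in>Basis. (f (x + h *\<^sub>R i) \<bullet> i - f x \<bullet> i) / h)"

text \<open>The i-th quotient minus its limit is the first-order remainder for the increment h e_i,
  divided by h; \<open>difference_estimate\<close> provides exactly the factor h.\<close>

lemma diff_div_limit:
 fixes f :: "'a::euclidean_space => 'a"
 assumes wg: "!!j. j : Basis ==> weak_grad (%x. f x \<bullet> j) (G j)" and [measurable]: "f : bm" and de: "de > 0"
 shows "\<exists>h0>0. ALL h. 0 < h --> h <= h0 -->
 (NN x. ennreal (ib r x * \<bar>diff_div f h x - (\<Sum>i\<in>Basis. G i x \<bullet> i)\<bar>)) <= ennreal de"
proof -
 have Gl: "loc_int (G i)" if "i : Basis" for i using wg[OF that] by (simp add: weak_grad_def)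
 have [measurable]: "G i : bm" if "i : Basis" for i using Gl[OF that] by (simp add: loc_int_def)
 have "\<forall>i\<in>Basis. \<exists>s>0. ALL h. norm h <= s --> (NN x. ennreal (ib r x * norm (G i (x + h) - G i x))) <= ennreal (de / DIM('a))"
 using de by (intro ballI loc_translation Gl) auto
 from bchoice[OF this] obtain s where s: "!!i. i : Basis ==> s i > 0"
 "!!i h. i : Basis ==> norm h <= s i ==> (NN x. ennreal (ib r x * norm (G i (x + h) - G i x))) <= ennreal (de / DIM('a))" by blast
 define h0 where "h0 = Min (s ` Basis)"
 have h0: "h0 > 0" "!!i. i : Basis ==> h0 <= s i" using s(1) by (auto simp: h0_def)
 have "(NN x. ennreal (ib r x * \<bar>diff_div f h x - (\<Sum>i\<in>Basis. G i x \<bullet> i)\<bar>)) <= ennreal de" if h: "0 < h" "h <= h0" for h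
 proof -
 have "(NN x. ennreal (ib r x * \<bar>diff_div f h x - (\<Sum>i\<in>Basis. G i x \<bullet> i)\<bar>))
 <= (NN x. (\<Sum>i\<in>Basis. ennreal (1 / h) * ennreal (ib r x * \<bar>f (x + h *\<^sub>R i) \<bullet> i - f x \<bullet> i - G i x \<bullet> (h *\<^sub>R i)\<bar>)))"
 proof (rule nn_integral_mono)
 fix x :: 'a
 have "diff_div f h x - (\<Sum>i\<in>Basis. G i x \<bullet> i) = (\<Sum>i\<in>Basis. (1 / h) * (f (x + h *\<^sub>R i) \<bullet> i - f x \<bullet> i - G i x \<bullet> (h *\<^sub>R i)))"
  unfolding diff_div_def sum_subtractf[symmetric] using h by (intro sum.cong refl) (simp add: field_simps)
 then have "\<bar>diff_div f h x - (\<Sum>i\<in>Basis. G i x \<bullet> i)\<bar> <= (\<Sum>i\<in>Basis. (1 / h) * \<bar>f (x + h *\<^sub>R i) \<bullet> i - f x \<bullet> i - G i x \<bullet> (h *\<^sub>R i)\<bar>)"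
  using h by (simp only:) (rule order_trans[OF sum_abs], simp add: abs_mult)
 then have "ib r x * \<bar>diff_div f h x - (\<Sum>i\<in>Basis. G i x \<bullet> i)\<bar> <= (\<Sum>i\<in>Basis. (1 / h) * (ib r x * \<bar>f (x + h *\<^sub>R i) \<bullet> i - f x \<bullet> i - G i x \<bullet> (h *\<^sub>R i)\<bar>))"
  by (simp add: indicator_def)
 then have "ennreal (ib r x * \<bar>diff_div f h x - (\<Sum>i\<in>Basis. G i x \<bullet> i)\<bar>) <= (\<Sum>i\<in>Basis. ennreal ((1 / h) * (ib r x * \<bar>f (x + h *\<^sub>R i) \<bullet> i - f x \<bullet> i - G i x \<bullet> (h *\<^sub>R i)\<bar>)))"
  using h by (subst sum_ennreal) (auto intro: ennreal_leI)
 also have "... = (\<Sum>i\<in>Basis. ennreal (1 / h) * ennreal (ib r x * \<bar>f (x + h *\<^sub>R i) \<bullet> i - f x \<bullet> i - G i x \<bullet> (h *\<^sub>R i)\<bar>))"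
  using h by (intro sum.cong refl ennreal_mult') simp
 finally show "ennreal (ib r x * \<bar>diff_div f h x - (\<Sum>i\<in>Basis. G i x \<bullet> i)\<bar>) <= (\<Sum>i\<in>Basis. ennreal (1 / h) * ennreal (ib r x * \<bar>f (x + h *\<^sub>R i) \<bullet> i - f x \<bullet> i - G i x \<bullet> (h *\<^sub>R i)\<bar>))" .
 qed
 also have "... = (\<Sum>i\<in>Basis. \<integral>\<^sup>+x. ennreal (1 / h) * ennreal (ib r x * \<bar>f (x + h *\<^sub>R i) \<bullet> i - f x \<bullet> i - G i x \<bullet> (h *\<^sub>R i)\<bar>) \<partial>lborel)"
 by (rule nn_integral_sum) measurable
 also have "... <= (\<Sum>i\<in>(Basis::'a set). ennreal (de / DIM('a)))"
 proof (rule sum_mono)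
 fix i :: 'a assume i: "i : Basis"
 have "(NN x. ennreal (1 / h) * ennreal (ib r x * \<bar>f (x + h *\<^sub>R i) \<bullet> i - f x \<bullet> i - G i x \<bullet> (h *\<^sub>R i)\<bar>))
  = ennreal (1 / h) * (NN x. ennreal (ib r x * \<bar>f (x + h *\<^sub>R i) \<bullet> i - f x \<bullet> i - G i x \<bullet> (h *\<^sub>R i)\<bar>))"
  by (rule nn_integral_cmult) (use i in measurable)
 also have "... <= ennreal (1 / h) * (ennreal (norm (h *\<^sub>R i)) * ennreal (de / DIM('a)))"
 proof (rule mult_left_mono[OF difference_estimate[OF wg[OF i]]])
  fix t :: real assume t: "t : {0..1}"
  then have "t * h <= h" using h by (intro mult_left_le_one_le) auto
  moreover have "norm (t *\<^sub>R (h *\<^sub>R i)) = t * h" using h i t by simp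
  ultimately have "norm (t *\<^sub>R (h *\<^sub>R i)) <= s i" using h(2) h0(2)[OF i] by linarith
  then show "(NN x. ennreal (ib r x * norm (G i (x + t *\<^sub>R (h *\<^sub>R i)) - G i x))) <= ennreal (de / DIM('a))" by (rule s(2)[OF i])
 qed (use i in auto)
 also have "... = ennreal (de / DIM('a))"
  using h i de by (simp add: ennreal_mult'[symmetric])
 finally show "(NN x. ennreal (1 / h) * ennreal (ib r x * \<bar>f (x + h *\<^sub>R i) \<bullet> i - f x \<bullet> i - G i x \<bullet> (h *\<^sub>R i)\<bar>)) <= ennreal (de / DIM('a))" .
 qed
 also have "... = ennreal de" using de by (simp add: ennreal_of_nat_eq_real_of_nat ennreal_mult'[symmetric])
 finally show ?thesis .
 qed
 then show ?thesis using h0(1) by blast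
qed

text \<open>\<open>difference_estimate\<close> with V = 0. It provides the majorant in time for the
  quotients.\<close>

lemma diff_div_bound:
 fixes f :: "'a::euclidean_space => 'a"
 assumes wg: "!!j. j : Basis ==> weak_grad (%x. f x \<bullet> j) (G j)" and [measurable]: "f : bm" and h: "0 < h" "h <= 1"
 and B: "(NN x. ennreal (ind (ball 0 (r + 1)) x * (norm (f x) + (\<Sum>j\<in>Basis. norm (G j x))))) <= B"
 shows "(NN x. ennreal (ib r x * \<bar>diff_div f h x\<bar>)) <= ennreal (DIM('a)) * B"
proof -
 have [measurable]: "G i : bm" if "i : Basis" for i using wg[OF that] by (simp add: weak_grad_def loc_int_def)
 have "(NN x. ennreal (ib r x * \<bar>diff_div f h x\<bar>))
 <= (NN x. (\<Sum>i\<in>Basis. ennreal (1 / h) * ennreal (ib r x * \<bar>f (x + h *\<^sub>R i) \<bullet> i - f x \<bullet> i - 0 \<bullet> (h *\<^sub>R i)\<bar>)))"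
 proof (rule nn_integral_mono)
 fix x :: 'a
 have "\<bar>diff_div f h x\<bar> <= (\<Sum>i\<in>Basis. (1 / h) * \<bar>f (x + h *\<^sub>R i) \<bullet> i - f x \<bullet> i - 0 \<bullet> (h *\<^sub>R i)\<bar>)"
 unfolding diff_div_def using h by (intro order_trans[OF sum_abs]) simp
 then have "ib r x * \<bar>diff_div f h x\<bar> <= (\<Sum>i\<in>Basis. (1 / h) * (ib r x * \<bar>f (x + h *\<^sub>R i) \<bullet> i - f x \<bullet> i - 0 \<bullet> (h *\<^sub>R i)\<bar>))"
 by (simp add: indicator_def)
 then have "ennreal (ib r x * \<bar>diff_div f h x\<bar>) <= (\<Sum>i\<in>Basis. ennreal ((1 / h) * (ib r x * \<bar>f (x + h *\<^sub>R i) \<bullet> i - f x \<bullet> i - 0 \<bullet> (h *\<^sub>R i)\<bar>)))"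
 using h by (subst sum_ennreal) (auto intro: ennreal_leI)
 also have "... = (\<Sum>i\<in>Basis. ennreal (1 / h) * ennreal (ib r x * \<bar>f (x + h *\<^sub>R i) \<bullet> i - f x \<bullet> i - 0 \<bullet> (h *\<^sub>R i)\<bar>))"
 using h by (intro sum.cong refl ennreal_mult') simp
 finally show "ennreal (ib r x * \<bar>diff_div f h x\<bar>) <= (\<Sum>i\<in>Basis. ennreal (1 / h) * ennreal (ib r x * \<bar>f (x + h *\<^sub>R i) \<bullet> i - f x \<bullet> i - 0 \<bullet> (h *\<^sub>R i)\<bar>))" .
 qed
 also have "... = (\<Sum>i\<in>Basis. \<integral>\<^sup>+x. ennreal (1 / h) * ennreal (ib r x * \<bar>f (x + h *\<^sub>R i) \<bullet> i - f x \<bullet> i - 0 \<bullet> (h *\<^sub>R i)\<bar>) \<partial>lborel)"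
 by (rule nn_integral_sum) measurable
 also have "... <= (\<Sum>i\<in>(Basis::'a set). B)"
 proof (rule sum_mono)
 fix i :: 'a assume i: "i : Basis"
 have "(NN x. ennreal (1 / h) * ennreal (ib r x * \<bar>f (x + h *\<^sub>R i) \<bullet> i - f x \<bullet> i - 0 \<bullet> (h *\<^sub>R i)\<bar>))
 = ennreal (1 / h) * (NN x. ennreal (ib r x * \<bar>f (x + h *\<^sub>R i) \<bullet> i - f x \<bullet> i - 0 \<bullet> (h *\<^sub>R i)\<bar>))"
 by (rule nn_integral_cmult) (use i in measurable)
 also have "... <= ennreal (1 / h) * (ennreal (norm (h *\<^sub>R i)) * B)"
 proof (rule mult_left_mono[OF difference_estimate[OF wg[OF i]]])
 fix t :: real assume t: "t : {0..1}"
 have n: "norm (t *\<^sub>R (h *\<^sub>R i)) <= 1" using h i t mult_le_one[of t h] by simp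
 let ?k = "t *\<^sub>R (h *\<^sub>R i)"
 have "(NN x. ennreal (ib r x * norm (G i (x + ?k) - 0)))
  <= (NN x. (%x. ennreal (ind (ball 0 (r + 1)) x * (norm (f x) + (\<Sum>j\<in>Basis. norm (G j x))))) (x + ?k))"
 proof (intro nn_integral_mono ennreal_leI)
  fix x :: 'a
  have "norm (G i (x + ?k)) <= (\<Sum>j\<in>Basis. norm (G j (x + ?k)))" using i by (intro member_le_sum) auto
  then have "norm (G i (x + ?k)) <= norm (f (x + ?k)) + (\<Sum>j\<in>Basis. norm (G j (x + ?k)))" using norm_ge_zero[of "f (x + ?k)"] by linarith
  moreover have "x + ?k : ball 0 (r + 1)" if "x : ball 0 r" using that n norm_triangle_ineq[of x ?k] unfolding mem_ball_0 by linarith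
  ultimately show "ib r x * norm (G i (x + ?k) - 0) <= ind (ball 0 (r + 1)) (x + ?k) * (norm (f (x + ?k)) + (\<Sum>j\<in>Basis. norm (G j (x + ?k))))"
  using add_nonneg_nonneg[OF norm_ge_zero[of "f (x + ?k)"] sum_nonneg[of Basis "%j. norm (G j (x + ?k))", OF norm_ge_zero]]
  by (cases "x : ball 0 r"; cases "x + ?k : ball 0 (r + 1)") (simp_all del: mem_ball mem_ball_0)
 qed
 also have "... = (NN x. ennreal (ind (ball 0 (r + 1)) x * (norm (f x) + (\<Sum>j\<in>Basis. norm (G j x)))))"
  by (rule nn_integral_lborel_shift) measurable
 also have "... <= B" by (rule B)
 finally show "(NN x. ennreal (ib r x * norm (G i (x + ?k) - 0))) <= B" .
 qed auto
 also have "... = B" using h i by (simp add: mult.assoc[symmetric] ennreal_mult'[symmetric])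
 finally show "(NN x. ennreal (1 / h) * ennreal (ib r x * \<bar>f (x + h *\<^sub>R i) \<bullet> i - f x \<bullet> i - 0 \<bullet> (h *\<^sub>R i)\<bar>)) <= B" .
 qed
 also have "... = ennreal (DIM('a)) * B" by (simp add: ennreal_of_nat_eq_real_of_nat)
 finally show ?thesis .
qed

lemma lborel_slices:
 fixes Q :: "real \<times> 'a::euclidean_space => bool"
 assumes "AL p. Q p" shows "AL t. AL x. Q (t, x)"
 using lborel_pair.AE_pair[of Q] assms unfolding lborel_prod by simp

text \<open>\<open>M k\<close> dominates the W^{1,1} norm on the ball of radius k. Gradients are
  only asserted to exist for almost every t, with no selection that is measurable in t.\<close>

locale field =
 fixes T :: real and b :: "real => 'a::euclidean_space => 'a" and M :: "nat => real => ennreal"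
 assumes T: "T > 0"
 and b_borel [measurable]: "(%(t, x). b t x) : bm2"
 and M_borel [measurable]: "M k : bm"
 and M_fin: "(\<integral>\<^sup>+t\<in>{0<..<T}. M k t \<partial>lborel) < \<infinity>"
 and gradients: "AL t. t : {0<..<T} --> (EX G. (\<forall>j\<in>Basis. weak_grad (%x. b t x \<bullet> j) (G j)) &
  (ALL k. (NN x. ennreal (ib (real k) x * (norm (b t x) + (\<Sum>j\<in>Basis. norm (G j x))))) <= M k t))"
begin

lemma b_slice [measurable]: "b t : bm"
 by measurable

text \<open>For almost every t the quotients are Cauchy in L^1 of the ball and dominated by a
  multiple of \<open>M (k + 1) t\<close>; dominated convergence in t makes them Cauchy in L^1 of
  space-time.\<close>

lemma diff_div_cauchy:
 fixes k :: nat
 defines "s \<equiv> %n (t, x). iT T t * (ib (real k) x * diff_div (b t) (1 / Suc n) x)"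
 shows "integrable (lborel \<Otimes>\<^sub>M lborel) (s n)"
 and "e > 0 ==> EX N. \<forall>i\<ge>N. \<forall>j\<ge>N. (LINT z|(lborel \<Otimes>\<^sub>M lborel). norm (s i z - s j z)) < e"
proof -
 have mD[measurable]: "(%(t, x). diff_div (b t) h x) : bm2" for h
 unfolding diff_div_def by measurable
 have sm[measurable]: "s n : borel_measurable (lborel \<Otimes>\<^sub>M lborel)" for n unfolding s_def by measurable
 define w where "w t = iT T t * (ennreal (DIM('a)) * M (k + 1) t)" for t
 have w: "(NN t. w t) < \<infinity>"
 proof -
 have "(NN t. w t) = ennreal (DIM('a)) * (\<integral>\<^sup>+t\<in>{0<..<T}. M (k + 1) t \<partial>lborel)"
 unfolding w_def by (subst nn_integral_cmult[symmetric]) (auto intro!: nn_integral_cong simp: mult_ac)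
 then show ?thesis using M_fin[of "k + 1"] by (simp add: ennreal_mult_less_top)
 qed
 have [measurable]: "w : bm" unfolding w_def by measurable
 have sb: "AL t. ALL n. (NN x. ennreal (norm (s n (t, x)))) <= w t"
 using gradients
 proof eventually_elim
 case (elim t)
 show ?case
 proof
 fix n
 show "(NN x. ennreal (norm (s n (t, x)))) <= w t"
 proof (cases "t : {0<..<T}")
  case True
  then obtain G where G: "!!j. j : Basis ==> weak_grad (%x. b t x \<bullet> j) (G j)"
  "!!k. (NN x. ennreal (ib (real k) x * (norm (b t x) + (\<Sum>j\<in>Basis. norm (G j x))))) <= M k t"
  using elim by blast
  have "(NN x. ennreal (ib (real k) x * \<bar>diff_div (b t) (1 / Suc n) x\<bar>)) <= ennreal (DIM('a)) * M (k + 1) t"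
  by (rule diff_div_bound[OF G(1)]) (use G(2)[of "k + 1"] in \<open>auto simp: add.commute\<close>)
  then show ?thesis using True by (simp add: s_def w_def abs_mult)
 qed (simp add: s_def)
 qed
 qed
 show int: "integrable (lborel \<Otimes>\<^sub>M lborel) (s n)" for n
 proof (rule integrableI_bounded)
 have "(\<integral>\<^sup>+z. ennreal (norm (s n z)) \<partial>(lborel \<Otimes>\<^sub>M lborel)) = (NN t. \<integral>\<^sup>+x. ennreal (norm (s n (t, x))) \<partial>lborel)"
 by (rule lborel.nn_integral_fst[symmetric]) measurable
 also have "... <= (NN t. w t)" by (rule nn_integral_mono_AE) (use sb in auto)
 finally show "(\<integral>\<^sup>+z. ennreal (norm (s n z)) \<partial>(lborel \<Otimes>\<^sub>M lborel)) < \<infinity>" using w by (rule le_less_trans)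
 qed measurable
 show "EX N. \<forall>i\<ge>N. \<forall>j\<ge>N. (LINT z|(lborel \<Otimes>\<^sub>M lborel). norm (s i z - s j z)) < e" if e: "e > 0"
 proof (rule ccontr)
 assume "~ ?thesis"
 then have "ALL N. EX p. fst p >= N & snd p >= N & (LINT z|(lborel \<Otimes>\<^sub>M lborel). norm (s (fst p) z - s (snd p) z)) >= e"
 by (simp add: not_less)
 \<comment> \<open>Dominated convergence needs a sequence, so a failure of the Cauchy property is
   recorded as a sequence of pairs of indices.\<close>
 from choice[OF this] obtain p where p: "!!N. fst (p N) >= N" "!!N. snd (p N) >= N"
 "!!N. (LINT z|(lborel \<Otimes>\<^sub>M lborel). norm (s (fst (p N)) z - s (snd (p N)) z)) >= e" by blast
 define c where "c N t = (NN x. ennreal (norm (s (fst (p N)) (t, x) - s (snd (p N)) (t, x))))" for N t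
 have [measurable]: "c N : bm" for N
 proof -
 have "c N : borel_measurable lborel" unfolding c_def by measurable
 then show ?thesis by simp
 qed
 have "(%N. \<integral>\<^sup>+t. c N t \<partial>lborel) \<longlonglongrightarrow> (\<integral>\<^sup>+t. 0 \<partial>(lborel::real measure))"
 proof (rule nn_integral_dominated_convergence[where w="%t. w t + w t"])
 show "(NN t. w t + w t) < \<infinity>" using w by (subst nn_integral_add) auto
 show "AL t. c N t <= w t + w t" for N
  using sb
 proof eventually_elim
  case (elim t)
  have "c N t <= (NN x. ennreal (norm (s (fst (p N)) (t, x))) + ennreal (norm (s (snd (p N)) (t, x))))"
  unfolding c_def by (intro nn_integral_mono) (simp add: ennreal_plus[symmetric] ennreal_leI norm_triangle_ineq4 del: ennreal_plus)
  also have "... = (NN x. ennreal (norm (s (fst (p N)) (t, x)))) + (NN x. ennreal (norm (s (snd (p N)) (t, x))))"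
  by (rule nn_integral_add) measurable
  also have "... <= w t + w t" using elim by (intro add_mono) auto
  finally show ?case .
 qed
 show "AL t. (%N. c N t) \<longlonglongrightarrow> 0"
  using gradients
 proof eventually_elim
  case (elim t)
  show ?case
  proof (cases "t : {0<..<T}")
  case False then show ?thesis by (simp add: c_def s_def)
  next
  case True
  then obtain G where G: "!!j. j : Basis ==> weak_grad (%x. b t x \<bullet> j) (G j)" using elim by blast
  have [measurable]: "G i : bm" if "i : Basis" for i using G[OF that] by (simp add: weak_grad_def loc_int_def)
  show ?thesis
  proof (rule tendsto_0_ennreal)
   fix de :: real assume de: "de > 0"
   obtain h0 where h0: "h0 > 0" "!!h. 0 < h ==> h <= h0 ==>
   (NN x. ennreal (ib (real k) x * \<bar>diff_div (b t) h x - (\<Sum>i\<in>Basis. G i x \<bullet> i)\<bar>)) <= ennreal (de / 2)"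
   using diff_div_limit[of "b t" G "de / 2" "real k", OF G] de by auto
   obtain N0 :: nat where N0: "1 / Suc N0 < h0" using reals_Archimedean[OF h0(1)] by (auto simp: inverse_eq_divide)
   have "c N t <= ennreal de" if N: "N >= N0" for N
   proof -
   have le: "1 / Suc n <= h0" if "n >= N" for n
    using N0 N that by (intro order_trans[OF _ less_imp_le[OF N0]]) (auto simp: frac_le)
   have "c N t <= (NN x. ennreal (ib (real k) x * \<bar>diff_div (b t) (1 / Suc (fst (p N))) x - (\<Sum>i\<in>Basis. G i x \<bullet> i)\<bar>)
    + ennreal (ib (real k) x * \<bar>diff_div (b t) (1 / Suc (snd (p N))) x - (\<Sum>i\<in>Basis. G i x \<bullet> i)\<bar>))"
    unfolding c_def s_def using True
    by (intro nn_integral_mono) (auto simp: indicator_def ennreal_plus[symmetric] simp del: ennreal_plus intro!: ennreal_leI)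
   also have "... = (NN x. ennreal (ib (real k) x * \<bar>diff_div (b t) (1 / Suc (fst (p N))) x - (\<Sum>i\<in>Basis. G i x \<bullet> i)\<bar>))
    + (NN x. ennreal (ib (real k) x * \<bar>diff_div (b t) (1 / Suc (snd (p N))) x - (\<Sum>i\<in>Basis. G i x \<bullet> i)\<bar>))"
    by (rule nn_integral_add) measurable
   also have "... <= ennreal (de / 2) + ennreal (de / 2)"
    by (intro add_mono h0(2) le p) auto
   also have "... = ennreal de" using de by (subst ennreal_plus[symmetric]) auto
   finally show ?thesis .
   qed
   then show "\<forall>\<^sub>F N in sequentially. c N t <= ennreal de" by (auto simp: eventually_sequentially)
  qed
  qed
 qed
 qed auto
 then have "\<forall>\<^sub>F N in sequentially. (NN t. c N t) < ennreal e"
 using e by (intro order_tendstoD(2)[where y="\<integral>\<^sup>+t. 0 \<partial>(lborel::real measure)"]) auto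
 then obtain N where N: "(NN t. c N t) < ennreal e" by (auto simp: eventually_sequentially)
 have "ennreal e <= ennreal (LINT z|(lborel \<Otimes>\<^sub>M lborel). norm (s (fst (p N)) z - s (snd (p N)) z))"
 by (intro ennreal_leI p)
 also have "... = (\<integral>\<^sup>+z. ennreal (norm (s (fst (p N)) z - s (snd (p N)) z)) \<partial>(lborel \<Otimes>\<^sub>M lborel))"
 by (intro nn_integral_eq_integral[symmetric] integrable_norm idiff int) auto
 also have "... = (NN t. c N t)"
 unfolding c_def by (rule lborel.nn_integral_fst[symmetric]) measurable
 finally show False using N by simp
 qed
qed

text \<open>An L^1 Cauchy sequence has an almost everywhere convergent subsequence, whose limit is
  jointly measurable. By Fatou it equals the trace of the weak gradients on almost every slice, and
  the null set of times is the same for all gradients \<open>G\<close>.\<close>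

lemma joint_div:
 "EX d. (%(t, x). d t x) : bm2 &
 (AL t. t : {0<..<T} --> (ALL G. (\<forall>j\<in>Basis. weak_grad (%x. b t x \<bullet> j) (G j)) --> (AL x. d t x = (\<Sum>i\<in>Basis. G i x \<bullet> i))))"
proof -
 have mD[measurable]: "(%(t, x). diff_div (b t) h x) : bm2" for h
 unfolding diff_div_def by measurable
 define s where "s k n = (%(t, x). iT T t * (ib (real k) x * diff_div (b t) (1 / Suc n) x))" for k n :: nat
 have [measurable]: "s k n : bm2" for k n unfolding s_def by measurable
 have "ALL k. EX rh. strict_mono rh & (AE z in lborel \<Otimes>\<^sub>M lborel. Cauchy (%i. s k (rh i) z))"
 proof
 fix k
 note dc = diff_div_cauchy(1)[of k, folded s_def] diff_div_cauchy(2)[of _ k, folded s_def]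
 obtain rh where "strict_mono rh" "AE z in lborel \<Otimes>\<^sub>M lborel. Cauchy (%i. s k (rh i) z)"
 by (rule cauchy_L1_AE_cauchy_subseq[OF dc]) assumption+
 then show "EX rh. strict_mono rh & (AE z in lborel \<Otimes>\<^sub>M lborel. Cauchy (%i. s k (rh i) z))" by blast
 qed
 from choice[OF this] obtain rh where rh: "!!k. strict_mono (rh k)" "!!k. AE z in lborel \<Otimes>\<^sub>M lborel. Cauchy (%i. s k (rh k i) z)" by blast
 define D where "D k t x = lim (%i. s k (rh k i) (t, x))" for k t x
 have Dm[measurable]: "(%(t, x). D k t x) : bm2" for k unfolding D_def by measurable
 have conv: "AL t. AL x. (%i. s k (rh k i) (t, x)) \<longlonglongrightarrow> D k t x" for k
 proof -
 have "AL z. Cauchy (%i. s k (rh k i) z)" using rh(2)[of k] unfolding lborel_prod .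
 from lborel_slices[OF this] show ?thesis
 unfolding D_def by (auto simp: Cauchy_convergent_iff convergent_LIMSEQ_iff)
 qed
 have tr: "AL t. t : {0<..<T} --> (ALL G. (\<forall>j\<in>Basis. weak_grad (%x. b t x \<bullet> j) (G j)) --> (AL x. x : ball 0 (real k) --> D k t x = (\<Sum>i\<in>Basis. G i x \<bullet> i)))" for k
 using conv[of k]
 proof eventually_elim
 case (elim t)
 show ?case
 proof (intro impI allI)
 fix G assume t: "t : {0<..<T}" and G: "\<forall>j\<in>Basis. weak_grad (%x. b t x \<bullet> j) (G j)"
 have [measurable]: "G i : bm" if "i : Basis" for i using G that by (simp add: weak_grad_def loc_int_def)
 let ?tr = "%x. \<Sum>i\<in>Basis. G i x \<bullet> i"
 let ?u = "%i x. ennreal (ib (real k) x * \<bar>diff_div (b t) (1 / Suc (rh k i)) x - ?tr x\<bar>)"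
 let ?U = "%x. ennreal (ib (real k) x * \<bar>D k t x - ?tr x\<bar>)"
 have [measurable]: "(%x. diff_div (b t) h x) : bm" for h unfolding diff_div_def by measurable
 have lim: "AL x. (%i. ?u i x) \<longlonglongrightarrow> ?U x"
  using elim
 proof eventually_elim
  case (elim x)
  show ?case
  proof (cases "x : ball 0 (real k)")
  case True
  then have "(%i. diff_div (b t) (1 / Suc (rh k i)) x) \<longlonglongrightarrow> D k t x" using elim t by (simp add: s_def)
  then show ?thesis using True by (auto intro!: tendsto_ennrealI tendsto_intros)
  qed simp
 qed
 have "(%i. \<integral>\<^sup>+x. ?u i x \<partial>lborel) \<longlonglongrightarrow> 0"
 proof (rule tendsto_0_ennreal)
  fix de :: real assume de: "de > 0"
  obtain h0 where h0: "h0 > 0" "!!h. 0 < h ==> h <= h0 ==>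
  (NN x. ennreal (ib (real k) x * \<bar>diff_div (b t) h x - ?tr x\<bar>)) <= ennreal de"
  using diff_div_limit[of "b t" G de "real k"] G de by auto
  obtain N0 :: nat where N0: "1 / Suc N0 < h0" using reals_Archimedean[OF h0(1)] by (auto simp: inverse_eq_divide)
  have "(NN x. ?u i x) <= ennreal de" if "i >= N0" for i
  proof (rule h0(2))
  have "rh k i >= N0" using seq_suble[OF rh(1), of i k] that by linarith
  then show "1 / Suc (rh k i) <= h0" by (intro order_trans[OF _ less_imp_le[OF N0]]) (auto simp: frac_le)
  qed simp
  then show "\<forall>\<^sub>F i in sequentially. (NN x. ?u i x) <= ennreal de" by (auto simp: eventually_sequentially)
 qed
 then have L0: "liminf (%i. \<integral>\<^sup>+x. ?u i x \<partial>lborel) = 0" by (intro lim_imp_Liminf) auto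
 have "(NN x. ?U x) = (NN x. liminf (%i. ?u i x))"
 proof (rule nn_integral_cong_AE, use lim in eventually_elim)
  case (elim x)
  show ?case by (rule lim_imp_Liminf[OF _ elim, symmetric]) simp
 qed
 also have "... <= liminf (%i. \<integral>\<^sup>+x. ?u i x \<partial>lborel)" by (rule nn_integral_liminf) measurable
 finally have "(NN x. ?U x) = 0" using L0 by simp
 then have "AL x. ?U x = 0" by (subst (asm) nn_integral_0_iff_AE) auto
 then show "AL x. x : ball 0 (real k) --> D k t x = ?tr x"
  by eventually_elim (auto simp: indicator_def)
 qed
 qed
 define \<kappa> :: "'a => nat" where "\<kappa> x = nat \<lfloor>norm x\<rfloor> + 1" for x
 have \<kappa>: "x : ball 0 (real (\<kappa> x))" for x unfolding \<kappa>_def by simp linarith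
 have [measurable]: "\<kappa> : measurable borel (count_space UNIV)" unfolding \<kappa>_def[abs_def] by measurable
 define d where "d t x = D (\<kappa> x) t x" for t x
 have "(%z. (%(t, x). D (\<kappa> (snd z)) t x) z) : bm2"
 by (rule measurable_compose_countable[OF Dm]) measurable
 then have 1: "(%(t, x). d t x) : bm2"
 by (simp add: d_def split_def)
 have "AL t. ALL k. t : {0<..<T} --> (ALL G. (\<forall>j\<in>Basis. weak_grad (%x. b t x \<bullet> j) (G j)) --> (AL x. x : ball 0 (real k) --> D k t x = (\<Sum>i\<in>Basis. G i x \<bullet> i)))"
 unfolding AE_all_countable by (intro allI tr)
 then have "AL t. t : {0<..<T} --> (ALL G. (\<forall>j\<in>Basis. weak_grad (%x. b t x \<bullet> j) (G j)) --> (AL x. d t x = (\<Sum>i\<in>Basis. G i x \<bullet> i)))"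
 proof eventually_elim
 case (elim t)
 show ?case
 proof (intro impI allI)
 fix G assume "t : {0<..<T}" "\<forall>j\<in>Basis. weak_grad (%x. b t x \<bullet> j) (G j)"
 then have "AL x. ALL k. x : ball 0 (real k) --> D k t x = (\<Sum>i\<in>Basis. G i x \<bullet> i)"
  using elim unfolding AE_all_countable by blast
 then show "AL x. d t x = (\<Sum>i\<in>Basis. G i x \<bullet> i)"
  by eventually_elim (use \<kappa> in \<open>auto simp: d_def\<close>)
 qed
 qed
 then show ?thesis using 1 by blast
qed

end

section \<open>Evolution of the mollified solution\<close>

lemma indicator_lessThan_measurable [measurable]:
 "(%(t, s). indicat_real {..<t::real} s) : bm2"
 unfolding indicator_def lessThan_iff by measurable

text \<open>The primitive vanishes near T, not near 0: a test function in time may be nonzero at 0,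
  which is how the initial value is seen. Up to sign it is the convolution of \<open>et\<close> with
  the indicator of the negative half-line, so smoothness comes from
  \<open>smooth_conv\<close>.\<close>

lemma smooth_primitive:
 fixes et :: "real => real"
 assumes et: "test_function {0<..<T} et" and T: "T > 0"
 obtains th where "smooth th" "!!t. frechet_derivative th (at t) 1 = et t" "\<exists>de>0. \<forall>t>T - de. th t = 0"
 "!!s. th s = - (LL t. ind {s<..} t * et t)"
proof -
 have etU: "test_function UNIV et" using et by (auto simp: test_function_def)
 note c = test_function_C1c[OF etU] note [measurable] = C1_borel[OF C1c_C1[OF c]]
 have l: "loc_int (%x::real. indicat_real {..<0} x)" by (rule loc_int_bounded[of _ 1]) auto
 define th where "th t = - conv (indicat_real {..<0}) et t" for t
 have sm: "smooth th" unfolding th_def using smooth_cmult[OF smooth_conv[OF l etU], of "-1"] by simp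
 have C1: "C1 th (%t. - conv (indicat_real {..<0}) (grad et) t)"
 using C1_cmult[OF conv_C1[OF l c], of "-1"] by (simp add: th_def[abs_def])
 have eq: "th s = - (LL t. ind {s<..} t * et t)" for s
 proof -
 have "(LL y. (%t. ind {s<..} t * et t) (s - y)) = (LL t. ind {s<..} t * et t)"
 by (rule lborel_integral_reflect) measurable
 moreover have "indicat_real {s<..} (s - y) = indicat_real {..<0} y" for y by (auto simp: indicator_def)
 ultimately show ?thesis by (simp add: th_def conv_def)
 qed
 have supp: "closure {x. et x ~= 0} \<subseteq> {0<..<T}" "compact (closure {x. et x ~= 0})" using et by (auto simp: test_function_def)
 have z: "\<exists>de>0. \<forall>t>T - de. et t = 0"
 proof (cases "closure {x. et x ~= 0} = {}")
 case True then show ?thesis using closure_subset[of "{x. et x ~= 0}"] by (intro exI[of _ 1]) auto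
 next
 case False
 then obtain m where m: "m : closure {x. et x ~= 0}" "!!x. x : closure {x. et x ~= 0} ==> x <= m"
 using compact_attains_sup[OF supp(2)] by blast
 have "et t = 0" if "t > m" for t using m(2)[of t] that closure_subset[of "{x. et x ~= 0}"] by fastforce
 moreover have "m < T" using m(1) supp(1) by auto
 ultimately show ?thesis by (intro exI[of _ "T - m"]) auto
 qed
 have "frechet_derivative th (at t) 1 = et t" for t
 proof -
 obtain r where r: "r > 0" "!!x. norm x >= r ==> et x = 0" using C1c_support[OF c] by metis
 have g0: "grad et x = 0" if "x > r" for x
 by (rule C1_zero_open[OF C1c_C1[OF c], of "{r<..}"]) (use that r in auto)
 define R where "R = r + \<bar>t\<bar> + 1"
 have R: "R > 0" using r by (simp add: R_def)
 have der: "(et has_real_derivative grad et x) (at x)" for x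
 using C1c_C1[OF c] unfolding C1_def has_field_derivative_def by simp
 have "(LL s. grad et (t + s) * ind {0..R} s) = et (t + R) - et (t + 0)"
 proof (rule integral_FTC_Icc_real)
 show "((%s. et (t + s)) has_real_derivative grad et (t + x)) (at x)" for x
  using DERIV_shift[of et "grad et (t + x)" x t] der[of "t + x"] by (simp add: add.commute)
 show "isCont (%s. grad et (t + s)) x" for x
 proof -
  have "continuous_on UNIV (%s. grad et (t + s))"
  by (rule continuous_on_compose2[OF C1_continuous_grad[OF C1c_C1[OF c], of UNIV]]) (auto intro!: continuous_intros)
  then show ?thesis by (simp add: continuous_on_eq_continuous_at)
 qed
 qed (use R in simp)
 then have I: "(LL s. grad et (t + s) * ind {0..R} s) = - et t"
 using r(2)[of "t + R"] by (simp add: R_def)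
 have "conv (indicat_real {..<0}) (grad et) t = (LL y. (%s. indicat_real {0<..} s * grad et (t + s)) (0 - y))"
 unfolding conv_def by (intro lcong refl) (auto simp: indicator_def)
 also have "... = (LL s. indicat_real {0<..} s * grad et (t + s))"
 by (rule lborel_integral_reflect) measurable
 also have "... = (LL s. grad et (t + s) * ind {0..R} s)"
 proof (rule integral_cong_AE)
 show "AL s. indicat_real {0<..} s * grad et (t + s) = grad et (t + s) * ind {0..R} s"
  using AE_lborel_singleton[of "0::real"]
 proof eventually_elim
  case (elim s)
  then show ?case using g0[of "t + s"] by (auto simp: indicator_def R_def abs_if split: if_splits)
 qed
 qed measurable
 finally have "conv (indicat_real {..<0}) (grad et) t = - et t" using I by simp
 then show ?thesis using C1_frechet[OF C1] by simp
 qed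
 moreover have "\<exists>de>0. \<forall>t>T - de. th t = 0"
 proof -
 obtain de where "de > 0" "!!t. t > T - de ==> et t = 0" using z by blast
 then have "ind {s<..} t * et t = 0" if "s > T - de" for s t using that by (auto simp: indicator_def)
 then have "th s = 0" if "s > T - de" for s unfolding eq using that by (simp only: Bochner_Integration.integral_zero minus_zero)
 then show ?thesis using \<open>de > 0\<close> by blast
 qed
 ultimately show ?thesis using that sm eq by blast
qed

text \<open>Since the test functions need not vanish at time 0, the identity encodes the initial
  value 0 as well, and no constant of integration is left.\<close>

lemma time_primitive:
 fixes f g :: "real => real"
 assumes T: "T > 0" and [measurable]: "g : bm" and g: "!!t. \<bar>g t\<bar> <= K"
 and f: "ilb f"
 and eq: "!!th. smooth th ==> (\<exists>de>0. \<forall>t>T - de. th t = 0) ==>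
 (LL t. iT T t * (frechet_derivative th (at t) 1 * g t)) = - (LL t. th t * f t)"
 shows "AL t. t : {0<..<T} --> g t = (LL s. ind {..<t} s * f s)"
proof -
 have [measurable]: "f : bm" using f by auto
 define W where "W t = (LL s. ind {..<t} s * f s)" for t
 have Wm[measurable]: "W : bm"
 proof -
 have "W : borel_measurable lborel" unfolding W_def by measurable
 then show ?thesis by simp
 qed
 have Wb: "\<bar>W t\<bar> <= (LL s. \<bar>f s\<bar>)" for t
 proof -
 have i: "ilb (%s. ind {..<t} s * f s)"
 by (rule ibd[OF f]) (auto simp: indicator_def)
 have "\<bar>W t\<bar> <= (LL s. \<bar>ind {..<t} s * f s\<bar>)" unfolding W_def using integral_norm_bound[of lborel "%s. ind {..<t} s * f s"] by simp
 also have "... <= (LL s. \<bar>f s\<bar>)"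
 by (rule integral_mono) (use i f in \<open>auto simp: indicator_def\<close>)
 finally show ?thesis .
 qed
 have ball: "ball (T / 2) (T / 2) = {0<..<T}" by (simp add: ball_eq_greaterThanLessThan)
 have fin: "ilb (%t. indicat_real {0<..<T} t)"
 using integrable_real_indicator[of "{0<..<T}" lborel] T by simp
 have "AL t. t : ball (T / 2) (T / 2) --> g t - W t = 0"
 proof (rule fundamental_lemma)
 show "ilb (%t. ind (ball (T / 2) (T / 2)) t * (g t - W t))"
 unfolding ball
 proof (rule ibd[OF imr[OF fin, of "K + (LL s. \<bar>f s\<bar>)"]])
 show "AL t. norm (indicat_real {0<..<T} t * (g t - W t)) <= norm ((K + (LL s. \<bar>f s\<bar>)) * indicat_real {0<..<T} t)"
 proof (rule AE_I2)
  fix t show "norm (indicat_real {0<..<T} t * (g t - W t)) <= norm ((K + (LL s. \<bar>f s\<bar>)) * indicat_real {0<..<T} t)"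
  using g[of t] Wb[of t] by (auto simp: indicator_def)
 qed
 qed measurable
 fix et assume "test_function (ball (T / 2) (T / 2)) et"
 then have et: "test_function {0<..<T} et" by (simp add: ball)
 then have "test_function UNIV et" by (auto simp: test_function_def)
 note c = test_function_C1c[OF this] note [measurable] = C1_borel[OF C1c_C1[OF c]]
 have out: "et t = 0" if "t \<notin> {0<..<T}" for t using et that closure_subset[of "{x. et x ~= 0}"] unfolding test_function_def by blast
 obtain th where th: "smooth th" "!!t. frechet_derivative th (at t) 1 = et t" "\<exists>de>0. \<forall>t>T - de. th t = 0"
 "!!s. th s = - (LL t. ind {s<..} t * et t)" by (rule smooth_primitive[OF et T]) blast
 note iet = C1c_integrable(1)[OF c]
 have bd: "ilb (%t. et t * q t)" if [measurable]: "q : bm" and q: "!!t. \<bar>q t\<bar> <= B" for q B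
 proof (rule ibd[OF imr[OF iet, of B]])
 show "AL t. norm (et t * q t) <= norm (B * et t)"
 proof (rule AE_I2)
  fix t
  have "\<bar>q t\<bar> * \<bar>et t\<bar> <= \<bar>B\<bar> * \<bar>et t\<bar>" by (intro mult_right_mono order_trans[OF q abs_ge_self]) auto
  then show "norm (et t * q t) <= norm (B * et t)" by (simp add: abs_mult mult.commute)
 qed
 qed measurable
 have ig: "ilb (%t. et t * g t)" by (rule bd[OF _ g]) measurable
 have iW: "ilb (%t. et t * W t)" by (rule bd[OF _ Wb]) measurable
 have "(LL t. et t * W t) = (LL t. (LL s. et t * (ind {..<t} s * f s)))"
 unfolding W_def by simp
 also have "... = (LL s. (LL t. et t * (ind {..<t} s * f s)))"
 proof (rule lborel_pair.Fubini_integral[symmetric])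
 have "integrable (lborel \<Otimes>\<^sub>M lborel) (%(t, s). et t * f (s + t *\<^sub>R 0))" by (rule integrable_shear[OF iet f])
 then show "integrable (lborel \<Otimes>\<^sub>M lborel) (%(t, s). et t * (ind {..<t} s * f s))"
  by (rule ibd) (auto simp: indicator_def split_def)
 qed
 also have "... = (LL s. - (th s * f s))"
 proof (rule lcong[OF refl])
 fix s
 have "(LL t. et t * (ind {..<t} s * f s)) = (LL t. (ind {s<..} t * et t) * f s)"
  by (intro lcong refl) (auto simp: indicator_def)
 then show "(LL t. et t * (ind {..<t} s * f s)) = - (th s * f s)" by (simp add: th(4))
 qed
 also have "... = (LL t. iT T t * (frechet_derivative th (at t) 1 * g t))"
 using eq[OF th(1,3)] by simp
 also have "... = (LL t. et t * g t)"
 unfolding th(2) by (intro lcong refl) (use out in \<open>auto simp: indicator_def\<close>)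
 finally show "(LL t. et t * (g t - W t)) = 0" by (simp add: right_diff_distrib ig iW)
 qed
 then show ?thesis unfolding ball W_def by eventually_elim auto
qed

text \<open>The identity (W^2)' = 2 W W' in integrated form, for a primitive W of an integrable
  function: cut the square of pairs (s, r) below t along the diagonal and use Fubini and
  symmetry.\<close>

lemma primitive_square:
 fixes f :: "real => real"
 assumes f: "ilb f"
 shows "(LL s. ind {..<t} s * f s)^2 = 2 * (LL s. ind {..<t} s * (f s * (LL r. ind {..<s} r * f r)))"
proof -
 have [measurable]: "f : bm" using f by auto
 define g where "g s = ind {..<t} s * f s" for s
 have g: "ilb g" unfolding g_def
 by (rule ibd[OF f]) (auto simp: indicator_def)
 have [measurable]: "g : bm" using g by auto
 have gg: "integrable (lborel \<Otimes>\<^sub>M lborel) (%(s, r). g s * g (r + s *\<^sub>R 0))" by (rule integrable_shear[OF g g])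
 have P1: "integrable (lborel \<Otimes>\<^sub>M lborel) (%(s, r). g s * (ind {..<s} r * g r))"
 by (rule ibd[OF gg]) (auto simp: indicator_def split_def)
 have P2: "integrable (lborel \<Otimes>\<^sub>M lborel) (%(s, r). g s * (ind {..<r} s * g r))"
 by (rule ibd[OF gg]) (auto simp: indicator_def split_def)
 have i: "ilb (%r. ind {..<s} r * g r)" "ilb (%r. ind {..<r} s * g r)" for s
 by (rule ibd[OF g]; auto simp: indicator_def)+
 have split: "(LL r. g r) = (LL r. ind {..<s} r * g r) + (LL r. ind {..<r} s * g r)" for s
 proof -
 have "(LL r. g r) = (LL r. ind {..<s} r * g r + ind {..<r} s * g r)"
 by (rule integral_cong_AE) (use AE_lborel_singleton[of s] in \<open>auto simp: indicator_def elim!: eventually_mono\<close>)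
 then show ?thesis using i by simp
 qed
 have "(LL s. g s)^2 = (LL s. g s * (LL r. g r))" by (simp add: power2_eq_square)
 also have "... = (LL s. (LL r. g s * (ind {..<s} r * g r)) + (LL r. g s * (ind {..<r} s * g r)))"
 by (intro lcong refl) (subst split, simp add: distrib_left)
 also have "... = (LL s. (LL r. g s * (ind {..<s} r * g r))) + (LL s. (LL r. g s * (ind {..<r} s * g r)))"
 by (rule ladd[OF lborel_pair.integrable_fst[OF P1] lborel_pair.integrable_fst[OF P2]])
 also have "(LL s. (LL r. g s * (ind {..<r} s * g r))) = (LL r. (LL s. g s * (ind {..<r} s * g r)))"
 by (rule lborel_pair.Fubini_integral[OF P2, symmetric])
 also have "... = (LL s. (LL r. g s * (ind {..<s} r * g r)))"
 by (simp add: mult_ac)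
 finally have "(LL s. g s)^2 = 2 * (LL s. g s * (LL r. ind {..<s} r * g r))" by simp
 also have "(LL s. g s * (LL r. ind {..<s} r * g r)) = (LL s. ind {..<t} s * (f s * (LL r. ind {..<s} r * f r)))"
 proof (rule lcong[OF refl])
 fix s
 have "ind {..<s} r * g r = ind {..<s} r * f r" if "s < t" for r using that by (auto simp: indicator_def g_def)
 then have "(LL r. ind {..<s} r * g r) = (LL r. ind {..<s} r * f r)" if "s < t"
 using that by (simp only:)
 then show "g s * (LL r. ind {..<s} r * g r) = ind {..<t} s * (f s * (LL r. ind {..<s} r * f r))"
 by (cases "s < t") (simp_all add: g_def)
 qed
 finally show ?thesis unfolding g_def .
qed

text \<open>The same expression as \<open>static.F\<close>, outside that locale, so that it can be
  used with data depending on time.\<close>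

definition flux :: "('a::euclidean_space => real) => ('a => 'a) => ('a => real) => real => 'a => real" where
 "flux w b d e x = (LL y. w y * (d y * moll e (x - y) - b y \<bullet> grad (moll e) (x - y)))"

text \<open>\<open>evolution\<close> is the transport equation with initial value 0, tested with
  th(t) times the mollifier centred at x. It says that the mollified w has time derivative
  \<open>flux\<close>.\<close>

locale transported = field T b M for T and b :: "real => 'a::euclidean_space => 'a" and M +
 fixes d w :: "real => 'a => real" and K :: real
 assumes d_borel [measurable]: "(%(t, x). d t x) : bm2"
 and d_trace: "AL t. t : {0<..<T} --> (ALL G. (\<forall>j\<in>Basis. weak_grad (%x. b t x \<bullet> j) (G j)) --> (AL x. d t x = (\<Sum>i\<in>Basis. G i x \<bullet> i)))"
 and w_borel [measurable]: "(%(t, x). w t x) : bm2"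
 and w_bound: "!!t x. \<bar>w t x\<bar> <= K"
 and evolution: "!!e x th. e > 0 ==> smooth th ==> (\<exists>de>0. \<forall>t>T - de. th t = 0) ==>
 (LL t. iT T t * (frechet_derivative th (at t) 1 * conv (w t) (moll e) x))
 = - (LL t. th t * (iT T t * flux (w t) (b t) (d t) e x))"
begin

lemma K0: "K >= 0" using w_bound[of 0 0] by linarith

definition C :: real where
 "C = (SOME C. C >= 0 & (\<forall>e>0. (LL x. norm x * norm (grad (moll e) (x::'a))) <= C))"

lemma C: "C >= 0" "e > 0 ==> (LL x. norm x * norm (grad (moll e) (x::'a))) <= C"
proof -
 have "EX C. C >= 0 & (\<forall>e>0. (LL x. norm x * norm (grad (moll e) (x::'a))) <= C)" using grad_moll_bound by metis
 from someI_ex[OF this] show "C >= 0" "e > 0 ==> (LL x. norm x * norm (grad (moll e) (x::'a))) <= C" unfolding C_def by blast+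
qed

lemma w_slice [measurable]: "w t : bm"
 and d_slice [measurable]: "d t : bm"
 by measurable

lemma static_ae:
 "AL t. t : {0<..<T} --> (EX G. static (w t) (b t) G (d t) K C &
 (ALL k. (NN x. ennreal (ib (real k) x * (norm (b t x) + (\<Sum>j\<in>Basis. norm (G j x))))) <= M k t))"
 using gradients d_trace
proof eventually_elim
 case (elim t)
 show ?case
 proof
 assume t: "t : {0<..<T}"
 then obtain G where G: "\<forall>j\<in>Basis. weak_grad (%x. b t x \<bullet> j) (G j)"
 "ALL k. (NN x. ennreal (ib (real k) x * (norm (b t x) + (\<Sum>j\<in>Basis. norm (G j x))))) <= M k t" using elim by blast
 have "static (w t) (b t) G (d t) K C"
 by unfold_locales (use w_bound G elim t C in auto)
 then show "EX G. static (w t) (b t) G (d t) K C &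
 (ALL k. (NN x. ennreal (ib (real k) x * (norm (b t x) + (\<Sum>j\<in>Basis. norm (G j x))))) <= M k t)" using G(2) by blast
 qed
qed

section \<open>From the mollified to the renormalised equation\<close>

lemma flux_measurable [measurable]:
 "e > 0 ==> (%(t, x). flux (w t) (b t) (d t) e x) : bm2"
proof -
 assume e: "e > 0"
 note [measurable] = grad_moll_borel[OF e]
 show ?thesis unfolding flux_def by measurable
qed

lemma conv_measurable [measurable]:
 "(%(t, x). conv (w t) (moll e) x) : bm2"
 unfolding conv_def by measurable

text \<open>For fixed e the kernel and its gradient are bounded, and for x in a ball they only see b
  and d on a larger ball; one majorant in time serves all these x.\<close>

lemma flux_bound:
 assumes e: "e > 0"
 shows "EX c k. c >= 0 & (AL t. t : {0<..<T} --> (\<forall>x\<in>ball 0 r. ennreal \<bar>flux (w t) (b t) (d t) e x\<bar> <= ennreal c * M k t))"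
proof -
 obtain A where A: "A >= 0" "!!x. \<bar>moll e (x::'a)\<bar> <= A" "!!x. norm (grad (moll e) (x::'a)) <= A"
 using C1c_bounded[OF moll_C1c[OF e]] by metis
 obtain k :: nat where k: "r + e + 1 <= k" using real_arch_simple by blast
 have "AL t. t : {0<..<T} --> (\<forall>x\<in>ball 0 r. ennreal \<bar>flux (w t) (b t) (d t) e x\<bar> <= ennreal (K * A) * M k t)"
 using static_ae
 proof eventually_elim
 case (elim t)
 show ?case
 proof (intro impI ballI)
 fix x :: 'a assume t: "t : {0<..<T}" and x: "x : ball 0 r"
 obtain G where st: "static (w t) (b t) G (d t) K C"
  and G: "(NN x. ennreal (ib (real k) x * (norm (b t x) + (\<Sum>j\<in>Basis. norm (G j x))))) <= M k t" using elim t by blast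
 interpret st: static "w t" "b t" G "d t" K C by (rule st)
 let ?f = "%y. w t y * (d t y * moll e (x - y) - b t y \<bullet> grad (moll e) (x - y))"
 note [measurable] = st.G_borel
 have "ennreal \<bar>flux (w t) (b t) (d t) e x\<bar> <= (NN y. ennreal \<bar>?f y\<bar>)"
 proof (cases "ilb ?f")
  case True from integral_norm_bound_ennreal[OF this] show ?thesis by (simp add: flux_def)
 qed (simp add: flux_def not_integrable_integral_eq)
 also have "... <= (NN y. ennreal (K * A) * ennreal (ib (real k) y * (norm (b t y) + (\<Sum>j\<in>Basis. norm (G j y)))))"
 proof (rule nn_integral_mono_AE, use st.d_trace in eventually_elim)
  case (elim y)
  have dy: "\<bar>d t y\<bar> <= (\<Sum>i\<in>Basis. norm (G i y))" unfolding elim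
  by (rule order_trans[OF sum_abs sum_mono]) (simp add: Basis_le_norm)
  have "\<bar>?f y\<bar> <= K * A * (ib (real k) y * (norm (b t y) + (\<Sum>j\<in>Basis. norm (G j y))))"
  proof (cases "norm (x - y) <= e")
  case True
  then have y: "y : ball 0 (real k)" using x k norm_triangle_ineq4[of x "x - y"] by simp
  have "\<bar>d t y * moll e (x - y) - b t y \<bullet> grad (moll e) (x - y)\<bar> <= \<bar>d t y\<bar> * \<bar>moll e (x - y)\<bar> + norm (b t y) * norm (grad (moll e) (x - y))"
   using Cauchy_Schwarz_ineq2[of "b t y" "grad (moll e) (x - y)"] by (intro order_trans[OF abs_triangle_ineq4]) (simp add: abs_mult)
  also have "... <= (\<Sum>i\<in>Basis. norm (G i y)) * A + norm (b t y) * A"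
   by (intro add_mono mult_mono dy A) (auto simp: sum_nonneg)
  finally have "\<bar>w t y\<bar> * \<bar>d t y * moll e (x - y) - b t y \<bullet> grad (moll e) (x - y)\<bar> <= K * ((\<Sum>i\<in>Basis. norm (G i y)) * A + norm (b t y) * A)"
   by (intro mult_mono w_bound K0) auto
  moreover have "K * A * (ib (real k) y * (norm (b t y) + (\<Sum>j\<in>Basis. norm (G j y)))) = K * ((\<Sum>i\<in>Basis. norm (G i y)) * A + norm (b t y) * A)"
   using y by (simp add: algebra_simps)
  ultimately show ?thesis by (simp only: abs_mult)
  next
  case False
  then have "?f y = 0" by (simp add: moll_zero[OF e] grad_moll_zero[OF e])
  moreover have "0 <= K * A * (ib (real k) y * (norm (b t y) + (\<Sum>j\<in>Basis. norm (G j y))))"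
   by (intro mult_nonneg_nonneg add_nonneg_nonneg sum_nonneg K0 A) auto
  ultimately show ?thesis by (simp only: abs_zero)
  qed
  then show ?case using K0 A by (subst ennreal_mult'[symmetric]) (auto intro: ennreal_leI)
 qed
 also have "... = ennreal (K * A) * (NN y. ennreal (ib (real k) y * (norm (b t y) + (\<Sum>j\<in>Basis. norm (G j y)))))"
  by (rule nn_integral_cmult) measurable
 also have "... <= ennreal (K * A) * M k t" using G by (intro mult_left_mono) auto
 finally show "ennreal \<bar>flux (w t) (b t) (d t) e x\<bar> <= ennreal (K * A) * M k t" .
 qed
 qed
 then show ?thesis using K0 A by (intro exI[of _ "K * A"] exI[of _ k]) auto
qed

lemma M_dominated:
 assumes f: "f : bm" and c: "AL t. t : {0<..<T} --> ennreal \<bar>f t\<bar> <= ennreal c * M k t"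
 shows "ilb (%t. iT T t * f t)"
proof (rule integrableI_bounded)
 have "(NN t. ennreal (norm (iT T t * f t))) <= (NN t. ennreal c * (M k t * iT T t))"
 by (rule nn_integral_mono_AE) (use c in \<open>auto simp: indicator_def elim!: eventually_mono\<close>)
 also have "... = ennreal c * (\<integral>\<^sup>+t\<in>{0<..<T}. M k t \<partial>lborel)" by (rule nn_integral_cmult) measurable
 also have "... < \<infinity>" using M_fin by (simp add: ennreal_mult_less_top)
 finally show "(NN t. ennreal (norm (iT T t * f t))) < \<infinity>" .
qed (use f in measurable)

lemma flux_integrable:
 assumes e: "e > 0" shows "ilb (%t. iT T t * flux (w t) (b t) (d t) e x)"
proof -
 obtain c k where "AL t. t : {0<..<T} --> (\<forall>y\<in>ball 0 (norm x + 1). ennreal \<bar>flux (w t) (b t) (d t) e y\<bar> <= ennreal c * M k t)"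
 using flux_bound[OF e] by blast
 note [measurable] = flux_measurable[OF e]
 show ?thesis
 by (rule M_dominated[where c=c and k=k]) (measurable, use \<open>AL t. _\<close> in \<open>auto elim!: eventually_mono\<close>)
qed

text \<open>At a fixed point x the mollified w is a primitive in time of the flux, so its square is
  given by \<open>primitive_square\<close>.\<close>

lemma mollified_square:
 assumes e: "e > 0"
 shows "AL t. t : {0<..<T} --> (conv (w t) (moll e) x)^2
 = 2 * (LL s. ind {..<t} s * (iT T s * (flux (w s) (b s) (d s) e x * conv (w s) (moll e) x)))"
proof -
 let ?f = "%s. iT T s * flux (w s) (b s) (d s) e x"
 note [measurable] = flux_measurable[OF e]
 have [measurable]: "(%t. conv (w t) (moll e) x) : bm" by measurable
 have [measurable]: "(%t. flux (w t) (b t) (d t) e x) : bm" by measurable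
 have fm[measurable]: "?f : bm" by measurable
 have [measurable]: "(%s. LL r. ind {..<s} r * ?f r) : borel_measurable lborel" by measurable
 have tp: "AL t. t : {0<..<T} --> conv (w t) (moll e) x = (LL s. ind {..<t} s * ?f s)"
 by (rule time_primitive[OF T _ _ flux_integrable[OF e], where K=K])
 (use conv_moll_bound[OF w_bound e] evolution[OF e] in auto)
 have eq: "(LL s. ind {..<t} s * (?f s * (LL r. ind {..<s} r * ?f r)))
 = (LL s. ind {..<t} s * (iT T s * (flux (w s) (b s) (d s) e x * conv (w s) (moll e) x)))" for t
 by (rule integral_cong_AE) (measurable, use tp in \<open>auto simp: indicator_def elim!: eventually_mono\<close>)
 show ?thesis
 using tp by eventually_elim (use primitive_square[OF flux_integrable[OF e], of _ x] eq in auto)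
qed

lemma flux_static:
 assumes "static (w t) (b t) G (d t) K C"
 shows "static.F (w t) (b t) (d t) e x = flux (w t) (b t) (d t) e x"
 and "static.J (w t) (b t) (d t) e ph = 2 * (LL x. ph x * conv (w t) (moll e) x * flux (w t) (b t) (d t) e x)"
 by (simp_all add: static.F_def[OF assms] static.J_def[OF assms] flux_def)

definition energy_rate :: "real => ('a => real) => real => real" where
 "energy_rate e ph t = 2 * (LL x. ph x * conv (w t) (moll e) x * flux (w t) (b t) (d t) e x)"

text \<open>The identity for the square holds for every x outside a null set of times that depends
  on x. Exchanging the exceptional sets gives it for almost every t and almost every x, and Fubini
  integrates it against \<open>ph\<close>.\<close>

lemma mollified_energy:
 assumes ph: "C1c ph ph'" and e: "0 < e"
 shows "AL t. t : {0<..<T} --> (LL x. (conv (w t) (moll e) x)^2 * ph x)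
 = (LL s. ind {..<t} s * (iT T s * energy_rate e ph s))"
proof -
 note [measurable] = flux_measurable[OF e] C1_borel[OF C1c_C1[OF ph]]
 let ?H = "%t s x. ind {..<t} s * (iT T s * (flux (w s) (b s) (d s) e x * conv (w s) (moll e) x))"
 have [measurable]: "(%(t, x). LL s. ?H t s x) : borel_measurable (lborel \<Otimes>\<^sub>M lborel)" by measurable
 have [measurable]: "(%(t, x). conv (w t) (moll e) x) : borel_measurable (lborel \<Otimes>\<^sub>M lborel)" unfolding conv_def by measurable
 have sets: "{z : space (lborel \<Otimes>\<^sub>M lborel). fst z : {0<..<T} --> (conv (w (fst z)) (moll e) (snd z))^2 = 2 * (LL s. ?H (fst z) s (snd z))}
 : sets (lborel \<Otimes>\<^sub>M (lborel :: 'a measure))" by measurable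
 have "AL x. AL t. t : {0<..<T} --> (conv (w t) (moll e) x)^2 = 2 * (LL s. ?H t s x)"
 by (rule AE_I2) (rule mollified_square[OF e])
 then have "AL t. AL x. t : {0<..<T} --> (conv (w t) (moll e) x)^2 = 2 * (LL s. ?H t s x)"
 by (rule lborel_pair.AE_commute[of "%t x. t : {0<..<T} --> (conv (w t) (moll e) x)^2 = 2 * (LL s. ?H t s x)", THEN iffD2, OF sets])
 then show ?thesis
 proof eventually_elim
 case (elim t)
 show ?case
 proof
 assume t: "t : {0<..<T}"
 obtain r where r: "!!x. norm x >= r ==> ph x = 0" using C1c_support[OF ph] by metis
 obtain c k where c: "c >= 0" "AL t. t : {0<..<T} --> (\<forall>x\<in>ball 0 r. ennreal \<bar>flux (w t) (b t) (d t) e x\<bar> <= ennreal c * M k t)"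
  using flux_bound[OF e] by blast
 have int: "integrable (lborel \<Otimes>\<^sub>M lborel) (%(s, x). ph x * ?H t s x)"
 proof (rule integrableI_bounded)
  show "(%(s, x). ph x * ?H t s x) : borel_measurable (lborel \<Otimes>\<^sub>M lborel)" by measurable
  have "(\<integral>\<^sup>+z. ennreal (norm (case z of (s, x) => ph x * ?H t s x)) \<partial>(lborel \<Otimes>\<^sub>M lborel))
  = (NN s. \<integral>\<^sup>+x. ennreal (norm (ph x * ?H t s x)) \<partial>lborel)"
  by (subst lborel.nn_integral_fst[symmetric]) auto
  also have "... <= (NN s. (M k s * iT T s) * (ennreal (K * c) * (NN x. ennreal \<bar>ph x\<bar>)))"
  proof (rule nn_integral_mono_AE, use c(2) in eventually_elim)
  case (elim s)
  have "ennreal (norm (ph x * ?H t s x)) <= ((M k s * iT T s) * ennreal (K * c)) * ennreal \<bar>ph x\<bar>" for x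
  proof (cases "s : {0<..<T} & norm x < r")
   case True
   have "norm (ph x * ?H t s x) <= \<bar>ph x\<bar> * (\<bar>flux (w s) (b s) (d s) e x\<bar> * K)"
   unfolding real_norm_def abs_mult
   proof (rule mult_left_mono)
   have "\<bar>indicat_real {..<t} s\<bar> * (\<bar>indicat_real {0<..<T} s\<bar> * (\<bar>flux (w s) (b s) (d s) e x\<bar> * \<bar>conv (w s) (moll e) x\<bar>)) <= 1 * (1 * (\<bar>flux (w s) (b s) (d s) e x\<bar> * K))"
    by (intro mult_mono conv_moll_bound[OF w_bound e]) (auto simp: indicator_def K0)
   then show "\<bar>indicat_real {..<t} s\<bar> * (\<bar>indicat_real {0<..<T} s\<bar> * (\<bar>flux (w s) (b s) (d s) e x\<bar> * \<bar>conv (w s) (moll e) x\<bar>)) <= \<bar>flux (w s) (b s) (d s) e x\<bar> * K" by simp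
   qed simp
   then have "ennreal (norm (ph x * ?H t s x)) <= ennreal (\<bar>ph x\<bar> * (\<bar>flux (w s) (b s) (d s) e x\<bar> * K))" by (rule ennreal_leI)
   also have "... = ennreal \<bar>ph x\<bar> * (ennreal \<bar>flux (w s) (b s) (d s) e x\<bar> * ennreal K)"
   using K0 by (simp add: ennreal_mult)
   also have "... <= ennreal \<bar>ph x\<bar> * ((ennreal c * M k s) * ennreal K)"
   using elim True by (intro mult_left_mono mult_right_mono) auto
   also have "... = ((M k s * iT T s) * ennreal (K * c)) * ennreal \<bar>ph x\<bar>"
   using True K0 c(1) by (simp add: ennreal_mult mult_ac)
   finally show ?thesis .
  next
   case False then show ?thesis using r[of x] by auto
  qed
  then have "(NN x. ennreal (norm (ph x * ?H t s x))) <= (NN x. ((M k s * iT T s) * ennreal (K * c)) * ennreal \<bar>ph x\<bar>)"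
   by (rule nn_integral_mono)
  also have "... = ((M k s * iT T s) * ennreal (K * c)) * (NN x. ennreal \<bar>ph x\<bar>)"
   by (rule nn_integral_cmult) measurable
  finally show ?case by (simp add: mult.assoc)
  qed
  also have "... = (\<integral>\<^sup>+s\<in>{0<..<T}. M k s \<partial>lborel) * (ennreal (K * c) * (NN x. ennreal \<bar>ph x\<bar>))"
  by (rule nn_integral_multc) measurable
  also have "... < \<infinity>"
  using M_fin C1c_integrable(1)[OF ph] by (simp add: ennreal_mult_less_top integrable_iff_bounded)
  finally show "(\<integral>\<^sup>+z. ennreal (norm (case z of (s, x) => ph x * ?H t s x)) \<partial>(lborel \<Otimes>\<^sub>M lborel)) < \<infinity>" .
 qed
 have "(LL x. (conv (w t) (moll e) x)^2 * ph x) = (LL x. 2 * (LL s. ph x * ?H t s x))"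
  by (rule integral_cong_AE) (measurable, use elim t in \<open>auto elim!: eventually_mono\<close>)
 also have "... = 2 * (LL s. (LL x. ph x * ?H t s x))"
  using lborel_pair.Fubini_integral[OF int] by simp
 also have "... = (LL s. ind {..<t} s * (iT T s * energy_rate e ph s))"
 proof -
  have "(LL x. ph x * ?H t s x) = ind {..<t} s * (iT T s * (LL x. ph x * conv (w s) (moll e) x * flux (w s) (b s) (d s) e x))" for s
  by (simp add: integral_mult_right_zero[symmetric] mult_ac del: integral_mult_right_zero integral_mult_left_zero)
  then have "2 * (LL x. ph x * ?H t s x) = ind {..<t} s * (iT T s * energy_rate e ph s)" for s
  by (simp add: energy_rate_def)
  then show ?thesis by (simp only: integral_mult_right_zero[symmetric])
 qed
 finally show "(LL x. (conv (w t) (moll e) x)^2 * ph x) = (LL s. ind {..<t} s * (iT T s * energy_rate e ph s))" .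
 qed
 qed
qed

text \<open>Along e = 1/(n+1) the rates converge for almost every time by \<open>J_limit\<close>,
  with the majorant of \<open>J_bound\<close>. So w^2 satisfies the weak transport equation tested
  with \<open>ph\<close>.\<close>

lemma renormalized:
 assumes ph: "C1c ph ph'"
 shows "AL t. t : {0<..<T} --> (LL x. (w t x)^2 * ph x)
 = (LL s. ind {..<t} s * (iT T s * (LL x. (w s x)^2 * (ph x * d s x + ph' x \<bullet> b s x))))"
proof -
 note [measurable] = C1_borel[OF C1c_C1[OF ph]]
 obtain r where r: "r > 0" "!!x. norm x >= r ==> ph x = 0" "!!x. norm x >= r ==> ph' x = 0" using C1c_support[OF ph] by metis
 obtain A where A: "A >= 0" "!!x. \<bar>ph x\<bar> <= A" "!!x. norm (ph' x) <= A" using C1c_bounded[OF ph] by metis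
 obtain k :: nat where k: "r + 1 <= k" using real_arch_simple by blast
 define E where "E n = 1 / real (Suc n)" for n
 have E: "E n > 0" "E n <= 1" for n by (auto simp: E_def)
 have Elim: "EX N. \<forall>n\<ge>N. E n <= e0" if e0: "e0 > 0" for e0
 proof -
 obtain N :: nat where "1 / Suc N < e0" using reals_Archimedean[OF e0] by (auto simp: inverse_eq_divide)
 then show ?thesis unfolding E_def by (intro exI[of _ N]) (auto intro!: order_trans[OF _ less_imp_le[OF \<open>1 / Suc N < e0\<close>]] simp: frac_le)
 qed
 define c where "c = A * (K\<^sup>2 + 2 * K * (K * (1 + C) * (2 + DIM('a))))"
 define L where "L s = (LL x. (w s x)^2 * (ph x * d s x + ph' x \<bullet> b s x))" for s
 have Lm[measurable]: "L : bm"
 proof -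
 have "L : borel_measurable lborel" unfolding L_def by measurable
 then show ?thesis by simp
 qed
 have Rm[measurable]: "energy_rate (E n) ph : bm" for n
 proof -
 note [measurable] = flux_measurable[OF E(1)[of n]]
 have "energy_rate (E n) ph : borel_measurable lborel" unfolding energy_rate_def[abs_def] by measurable
 then show ?thesis by simp
 qed
 have finM: "AL t. t : {0<..<T} --> M k t ~= \<infinity>"
 proof -
 have "AL t. M k t * iT T t ~= \<infinity>"
 using M_fin[of k] by (intro nn_integral_noteq_infinite) auto
 then show ?thesis by eventually_elim (auto simp: indicator_def split: if_splits)
 qed
 \<comment> \<open>The majorant has to be real-valued; \<open>M k t\<close> is finite for almost
   every t in (0,T).\<close>
 define g where "g t = enn2real (ennreal c * M k t)" for t
 have gm[measurable]: "g : bm" unfolding g_def by measurable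
 have gi: "ilb (%t. iT T t * g t)"
 proof (rule M_dominated[where c=c and k=k, OF gm])
 show "AL t. t : {0<..<T} --> ennreal \<bar>g t\<bar> <= ennreal c * M k t"
 using finM by eventually_elim (auto simp: g_def ennreal_mult_less_top less_top intro!: eq_refl ennreal_enn2real)
 qed
 have rate: "AL s. s : {0<..<T} --> (ALL n. \<bar>energy_rate (E n) ph s\<bar> <= g s) & (%n. energy_rate (E n) ph s) \<longlonglongrightarrow> L s"
 using static_ae finM
 proof eventually_elim
 case (elim s)
 show ?case
 proof
 assume s: "s : {0<..<T}"
 then obtain G where st: "static (w s) (b s) G (d s) K C"
  and G: "(NN x. ennreal (ib (real k) x * (norm (b s x) + (\<Sum>j\<in>Basis. norm (G j x))))) <= M k s" using elim by blast
 interpret st: static "w s" "b s" G "d s" K C by (rule st)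
 have J: "energy_rate e ph s = st.J e ph" for e by (simp add: energy_rate_def flux_static(2)[OF st])
 have fin: "ennreal c * M k s < \<infinity>" using elim s by (simp add: ennreal_mult_less_top less_top)
 have "\<bar>energy_rate (E n) ph s\<bar> <= g s" for n
 proof -
  \<comment> \<open>With radius k - 1 the enlarged ball of \<open>J_bound\<close> is the one that
    \<open>M k\<close> controls.\<close>
  have "ennreal \<bar>energy_rate (E n) ph s\<bar> <= ennreal c * (NN x. ennreal (ind (ball 0 ((real k - 1) + 1)) x * (norm (b s x) + (\<Sum>i\<in>Basis. norm (G i x)))))"
  unfolding J c_def by (rule st.J_bound[OF ph E]) (use A r k in auto)
  also have "... <= ennreal c * M k s" using G by (intro mult_left_mono) auto
  also have "... = ennreal (g s)" unfolding g_def using fin by (simp add: less_top)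
  finally show ?thesis by (simp add: g_def)
 qed
 moreover have "(%n. energy_rate (E n) ph s) \<longlonglongrightarrow> L s"
 proof (rule LIMSEQ_I)
  fix de :: real assume "de > 0"
  then obtain e0 where e0: "e0 > 0" "!!e. 0 < e ==> e <= e0 ==> \<bar>st.J e ph - L s\<bar> <= de / 2"
  using st.J_limit[OF ph, of "de / 2"] unfolding L_def by auto
  obtain N where "!!n. n >= N ==> E n <= e0" using Elim[OF e0(1)] by blast
  then show "EX N. \<forall>n\<ge>N. norm (energy_rate (E n) ph s - L s) < de"
  unfolding J using e0(2)[OF E(1)] \<open>de > 0\<close> by (intro exI[of _ N]) force
 qed
 ultimately show "(ALL n. \<bar>energy_rate (E n) ph s\<bar> <= g s) & (%n. energy_rate (E n) ph s) \<longlonglongrightarrow> L s" by blast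
 qed
 qed
 have "AL t. ALL n. t : {0<..<T} --> (LL x. (conv (w t) (moll (E n)) x)^2 * ph x)
 = (LL s. ind {..<t} s * (iT T s * energy_rate (E n) ph s))"
 unfolding AE_all_countable by (intro allI mollified_energy[OF ph E(1)])
 then show ?thesis
 proof eventually_elim
 case (elim t)
 show ?case
 proof
 assume t: "t : {0<..<T}"
 have "(%n. LL x. (conv (w t) (moll (E n)) x)^2 * ph x) \<longlonglongrightarrow> (LL x. (w t x)^2 * ph x)"
 proof (rule LIMSEQ_I)
  fix de :: real assume "de > 0"
  then obtain e0 where e0: "e0 > 0" "!!e. 0 < e ==> e <= e0 ==>
  \<bar>(LL x. (conv (w t) (moll e) x)^2 * ph x) - (LL x. (w t x)^2 * ph x)\<bar> <= de / 2"
  using mollified_square_limit[OF w_slice[of t] w_bound[of t] C1c_integrable(1)[OF ph], of r "de / 2"] r(2) by auto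
  obtain N where "!!n. n >= N ==> E n <= e0" using Elim[OF e0(1)] by blast
  then show "EX N. \<forall>n\<ge>N. norm ((LL x. (conv (w t) (moll (E n)) x)^2 * ph x) - (LL x. (w t x)^2 * ph x)) < de"
  using e0(2)[OF E(1)] \<open>de > 0\<close> by (intro exI[of _ N]) force
 qed
 moreover have "(%n. LL s. ind {..<t} s * (iT T s * energy_rate (E n) ph s))
  \<longlonglongrightarrow> (LL s. ind {..<t} s * (iT T s * L s))"
 proof (rule ldct[OF _ _ gi])
  show "AL s. (%n. ind {..<t} s * (iT T s * energy_rate (E n) ph s)) \<longlonglongrightarrow> ind {..<t} s * (iT T s * L s)"
  using rate by eventually_elim (auto simp: indicator_def intro!: tendsto_intros)
  show "AL s. norm (ind {..<t} s * (iT T s * energy_rate (E n) ph s)) <= iT T s * g s" for n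
  using rate by eventually_elim (auto simp: indicator_def g_def)
 qed measurable
 ultimately show "(LL x. (w t x)^2 * ph x)
  = (LL s. ind {..<t} s * (iT T s * (LL x. (w s x)^2 * (ph x * d s x + ph' x \<bullet> b s x))))"
  using elim t LIMSEQ_unique unfolding L_def by auto
 qed
 qed
qed

end

section \<open>The Orlicz function and an Osgood lemma\<close>

text \<open>Applied to x = ln y, as (ln y)^2 <= y.\<close>

lemma square_le_exp: assumes "x >= 0" shows "x\<^sup>2 <= exp (x::real)"
proof -
 have "x <= 1 + x / 2 + (x / 2)^2 / 2"
 using zero_le_power2[of "x - 2"] by (simp add: power2_eq_square field_simps)
 also have "... <= exp (x / 2)" by (rule exp_lower_Taylor_quadratic) (use assms in simp)
 finally have "x * x <= exp (x / 2) * exp (x / 2)" using assms by (intro mult_mono) auto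
 then show ?thesis by (simp add: power2_eq_square exp_add[symmetric])
qed

text \<open>Logarithmic form of the fact that r exp(-r / ln r) decreases for r >= e^2. The sign of
  the derivative amounts to (ln x)^2 <= x (ln x - 1), which holds as ln x >= 2 there.\<close>

lemma orlicz_decay:
 assumes "exp 2 <= s" "s <= r"
 shows "ln r - r / ln r <= ln s - s / ln (s::real)"
proof (rule DERIV_nonpos_imp_nonincreasing[OF assms(2), of "%r. ln r - r / ln r"])
 fix x assume "s <= x" "x <= r"
 then have x: "x >= exp 2" using assms by simp
 then have x0: "x > 0" using exp_gt_zero[of "2::real"] by linarith
 have l: "ln x >= 2" using x x0 by (simp add: ln_ge_iff)
 have d: "((%r. ln r - r / ln r) has_real_derivative (1 / x - (ln x - 1) / (ln x)^2)) (at x)"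
 using x0 l by (auto intro!: derivative_eq_intros simp: power2_eq_square field_simps)
 have "(ln x)^2 <= exp (ln x)" by (rule square_le_exp) (use l in linarith)
 then have "(ln x)^2 <= x" using x0 by simp
 also have "x <= x * (ln x - 1)" using mult_left_mono[of 1 "ln x - 1" x] l x0 by simp
 finally have "(ln x)^2 / x <= ln x - 1" using x0 by (simp add: pos_divide_le_eq mult.commute)
 then have "((ln x)^2 / x) / (ln x)^2 <= (ln x - 1) / (ln x)^2" by (rule divide_right_mono) simp
 moreover have "((ln x)^2 / x) / (ln x)^2 = 1 / x" using l by simp
 ultimately have "1 / x <= (ln x - 1) / (ln x)^2" by simp
 then show "EX y. ((%r. ln r - r / ln r) has_real_derivative y) (at x) & y <= 0"
 using d by (intro exI conjI) auto
qed

text \<open>For r > s write r as r exp(-r / ln r) times exp(r / ln r). The first factor is at most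
  its value at s, and the second is at most 2 P(r), because it is at least 2.\<close>

lemma orlicz_young:
 assumes s: "exp 2 <= s" and r: "0 <= r"
 shows "r <= s + 2 * s * exp (- (s / ln s)) * orlicz_P r"
proof -
 have s0: "s > 0" using s exp_gt_zero[of "2::real"] by linarith
 have P0: "orlicz_P r >= 0" unfolding orlicz_P_def log_plus_def using r by simp
 show ?thesis
 proof (cases "r <= s")
 case True
 then show ?thesis using s0 P0 by (simp add: add_increasing2)
 next
 case False
 then have rs: "s <= r" by simp
 then have r0: "r > 0" using s0 by simp
 have l: "ln r >= 2" using s rs r0 by (simp add: ln_ge_iff)
 have lp: "log_plus r = ln r" using l by (simp add: log_plus_def)
 have "(ln r)^2 <= exp (ln r)" by (rule square_le_exp) (use l in linarith)
 then have "(ln r)^2 <= r" using r0 by simp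
 then have q: "ln r <= r / ln r" using l by (simp add: field_simps power2_eq_square)
 have "exp 1 >= (2::real)" using exp_ge_add_one_self[of 1] by simp
 moreover have "exp 1 <= exp (r / ln r)"
 proof -
 have "1 <= r / ln r" using q l by linarith
 then show ?thesis by (simp only: exp_le_cancel_iff)
 qed
 ultimately have "2 <= exp (r / ln r)" by (rule order_trans)
 then have P: "exp (r / ln r) <= 2 * orlicz_P r" by (simp add: orlicz_P_def lp)
 have "r = exp (ln r - r / ln r) * exp (r / ln r)" using r0 by (simp add: exp_add[symmetric])
 also have "... <= exp (ln s - s / ln s) * (2 * orlicz_P r)"
 using orlicz_decay[OF s rs] P by (intro mult_mono) auto
 also have "... = 2 * s * exp (- (s / ln s)) * orlicz_P r" using s0 by (simp add: exp_diff exp_minus field_simps)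
 finally show ?thesis using s0 by simp
 qed
qed

text \<open>\<open>log_plus\<close> equals 1 up to e, and r / ln r increases from e on, with the
  common value e at the junction.\<close>

lemma orlicz_P_mono:
 assumes "0 <= r" "r <= s" shows "orlicz_P r <= orlicz_P s"
proof -
 have "r / log_plus r <= s / log_plus s"
 proof (cases "ln s <= 1 \<or> s = 0")
 case True
 then have s1: "log_plus s = 1" by (auto simp: log_plus_def)
 have "r / log_plus r <= r / 1" using assms by (intro divide_left_mono) (auto simp: log_plus_def)
 then show ?thesis using assms s1 by simp
 next
 case False
 then have s: "ln s > 1" "s > 0" using assms by auto
 have es: "exp 1 < s" using s by (metis exp_less_cancel_iff exp_ln)
 have mono: "u / ln u <= v / ln v" if "exp 1 <= u" "u <= v" for u v :: real
 proof (rule DERIV_nonneg_imp_nondecreasing[OF that(2), of "%r. r / ln r"])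
 fix x assume "u <= x" "x <= v"
 then have x: "x >= exp 1" using that by simp
 then have x0: "x > 0" using exp_gt_zero[of "1::real"] by linarith
 have l: "ln x >= 1" using x x0 by (simp add: ln_ge_iff)
 have "((%r. r / ln r) has_real_derivative ((ln x - 1) / (ln x)^2)) (at x)"
  using x0 l by (auto intro!: derivative_eq_intros simp: power2_eq_square field_simps)
 then show "EX y. ((%r. r / ln r) has_real_derivative y) (at x) & y >= 0" using l by (intro exI conjI) auto
 qed
 show ?thesis
 proof (cases "r <= exp 1")
 case True
 have "r / log_plus r <= r / 1" using assms by (intro divide_left_mono) (auto simp: log_plus_def)
 also have "... <= exp 1 / ln (exp 1)" using True by simp
 also have "... <= s / ln s" using es by (intro mono) auto
 finally show ?thesis using s by (simp add: log_plus_def)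
 next
 case False
 then have r0: "r > 0" using exp_gt_zero[of "1::real"] by linarith
 then have "ln r >= 1" using False by (simp add: ln_ge_iff)
 then show ?thesis using mono[of r s] False assms s by (simp add: log_plus_def)
 qed
 qed
 then show ?thesis by (simp add: orlicz_P_def)
qed

section \<open>Levels with divergent sum of reciprocals, and the Osgood argument\<close>

definition level :: "nat => real" where
 "level j = 2 * (real j + 5) * ln (real j + 5)"

text \<open>With x = j + 5, from 2 ln x <= x one gets 2 x ln x <= x^2, hence the logarithm of the
  level is at most 2 ln x and its quotient is at least x. The shift by 5 puts every level above
  e^2.\<close>

lemma level: "exp 2 <= level j" "real j <= level j / ln (level j)" "level j > 0"
proof -
 let ?x = "real j + 5"
 have l1: "ln ?x >= 1"
 proof -
 have "exp 1 <= ?x" using e_less_272 by (simp add: order_trans[OF less_imp_le])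
 then show ?thesis by (simp add: ln_ge_iff)
 qed
 have e2: "exp 2 <= (10::real)"
 proof -
 have "exp 2 = exp 1 * exp (1::real)" by (simp add: exp_add[symmetric])
 also have "... <= 3 * 3" using e_less_272 by (intro mult_mono) auto
 finally show ?thesis by simp
 qed
 have "10 * 1 <= (2 * ?x) * ln ?x" using l1 by (intro mult_mono) auto
 then show e: "exp 2 <= level j" using e2 unfolding level_def by linarith
 then show p: "level j > 0" using exp_gt_zero[of "2::real"] by linarith
 have "2 * ln ?x <= ?x"
 proof -
 have "2 * ln ?x <= (ln ?x)^2 / 2 + 2" using zero_le_power2[of "ln ?x - 2"] by (simp add: power2_eq_square field_simps)
 also have "... <= ?x / 2 + 2"
 proof -
 have "(ln ?x)^2 <= exp (ln ?x)" by (rule square_le_exp) (use l1 in linarith)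
 then show ?thesis by simp
 qed
 also have "?x / 2 + 2 <= ?x" by simp
 finally show ?thesis .
 qed
 moreover have y: "2 * y * l <= y * y" if "2 * l <= y" "y >= 0" for y l :: real
 using mult_left_mono[OF that] by (simp add: mult_ac)
 ultimately have "level j <= ?x * ?x" unfolding level_def by (intro y) auto
 then have "ln (level j) <= ln (?x * ?x)" using p by (intro ln_mono) auto
 also have "... = 2 * ln ?x" by (subst ln_mult) auto
 finally have le: "ln (level j) <= 2 * ln ?x" .
 have lp: "ln (level j) > 0" using e by (intro ln_gt_zero) (smt (verit) exp_ge_add_one_self)
 have "real j * ln (level j) <= ?x * (2 * ln ?x)" using le lp by (intro mult_mono) auto
 then show "real j <= level j / ln (level j)" using lp by (simp add: field_simps level_def)
qed

text \<open>Telescoping: the increment of ln ln x from x to x + 1 is at most 1 / (x ln x) = 2 /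
  level, by applying ln y <= y - 1 twice.\<close>

lemma sum_level:
 assumes "k <= N"
 shows "(ln (ln (real N + 5)) - ln (ln (real k + 5))) / 2 <= (\<Sum>j=k..<N. 1 / level j)"
proof -
 have step: "ln (ln (real (Suc j) + 5)) - ln (ln (real j + 5)) <= 2 * (1 / level j)" for j
 proof -
 let ?x = "real j + 5"
 have l1: "ln ?x > 0" "ln (?x + 1) > 0" by auto
 have "ln (ln (?x + 1)) - ln (ln ?x) = ln (ln (?x + 1) / ln ?x)" using l1 by (simp add: ln_div)
 also have "... <= ln (?x + 1) / ln ?x - 1" using l1 by (intro ln_le_minus_one) auto
 also have "... = (ln (?x + 1) - ln ?x) / ln ?x" using l1 by (simp add: diff_divide_distrib)
 also have "ln (?x + 1) - ln ?x = ln ((?x + 1) / ?x)" by (subst ln_div) auto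
 also have "... / ln ?x <= ((?x + 1) / ?x - 1) / ln ?x" using l1 by (intro divide_right_mono ln_le_minus_one) auto
 also have "(?x + 1) / ?x - 1 = 1 / ?x" by (simp add: field_simps)
 also have "1 / ?x / ln ?x = 2 * (1 / level j)"
 proof -
 have "1 / y / l = 2 * (1 / (2 * y * l))" for y l :: real by simp
 then show ?thesis unfolding level_def .
 qed
 finally show ?thesis by (simp add: add_ac)
 qed
 have "ln (ln (real N + 5)) - ln (ln (real k + 5)) = (\<Sum>j=k..<N. ln (ln (real (Suc j) + 5)) - ln (ln (real j + 5)))"
 using sum_Suc_diff'[OF assms, of "%j. ln (ln (real j + 5))"] by simp
 also have "... <= (\<Sum>j=k..<N. 2 * (1 / level j))" by (intro sum_mono step)
 also have "... = 2 * (\<Sum>j=k..<N. 1 / level j)" by (simp add: sum_distrib_left)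
 finally show ?thesis by simp
qed

lemma lnln_unbounded: "\<exists>N::nat. N >= k & B < ln (ln (real N + 5))"
proof -
 obtain N :: nat where N: "exp (exp B) + k < real N" using reals_Archimedean2 by blast
 then have "exp (exp B) < real N + 5" by linarith
 then have "exp B < ln (real N + 5)" by (metis exp_gt_zero exp_less_cancel_iff exp_ln less_trans)
 then have "B < ln (ln (real N + 5))" by (metis exp_gt_zero exp_less_cancel_iff exp_ln less_trans)
 moreover have "real k <= real N" using N exp_gt_zero[of "exp B"] by linarith
 ultimately show ?thesis by auto
qed

lemma primitive_continuous:
 fixes f :: "real => real"
 assumes f: "ilb f"
 shows "continuous_on UNIV (%t. LL s. ind {..<t} s * f s)"
proof (rule continuous_at_imp_continuous_on, rule ballI, rule continuous_at_sequentially[THEN iffD2], intro allI impI)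
 fix t :: real and u :: "nat => real" assume u: "u \<longlonglongrightarrow> t"
 have [measurable]: "f : bm" using f by auto
 show "((%t. LL s. ind {..<t} s * f s) \<circ> u) \<longlonglongrightarrow> (LL s. ind {..<t} s * f s)"
 unfolding comp_def
 proof (rule ldct[OF _ _ integrable_norm[OF f]])
 show "AL s. (%n. ind {..<u n} s * f s) \<longlonglongrightarrow> ind {..<t} s * f s"
 using AE_lborel_singleton[of t]
 proof eventually_elim
 case (elim s)
 have "\<forall>\<^sub>F n in sequentially. ind {..<u n} s * f s = ind {..<t} s * f s"
 proof (cases "s < t")
  case True
  then have "\<forall>\<^sub>F n in sequentially. s < u n" using u by (rule order_tendstoD(1)[rotated])
  then show ?thesis by (rule eventually_mono) (use True in simp)
 next
  case False
  then have "t < s" using elim by simp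
  then have "\<forall>\<^sub>F n in sequentially. u n < s" using u by (rule order_tendstoD(2)[rotated])
  then show ?thesis by (rule eventually_mono) (use False in simp)
 qed
 then show ?case by (rule tendsto_eventually)
 qed
 qed (auto simp: indicator_def)
qed

text \<open>The bound z of Y is continuous, nondecreasing and starts at exp(-N). If it exceeded
  exp(-k), it would pass all levels exp(-j) for j from N down to k, and the integral of a used up on
  the way would contradict \<open>big\<close>. A finite N replaces the divergent series.\<close>

lemma osgood:
 fixes a H Y :: "real => real"
 assumes a: "ilb a" "!!s. a s >= 0"
 and H: "ilb H" "!!s. H s >= 0" "!!s. s \<notin> {0<..<T} ==> H s = 0"
 and T: "T > 0"
 and Y: "AL t. t : {0<..<T} --> Y t <= exp (- real N) + (LL s. ind {..<t} s * H s)"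
 and Hb: "AL s. s : {0<..<T} --> (\<forall>si\<ge>exp 2. H s <= a s * (si * Y s + si * exp (- (si / ln si))))"
 and kN: "k <= N" and big: "(LL s. a s) < (1 - exp (- 1)) / 4 * (ln (ln (real N + 5)) - ln (ln (real k + 5)))"
 shows "AL t. t : {0<..<T} --> Y t <= exp (- real k)"
proof -
 define z where "z t = exp (- real N) + (LL s. ind {..<t} s * H s)" for t
 define A where "A t = (LL s. ind {..<t} s * a s)" for t
 have iH: "ilb (%s. ind {..<t} s * H s)" and ia: "ilb (%s. ind {..<t} s * a s)" for t
 by (rule ibd[OF H(1)] ibd[OF a(1)];
  use H a in \<open>auto simp: indicator_def\<close>)+
 have zc: "continuous_on {0..T} z" unfolding z_def
 by (intro continuous_intros continuous_on_subset[OF primitive_continuous[OF H(1)]]) auto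
 have zm: "z s <= z t" if "s <= t" for s t
 unfolding z_def by (intro add_left_mono integral_mono iH) (use that H(2) in \<open>auto simp: indicator_def\<close>)
 have z0: "z 0 = exp (- real N)"
 proof -
 have "(%s. ind {..<0} s * H s) = (%s. 0)" using H(3) by (auto simp: indicator_def)
 then show ?thesis by (simp add: z_def)
 qed
 have "z T <= exp (- real k)"
 proof (rule ccontr)
 assume zT: "~ z T <= exp (- real k)"
 have "ALL j. EX t. k <= j & j <= N --> 0 <= t & t <= T & z t = exp (- real j)"
 proof
 fix j
 show "EX t. k <= j & j <= N --> 0 <= t & t <= T & z t = exp (- real j)"
 proof (cases "k <= j & j <= N")
  case True
  then have "exp (- real j) <= exp (- real k)" by simp
  then have "exp (- real j) <= z T" using zT by linarith
  moreover have "z 0 <= exp (- real j)" using True by (simp add: z0)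
  ultimately show ?thesis using IVT'[of z 0 "exp (- real j)" T] zc T by auto
 qed auto
 qed
 from choice[OF this] obtain ta where ta: "!!j. k <= j ==> j <= N ==> 0 <= ta j & ta j <= T & z (ta j) = exp (- real j)" by blast
 \<comment> \<open>While z lies between exp(-j-1) and exp(-j), the choice si =
   \<open>level j\<close> bounds H by 2 a level exp(-j), but z grows by (1 - 1/e) exp(-j). The other
   factor 1/2 in \<open>big\<close> comes from \<open>sum_level\<close>.\<close>
 have step: "(1 - exp (- 1)) / 2 * (1 / level j) <= A (ta j) - A (ta (Suc j))" if j: "k <= j" "j < N" for j
 proof -
 have t1: "0 <= ta j" "ta j <= T" "z (ta j) = exp (- real j)" "z (ta (Suc j)) = exp (- real (Suc j))"
  using ta[of j] ta[of "Suc j"] j by auto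
 have le: "ta (Suc j) <= ta j"
 proof (rule ccontr)
  assume "~ ta (Suc j) <= ta j"
  then have "z (ta j) <= z (ta (Suc j))" by (intro zm) simp
  then show False using t1 by simp
 qed
 let ?I = "%s. indicat_real {..<ta j} s - indicat_real {..<ta (Suc j)} s"
 have I: "?I s >= 0" for s using le by (auto simp: indicator_def)
 have "exp (- real j) - exp (- real (Suc j)) = (LL s. ?I s * H s)"
  using t1(3,4) by (simp add: z_def left_diff_distrib iH)
 also have "... <= (LL s. ?I s * (2 * level j * exp (- real j) * a s))"
 proof (rule integral_mono_AE)
  show "ilb (%s. ?I s * H s)" by (simp add: left_diff_distrib iH)
  have "ilb (%s. (2 * level j * exp (- real j)) * (ind {..<ta j} s * a s - ind {..<ta (Suc j)} s * a s))"
  by (intro imr idiff ia)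
  then show "ilb (%s. ?I s * (2 * level j * exp (- real j) * a s))" by (simp add: algebra_simps)
  show "AL s. ?I s * H s <= ?I s * (2 * level j * exp (- real j) * a s)"
  using Y Hb
  proof eventually_elim
  case (elim s)
  show ?case
  proof (cases "s : {0<..<T} & s < ta j")
   case True
   then have "Y s <= z s" using elim by (simp add: z_def)
   also have "... <= exp (- real j)" using zm[of s "ta j"] True t1(3) by simp
   finally have Ys: "Y s <= exp (- real j)" .
   have "H s <= a s * (level j * Y s + level j * exp (- (level j / ln (level j))))" using elim True level(1) by blast
   also have "... <= a s * (level j * exp (- real j) + level j * exp (- real j))"
   using Ys level(2)[of j] level(3)[of j] by (intro mult_left_mono add_mono a) auto
   finally show ?thesis by (intro mult_left_mono I) (simp add: algebra_simps)
  next
   case False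
   have "H s = 0 \<or> ?I s = 0" using False le H(3)[of s] by (auto simp: indicator_def)
   moreover have "0 <= ?I s * (2 * level j * exp (- real j) * a s)" using I a level(3)[of j] by (intro mult_nonneg_nonneg) auto
   ultimately show ?thesis by auto
  qed
  qed
 qed
 also have "... = 2 * level j * exp (- real j) * (A (ta j) - A (ta (Suc j)))"
 proof -
  have "(%s. ?I s * (2 * level j * exp (- real j) * a s)) = (%s. (2 * level j * exp (- real j)) * (ind {..<ta j} s * a s - ind {..<ta (Suc j)} s * a s))"
  by (auto simp: algebra_simps)
  then show ?thesis by (simp add: A_def ia)
 qed
 finally have "exp (- real j) * (1 - exp (- 1)) <= exp (- real j) * (2 * level j * (A (ta j) - A (ta (Suc j))))"
  by (simp add: algebra_simps exp_add[symmetric])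
 then have "1 - exp (- 1) <= 2 * level j * (A (ta j) - A (ta (Suc j)))" by simp
 then show ?thesis using level(3)[of j] by (simp add: field_simps)
 qed
 have "(1 - exp (- 1)) / 4 * (ln (ln (real N + 5)) - ln (ln (real k + 5))) = (1 - exp (- 1)) / 2 * ((ln (ln (real N + 5)) - ln (ln (real k + 5))) / 2)" by simp
 also have "... <= (1 - exp (- 1)) / 2 * (\<Sum>j=k..<N. 1 / level j)"
 by (intro mult_left_mono sum_level kN) auto
 also have "... = (\<Sum>j=k..<N. (1 - exp (- 1)) / 2 * (1 / level j))" by (simp add: sum_distrib_left)
 also have "... <= (\<Sum>j=k..<N. A (ta j) - A (ta (Suc j)))" by (intro sum_mono step) auto
 also have "... = A (ta k) - A (ta N)"
 using sum_Suc_diff'[OF kN, of "%j. - A (ta j)"] by simp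
 also have "... <= (LL s. a s)"
 proof -
 have "A (ta N) >= 0" unfolding A_def by (rule integral_nonneg_AE) (use a in auto)
 moreover have "A (ta k) <= (LL s. a s)" unfolding A_def by (rule integral_mono[OF ia a(1)]) (use a in \<open>auto simp: indicator_def\<close>)
 ultimately show ?thesis by simp
 qed
 finally show False using big by simp
 qed
 then have zle: "z t <= exp (- real k)" if "t < T" for t using zm[of t T] that by simp
 from Y show ?thesis unfolding z_def[symmetric]
 proof eventually_elim
 case (elim t)
 then show ?case using zle[of t] by auto
 qed
qed

section \<open>The weight\<close>

text \<open>The exponent n + 1 gives an integrable square. The scale R flattens the weight on ever
  larger balls, so that its logarithmic gradient tends to 0 at each point.\<close>

definition weight :: "real => 'a::euclidean_space => real" where
 "weight R x = inverse ((1 + x \<bullet> x / R\<^sup>2) ^ (DIM('a) + 1))"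

definition weight' :: "real => 'a::euclidean_space => 'a" where
 "weight' R x = - (real (DIM('a) + 1) * 2 / R\<^sup>2 * inverse ((1 + x \<bullet> x / R\<^sup>2) ^ (DIM('a) + 2))) *\<^sub>R x"

lemma weight_base: "R > 0 ==> 1 + x \<bullet> x / R\<^sup>2 >= 1"
 by simp

lemma weight_C1:
 assumes R: "R > 0" shows "C1 (weight R) (weight' R :: 'a::euclidean_space => 'a)"
proof (rule C1I)
 have nz: "1 + x \<bullet> x / R\<^sup>2 ~= 0" for x :: 'a using weight_base[OF R, of x] by linarith
 let ?m = "DIM('a) + 1"
 fix x :: 'a
 let ?u = "1 + x \<bullet> x / R\<^sup>2"
 have 1: "((%x::'a. 1 + x \<bullet> x / R\<^sup>2) has_derivative (%h. 2 * (x \<bullet> h) / R\<^sup>2)) (at x)"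
 proof -
 have "((%x::'a. x \<bullet> x) has_derivative (%h. 2 * (x \<bullet> h))) (at x)"
 by (auto intro!: derivative_eq_intros simp: inner_commute)
 from has_derivative_add[OF has_derivative_const[of 1] has_derivative_mult_right[OF this, of "1 / R\<^sup>2"]]
 show ?thesis by simp
 qed
 have 2: "((%u. inverse (u ^ ?m)) has_derivative (%v. (- (real ?m * inverse (?u ^ (DIM('a) + 2)))) * v)) (at ?u)"
 proof -
 have gen: "((%u. inverse (u ^ Suc n)) has_real_derivative (- (real (Suc n) * inverse (v ^ (n + 2))))) (at v)" if v: "v ~= 0" for v :: real and n
 proof -
 have "((%u. inverse (u ^ Suc n)) has_real_derivative (- (real (Suc n) * v ^ n * inverse ((v ^ Suc n)^2)))) (at v)"
  using DERIV_inverse_fun[OF DERIV_pow[of "Suc n" v], of UNIV] v by (simp add: power2_eq_square mult_ac)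
 moreover have "v ^ n * inverse ((v ^ Suc n)^2) = inverse (v ^ (n + 2))" using v by (simp add: field_simps power2_eq_square power_add)
 ultimately show ?thesis by (simp only: mult.assoc)
 qed
 have "(*) c = (%v. c * v)" for c :: real by (rule ext) simp
 then show ?thesis using gen[OF nz[of x], of "DIM('a)"] unfolding has_field_derivative_def by (simp only: Suc_eq_plus1)
 qed
 show "(weight R has_derivative (%h. (- (real ?m * inverse (?u ^ (DIM('a) + 2)))) * (2 * (x \<bullet> h) / R\<^sup>2))) (at x)"
 unfolding weight_def[abs_def] using has_derivative_compose[OF 1 2] .
 show "(- (real ?m * inverse (?u ^ (DIM('a) + 2)))) * (2 * (x \<bullet> h) / R\<^sup>2) = weight' R x \<bullet> h" for h
 by (simp add: weight'_def)
 have "continuous_on UNIV (%x::'a. inverse ((1 + x \<bullet> x / R\<^sup>2) ^ (DIM('a) + 2)))"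
 by (intro continuous_intros) (use nz R in auto)
 show "continuous_on UNIV (weight' R :: 'a => 'a)"
 unfolding weight'_def[abs_def] by (intro continuous_intros) (use nz R in auto)
qed

lemma weight_pos: "R > 0 ==> weight R x > 0"
 unfolding weight_def using weight_base[of R x] by (intro positive_imp_inverse_positive zero_less_power) linarith

lemma weight_le_1:
 fixes x :: "'a::euclidean_space"
 assumes R: "R > 0" shows "weight R x <= 1"
proof -
 have "1 <= (1 + x \<bullet> x / R\<^sup>2) ^ (DIM('a) + 1)" by (rule one_le_power[OF weight_base[OF R]])
 from le_imp_inverse_le[OF this] show ?thesis by (simp only: weight_def inverse_1 zero_less_one)
qed

lemma weight_mono:
 assumes "R >= 1" shows "weight 1 x <= weight R x"
proof -
 have "x \<bullet> x / R\<^sup>2 <= x \<bullet> x / 1" using assms by (intro divide_left_mono) (auto simp: one_le_power)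
 then show ?thesis unfolding weight_def using weight_base[of R x] assms
 by (intro le_imp_inverse_le power_mono zero_less_power) (auto simp: add_nonneg_nonneg intro: add_pos_nonneg)
qed

text \<open>The quotient (1 + |x|) |grad p| / ((n + 1) p) for the weight p. The factor 1 + |x| is
  the one against which the growth of b is measured.\<close>

definition weight_ratio :: "real => 'a::euclidean_space => real" where
 "weight_ratio R x = 2 * norm x * (1 + norm x) / (R\<^sup>2 + (norm x)^2)"

lemma weight_grad:
 fixes x :: "'a::euclidean_space"
 assumes R: "R > 0" shows "norm (weight' R x) * (1 + norm x) = (DIM('a) + 1) * weight_ratio R x * weight R x"
proof -
 let ?u = "1 + x \<bullet> x / R\<^sup>2"
 have u: "?u > 0" using weight_base[OF R, of x] by linarith
 have R2: "R\<^sup>2 * ?u = R\<^sup>2 + (norm x)^2" using R by (simp add: field_simps power2_norm_eq_inner)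
 have "norm (weight' R x) = real (DIM('a) + 1) * 2 / R\<^sup>2 * inverse (?u ^ (DIM('a) + 2)) * norm x"
 unfolding weight'_def using u by (simp add: abs_mult)
 also have "inverse (?u ^ (DIM('a) + 2)) = weight R x / ?u" using u by (simp add: weight_def field_simps)
 finally have n: "norm (weight' R x) = real (DIM('a) + 1) * 2 / R\<^sup>2 * (weight R x / ?u) * norm x" .
 have "norm (weight' R x) * (1 + norm x) = (DIM('a) + 1) * (2 * norm x * (1 + norm x) / (R\<^sup>2 * ?u)) * weight R x"
 unfolding n by (simp only: divide_inverse inverse_mult_distrib mult_ac)
 then show ?thesis unfolding R2 weight_ratio_def .
qed

lemma weight_ratio_bounds:
 assumes R: "R >= 1" shows "0 <= weight_ratio R x" "weight_ratio R x <= 3"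
proof -
 have R1: "R\<^sup>2 >= 1" using R by (simp add: one_le_power)
 then have p: "R\<^sup>2 + (norm x)^2 > 0" using zero_le_power2[of "norm x"] by linarith
 show "0 <= weight_ratio R x" unfolding weight_ratio_def using p by simp
 have "2 * norm x * (1 + norm x) <= 3 * (1 + (norm x)^2)"
 using zero_le_power2[of "norm x - 1"] by (simp add: power2_eq_square algebra_simps)
 also have "... <= 3 * (R\<^sup>2 + (norm x)^2)" using R1 by simp
 finally show "weight_ratio R x <= 3" unfolding weight_ratio_def using p by (simp add: field_simps)
qed

lemma weight_ratio_tendsto: "(%n. weight_ratio (real n) x) \<longlonglongrightarrow> 0"
proof -
 have "(%n. 2 * norm x * (1 + norm x) * inverse (real n)) \<longlonglongrightarrow> 2 * norm x * (1 + norm x) * 0"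
 by (intro tendsto_intros lim_inverse_n)
 then have l: "(%n. 2 * norm x * (1 + norm x) * inverse (real n)) \<longlonglongrightarrow> 0" by simp
 show ?thesis
 proof (rule Lim_null_comparison[OF _ l], rule eventually_sequentiallyI[of 1])
 fix n :: nat assume n: "1 <= n"
 have "real n <= (real n)^2 + (norm x)^2" using n self_le_power[of "real n" 2] by (simp add: add_increasing2)
 then have "weight_ratio (real n) x <= 2 * norm x * (1 + norm x) / real n"
 unfolding weight_ratio_def using n by (intro divide_left_mono) (auto simp: add_pos_nonneg)
 then show "norm (weight_ratio (real n) x) <= 2 * norm x * (1 + norm x) * inverse (real n)"
 using weight_ratio_bounds(1)[of "real n" x] n by (simp add: divide_inverse)
 qed
qed

lemma weight_vanish:
 assumes R: "R > 0" and et: "et > 0"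
 shows "EX r. \<forall>x::'a::euclidean_space. norm x >= r --> weight R x <= et"
proof (intro exI allI impI)
 fix x :: 'a assume x: "norm x >= R * (1 + inverse et)"
 have "1 + inverse et <= norm x / R" using x R by (simp add: field_simps)
 then have "(1 + inverse et)^2 <= (norm x / R)^2" using et by (intro power_mono) auto
 moreover have "inverse et <= (1 + inverse et)^2" using et by (simp add: power2_eq_square algebra_simps)
 ultimately have u: "inverse et <= 1 + x \<bullet> x / R\<^sup>2" by (simp add: power_divide power2_norm_eq_inner)
 have "1 + x \<bullet> x / R\<^sup>2 <= (1 + x \<bullet> x / R\<^sup>2) ^ (DIM('a) + 1)" using weight_base[OF R, of x] by (intro self_le_power) auto
 then have "inverse et <= (1 + x \<bullet> x / R\<^sup>2) ^ (DIM('a) + 1)" using u by linarith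
 then have "weight R x <= inverse (inverse et)" unfolding weight_def using et by (intro le_imp_inverse_le) auto
 then show "weight R x <= et" by simp
qed

text \<open>Majorant by a series of constants on balls of radius k + 1: the decay (k+1)^(-4(n+1))
  beats the volume, which grows like (k+1)^n.\<close>

lemma weight_integrable:
 assumes R: "R >= 1" shows "ilb (%x::'a::euclidean_space. (weight R x)^2)"
proof (rule integrableI_bounded)
 have R0: "R > 0" using R by simp
 show "(%x::'a. (weight R x)^2) : borel_measurable lborel" using C1_borel(1)[OF weight_C1[OF R0, where 'a='a]] by measurable
 let ?m = "DIM('a) + 1"
 define v where "v = measure lborel (ball (0::'a) 1)"
 \<comment> \<open>With k the integer part of |x|, (k+1)^2 <= 2 (1 + |x|^2) <= 2 R^2 (1 + |x|^2 /
   R^2); the power 2 (n+1) of this inequality gives the constant.\<close>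
 define c where "c k = (2 * R\<^sup>2) ^ (2 * ?m) / (real k + 1) ^ (4 * ?m)" for k :: nat
 have c0: "c k >= 0" for k by (simp add: c_def)
 have pt: "(weight R x)^2 <= c (nat \<lfloor>norm x\<rfloor>)" for x :: 'a
 proof -
 let ?k = "real (nat \<lfloor>norm x\<rfloor>)"
 have k: "?k <= norm x" by simp
 have "(?k + 1)^2 <= 2 * (1 + ?k\<^sup>2)" using zero_le_power2[of "?k - 1"] by (simp add: power2_eq_square algebra_simps)
 also have "... <= 2 * (1 + (norm x)^2)" using k by simp
 also have "... <= 2 * R\<^sup>2 * (1 + x \<bullet> x / R\<^sup>2)"
 proof -
 have "R\<^sup>2 * (1 + x \<bullet> x / R\<^sup>2) = R\<^sup>2 + (norm x)^2" using R0 by (simp add: distrib_left power2_norm_eq_inner)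
 then show ?thesis using one_le_power[OF R, of 2] by simp
 qed
 finally have "((?k + 1)^2) ^ (2 * ?m) <= (2 * R\<^sup>2 * (1 + x \<bullet> x / R\<^sup>2)) ^ (2 * ?m)" by (intro power_mono) auto
 moreover have "(y\<^sup>2) ^ (2 * m) = y ^ (4 * m)" for y :: real and m by (simp add: power_mult[symmetric])
 then have "((?k + 1)^2) ^ (2 * ?m) = (?k + 1) ^ (4 * ?m)" .
 ultimately have "(?k + 1) ^ (4 * ?m) <= (2 * R\<^sup>2 * (1 + x \<bullet> x / R\<^sup>2)) ^ (2 * ?m)" by (simp only:)
 moreover have "(2 * R\<^sup>2 * (1 + x \<bullet> x / R\<^sup>2)) ^ (2 * ?m) = (2 * R\<^sup>2) ^ (2 * ?m) * (1 + x \<bullet> x / R\<^sup>2) ^ (2 * ?m)" by (rule power_mult_distrib)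
 ultimately have *: "(?k + 1) ^ (4 * ?m) <= (2 * R\<^sup>2) ^ (2 * ?m) * (1 + x \<bullet> x / R\<^sup>2) ^ (2 * ?m)" by (simp only:)
 have gw: "(inverse (u ^ m))^2 = inverse (u ^ (2 * m))" for u :: real and m by (simp add: power_inverse power_mult[symmetric] mult.commute)
 have w: "(weight R x)^2 = inverse ((1 + x \<bullet> x / R\<^sup>2) ^ (2 * ?m))"
 unfolding weight_def by (rule gw)
 have p: "(1 + x \<bullet> x / R\<^sup>2) ^ (2 * ?m) > 0" using weight_base[OF R0, of x] by (intro zero_less_power) linarith
 have q: "(?k + 1) ^ (4 * ?m) > 0" by (intro zero_less_power add_nonneg_pos) auto
 have "inverse P <= B / A" if "A <= B * P" "P > 0" "A > 0" for A B P :: real using that by (simp add: field_simps)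
 from this[OF * p q] show ?thesis unfolding w c_def .
 qed
 have bc: "emeasure lborel (ball (0::'a) (real k + 1)) = ennreal ((real k + 1) ^ DIM('a) * v)" for k
 using content_ball_conv_unit_ball[of "real k + 1" "0::'a"] emeasure_eq_ennreal_measure[of lborel "ball (0::'a) (real k + 1)"]
 emeasure_bounded_finite[of "ball (0::'a) (real k + 1)"] by (simp add: v_def)
 have "(\<integral>\<^sup>+x. ennreal (norm ((weight R x)^2)) \<partial>(lborel::'a measure)) <= (\<integral>\<^sup>+x. (\<Sum>k. ennreal (c k) * ind (ball 0 (real k + 1)) x) \<partial>(lborel::'a measure))"
 proof (rule nn_integral_mono)
 fix x :: 'a
 let ?k = "nat \<lfloor>norm x\<rfloor>"
 have "x : ball 0 (real ?k + 1)" by simp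
 then have "ennreal (norm ((weight R x)^2)) <= ennreal (c ?k) * ind (ball 0 (real ?k + 1)) x" using pt[of x] by (simp add: ennreal_leI)
 also have "... = (\<Sum>k\<in>{?k}. ennreal (c k) * ind (ball 0 (real k + 1)) x)" by simp
 also have "... <= (\<Sum>k. ennreal (c k) * ind (ball 0 (real k + 1)) x)" by (rule sum_le_suminf) auto
 finally show "ennreal (norm ((weight R x)^2)) <= (\<Sum>k. ennreal (c k) * ind (ball 0 (real k + 1)) x)" .
 qed
 also have "... = (\<Sum>k. \<integral>\<^sup>+x. ennreal (c k) * ind (ball 0 (real k + 1)) x \<partial>(lborel::'a measure))"
 by (rule nn_integral_suminf) measurable
 also have "... = (\<Sum>k. ennreal (c k * ((real k + 1) ^ DIM('a) * v)))"
 by (simp add: nn_integral_cmult_indicator bc ennreal_mult'[OF c0])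
 also have "... < \<infinity>"
 proof -
 have "summable (%k. c k * ((real k + 1) ^ DIM('a) * v))"
 proof (rule summable_comparison_test')
 have "summable (%n. 1 / real (Suc n) ^ 2)" using inverse_power_summable[of 2] summable_Suc_iff[of "%n. inverse (real n ^ 2)"] by (simp add: inverse_eq_divide)
 then show "summable (%k. (2 * R\<^sup>2) ^ (2 * ?m) * v * (1 / real (Suc k) ^ 2))" by (rule summable_mult)
 fix k :: nat
 have v0: "v >= 0" by (simp add: v_def)
 have "(real k + 1) ^ (DIM('a) + 2) <= (real k + 1) ^ (4 * ?m)" by (intro power_increasing) auto
 then have "(real k + 1) ^ DIM('a) / (real k + 1) ^ (4 * ?m) <= 1 / (real k + 1) ^ 2"
 proof -
  have "A / B <= 1 / C" if "A * C <= B" "C > 0" "B > 0" for A B C :: real using that by (simp add: field_simps)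
  then show ?thesis using \<open>(real k + 1) ^ (DIM('a) + 2) <= (real k + 1) ^ (4 * ?m)\<close>[unfolded power_add] zero_less_power[of "real k + 1"] by (metis add_nonneg_pos of_nat_0_le_iff zero_less_one)
 qed
 then have "(2 * R\<^sup>2) ^ (2 * ?m) * v * ((real k + 1) ^ DIM('a) / (real k + 1) ^ (4 * ?m)) <= (2 * R\<^sup>2) ^ (2 * ?m) * v * (1 / (real k + 1) ^ 2)"
  using v0 by (intro mult_left_mono) auto
 moreover have "c k * ((real k + 1) ^ DIM('a) * v) = (2 * R\<^sup>2) ^ (2 * ?m) * v * ((real k + 1) ^ DIM('a) / (real k + 1) ^ (4 * ?m))"
  by (simp add: c_def)
 ultimately show "norm (c k * ((real k + 1) ^ DIM('a) * v)) <= (2 * R\<^sup>2) ^ (2 * ?m) * v * (1 / real (Suc k) ^ 2)"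
  using c0[of k] v0 by (simp add: add.commute)
 qed
 then show ?thesis using c0 by (subst suminf_ennreal2) (auto simp: v_def)
 qed
 finally show "(\<integral>\<^sup>+x. ennreal (norm ((weight R x)^2)) \<partial>(lborel::'a measure)) < \<infinity>" .
qed

section \<open>Uniqueness\<close>

text \<open>Squaring the positive part keeps it C^1. Composed with the weight minus a constant, it
  yields admissible cut-offs of compact support.\<close>

lemma pos_square_deriv: "((%s::real. (max 0 s)^2) has_real_derivative 2 * max 0 s) (at s)"
proof -
 consider "s > 0" | "s < 0" | "s = 0" by linarith
 then show ?thesis
 proof cases
 case 1
 have "((%s::real. s\<^sup>2) has_real_derivative 2 * max 0 s) (at s)" using 1 by (auto intro!: derivative_eq_intros)
 then show ?thesis by (rule has_field_derivative_transform_within_open[of _ _ _ "{0<..}"]) (use 1 in auto)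
 next
 case 2
 have "((%s::real. 0) has_real_derivative 2 * max 0 s) (at s)" using 2 by simp
 then show ?thesis by (rule has_field_derivative_transform_within_open[of _ _ _ "{..<0}"]) (use 2 in auto)
 next
 case 3
 have "((%h::real. (max 0 (0 + h))^2 / h) \<longlongrightarrow> 0) (at 0)"
 proof (rule Lim_null_comparison)
 show "((%h::real. \<bar>h\<bar>) \<longlongrightarrow> 0) (at 0)" by (rule tendsto_eq_intros | simp)+
 show "\<forall>\<^sub>F h in at (0::real). norm ((max 0 (0 + h))^2 / h) <= \<bar>h\<bar>"
  by (rule always_eventually) (auto simp: max_def power2_eq_square)
 qed
 then show ?thesis by (simp add: 3 DERIV_def)
 qed
qed

text \<open>\<open>be\<close> is the part of |b| / (1 + |x|) that is integrable in space-time;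
  \<open>a\<close> dominates the L^oo norms of the remaining part of |b| / (1 + |x|) and of the
  bounded part of the divergence, and the Orlicz norm of its other part \<open>de\<close>.\<close>

locale transported_growth = transported T b M d w K for T and b :: "real => 'a::euclidean_space => 'a" and M d w K +
 fixes be :: "real => 'a => real" and a :: "real => real"
 assumes be_borel [measurable]: "(%(t, x). be t x) : bm2"
 and be_fin: "(NN t. \<integral>\<^sup>+x. ennreal (iT T t * \<bar>be t x\<bar>) \<partial>lborel) < \<infinity>"
 and a1: "!!t. a t >= 1" and a_int: "ilb (%t. iT T t * a t)"
 and growth_b: "AL t. t : {0<..<T} --> (AL x. norm (b t x) <= (1 + norm x) * (\<bar>be t x\<bar> + a t))"
 and growth_d: "AL t. t : {0<..<T} --> (\<exists>de\<in>bm. (AL x. \<bar>d t x\<bar> <= a t + \<bar>de x\<bar>)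
 & (NN x. ennreal (orlicz_P (\<bar>de x\<bar> / a t))) <= 1)"
begin

definition m :: real where "m = DIM('a) + 1"

definition Y :: "real => real => real" where "Y R s = (LL x. (w s x)^2 * (weight R x)^2)"

text \<open>A bound without signs for w^2 (p^2 d + grad(p^2) . b), the density of the rate of
  Y.\<close>

definition zi :: "real => real => 'a => real" where
 "zi R s x = (w s x)^2 * ((weight R x)^2 * \<bar>d s x\<bar> + 2 * weight R x * norm (weight' R x) * norm (b s x))"

definition Z :: "real => real => real" where "Z R s = (LL x. zi R s x)"

text \<open>The contribution of the L^1 part \<open>be\<close>; it vanishes as R tends to infinity
  and is kept apart from the terms that Y controls.\<close>

definition e :: "real => real => real" where "e R s = 2 * m * K\<^sup>2 * (LL x. weight_ratio R x * \<bar>be s x\<bar>)"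

text \<open>Large enough for 1 + si + 6 m <= c si whenever si >= 1, and for 2 K^2 <= c.\<close>

definition c :: real where "c = 2 + 6 * m + 2 * K\<^sup>2"

text \<open>The rate beyond the error \<open>e\<close>, truncated at 0 so that its primitive is
  nondecreasing as \<open>osgood\<close> requires.\<close>

definition H :: "real => real => real" where "H R s = iT T s * max 0 (Z R s - e R s)"

lemma m0: "m > 0" by (simp add: m_def)

lemma c0: "c > 0" using m0 by (simp add: c_def add_pos_nonneg)

section \<open>The differential inequality for the weighted energy\<close>

lemma weight_borel [measurable]:
 "R >= 1 ==> weight R : borel_measurable (borel :: 'a measure)" "R >= 1 ==> weight' R : borel_measurable (borel :: 'a measure)"
 using C1_borel[OF weight_C1[of R, where 'a='a]] by auto

lemma ratio_borel [measurable]: "weight_ratio R : borel_measurable (borel :: 'a measure)"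
 unfolding weight_ratio_def by measurable

lemma w_sq: "0 <= (w s x)^2" "(w s x)^2 <= K\<^sup>2"
 using w_bound[of s x] by (auto simp: abs_le_square_iff[symmetric])

lemma w_slice [measurable]: "w s : bm" "d s : bm" "b s : bm" "be s : bm"
 by measurable

lemma Y_integrable: assumes R: "R >= 1" shows "ilb (%x. (w s x)^2 * (weight R x)^2)"
 by (rule ibd[OF imr[OF weight_integrable[OF R], of "K\<^sup>2"]])
 (use w_sq R in \<open>auto intro!: mult_right_mono simp: abs_mult\<close>)

lemma Y_nonneg: "Y R s >= 0" unfolding Y_def by (rule integral_nonneg_AE) simp

lemma Y_bound: "R >= 1 ==> Y R s <= K\<^sup>2 * (LL x. (weight R (x::'a))^2)"
 unfolding Y_def integral_mult_right_zero[symmetric]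
 by (intro integral_mono Y_integrable imr weight_integrable mult_right_mono w_sq) auto

lemma e_nonneg: "R >= 1 ==> e R s >= 0"
 unfolding e_def using m0 weight_ratio_bounds(1)[of R, where 'a='a] by (intro mult_nonneg_nonneg integral_nonneg_AE) auto

lemma be_ae: "AL s. s : {0<..<T} --> ilb (be s)"
proof -
 have "AL s. (NN x. ennreal (iT T s * \<bar>be s x\<bar>)) ~= \<infinity>"
 by (rule nn_integral_PInf_AE) (use be_fin in auto)
 then show ?thesis
 proof eventually_elim
 case (elim s)
 then show ?case by (auto simp: integrable_iff_bounded top.not_eq_extremum)
 qed
qed

lemma be_int: "ilb (%s. iT T s * (LL x. \<bar>be s x\<bar>))"
proof (rule integrableI_bounded)
 have "(NN s. ennreal (norm (iT T s * (LL x. \<bar>be s x\<bar>))))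
 <= (NN t. \<integral>\<^sup>+x. ennreal (iT T t * \<bar>be t x\<bar>) \<partial>lborel)"
 proof (rule nn_integral_mono_AE, use be_ae in eventually_elim)
 case (elim s)
 have "(LL x. \<bar>be s x\<bar>) >= 0" by (rule integral_nonneg_AE) simp
 with elim show ?case by (auto simp: indicator_def nn_integral_eq_integral)
 qed
 then show "(NN s. ennreal (norm (iT T s * (LL x. \<bar>be s x\<bar>)))) < \<infinity>"
 using be_fin by (rule le_less_trans)
qed measurable

text \<open>Young's inequality at r = |de| / a splits the divergence term into a multiple of a si
  w^2 p^2 and of a si exp(-si / ln si) P(r), where P(r) has integral at most 1. In the drift term
  \<open>weight_grad\<close> cancels 1 + |x|: the part with \<open>be\<close> is the error
  \<open>e\<close>, and the part with a yields 6 m from the bound 3 of the ratio.\<close>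

lemma Z_estimate: assumes R: "R >= 1"
 shows "AL s. s : {0<..<T} --> ilb (zi R s) &
 (\<forall>si\<ge>exp 2. Z R s <= e R s + c * a s * (si * Y R s + si * exp (- (si / ln si))))"
 using growth_b growth_d be_ae
proof eventually_elim
 case (elim s)
 show ?case
 proof
 assume s: "s : {0<..<T}"
 obtain de where [measurable]: "de : bm" and de: "AL x. \<bar>d s x\<bar> <= a s + \<bar>de x\<bar>"
 "(NN x. ennreal (orlicz_P (\<bar>de x\<bar> / a s))) <= 1" using elim(2) s by auto
 have a: "a s >= 1" by (rule a1)
 define P where "P x = orlicz_P (\<bar>de x\<bar> / a s)" for x
 have P0: "P x >= 0" for x unfolding P_def orlicz_P_def log_plus_def using a by simp
 have [measurable]: "P : bm" unfolding P_def orlicz_P_def log_plus_def by measurable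
 have Pi: "ilb P"
 by (rule integrableI_bounded) (use de(2) P0 in \<open>auto simp: P_def[symmetric] intro: le_less_trans\<close>)
 have P1: "(LL x. P x) <= 1"
 proof -
 have "ennreal (LL x. P x) <= ennreal 1" using de(2) P0 Pi by (simp add: P_def[symmetric] nn_integral_eq_integral)
 then show ?thesis by (simp only: ennreal_le_iff zero_le_one)
 qed
 define up where "up si x = 2 * m * K\<^sup>2 * (weight_ratio R x * \<bar>be s x\<bar>)
 + (a s * (1 + si + 6 * m) * ((w s x)^2 * (weight R x)^2) + 2 * K\<^sup>2 * a s * si * exp (- (si / ln si)) * P x)" for si x
 have i1: "ilb (%x. weight_ratio R x * \<bar>be s x\<bar>)"
 by (rule ibd[OF imr[OF integrable_abs[of lborel "be s"], of 3]])
  (use elim(3) s weight_ratio_bounds[OF R, where 'a='a] in \<open>auto simp: abs_mult intro!: mult_right_mono\<close>)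
 have iup: "ilb (up si)" for si
 unfolding up_def by (intro iadd imr i1 Pi Y_integrable R)
 have zi0: "zi R s x >= 0" for x unfolding zi_def using weight_pos[of R x] R by (intro mult_nonneg_nonneg add_nonneg_nonneg) auto
 have dom: "AL x. zi R s x <= up si x" if si: "si >= exp 2" for si
 using elim(1)[rule_format, OF s] de(1)
 proof eventually_elim
 case (elim x)
 let ?p = "weight R x" and ?r = "\<bar>de x\<bar> / a s" and ?E = "exp (- (si / ln si))" and ?W = "(w s x)^2" and ?q = "weight_ratio R x"
 have si0: "si > 0" using si exp_gt_zero[of "2::real"] by linarith
 have p: "0 < ?p" "?p <= 1" using weight_pos[of R x] weight_le_1[of R x] R by auto
 have p2: "?p\<^sup>2 <= 1" "?p\<^sup>2 >= 0" using p by (auto simp: power_le_one)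
 have Wp: "?W * ?p\<^sup>2 <= K\<^sup>2" "?W * ?p\<^sup>2 >= 0" using mult_mono[OF w_sq(2) p2(1), of s x] p2 by auto
 have q: "0 <= ?q" "?q <= 3" using weight_ratio_bounds[OF R, of x] by auto
 have dl: "\<bar>d s x\<bar> <= a s + a s * (si + 2 * si * ?E * P x)"
 proof -
  have "\<bar>de x\<bar> = a s * ?r" using a by simp
  also have "... <= a s * (si + 2 * si * ?E * P x)"
  unfolding P_def using a by (intro mult_left_mono orlicz_young si) auto
  finally show ?thesis using elim(2) by linarith
 qed
 have "?W * ?p\<^sup>2 * \<bar>d s x\<bar> <= ?W * ?p\<^sup>2 * (a s + a s * (si + 2 * si * ?E * P x))" by (rule mult_left_mono[OF dl Wp(2)])
 also have "... = a s * (1 + si) * (?W * ?p\<^sup>2) + (?W * ?p\<^sup>2) * (2 * a s * si * ?E * P x)" by (simp add: algebra_simps)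
 also have "... <= a s * (1 + si) * (?W * ?p\<^sup>2) + K\<^sup>2 * (2 * a s * si * ?E * P x)"
  using P0[of x] a si0 by (intro add_left_mono mult_right_mono Wp mult_nonneg_nonneg) auto
 finally have 1: "?W * ?p\<^sup>2 * \<bar>d s x\<bar> <= a s * (1 + si) * (?W * ?p\<^sup>2) + 2 * K\<^sup>2 * a s * si * ?E * P x" by (simp add: mult_ac)
 have "norm (weight' R x) * norm (b s x) <= norm (weight' R x) * ((1 + norm x) * (\<bar>be s x\<bar> + a s))" by (rule mult_left_mono[OF elim(1)]) simp
 also have "... = (norm (weight' R x) * (1 + norm x)) * (\<bar>be s x\<bar> + a s)" by (simp only: mult.assoc)
 also have "... = m * ?q * ?p * (\<bar>be s x\<bar> + a s)" using weight_grad[of R x] R by (simp add: m_def)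
 finally have "2 * (?W * ?p) * (norm (weight' R x) * norm (b s x)) <= 2 * (?W * ?p) * (m * ?q * ?p * (\<bar>be s x\<bar> + a s))"
  using p w_sq(1)[of s x] by (intro mult_left_mono) auto
 also have "... = 2 * m * (?W * ?p\<^sup>2) * (?q * \<bar>be s x\<bar>) + 2 * m * a s * (?W * ?p\<^sup>2) * ?q" by (simp add: algebra_simps power2_eq_square)
 also have "... <= 2 * m * K\<^sup>2 * (?q * \<bar>be s x\<bar>) + 2 * m * a s * (?W * ?p\<^sup>2) * 3"
  using m0 a q Wp by (intro add_mono mult_right_mono mult_left_mono mult_nonneg_nonneg) auto
 finally have 2: "2 * (?W * ?p) * (norm (weight' R x) * norm (b s x)) <= 2 * m * K\<^sup>2 * (?q * \<bar>be s x\<bar>) + 6 * m * a s * (?W * ?p\<^sup>2)" by (simp add: mult_ac)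
 have "zi R s x = ?W * ?p\<^sup>2 * \<bar>d s x\<bar> + 2 * (?W * ?p) * (norm (weight' R x) * norm (b s x))" by (simp add: zi_def algebra_simps)
 also have "... <= up si x" using add_mono[OF 1 2] by (simp add: up_def algebra_simps)
 finally show ?case .
 qed
 have izi: "ilb (zi R s)"
 proof (rule ibd[OF iup[of "exp 2"]])
 show "zi R s : borel_measurable lborel" unfolding zi_def using R by measurable
 show "AL x. norm (zi R s x) <= norm (up (exp 2) x)" using dom[OF order_refl] by eventually_elim (use zi0 in \<open>simp add: abs_of_nonneg\<close>)
 qed
 moreover have "Z R s <= e R s + c * a s * (si * Y R s + si * exp (- (si / ln si)))" if si: "si >= exp 2" for si
 proof -
 let ?E = "exp (- (si / ln si))"
 have si1: "si >= 1" using si exp_ge_add_one_self[of "2::real"] by linarith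
 have "Z R s <= (LL x. up si x)" unfolding Z_def by (rule integral_mono_AE[OF izi iup dom[OF si]])
 also have "... = e R s + (a s * (1 + si + 6 * m) * Y R s + 2 * K\<^sup>2 * a s * si * ?E * (LL x. P x))"
  unfolding up_def e_def Y_def by (simp add: i1 Pi Y_integrable R)
 also have "... <= e R s + (a s * (c * si) * Y R s + c * a s * si * ?E * 1)"
 proof (intro add_left_mono add_mono mult_right_mono mult_mono mult_left_mono Y_nonneg P1)
  have "0 <= (1 + 6 * m + 2 * K\<^sup>2) * (si - 1)" using si1 m0 by (intro mult_nonneg_nonneg) auto
  then have "1 + si + 6 * m <= 1 + si + 6 * m + (1 + 6 * m + 2 * K\<^sup>2) * (si - 1) + 2 * K\<^sup>2" by simp
  also have "... = c * si" by (simp add: c_def algebra_simps)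
  finally show "1 + si + 6 * m <= c * si" .
  show "2 * K\<^sup>2 <= c" using m0 by (simp add: c_def)
 qed (use a si1 c0 m0 P0 in \<open>auto intro!: integral_nonneg_AE\<close>)
 also have "... = e R s + c * a s * (si * Y R s + si * ?E)" by (simp add: algebra_simps)
 finally show ?thesis .
 qed
 ultimately show "ilb (zi R s) & (\<forall>si\<ge>exp 2. Z R s <= e R s + c * a s * (si * Y R s + si * exp (- (si / ln si))))" by blast
 qed
qed

lemma measurables: assumes R: "R >= 1"
 shows "Y R : bm" "Z R : bm" "e R : bm" "H R : bm"
proof -
 show 1: "Y R : bm" unfolding Y_def using R by measurable
 show 2 [measurable]: "Z R : bm" unfolding Z_def zi_def using R by measurable
 show 3 [measurable]: "e R : bm" unfolding e_def using R by measurable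
 show "H R : bm" unfolding H_def by measurable
qed

lemma H_estimate: assumes R: "R >= 1"
 shows "AL s. s : {0<..<T} --> (\<forall>si\<ge>exp 2. H R s <= (iT T s * (c * a s)) * (si * Y R s + si * exp (- (si / ln si))))"
 using Z_estimate[OF R]
proof (eventually_elim, intro impI allI)
 fix s si :: real
 assume *: "s : {0<..<T} --> ilb (zi R s) & (\<forall>si\<ge>exp 2. Z R s <= e R s + c * a s * (si * Y R s + si * exp (- (si / ln si))))"
 and s: "s : {0<..<T}" and si: "exp 2 <= si"
 have "si > 0" using si exp_gt_zero[of "2::real"] by linarith
 then have "0 <= c * a s * (si * Y R s + si * exp (- (si / ln si)))"
 using c0 a1[of s] Y_nonneg[of R s] by (intro mult_nonneg_nonneg add_nonneg_nonneg) auto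
 moreover have "Z R s - e R s <= c * a s * (si * Y R s + si * exp (- (si / ln si)))" using * s si by (simp add: algebra_simps)
 ultimately show "H R s <= (iT T s * (c * a s)) * (si * Y R s + si * exp (- (si / ln si)))"
 using s by (simp add: H_def)
qed

lemma H_nonneg: "H R s >= 0" by (simp add: H_def)

lemma H_integrable: assumes R: "R >= 1" shows "ilb (H R)"
proof -
 note [measurable] = measurables[OF R]
 \<comment> \<open>The bound of \<open>H_estimate\<close> at the smallest admissible si = exp 2,
   with Y replaced by its bound independent of time.\<close>
 let ?L = "exp 2 * (K\<^sup>2 * (LL x. (weight R (x::'a))^2)) + exp 2 * exp (- (exp 2 / ln (exp 2)))"
 show ?thesis
 proof (rule ibd[OF integrable_mult_left[OF a_int, of "c * ?L"]])
 show "AL s. norm (H R s) <= norm (iT T s * a s * (c * ?L))" using H_estimate[OF R]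
 proof eventually_elim
 case (elim s)
 show ?case
 proof (cases "s : {0<..<T}")
  case True
  have L0: "?L >= 0" by (intro add_nonneg_nonneg mult_nonneg_nonneg integral_nonneg_AE) auto
  have "H R s <= c * a s * (exp 2 * Y R s + exp 2 * exp (- (exp 2 / ln (exp 2))))" using elim[rule_format, OF True order_refl] True by (simp only: indicator_simps mult_1)
  also have "... <= c * a s * ?L" using c0 a1[of s] by (intro mult_left_mono add_right_mono Y_bound R) auto
  also have "... = norm (iT T s * a s * (c * ?L))"
  using True c0 a1[of s] L0 by (simp add: abs_mult mult_ac)
  finally show ?thesis using H_nonneg[of R s] by simp
 qed (simp add: H_def)
 qed
 qed measurable
qed

lemma e_integrable: assumes R: "R >= 1" shows "ilb (%s. iT T s * e R s)"
proof -
 note [measurable] = measurables[OF R]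
 show ?thesis
 proof (rule ibd[OF imr[OF be_int, of "6 * m * K\<^sup>2"]])
 show "AL s. norm (iT T s * e R s) <= norm (6 * m * K\<^sup>2 * (iT T s * (LL x. \<bar>be s x\<bar>)))" using be_ae
 proof eventually_elim
 case (elim s)
 have i: "(LL x. \<bar>be s x\<bar>) >= 0" by (rule integral_nonneg_AE) simp
 show ?case
 proof (cases "s : {0<..<T}")
  case True
  have "(LL x. weight_ratio R x * \<bar>be s x\<bar>) <= (LL x. 3 * \<bar>be s x\<bar>)"
  by (rule integral_mono') (use elim True weight_ratio_bounds[OF R, where 'a='a] in \<open>auto intro!: mult_right_mono\<close>)
  then have "e R s <= 2 * m * K\<^sup>2 * (3 * (LL x. \<bar>be s x\<bar>))" unfolding e_def using m0 by (intro mult_left_mono) auto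
  then show ?thesis using True m0 i e_nonneg[OF R, of s] by (simp add: abs_mult)
 qed simp
 qed
 qed measurable
qed

text \<open>The squared weight has no compact support. It is approximated from below by (max 0 (p -
  1/(n+1)))^2, whose gradient is bounded by that of p^2; the renormalised equation applies to these,
  and n tends to infinity at fixed t.\<close>

lemma energy: assumes R: "R >= 1"
 shows "AL t. t : {0<..<T} --> Y R t <= (LL s. iT T s * e R s) + (LL s. ind {..<t} s * H R s)"
proof -
 note [measurable] = measurables[OF R] weight_borel[OF R]
 define ph where "ph n x = (max 0 (weight R x - 1 / Suc n))^2" for n and x :: 'a
 define ph' where "ph' n x = (2 * max 0 (weight R x - 1 / Suc n)) *\<^sub>R weight' R x" for n and x :: 'a
 have R0: "R > 0" using R by simp
 have C: "C1c (ph n) (ph' n)" for n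
 proof -
 have "C1 (ph n) (ph' n)" unfolding ph_def[abs_def] ph'_def[abs_def]
 proof (rule C1_compose[OF weight_C1[OF R0], where be = "%s. (max 0 (s - 1 / Suc n))^2"])
 show "((%s. (max 0 (s - 1 / Suc n))^2) has_real_derivative 2 * max 0 (s - 1 / Suc n)) (at s)" for s
 proof -
  have "((%s. s - 1 / Suc n) has_real_derivative 1) (at s)" by (auto intro!: derivative_eq_intros)
  from DERIV_chain2[OF pos_square_deriv this] show ?thesis by simp
 qed
 show "continuous_on UNIV (%s. 2 * max 0 (s - 1 / Suc n))" by (intro continuous_intros)
 qed
 moreover obtain r where "!!x::'a. norm x >= r ==> weight R x <= 1 / Suc n" using weight_vanish[OF R0, of "1 / Suc n", where 'a='a] by auto
 ultimately show ?thesis by (intro C1cI[of _ _ r]) (auto simp: ph_def)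
 qed
 have p: "0 < weight R x" for x :: 'a using weight_pos[OF R0] .
 have mx: "0 <= max 0 (weight R x - 1 / Suc n)" "max 0 (weight R x - 1 / Suc n) <= weight R x" for n and x :: 'a using p[of x] by auto
 have phb: "0 <= ph n x" "ph n x <= (weight R x)^2" for n x unfolding ph_def using mx[where n=n] by (auto intro!: power_mono)
 have ph'b: "norm (ph' n x) <= 2 * weight R x * norm (weight' R x)" for n x
 unfolding ph'_def norm_scaleR abs_mult using mx[of x n] by (intro mult_right_mono) auto
 have [measurable]: "ph n : bm" "ph' n : bm" for n using C1_borel[OF C1c_C1[OF C[of n]]] by auto
 have Zi: "ilb (%s. iT T s * e R s + H R s)" by (intro iadd e_integrable H_integrable R)
 have bound: "(LL s. ind {..<t} s * (iT T s * (LL x. (w s x)^2 * (ph n x * d s x + ph' n x \<bullet> b s x))))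
 <= (LL s. iT T s * e R s) + (LL s. ind {..<t} s * H R s)" for n t
 proof -
 have iH: "ilb (%s. ind {..<t} s * H R s)"
 by (rule ibd[OF H_integrable[OF R]]) (auto simp: indicator_def)
 have "(LL s. ind {..<t} s * (iT T s * (LL x. (w s x)^2 * (ph n x * d s x + ph' n x \<bullet> b s x))))
 <= (LL s. iT T s * e R s + ind {..<t} s * H R s)"
 proof (rule integral_mono_AE')
 show "ilb (%s. iT T s * e R s + ind {..<t} s * H R s)" by (intro iadd e_integrable iH R)
 show "AL s. 0 <= iT T s * e R s + ind {..<t} s * H R s" using e_nonneg[OF R] H_nonneg by simp
 show "AL s. ind {..<t} s * (iT T s * (LL x. (w s x)^2 * (ph n x * d s x + ph' n x \<bullet> b s x)))
  <= iT T s * e R s + ind {..<t} s * H R s" using Z_estimate[OF R]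
 proof eventually_elim
  case (elim s)
  show ?case
  proof (cases "s : {0<..<T} & s < t")
  case True
  have "(LL x. (w s x)^2 * (ph n x * d s x + ph' n x \<bullet> b s x)) <= Z R s" unfolding Z_def
  proof (rule integral_mono')
   show "ilb (zi R s)" using elim True by simp
   fix x
   have "ph n x * d s x <= (weight R x)^2 * \<bar>d s x\<bar>" using phb[of n x] by (intro order_trans[OF mult_left_mono[OF abs_ge_self] mult_right_mono]) auto
   moreover have "ph' n x \<bullet> b s x <= 2 * weight R x * norm (weight' R x) * norm (b s x)"
   by (rule order_trans[OF norm_cauchy_schwarz mult_right_mono[OF ph'b]]) simp
   ultimately show "(w s x)^2 * (ph n x * d s x + ph' n x \<bullet> b s x) <= zi R s x" unfolding zi_def by (intro mult_left_mono add_mono) auto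
   show "0 <= zi R s x" unfolding zi_def using p[of x] by (intro mult_nonneg_nonneg add_nonneg_nonneg) auto
  qed
  then show ?thesis using True by (simp add: H_def)
  next
  case False
  then show ?thesis using e_nonneg[OF R, of s] H_nonneg[of R s] by (auto simp: indicator_def)
  qed
 qed
 qed
 then show ?thesis using iH e_integrable[OF R] by simp
 qed
 have "AL t. ALL n. t : {0<..<T} --> (LL x. (w t x)^2 * ph n x)
 = (LL s. ind {..<t} s * (iT T s * (LL x. (w s x)^2 * (ph n x * d s x + ph' n x \<bullet> b s x))))"
 unfolding AE_all_countable by (intro allI renormalized C)
 then show ?thesis
 proof (eventually_elim, intro impI)
 fix t assume *: "ALL n. t : {0<..<T} --> (LL x. (w t x)^2 * ph n x)
 = (LL s. ind {..<t} s * (iT T s * (LL x. (w s x)^2 * (ph n x * d s x + ph' n x \<bullet> b s x))))" and t: "t : {0<..<T}"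
 have "(%n. LL x. (w t x)^2 * ph n x) \<longlonglongrightarrow> Y R t" unfolding Y_def
 proof (rule ldct[OF _ _ Y_integrable[OF R, of t]])
 show "AL x. (%n. (w t x)^2 * ph n x) \<longlonglongrightarrow> (w t x)^2 * (weight R x)^2"
 proof (rule AE_I2)
  fix x :: 'a
  have "(%n. ph n x) \<longlonglongrightarrow> (max 0 (weight R x - 0))^2" unfolding ph_def
  by (intro tendsto_intros tendsto_max LIMSEQ_Suc lim_1_over_n)
  then show "(%n. (w t x)^2 * ph n x) \<longlonglongrightarrow> (w t x)^2 * (weight R x)^2" using p[of x] by (intro tendsto_intros) simp
 qed
 show "AL x. norm ((w t x)^2 * ph n x) <= (w t x)^2 * (weight R x)^2" for n
  using phb[of n] by (auto simp: abs_mult intro!: mult_left_mono)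
 qed measurable
 then show "Y R t <= (LL s. iT T s * e R s) + (LL s. ind {..<t} s * H R s)"
 by (rule LIMSEQ_le_const2) (use * t bound in simp)
 qed
qed

lemma e_tendsto: "(%n. LL s. iT T s * e (real n) s) \<longlonglongrightarrow> 0"
proof -
 \<comment> \<open>The bounds on the ratio need R >= 1, hence the shift of the index.\<close>
 have "(%n. LL s. iT T s * e (real (Suc n)) s) \<longlonglongrightarrow> (LINT s|(lborel::real measure). 0)"
 proof (rule ldct[OF _ _ imr[OF be_int, of "6 * m * K\<^sup>2"]])
 show "AL s. norm (iT T s * e (real (Suc n)) s) <= 6 * m * K\<^sup>2 * (iT T s * (LL x. \<bar>be s x\<bar>))" for n using be_ae
 proof eventually_elim
 case (elim s)
 have R: "real (Suc n) >= 1" by simp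
 show ?case
 proof (cases "s : {0<..<T}")
  case True
  have "(LL x. weight_ratio (real (Suc n)) x * \<bar>be s x\<bar>) <= (LL x. 3 * \<bar>be s x\<bar>)"
  by (rule integral_mono') (use elim True weight_ratio_bounds[OF R, where 'a='a] in \<open>auto intro!: mult_right_mono simp del: of_nat_Suc\<close>)
  then have "e (real (Suc n)) s <= 2 * m * K\<^sup>2 * (3 * (LL x. \<bar>be s x\<bar>))" unfolding e_def using m0 by (intro mult_left_mono) auto
  then show ?thesis using True e_nonneg[OF R, of s] by simp
 qed simp
 qed
 show "AL s. (%n. iT T s * e (real (Suc n)) s) \<longlonglongrightarrow> 0" using be_ae
 proof eventually_elim
 case (elim s)
 show ?case
 proof (cases "s : {0<..<T}")
  case True
  have "(%n. LL x. weight_ratio (real (Suc n)) x * \<bar>be s x\<bar>) \<longlonglongrightarrow> (LINT x|(lborel::'a measure). 0)"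
  proof (rule ldct[where w = "%x. 3 * \<bar>be s x\<bar>"])
  show "AL x. (%n. weight_ratio (real (Suc n)) x * \<bar>be s x\<bar>) \<longlonglongrightarrow> 0"
   by (intro AE_I2 tendsto_mult_left_zero LIMSEQ_Suc[OF weight_ratio_tendsto])
  show "AL x. norm (weight_ratio (real (Suc n)) x * \<bar>be s x\<bar>) <= 3 * \<bar>be s x\<bar>" for n
   using weight_ratio_bounds[of "real (Suc n)", where 'a='a] by (intro AE_I2) (simp add: abs_mult mult_right_mono del: of_nat_Suc)
  qed (use elim True in auto)
  from tendsto_mult_right_zero[OF this[simplified], of "2 * m * K\<^sup>2"] True show ?thesis unfolding e_def by simp
 qed simp
 qed
 show "(%s. iT T s * e (real (Suc n)) s) : borel_measurable lborel" for n
 using measurables(3)[of "real (Suc n)"] by measurable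
 qed simp
 then show ?thesis by (simp add: LIMSEQ_imp_Suc del: of_nat_Suc)
qed

text \<open>The order of the choices matters: k is given, N comes from the divergence of ln ln, and
  R is then taken so large that the total error is below the starting level exp(-N). Monotonicity of
  the weight in R brings the result back to R = 1.\<close>

lemma decay: "AL t. t : {0<..<T} --> Y 1 t <= exp (- real k)"
proof -
 let ?a = "%s. iT T s * (c * a s)"
 have ia: "ilb ?a" using imr[OF a_int, of c] by (simp add: mult_ac)
 have a0: "?a s >= 0" for s using c0 a1[of s] by (intro mult_nonneg_nonneg) auto
 let ?q = "(1 - exp (- 1)) / (4::real)"
 have q: "?q > 0" by simp
 obtain N where N: "N >= k" "(LL s. ?a s) / ?q + ln (ln (real k + 5)) < ln (ln (real N + 5))" using lnln_unbounded by blast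
 have "(LL s. ?a s) / ?q < ln (ln (real N + 5)) - ln (ln (real k + 5))" using N(2) by linarith
 then have big: "(LL s. ?a s) < ?q * (ln (ln (real N + 5)) - ln (ln (real k + 5)))" using q by (simp only: pos_divide_less_eq mult.commute)
 have "\<forall>\<^sub>F n in sequentially. (LL s. iT T s * e (real n) s) < exp (- real N)"
 by (rule order_tendstoD(2)[OF e_tendsto]) simp
 then obtain n0 where "!!n. n >= n0 ==> (LL s. iT T s * e (real n) s) < exp (- real N)" unfolding eventually_sequentially by blast
 then have E: "(LL s. iT T s * e (real (Suc n0)) s) < exp (- real N)" by (metis le_SucI order_refl)
 define R where "R = real (Suc n0)"
 have R: "R >= 1" by (simp add: R_def)
 have "AL t. t : {0<..<T} --> Y R t <= exp (- real k)"
 proof (rule osgood[OF ia a0 H_integrable[OF R] H_nonneg _ T _ H_estimate[OF R] N(1) big])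
 show "H R s = 0" if "s \<notin> {0<..<T}" for s using that by (simp add: H_def)
 show "AL t. t : {0<..<T} --> Y R t <= exp (- real N) + (LL s. ind {..<t} s * H R s)"
 using energy[OF R] by eventually_elim (use E in \<open>auto simp: R_def simp del: of_nat_Suc\<close>)
 qed
 moreover have "Y 1 t <= Y R t" for t unfolding Y_def
 by (intro integral_mono Y_integrable R mult_left_mono power_mono weight_mono w_sq) (auto intro!: less_imp_le[OF weight_pos])
 ultimately show ?thesis by (auto elim!: eventually_mono intro: order_trans)
qed

theorem vanish: "AL t. t : {0<..<T} --> (AL x. w t x = 0)"
proof -
 have "AL t. ALL k. t : {0<..<T} --> Y 1 t <= exp (- real k)" unfolding AE_all_countable using decay by blast
 then show ?thesis
 proof (eventually_elim, intro impI)
 fix t assume *: "ALL k. t : {0<..<T} --> Y 1 t <= exp (- real k)" and t: "t : {0<..<T}"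
 have "(%k. exp (- real k)) \<longlonglongrightarrow> 0"
 using filterlim_compose[OF exp_at_bot filterlim_compose[OF filterlim_uminus_at_bot_at_top filterlim_real_sequentially]] by simp
 then have "Y 1 t <= 0" by (rule LIMSEQ_le_const) (use * t in auto)
 then have "(LL x. (w t x)^2 * (weight 1 x)^2) = 0" using Y_nonneg[of 1 t] by (simp add: Y_def order_antisym)
 then have "AL x. (w t x)^2 * (weight 1 x)^2 = 0" by (subst (asm) integral_nonneg_eq_0_iff_AE[OF Y_integrable]) auto
 then show "AL x. w t x = 0" by eventually_elim (use weight_pos[of 1, where 'a='a] in \<open>auto simp: less_le\<close>)
 qed
qed

end

section \<open>Functionals dominated by the \<open>L\<^sup>1\<close> norm\<close>

text \<open>A linear functional on a subspace, encoded as the graph. Single-valuedness is not part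
  of the definition; it follows from domination by a seminorm, since (0, a) in the graph forces a <=
  0 and -a <= 0.\<close>

definition lin_graph :: "(('x => real) \<times> real) set => bool" where
 "lin_graph G \<longleftrightarrow> ((%_. 0), 0) : G & (ALL f a g b c. (f, a) : G --> (g, b) : G --> ((%x. f x + c * g x), a + c * b) : G)"

text \<open>Zorn's lemma gives a maximal dominated graph. If g were missing from its domain, a value
  \<gamma> for g could be added, since every lower bound forced by the domination lies below every
  upper bound.\<close>

lemma hahn_banach:
 fixes V :: "('x => real) set" and p :: "('x => real) => real"
 assumes V: "!!f g c. f : V ==> g : V ==> (%x. f x + c * g x) : V"
 and p_add: "!!f g. f : V ==> g : V ==> p (%x. f x + g x) <= p f + p g"
 and p_cmult: "!!f c. f : V ==> p (%x. c * f x) = \<bar>c\<bar> * p f"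
 and G0: "lin_graph G0" "!!f a. (f, a) : G0 ==> f : V & a <= p f"
 obtains G where "lin_graph G" "G0 \<subseteq> G" "!!f a. (f, a) : G ==> f : V & a <= p f" "!!f. f : V ==> EX a. (f, a) : G"
proof -
 define S where "S = {G. lin_graph G & G0 \<subseteq> G & (ALL f a. (f, a) : G --> f : V & a <= p f)}"
 have "\<exists>M\<in>S. \<forall>X\<in>S. M \<subseteq> X --> X = M"
 proof (rule subset_Zorn_nonempty)
 show "S ~= {}" using G0 unfolding S_def by blast
 fix \<C> assume ne: "\<C> ~= {}" and ch: "subset.chain S \<C>"
 have CS: "G : S" if "G : \<C>" for G using ch that by (auto simp: subset_chain_def)
 have "lin_graph (\<Union>\<C>)" unfolding lin_graph_def
 proof (intro conjI allI impI)
 show "((%_. 0), 0) : \<Union>\<C>" using ne CS unfolding S_def lin_graph_def by blast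
 fix f a g b c assume "(f, a) : \<Union>\<C>" "(g, b) : \<Union>\<C>"
 then obtain A B where AB: "A : \<C>" "B : \<C>" "(f, a) : A" "(g, b) : B" by blast
 then have "A \<subseteq> B \<or> B \<subseteq> A" using ch unfolding subset_chain_def by blast
 then obtain D where "D : \<C>" "(f, a) : D" "(g, b) : D" using AB by blast
 then show "((%x. f x + c * g x), a + c * b) : \<Union>\<C>" using CS unfolding S_def lin_graph_def by blast
 qed
 then show "\<Union>\<C> : S" using ne CS unfolding S_def by blast
 qed
 then obtain G where GS: "G : S" and mx: "!!X. X : S ==> G \<subseteq> X ==> X = G" by blast
 have G: "lin_graph G" "G0 \<subseteq> G" and dom: "!!f a. (f, a) : G ==> f : V & a <= p f" using GS by (auto simp: S_def)
 have z: "((%_. 0), 0) : G" and lin: "!!f a g b c. (f, a) : G ==> (g, b) : G ==> ((%x. f x + c * g x), a + c * b) : G"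
 using G(1) unfolding lin_graph_def by blast+
 have total: "EX a. (g, a) : G" if g: "g : V" for g
 proof -
 \<comment> \<open>The lower bounds for the value at g; \<gamma> is their supremum, and
   \<open>key\<close> makes it a lower bound of the upper ones.\<close>
 define L where "L = {a - p (%x. f x + (-1) * g x) | f a. (f, a) : G}"
 have key: "a - p (%x. f x + (-1) * g x) <= p (%x. h x + 1 * g x) - b" if "(f, a) : G" "(h, b) : G" for f a h b
 proof -
 have "a + 1 * b <= p (%x. f x + 1 * h x)" using dom[OF lin[OF that]] by blast
 also have "(%x. f x + 1 * h x) = (%x. (f x + (-1) * g x) + (h x + 1 * g x))" by (simp add: algebra_simps)
 also have "p ... <= p (%x. f x + (-1) * g x) + p (%x. h x + 1 * g x)" using dom that g by (intro p_add V) blast+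
 finally show ?thesis by simp
 qed
 define \<gamma> where "\<gamma> = Sup L"
 have ne: "L ~= {}" using z unfolding L_def by blast
 have bd: "bdd_above L" unfolding L_def by (rule bdd_aboveI[of _ "p (%x. 0 + 1 * g x) - 0"]) (use key z in blast)
 have lo: "a - p (%x. f x + (-1) * g x) <= \<gamma>" if "(f, a) : G" for f a unfolding \<gamma>_def by (rule cSup_upper[OF _ bd]) (use that L_def in blast)
 have up: "\<gamma> <= p (%x. h x + 1 * g x) - b" if "(h, b) : G" for h b unfolding \<gamma>_def by (rule cSup_least[OF ne]) (use that key L_def in blast)
 define G' where "G' = {((%x. f x + c * g x), a + c * \<gamma>) | f a c. (f, a) : G}"
 have mem: "((%x. f x + c * g x), a + c * \<gamma>) : G'" if "(f, a) : G" for f a c using that unfolding G'_def by blast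
 have sub: "G \<subseteq> G'"
 proof
 fix q assume q: "q : G"
 obtain f a where fa: "q = (f, a)" by (cases q)
 have "(f, a) = ((%x. f x + 0 * g x), a + 0 * \<gamma>)" by simp
 then show "q : G'" using q unfolding G'_def fa by blast
 qed
 have "lin_graph G'" unfolding lin_graph_def
 proof (intro conjI allI impI)
 show "((%_. 0), 0) : G'" using z sub by blast
 fix f a h b c assume "(f, a) : G'" "(h, b) : G'"
 then obtain f1 a1 c1 h1 b1 c2 where *: "(f1, a1) : G" "f = (%x. f1 x + c1 * g x)" "a = a1 + c1 * \<gamma>"
  "(h1, b1) : G" "h = (%x. h1 x + c2 * g x)" "b = b1 + c2 * \<gamma>" unfolding G'_def by blast
 have "(%x. f x + c * h x) = (%x. (f1 x + c * h1 x) + (c1 + c * c2) * g x)" "a + c * b = (a1 + c * b1) + (c1 + c * c2) * \<gamma>"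
  unfolding * by (auto simp: algebra_simps)
 then show "((%x. f x + c * h x), a + c * b) : G'" using mem[OF lin[OF *(1,4), of c], of "c1 + c * c2"] by (simp only:)
 qed
 moreover have "f : V & a <= p f" if fa: "(f, a) : G'" for f a
 proof -
 obtain f1 a1 c where f1: "(f1, a1) : G" and f: "f = (%x. f1 x + c * g x)" and a: "a = a1 + c * \<gamma>" using fa unfolding G'_def by blast
 have fV: "f : V" using V[of f1 g c] dom[OF f1] g f by blast
 have h: "((%x. 0 + s * f1 x), 0 + s * a1) : G" for s by (rule lin[OF z f1])
 have hV: "(%x. (0 + s * f1 x) + r * g x) : V" for s r by (rule V) (use dom[OF h] g in blast)+
 consider "c = 0" | "c > 0" | "c < 0" by linarith
 then have "a <= p f"
 proof cases
  case 1 then show ?thesis using dom[OF f1] f a by simp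
 next
  case 2
  have "f = (%x. c * ((0 + (1 / c) * f1 x) + 1 * g x))" unfolding f using 2 by (simp add: distrib_left)
  then have "p f = c * p (%x. (0 + (1 / c) * f1 x) + 1 * g x)" using p_cmult[OF hV, of c "1 / c" 1] 2 by simp
  moreover have "c * \<gamma> <= c * (p (%x. (0 + (1 / c) * f1 x) + 1 * g x) - (0 + 1 / c * a1))" by (rule mult_left_mono[OF up[OF h]]) (use 2 in simp)
  ultimately show ?thesis using 2 by (simp add: a right_diff_distrib)
 next
  case 3
  have "f = (%x. (- c) * ((0 + (1 / (- c)) * f1 x) + (-1) * g x))" unfolding f using 3 by (simp add: distrib_left right_diff_distrib)
  then have "p f = (- c) * p (%x. (0 + (1 / (- c)) * f1 x) + (-1) * g x)" using p_cmult[OF hV, of "- c" "1 / (- c)" "-1"] 3 by simp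
  moreover have "(- c) * ((0 + 1 / (- c) * a1) - p (%x. (0 + (1 / (- c)) * f1 x) + (-1) * g x)) <= (- c) * \<gamma>" by (rule mult_left_mono[OF lo[OF h]]) (use 3 in simp)
  ultimately show ?thesis using 3 by (simp add: a right_diff_distrib)
 qed
 with fV show ?thesis by blast
 qed
 ultimately have "G' : S" using sub G(2) unfolding S_def by blast
 from mx[OF this sub] have "G' = G" .
 moreover have "((%x. 0 + 1 * g x), 0 + 1 * \<gamma>) : G'" by (rule mem[OF z])
 ultimately show ?thesis by auto
 qed
 show thesis by (rule that[OF G dom total])
qed

text \<open>On sets, F may take both signs. Adding C times the measure gives a positive measure to
  which Radon-Nikodym applies, and C is subtracted from the density afterwards. Linearity and the
  L^1 bound extend the representation from indicators to integrable functions.\<close>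

lemma L1_dual_finite:
 fixes M :: "'x measure" and F :: "('x => real) => real"
 assumes "finite_measure M" and C: "C >= 0"
 and lin: "!!f g c. integrable M f ==> integrable M g ==> F (%x. f x + c * g x) = F f + c * F g"
 and bd: "!!f. integrable M f ==> \<bar>F f\<bar> <= C * (LINT x|M. \<bar>f x\<bar>)"
 shows "\<exists>u\<in>borel_measurable M. (ALL x. \<bar>u x\<bar> <= C) & (ALL f. integrable M f --> F f = (LINT x|M. f x * u x))"
proof -
 interpret finite_measure M by fact
 have iI [simp]: "integrable M (ind A :: 'x => real)" if "A : sets M" for A using that by (simp add: integrable_indicator_iff emeasure_finite top.not_eq_extremum[symmetric])
 have FI: "\<bar>F (ind A)\<bar> <= C * measure M A" if "A : sets M" for A using bd[OF iI[OF that]] that sets.sets_into_space[OF that] by (simp add: Int_absorb2)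
 define r where "r A = F (ind A) + C * measure M A" for A
 have r: "0 <= r A" "r A <= 2 * C * measure M A" if "A : sets M" for A using FI[OF that] by (auto simp: r_def)
 have F0: "F (%_. 0) = 0" using bd[of "%_. 0"] by simp
 have add: "additive (sets M) (%A. ennreal (r A))"
 unfolding additive_def
 proof (intro ballI impI)
 fix A B assume AB: "A : sets M" "B : sets M" "A \<inter> B = {}"
 have "ind (A \<union> B) = (%x. ind A x + 1 * ind B x :: real)" using AB(3) by (auto simp: indicator_def fun_eq_iff)
 then have "F (ind (A \<union> B)) = F (ind A) + F (ind B)" using lin[OF iI iI, of A B 1] AB by simp
 then have "r (A \<union> B) = r A + r B" using AB by (simp add: r_def finite_measure_Union algebra_simps)
 then show "ennreal (r (A \<union> B)) = ennreal (r A) + ennreal (r B)" using r AB by simp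
 qed
 have pos: "positive (sets M) (%A. ennreal (r A))"
 proof -
 have "(ind {} :: 'x => real) = (%_. 0)" by auto
 then show ?thesis using F0 by (simp add: positive_def r_def)
 qed
 have ca: "countably_additive (sets M) (%A. ennreal (r A))"
 \<comment> \<open>For an additive set function continuity at the empty set suffices, and r is
   dominated by 2 C times the measure.\<close>
 proof (rule sets.empty_continuous_imp_countably_additive[OF pos add])
 fix A :: "nat => 'x set" assume A: "range A \<subseteq> sets M" "decseq A" "(\<Inter>i. A i) = {}"
 have "(%i. 2 * C * measure M (A i)) \<longlonglongrightarrow> 2 * C * 0" using finite_Lim_measure_decseq[OF A(1,2)] A(3) by (intro tendsto_intros) simp
 then have l: "(%i. 2 * C * measure M (A i)) \<longlonglongrightarrow> 0" by simp
 have "(%i. r (A i)) \<longlonglongrightarrow> 0"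
 proof (rule Lim_null_comparison[OF _ l], rule always_eventually, rule allI)
 fix i
 have "A i : sets M" using A(1) by auto
 from r[OF this] show "norm (r (A i)) <= 2 * C * measure M (A i)" by simp
 qed
 from tendsto_ennrealI[OF this] show "(%i. ennreal (r (A i))) \<longlonglongrightarrow> 0" by simp
 qed simp
 define N where "N = measure_of (space M) (sets M) (%A. ennreal (r A))"
 have sN [simp]: "sets N = sets M" "space N = space M" by (simp_all add: N_def sets.sigma_sets_eq sets.space_closed)
 have eN: "emeasure N A = ennreal (r A)" if "A : sets M" for A
 by (rule emeasure_measure_of[OF N_def sets.space_closed]) (use pos ca that in simp_all)
 have fN: "finite_measure N" by (rule finite_measureI) (simp add: eN)
 have "absolutely_continuous M N" unfolding absolutely_continuous_def
 proof
 fix A assume "A : null_sets M"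
 then have "A : sets M" "measure M A = 0" by (auto simp: null_sets_def measure_def)
 then show "A : null_sets N" using r[of A] by (auto simp: null_sets_def eN)
 qed
 from Radon_Nikodym_finite_measure[OF fN sN(1) this] obtain h where [measurable]: "h : borel_measurable M" and h: "density M h = N" by blast
 have hA: "(\<integral>\<^sup>+x. h x * ind A x \<partial>M) = ennreal (r A)" if "A : sets M" for A using eN[OF that] that unfolding h[symmetric] by (simp add: emeasure_density)
 have "AE x in M. h x ~= \<infinity>" using hA[OF sets.top] by (intro nn_integral_PInf_AE) (simp_all cong: nn_integral_cong)
 then have hf: "AE x in M. ennreal (enn2real (h x)) = h x" by eventually_elim (simp add: top.not_eq_extremum)
 have nnA: "(\<integral>\<^sup>+x. ennreal (enn2real (h x) * ind A x) \<partial>M) = ennreal (r A)" if "A : sets M" for A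
 unfolding hA[OF that, symmetric] by (rule nn_integral_cong_AE) (use hf in \<open>eventually_elim, auto simp: indicator_def\<close>)
 have ih: "integrable M (%x. enn2real (h x))"
 by (rule integrableI_bounded) (use nnA[OF sets.top] in \<open>simp_all cong: nn_integral_cong\<close>)
 have hr: "(LINT x|M. ind A x * (enn2real (h x) - C)) = F (ind A)" if "A : sets M" for A
 proof -
 have "(LINT x|M. enn2real (h x) * ind A x) = r A" by (subst integral_eq_nn_integral) (use nnA[OF that] r[OF that] that in auto)
 moreover have "(LINT x|M. ind A x * (enn2real (h x) - C)) = (LINT x|M. enn2real (h x) * ind A x) - (LINT x|M. C * ind A x)"
 by (subst ldiff[symmetric]) (use that ih in \<open>auto simp: algebra_simps intro!: integrable_real_mult_indicator\<close>)
 moreover have "(LINT x|M. C * ind A x) = C * measure M A" using that sets.sets_into_space[OF that] by (simp add: Int_absorb2)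
 ultimately show ?thesis by (simp only: r_def)
 qed
 define u0 where "u0 x = enn2real (h x) - C" for x
 have [measurable]: "u0 : borel_measurable M" and iu: "integrable M u0" unfolding u0_def using ih by auto
 \<comment> \<open>Testing F on the set where s u0 exceeds C shows that this set is null. The signs
   s = 1 and s = -1 give the two bounds.\<close>
 have sgn: "AE x in M. s * u0 x <= C" if s: "\<bar>s\<bar> = 1" for s :: real
 proof -
 let ?A = "{x : space M. s * u0 x > C}"
 have A: "?A : sets M" by measurable
 have i: "integrable M (%x. ind ?A x * (s * u0 x - C))" using iu A by (intro integrable_mult_indicator[where 'b=real, simplified]) auto
 have "(LINT x|M. ind ?A x * (s * u0 x - C)) = s * F (ind ?A) - C * measure M ?A"
 proof -
 have "(LINT x|M. ind ?A x * (s * u0 x - C)) = (LINT x|M. s * (ind ?A x * u0 x) - C * ind ?A x)" by (simp add: algebra_simps)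
 also have "... = s * (LINT x|M. ind ?A x * u0 x) - C * (LINT x|M. ind ?A x)"
  using iu A iI[OF A] integrable_mult_indicator[OF A iu] by simp
 also have "(LINT x|M. ind ?A x) = measure M ?A" using A sets.sets_into_space[OF A] by (simp add: Int_absorb2)
 finally show ?thesis using hr[OF A] by (simp add: u0_def)
 qed
 also have "... <= 0"
 proof -
 have "s * F (ind ?A) <= \<bar>s\<bar> * \<bar>F (ind ?A)\<bar>" by (simp add: abs_mult[symmetric])
 then show ?thesis using FI[OF A] s by simp
 qed
 finally have "(LINT x|M. ind ?A x * (s * u0 x - C)) = 0" by (intro antisym integral_nonneg_AE) (auto simp: indicator_def)
 then have "AE x in M. ind ?A x * (s * u0 x - C) = 0" by (subst (asm) integral_nonneg_eq_0_iff_AE[OF i]) (auto simp: indicator_def)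
 with AE_space show ?thesis by eventually_elim (auto simp: indicator_def split: if_splits)
 qed
 \<comment> \<open>Clipping changes \<open>u0\<close> on a null set only and makes the bound hold at
   every point.\<close>
 define u where "u x = max (- C) (min C (u0 x))" for x
 have [measurable]: "u : borel_measurable M" unfolding u_def by measurable
 have ub: "\<bar>u x\<bar> <= C" for x unfolding u_def using C by auto
 have uu: "AE x in M. u x = u0 x" using sgn[of 1, simplified] sgn[of "-1", simplified] by eventually_elim (auto simp: u_def)
 have iuf: "integrable M (%x. f x * u x)" if "integrable M f" for f
 by (rule ibd[OF imr[OF that, of C]]) (use ub C that in \<open>auto simp: abs_mult mult.commute[of C] intro!: mult_left_mono\<close>)
 have "F f = (LINT x|M. f x * u x)" if "integrable M f" for f
 using that
 proof (induction rule: integrable_induct)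
 case (base A c)
 have "F (%x. 0 + c * ind A x) = F (%_. 0) + c * F (ind A)" using base by (intro lin) auto
 also have "... = c * (LINT x|M. ind A x * u x)" unfolding F0 hr[OF base(1), symmetric]
 using base uu by (simp, intro disjI2 integral_cong_AE) (auto simp: u0_def)
 also have "... = (LINT x|M. ind A x *\<^sub>R c * u x)" by (simp add: mult_ac)
 finally show ?case by (simp add: mult.commute)
 next
 case (add f g)
 have "F (%x. f x + 1 * g x) = F f + 1 * F g" by (rule lin) fact+
 then show ?case using add iuf by (simp add: distrib_right)
 next
 case (lim f s)
 have n: "(%i. LINT x|M. \<bar>s i x - f x\<bar>) \<longlonglongrightarrow> (LINT x|M. 0)"
 proof (rule ldct[where w = "%x. 3 * \<bar>f x\<bar>"])
 show "AE x in M. (%i. \<bar>s i x - f x\<bar>) \<longlonglongrightarrow> 0"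
 proof (rule AE_I2)
  fix x assume "x : space M"
  from tendsto_diff[OF lim.hyps(2)[OF this] tendsto_const[of "f x"]] show "(%i. \<bar>s i x - f x\<bar>) \<longlonglongrightarrow> 0" by (intro tendsto_rabs_zero) simp
 qed
 show "AE x in M. norm \<bar>s i x - f x\<bar> <= 3 * \<bar>f x\<bar>" for i
 proof (rule AE_I2)
  fix x assume "x : space M"
  from lim.hyps(3)[OF this, of i] show "norm \<bar>s i x - f x\<bar> <= 3 * \<bar>f x\<bar>" using abs_triangle_ineq4[of "s i x" "f x"] by simp
 qed
 qed (use lim.hyps(1,4) in auto)
 have d: "\<bar>F (s i) - F f\<bar> <= C * (LINT x|M. \<bar>s i x - f x\<bar>)" for i
 using lin[OF lim.hyps(1)[of i] lim.hyps(4), of "-1"] bd[of "%x. s i x + (-1) * f x"] lim.hyps(1)[of i] lim.hyps(4) by simp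
 have "(%i. F (s i) - F f) \<longlonglongrightarrow> 0"
 by (rule Lim_null_comparison[of _ "%i. C * (LINT x|M. \<bar>s i x - f x\<bar>)"]) (use d tendsto_mult_right_zero[OF n[simplified]] in \<open>auto intro: always_eventually\<close>)
 then have 1: "(%i. F (s i)) \<longlonglongrightarrow> F f" by (simp add: LIM_zero_iff)
 have "(%i. LINT x|M. s i x * u x) \<longlonglongrightarrow> (LINT x|M. f x * u x)"
 proof (rule ldct[where w = "%x. C * (2 * \<bar>f x\<bar>)"])
 show "AE x in M. (%i. s i x * u x) \<longlonglongrightarrow> f x * u x" by (rule AE_I2) (use lim.hyps(2) in \<open>auto intro!: tendsto_intros\<close>)
 show "AE x in M. norm (s i x * u x) <= C * (2 * \<bar>f x\<bar>)" for i
  by (rule AE_I2) (use lim.hyps(3)[of _ i] ub C in \<open>auto simp: abs_mult mult.commute[of _ "\<bar>u _\<bar>"] intro!: mult_mono\<close>)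
 qed (use lim.hyps(1,4) in auto)
 then have "(%i. F (s i)) \<longlonglongrightarrow> (LINT x|M. f x * u x)" using lim.IH by simp
 from LIMSEQ_unique[OF 1 this] show ?case .
 qed
 then show ?thesis using ub by (intro bexI[of _ u]) auto
qed

text \<open>\<open>L1_dual_finite\<close> needs a finite measure. The positive integrable function
  \<open>q\<close> is taken as a density of \<open>Q\<close>, and writing f = q (f / q) identifies
  the integrable functions for Lebesgue measure with those for \<open>Q\<close>.\<close>

theorem dominated_functional:
 fixes G0 :: "(('c::euclidean_space => real) \<times> real) set"
 assumes lg: "lin_graph G0" and C: "C >= 0" and dom: "!!f a. (f, a) : G0 ==> ilb f & a <= C * (LL x. \<bar>f x\<bar>)"
 shows "\<exists>u\<in>bm. (ALL x. \<bar>u x\<bar> <= C) & (\<forall>(f, a)\<in>G0. (LL x. f x * u x) = a)"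
proof -
 let ?p = "%f::'c => real. C * (LL x. \<bar>f x\<bar>)"
 obtain G where G: "lin_graph G" "G0 \<subseteq> G" "!!f a. (f, a) : G ==> f : {f. ilb f} & a <= ?p f" "!!f. f : {f. ilb f} ==> EX a. (f, a) : G"
 proof (rule hahn_banach[OF _ _ _ lg, of "{f. ilb f}" ?p])
 fix f g :: "'c => real" assume fg: "f : {f. ilb f}" "g : {f. ilb f}"
 have "(LL x. \<bar>f x + g x\<bar>) <= (LL x. \<bar>f x\<bar> + \<bar>g x\<bar>)" using fg by (intro integral_mono) auto
 also have "... = (LL x. \<bar>f x\<bar>) + (LL x. \<bar>g x\<bar>)" using fg by simp
 finally show "?p (%x. f x + g x) <= ?p f + ?p g" using mult_left_mono[OF _ C] by (simp only: distrib_left[symmetric])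
 qed (use dom in \<open>auto simp: abs_mult\<close>)
 have lin: "!!f a g b c. (f, a) : G ==> (g, b) : G ==> ((%x. f x + c * g x), a + c * b) : G" using G(1) unfolding lin_graph_def by blast
 define F where "F f = (SOME a. (f, a) : G)" for f
 have F: "(f, F f) : G" if "ilb f" for f unfolding F_def by (rule someI_ex) (use G(4) that in simp)
 have uniq: "a = b" if "(f, a) : G" "(f, b) : G" for f a b
 using G(3)[OF lin[OF that, of "-1"]] G(3)[OF lin[OF that(2,1), of "-1"]] by simp
 have Flin: "F (%x. f x + c * g x) = F f + c * F g" if "ilb f" "ilb g" for f g c
 by (rule uniq[OF F lin[OF F F]]) (use that in auto)
 have Fbd: "\<bar>F f\<bar> <= ?p f" if f: "ilb f" for f
 proof -
 have "F f <= ?p f" using G(3)[OF F[OF f]] by simp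
 \<comment> \<open>The domination is one-sided; f + (-2) f stands for -f and gives the other
   side.\<close>
 moreover have "F f + (-2) * F f <= ?p (%x. f x + (-2) * f x)" using G(3)[OF lin[OF F[OF f] F[OF f], of "-2"]] by simp
 ultimately show ?thesis by simp
 qed
 define q where "q x = (weight 1 x)^2" for x :: 'c
 have q0: "q x > 0" for x unfolding q_def using weight_pos[of 1 x] by simp
 have [measurable]: "q : bm" unfolding q_def using C1_borel(1)[OF weight_C1[of 1, where 'a='c]] by measurable
 have qi: "ilb q" unfolding q_def by (rule weight_integrable) simp
 define Q where "Q = density lborel q"
 have iQ: "integrable Q f \<longleftrightarrow> f : bm & ilb (%x. q x * f x)" for f :: "'c => real"
 unfolding Q_def using q0 by (cases "f : bm") (auto simp: integrable_density less_imp_le dest: borel_measurable_integrable)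
 have LQ: "(LINT x|Q. f x) = (LL x. q x * f x)" if "f : bm" for f :: "'c => real"
 unfolding Q_def using q0 that by (simp add: integral_density less_imp_le)
 have "finite_measure Q"
 by (rule finite_measureI) (use integrableD(2)[OF qi] q0 in \<open>simp add: Q_def emeasure_density less_imp_le top.not_eq_extremum\<close>)
 have "\<exists>u\<in>borel_measurable Q. (ALL x. \<bar>u x\<bar> <= C) & (ALL f. integrable Q f --> F (%x. q x * f x) = (LINT x|Q. f x * u x))"
 proof (rule L1_dual_finite[OF \<open>finite_measure Q\<close> C])
 fix f g :: "'c => real" and c assume fg: "integrable Q f" "integrable Q g"
 show "F (%x. q x * (f x + c * g x)) = F (%x. q x * f x) + c * F (%x. q x * g x)"
 using Flin[of "%x. q x * f x" "%x. q x * g x" c] fg by (simp add: iQ algebra_simps)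
 next
 fix f :: "'c => real" assume f: "integrable Q f"
 then have "(LINT x|Q. \<bar>f x\<bar>) = (LL x. q x * \<bar>f x\<bar>)" by (intro LQ borel_measurable_abs) (simp add: iQ)
 with f show "\<bar>F (%x. q x * f x)\<bar> <= C * (LINT x|Q. \<bar>f x\<bar>)"
 using Fbd[of "%x. q x * f x"] q0 by (simp add: iQ abs_mult less_imp_le)
 qed
 then obtain u where u: "u : bm" "!!x. \<bar>u x\<bar> <= C" "!!f. integrable Q f ==> F (%x. q x * f x) = (LINT x|Q. f x * u x)"
 by (auto simp: Q_def)
 have "(LL x. f x * u x) = a" if fa: "(f, a) : G0" for f a
 proof -
 have f: "ilb f" using dom[OF fa] by blast
 then have [measurable]: "f : bm" by auto
 have q': "q x ~= 0" for x using q0[of x] by simp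
 have e: "q x * (f x / q x) = f x" "q x * (f x / q x * u x) = f x * u x" for x using q0[of x] by auto
 have "F (%x. q x * (f x / q x)) = (LINT x|Q. f x / q x * u x)" by (rule u(3)) (use f q' in \<open>simp add: iQ\<close>)
 then have "F f = (LL x. f x * u x)" using u(1) q' by (simp add: LQ)
 moreover have "F f = a" by (rule uniq[OF F[OF f]]) (use fa G(2) in blast)
 ultimately show ?thesis by simp
 qed
 then show ?thesis using u by (intro bexI[of _ u]) auto
qed

section \<open>Existence\<close>

text \<open>The first coordinate attains its maximum on a compact subset of [0,T) x R^n, so the
  support keeps a positive distance \<open>de\<close> from T; boundedness gives the radius.\<close>

lemma spacetime_test_function_iff:
 fixes ph :: "real \<times> 'a::euclidean_space => real"
 assumes T: "T > 0"
 shows "spacetime_test_function T ph \<longleftrightarrow> smooth ph & (EX r de. de > 0 & (\<forall>t\<in>{0..T}. ALL x. norm x >= r \<or> t > T - de --> ph (t, x) = 0))"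
proof -
 let ?A = "{p : {0..T} \<times> UNIV. ph p ~= 0}"
 have "(EX r de. de > 0 & (\<forall>t\<in>{0..T}. ALL x. norm x >= r \<or> t > T - de --> ph (t, x) = 0))"
 if c: "compact (closure ?A)" and s: "closure ?A \<subseteq> {0..<T} \<times> UNIV"
 proof -
 obtain r where r: "!!z. z : closure ?A ==> norm z <= r" using compact_imp_bounded[OF c] by (auto simp: bounded_iff)
 have "\<exists>de>0. \<forall>z\<in>closure ?A. fst z <= T - de"
 proof (cases "closure ?A = {}")
 case False
 have "compact (fst ` closure ?A)" by (intro compact_continuous_image continuous_on_fst continuous_on_id c)
 moreover have "fst ` closure ?A ~= {}" using False by (simp only: image_is_empty not_False_eq_True)
 ultimately have "\<exists>m\<in>fst ` closure ?A. \<forall>s\<in>fst ` closure ?A. s <= m" by (rule compact_attains_sup)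
 then obtain m where m: "m : fst ` closure ?A" "\<forall>s\<in>fst ` closure ?A. s <= m" by (rule bexE)
 from m(1) obtain z where "z : closure ?A" "m = fst z" by (rule imageE)
 then have "m < T" using subsetD[OF s, of z] by (simp add: mem_Times_iff)
 then show ?thesis using m(2) by (intro exI[of _ "T - m"]) simp
 next
 case True
 show ?thesis unfolding True by (intro exI[of _ 1]) simp
 qed
 then obtain de where de: "de > 0" "!!z. z : closure ?A ==> fst z <= T - de" by blast
 have "ph (t, x) = 0" if t: "t : {0..T}" and *: "norm x >= r + 1 \<or> t > T - de" for t x
 proof (rule ccontr)
 assume "ph (t, x) ~= 0"
 then have "(t, x) : closure ?A" using t by (intro subsetD[OF closure_subset]) auto
 from r[OF this] de(2)[OF this] * show False using norm_snd_le[of x t] by auto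
 qed
 then show ?thesis using de(1) by blast
 qed
 moreover have "compact (closure ?A) & closure ?A \<subseteq> {0..<T} \<times> UNIV"
 if de: "de > 0" and v: "!!t x. t : {0..T} ==> norm x >= r \<or> t > T - de ==> ph (t, x) = 0" for r de
 proof -
 let ?B = "{0..T - de} \<times> cball (0::'a) r"
 have B: "compact ?B" by (intro compact_Times) auto
 have "?A \<subseteq> ?B"
 proof
 fix z assume "z : ?A"
 then obtain t x where z: "z = (t, x)" "t : {0..T}" "ph (t, x) ~= 0" by (cases z) auto
 then have "~ norm x >= r" "~ t > T - de" using v by blast+
 then show "z : ?B" using z by auto
 qed
 then have "closure ?A \<subseteq> ?B" by (rule closure_minimal) (use B compact_imp_closed in blast)
 moreover have "compact (closure ?A)" unfolding compact_closure by (rule bounded_subset[OF compact_imp_bounded[OF B] \<open>?A \<subseteq> ?B\<close>])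
 ultimately show ?thesis using de by auto
 qed
 ultimately show ?thesis unfolding spacetime_test_function_def Let_def by blast
qed

section \<open>Slices of smooth functions on space-time\<close>

lemma norm_components: "norm (fst z) <= norm z" "norm (snd z) <= norm z"
 using norm_fst_le[of "fst z" "snd z"] norm_snd_le[of "snd z" "fst z"] by auto

lemma grad_lincomb:
 fixes f g :: "'a::euclidean_space => real"
 assumes "smooth f" "smooth g" shows "grad (%x. f x + c * g x) x = grad f x + c *\<^sub>R grad g x"
proof -
 have "C1 (%x. f x + c * g x) (%x. grad f x + c *\<^sub>R grad g x)" by (intro C1_add C1_cmult smooth_C1 assms)
 from C1_grad[OF this] show ?thesis by simp
qed

lemma smooth_slices:
 fixes ph :: "real \<times> 'a::euclidean_space => real"
 assumes s: "smooth ph"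
 shows "((%s. ph (s, x)) has_real_derivative fst (grad ph (t, x))) (at t)" "C1 (%x. ph (t, x)) (%x. snd (grad ph (t, x)))"
 "continuous_on UNIV ph" "continuous_on UNIV (grad ph)"
proof -
 have C: "C1 ph (grad ph)" by (rule smooth_C1[OF s])
 show c: "continuous_on UNIV ph" "continuous_on UNIV (grad ph)" using C1_continuous[OF C] C1_continuous_grad[OF C] by auto
 have D: "(ph has_derivative (%h. grad ph z \<bullet> h)) (at z)" for z using C unfolding C1_def by blast
 have "((%s. (s, x)) has_derivative (%h. (h, 0))) (at t)" by (auto intro!: derivative_eq_intros)
 from has_derivative_compose[OF this D] show "((%s. ph (s, x)) has_real_derivative fst (grad ph (t, x))) (at t)"
 by (simp add: has_field_derivative_def inner_prod_def mult_commute_abs cong: if_cong)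
 show "C1 (%x. ph (t, x)) (%x. snd (grad ph (t, x)))"
 proof (rule C1I)
 fix x :: 'a
 have "((%x. (t, x)) has_derivative (%h. (0, h))) (at x)" by (auto intro!: derivative_eq_intros)
 from has_derivative_compose[OF this D] show "((%x. ph (t, x)) has_derivative (%h. snd (grad ph (t, x)) \<bullet> h)) (at x)" by (simp add: inner_prod_def)
 show "continuous_on UNIV (%x. snd (grad ph (t, x)))"
 by (intro continuous_on_snd continuous_on_compose2[OF c(2)] continuous_intros) auto
 qed simp
qed

section \<open>The backward equation for test functions\<close>

locale div_field = field T b M for T and b :: "real => 'a::euclidean_space => 'a" and M +
 fixes d :: "real => 'a => real"
 assumes d_borel [measurable]: "(%(t, x). d t x) : bm2"
 and d_trace: "AL t. t : {0<..<T} --> (ALL G. (\<forall>j\<in>Basis. weak_grad (%x. b t x \<bullet> j) (G j)) --> (AL x. d t x = (\<Sum>i\<in>Basis. G i x \<bullet> i)))"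
begin

lemma d_slice [measurable]: "d t : bm" "b t : bm" by measurable

lemma div_ae: "AL t. t : {0<..<T} --> wdiv (b t) (d t) &
 (\<forall>k::nat. (NN x. ennreal (ib (real k) x * (norm (b t x) + \<bar>d t x\<bar>))) <= M k t)"
 using gradients d_trace
proof (eventually_elim, intro impI)
 fix t assume *: "t : {0<..<T} --> (EX G. (\<forall>j\<in>Basis. weak_grad (%x. b t x \<bullet> j) (G j)) &
  (ALL k. (NN x. ennreal (ib (real k) x * (norm (b t x) + (\<Sum>j\<in>Basis. norm (G j x))))) <= M k t))"
 "t : {0<..<T} --> (ALL G. (\<forall>j\<in>Basis. weak_grad (%x. b t x \<bullet> j) (G j)) --> (AL x. d t x = (\<Sum>i\<in>Basis. G i x \<bullet> i)))" and t: "t : {0<..<T}"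
 from *(1) t obtain G where G: "!!j. j : Basis ==> weak_grad (%x. b t x \<bullet> j) (G j)"
 "!!k. (NN x. ennreal (ib (real k) x * (norm (b t x) + (\<Sum>j\<in>Basis. norm (G j x))))) <= M k t" by auto
 have tr: "AL x. d t x = (\<Sum>i\<in>Basis. G i x \<bullet> i)" using *(2) t G(1) by blast
 obtain C where C: "C >= 0" "!!e. e > 0 ==> (LL x. norm x * norm (grad (moll e) (x::'a))) <= C" using grad_moll_bound by metis
 \<comment> \<open>With w = 0 the locale still supplies the facts about b and d.\<close>
 interpret static "%_. 0" "b t" G "d t" 0 C by unfold_locales (use G(1) tr C in auto)
 have "wdiv (b t) (d t)" unfolding wdiv_def using b_loc_int d_loc_int weak_div by blast
 moreover have "(NN x. ennreal (ib (real k) x * (norm (b t x) + \<bar>d t x\<bar>))) <= M k t" for k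
 proof (rule order_trans[OF nn_integral_mono_AE G(2)], use tr in eventually_elim)
 case (elim x)
 have "\<bar>d t x\<bar> <= (\<Sum>j\<in>Basis. norm (G j x))" unfolding elim
 by (rule order_trans[OF sum_abs sum_mono]) (use Basis_le_norm in auto)
 then show ?case by (intro ennreal_leI mult_left_mono add_left_mono) auto
 qed
 ultimately show "wdiv (b t) (d t) & (ALL k. (NN x. ennreal (ib (real k) x * (norm (b t x) + \<bar>d t x\<bar>))) <= M k t)" by blast
qed

text \<open>The common majorant of all space-time integrands that occur: supported in a ball and
  linear in 1, |b| and |d|. Its integral in time is controlled by \<open>M k\<close>.\<close>

lemma spacetime_integrable:
 fixes g :: "real \<times> 'a => real"
 assumes [measurable]: "g : bm" and A: "A >= 0"
 and g: "!!t x. \<bar>g (t, x)\<bar> <= iT T t * (ib (real k) x * (A * (1 + norm (b t x) + \<bar>d t x\<bar>)))"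
 shows "ilb g"
proof (rule integrableI_bounded)
 have [measurable]: "g : bm2" by (simp add: borel_prod)
 let ?v = "emeasure lborel (ball (0::'a) (real k))"
 have v: "?v < \<infinity>" using emeasure_bounded_finite[of "ball (0::'a) (real k)"] by simp
 have "(NN z. ennreal (norm (g z))) = (NN t. \<integral>\<^sup>+x. ennreal (norm (g (t, x))) \<partial>lborel)"
 unfolding lborel_prod[symmetric] by (subst lborel.nn_integral_fst[symmetric]) auto
 also have "... <= (NN t. ennreal A * (?v * iT T t + M k t * iT T t))"
 proof (rule nn_integral_mono_AE, use div_ae in eventually_elim)
 case (elim t)
 show ?case
 proof (cases "t : {0<..<T}")
 case True
 have "(NN x. ennreal (norm (g (t, x))))
  <= (NN x. ennreal A * (ib (real k) x + ennreal (ib (real k) x * (norm (b t x) + \<bar>d t x\<bar>))))"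
 proof (rule nn_integral_mono)
  fix x :: 'a
  have "ennreal (norm (g (t, x))) <= ennreal (A * (ib (real k) x + ib (real k) x * (norm (b t x) + \<bar>d t x\<bar>)))"
  using g[of t x] True by (intro ennreal_leI) (simp add: algebra_simps)
  also have "... = ennreal A * (ib (real k) x + ennreal (ib (real k) x * (norm (b t x) + \<bar>d t x\<bar>)))"
  using A by (simp add: ennreal_mult ennreal_indicator)
  finally show "ennreal (norm (g (t, x))) <= ..." .
 qed
 also have "... = ennreal A * (?v + (NN x. ennreal (ib (real k) x * (norm (b t x) + \<bar>d t x\<bar>))))"
  by (simp add: nn_integral_cmult nn_integral_add)
 also have "... <= ennreal A * (?v + M k t)" using elim True by (intro mult_left_mono add_left_mono) auto
 finally show ?thesis using True by simp
 next
 case False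
 then have "g (t, x) = 0" for x using g[of t x] by simp
 then show ?thesis by simp
 qed
 qed
 also have "... = ennreal A * (?v * ennreal T + (\<integral>\<^sup>+t\<in>{0<..<T}. M k t \<partial>lborel))"
 using T by (simp add: nn_integral_cmult nn_integral_add nn_integral_cmult_indicator)
 also have "... < \<infinity>" using v M_fin[of k] by (simp add: ennreal_mult_less_top)
 finally show "(NN z. ennreal (norm (g z))) < \<infinity>" .
qed simp

text \<open>The backward operator f_t + div (b f), cut off to 0 < t < T; the divergence is expanded
  by the product rule.\<close>

definition transport :: "(real \<times> 'a => real) => real \<times> 'a => real" where
 "transport ph = (%(t, x). iT T t * (fst (grad ph (t, x)) + (ph (t, x) * d t x + snd (grad ph (t, x)) \<bullet> b t x)))"

lemma test_support:
 fixes ph :: "real \<times> 'a => real"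
 assumes ph: "spacetime_test_function T ph"
 obtains A and k :: nat where "A >= 0" "!!t x. t : {0<..<T} ==> x \<notin> ball 0 (real k) ==> ph (t, x) = 0 & grad ph (t, x) = 0"
 "!!x. x \<notin> ball 0 (real k) ==> ph (0, x) = 0" "!!x. ph (T, x) = 0"
 "!!t x. t : {0<..<T} ==> \<bar>ph (t, x)\<bar> <= A & norm (grad ph (t, x)) <= A"
 "!!t. t : {0<..<T} ==> C1c (%x. ph (t, x)) (%x. snd (grad ph (t, x)))"
proof -
 obtain r de where s: "smooth ph" and de: "de > 0" and v: "!!t x. t : {0..T} ==> norm x >= r \<or> t > T - de ==> ph (t, x) = 0"
 using ph unfolding spacetime_test_function_iff[OF T] by blast
 obtain k :: nat where k: "r + 1 <= real k" using real_arch_simple by blast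
 note sl = smooth_slices[OF s]
 have far: "ph (t, x) = 0 & grad ph (t, x) = 0" if "t : {0<..<T}" "x \<notin> ball 0 (real k)" for t x
 proof
 \<comment> \<open>The support condition controls \<open>ph\<close> only for times in [0,T], so the
   vanishing of the full gradient is derived on an open set of times.\<close>
 have op: "open ({0<..<T} \<times> - cball (0::'a) r)" by (intro open_Times) auto
 show "ph (t, x) = 0" using v that k by auto
 show "grad ph (t, x) = 0" by (rule C1_zero_open[OF smooth_C1[OF s] op]) (use v that k in auto)
 qed
 have cp: "compact ({0..T} \<times> cball (0::'a) (real k))" by (intro compact_Times) auto
 have "bounded (ph ` ({0..T} \<times> cball 0 (real k)))" "bounded (grad ph ` ({0..T} \<times> cball 0 (real k)))"
 using compact_continuous_image[OF continuous_on_subset[OF sl(3)] cp] compact_continuous_image[OF continuous_on_subset[OF sl(4)] cp] compact_imp_bounded by blast+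
 then obtain A1 A2 where A: "!!z. z : {0..T} \<times> cball 0 (real k) ==> norm (ph z) <= A1" "!!z. z : {0..T} \<times> cball 0 (real k) ==> norm (grad ph z) <= A2"
 unfolding bounded_iff by blast
 define A where "A = max 0 (max A1 A2)"
 show thesis
 proof (rule that[of A k])
 show "A >= 0" by (simp add: A_def)
 show "ph (t, x) = 0 & grad ph (t, x) = 0" if "t : {0<..<T}" "x \<notin> ball 0 (real k)" for t x by (rule far[OF that])
 show "ph (0, x) = 0" if "x \<notin> ball 0 (real k)" for x using v[of 0 x] that k T by simp
 show "ph (T, x) = 0" for x using v[of T x] de T by simp
 show "\<bar>ph (t, x)\<bar> <= A & norm (grad ph (t, x)) <= A" if t: "t : {0<..<T}" for t x
 proof (cases "x : ball 0 (real k)")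
 case True
 then have "(t, x) : {0..T} \<times> cball 0 (real k)" using t by auto
 from A(1)[OF this] A(2)[OF this] show ?thesis by (auto simp: A_def)
 qed (use far[OF t] in \<open>auto simp: A_def\<close>)
 show "C1c (%x. ph (t, x)) (%x. snd (grad ph (t, x)))" if t: "t : {0<..<T}" for t
 by (rule C1cI[OF sl(2), of "real k"]) (use far[OF t] in auto)
 qed
qed

lemma smooth_measurable:
 assumes "smooth ph"
 shows "ph : bm2" "grad ph : (borel \<Otimes>\<^sub>M borel) \<rightarrow>\<^sub>M (borel \<Otimes>\<^sub>M borel :: (real \<times> 'a) measure)"
 using borel_measurable_continuous_onI[OF smooth_slices(3)[OF assms]] borel_measurable_continuous_onI[OF smooth_slices(4)[OF assms]]
 by (auto simp: borel_prod)

lemma transport_integrable: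
 assumes ph: "spacetime_test_function T ph" shows "ilb (transport ph)"
proof -
 have s: "smooth ph" using ph by (simp add: spacetime_test_function_def)
 note [measurable] = smooth_measurable[OF s]
 obtain A and k :: nat where ts: "A >= 0" "!!t x. t : {0<..<T} ==> x \<notin> ball 0 (real k) ==> ph (t, x) = 0 & grad ph (t, x) = 0"
 "!!x. x \<notin> ball 0 (real k) ==> ph (0, x) = 0" "!!x. ph (T, x) = 0"
 "!!t x. t : {0<..<T} ==> \<bar>ph (t, x)\<bar> <= A & norm (grad ph (t, x)) <= A"
 "!!t. t : {0<..<T} ==> C1c (%x. ph (t, x)) (%x. snd (grad ph (t, x)))"
 by (rule test_support[OF ph]) (rule that; (assumption | blast | simp))
 note A = ts(1) and far = ts(2) and bd = ts(5)
 show ?thesis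
 proof (rule spacetime_integrable[OF _ A])
 show "transport ph : bm" unfolding transport_def borel_prod[symmetric] by measurable
 fix t :: real and x :: 'a
 show "\<bar>transport ph (t, x)\<bar> <= iT T t * (ib (real k) x * (A * (1 + norm (b t x) + \<bar>d t x\<bar>)))"
 proof (cases "t : {0<..<T} & x : ball 0 (real k)")
 case True
 have p: "\<bar>ph (t, x)\<bar> <= A" "norm (grad ph (t, x)) <= A" using bd True by auto
 have "\<bar>fst (grad ph (t, x))\<bar> <= A" using norm_components(1)[of "grad ph (t, x)"] p by simp
 moreover have "\<bar>ph (t, x) * d t x\<bar> <= A * \<bar>d t x\<bar>" using p by (simp add: abs_mult mult_right_mono)
 moreover have "\<bar>snd (grad ph (t, x)) \<bullet> b t x\<bar> <= A * norm (b t x)"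
  by (rule order_trans[OF Cauchy_Schwarz_ineq2 mult_right_mono]) (use norm_components(2)[of "grad ph (t, x)"] p in auto)
 ultimately have "\<bar>fst (grad ph (t, x)) + (ph (t, x) * d t x + snd (grad ph (t, x)) \<bullet> b t x)\<bar> <= A + (A * \<bar>d t x\<bar> + A * norm (b t x))"
  by (intro order_trans[OF abs_triangle_ineq] add_mono)
 then show ?thesis using True by (simp add: transport_def algebra_simps)
 qed (use far in \<open>auto simp: transport_def indicator_def\<close>)
 qed
qed

text \<open>Put be(y) = sqrt(y^2 + de^2) - de and multiply the operator by be'(ph), a number of
  modulus at most 1. The t-derivative of be(ph) integrates to minus its initial value, the
  divergence of b be(ph) integrates to 0, and the defect (be - y be') d is at most de |d| on a fixed
  ball.\<close>

lemma initial_bound: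
 assumes ph: "spacetime_test_function T ph"
 shows "(LL x. \<bar>ph (0, x)\<bar>) <= (LL z. \<bar>transport ph z\<bar>)"
proof -
 have s: "smooth ph" using ph by (simp add: spacetime_test_function_def)
 note [measurable] = smooth_measurable[OF s] and sl = smooth_slices[OF s]
 obtain A and k :: nat where ts: "A >= 0" "!!t x. t : {0<..<T} ==> x \<notin> ball 0 (real k) ==> ph (t, x) = 0 & grad ph (t, x) = 0"
 "!!x. x \<notin> ball 0 (real k) ==> ph (0, x) = 0" "!!x. ph (T, x) = 0"
 "!!t x. t : {0<..<T} ==> \<bar>ph (t, x)\<bar> <= A & norm (grad ph (t, x)) <= A"
 "!!t. t : {0<..<T} ==> C1c (%x. ph (t, x)) (%x. snd (grad ph (t, x)))"
 by (rule test_support[OF ph]) (rule that; (assumption | blast | simp))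
 note A = ts(1) and far = ts(2) and far0 = ts(3) and end0 = ts(4) and bd = ts(5) and C1c = ts(6)
 define D where "D = (LL z. (%(t, x). iT T t * (ib (real k) x * \<bar>d t x\<bar>)) (z :: real \<times> 'a))"
 have iD: "ilb (%(t, x :: 'a). iT T t * (ib (real k) x * \<bar>d t x\<bar>))"
 by (rule spacetime_integrable[where A=1 and k=k], unfold borel_prod[symmetric], measurable) (auto simp: indicator_def)
 define v where "v = measure lborel (ball (0::'a) (real k))"
 have fv: "emeasure lborel (ball (0::'a) (real k)) < \<infinity>" using emeasure_bounded_finite[of "ball (0::'a) (real k)"] by simp
 have v0: "v >= 0" "D >= 0" unfolding v_def D_def by (auto intro!: integral_nonneg_AE)
 have main: "(LL x. \<bar>ph (0, x)\<bar>) <= (LL z. \<bar>transport ph z\<bar>) + de * (D + v)" if de: "de > 0" for de :: real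
 proof -
 define be where "be y = sqrt (y\<^sup>2 + de\<^sup>2) - de" for y
 define be' where "be' y = y / sqrt (y\<^sup>2 + de\<^sup>2)" for y
 have pos: "y\<^sup>2 + de\<^sup>2 > 0" for y using de by (simp add: add_nonneg_pos)
 have sq: "sqrt (y\<^sup>2 + de\<^sup>2) >= de" "sqrt (y\<^sup>2 + de\<^sup>2) >= \<bar>y\<bar>" for y using de by (auto intro: real_le_rsqrt)
 have dbe: "(be has_real_derivative be' y) (at y)" for y unfolding be_def be'_def
 using pos[of y] by (auto intro!: derivative_eq_intros simp: field_simps)
 have cbe: "continuous_on UNIV be'" unfolding be'_def by (intro continuous_intros) (use pos in \<open>auto simp: less_le\<close>)
 have [measurable]: "be : bm" "be' : bm" unfolding be_def be'_def by measurable
 have be0: "be 0 = 0" using de by (simp add: be_def)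
 have q: "\<bar>y / s\<bar> <= 1" if "\<bar>y\<bar> <= s" "s > 0" for y s :: real using that by (simp add: abs_divide)
 have be: "\<bar>y\<bar> - de <= be y" "\<bar>be' y\<bar> <= 1" for y
 proof -
 show "\<bar>y\<bar> - de <= be y" using sq[of y] by (simp add: be_def)
 show "\<bar>be' y\<bar> <= 1" unfolding be'_def by (rule q) (use sq[of y] de in linarith)+
 qed
 have be4: "\<bar>be y - be' y * y\<bar> <= de" for y
 proof -
 let ?s = "sqrt (y\<^sup>2 + de\<^sup>2)"
 have s0: "?s > 0" using sq(1)[of y] de by linarith
 have ss: "?s * ?s = y\<^sup>2 + de\<^sup>2" using pos[of y] by simp
 have "s - de - y / s * y = de\<^sup>2 / s - de" if "s * s = y\<^sup>2 + de\<^sup>2" "s > 0" for s using that by (simp add: field_simps power2_eq_square)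
 from this[OF ss s0] have "be y - be' y * y = de\<^sup>2 / ?s - de" unfolding be_def be'_def .
 moreover have "de\<^sup>2 / ?s <= de" using sq(1)[of y] de s0 by (simp add: field_simps power2_eq_square)
 moreover have "de\<^sup>2 / ?s >= 0" using s0 by simp
 ultimately show ?thesis using de by linarith
 qed
 have be3: "\<bar>be y\<bar> <= \<bar>y\<bar>" for y using sq[of y] sqrt_add_le_add_sqrt[of "y\<^sup>2" "de\<^sup>2"] de by (simp add: be_def)
 let ?I = "iT T :: real => real"
 \<comment> \<open>\<open>J1\<close> is the time derivative of be(ph), and \<open>J2\<close> below
   is the divergence of b be(ph).\<close>
 define J1 where "J1 = (%(t, x). ?I t * (be' (ph (t, x)) * fst (grad ph (t, x))))"
 define J2 where "J2 = (%(t, x). ?I t * (be' (ph (t, x)) * (snd (grad ph (t, x)) \<bullet> b t x) + be (ph (t, x)) * d t x))"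
 have mJ: "J1 : bm" "J2 : bm" unfolding J1_def J2_def borel_prod[symmetric] by measurable
 have iJ1: "ilb J1"
 proof (rule spacetime_integrable[OF mJ(1) A])
 fix t :: real and x :: 'a
 show "\<bar>J1 (t, x)\<bar> <= ?I t * (ib (real k) x * (A * (1 + norm (b t x) + \<bar>d t x\<bar>)))"
 proof (cases "t : {0<..<T} & x : ball 0 (real k)")
  case True
  have "\<bar>fst (grad ph (t, x))\<bar> <= A" using norm_components(1)[of "grad ph (t, x)"] bd[of t x] True by simp
  then have "\<bar>be' (ph (t, x))\<bar> * \<bar>fst (grad ph (t, x))\<bar> <= 1 * A" by (intro mult_mono be) auto
  also have "... <= A * (1 + norm (b t x) + \<bar>d t x\<bar>)" using A by (simp add: algebra_simps)
  finally show ?thesis using True by (simp add: J1_def abs_mult)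
 qed (use far in \<open>auto simp: J1_def indicator_def\<close>)
 qed
 have iJ2: "ilb J2"
 proof (rule spacetime_integrable[OF mJ(2) A])
 fix t :: real and x :: 'a
 show "\<bar>J2 (t, x)\<bar> <= ?I t * (ib (real k) x * (A * (1 + norm (b t x) + \<bar>d t x\<bar>)))"
 proof (cases "t : {0<..<T} & x : ball 0 (real k)")
  case True
  have p: "\<bar>ph (t, x)\<bar> <= A" "norm (grad ph (t, x)) <= A" using bd True by auto
  have "\<bar>snd (grad ph (t, x)) \<bullet> b t x\<bar> <= A * norm (b t x)"
  by (rule order_trans[OF Cauchy_Schwarz_ineq2 mult_right_mono]) (use norm_components(2)[of "grad ph (t, x)"] p in auto)
  then have "\<bar>be' (ph (t, x)) * (snd (grad ph (t, x)) \<bullet> b t x)\<bar> <= 1 * (A * norm (b t x))" unfolding abs_mult by (intro mult_mono be) auto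
  moreover have "\<bar>be (ph (t, x)) * d t x\<bar> <= A * \<bar>d t x\<bar>" using p order_trans[OF be3 p(1)] by (simp add: abs_mult mult_right_mono)
  ultimately have "\<bar>be' (ph (t, x)) * (snd (grad ph (t, x)) \<bullet> b t x) + be (ph (t, x)) * d t x\<bar> <= 1 * (A * norm (b t x)) + A * \<bar>d t x\<bar>"
  by (intro order_trans[OF abs_triangle_ineq] add_mono)
  also have "... <= A * (1 + norm (b t x) + \<bar>d t x\<bar>)" using A by (simp add: algebra_simps)
  finally show ?thesis using True by (simp add: J2_def)
 qed (use far in \<open>auto simp: J2_def indicator_def be0\<close>)
 qed
 have "(LL z. J1 z) = (LL x. LL t. J1 (t, x))"
 proof -
 have "integrable (lborel \<Otimes>\<^sub>M lborel) (%(t, x). J1 (t, x))" using iJ1 by (simp add: lborel_prod)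
 from lborel_pair.integral_snd[OF this] show ?thesis by (simp add: lborel_prod)
 qed
 also have "... = (LL x. - be (ph (0, x)))"
 proof (rule arg_cong[where f = "integral\<^sup>L lborel"], rule ext)
 fix x :: 'a
 have ct: "continuous_on UNIV (%t. be' (ph (t, x)) * fst (grad ph (t, x)))"
  by (intro continuous_intros continuous_on_compose2[OF cbe] continuous_on_compose2[OF sl(3)] continuous_on_compose2[OF sl(4)]) auto
 note [measurable] = borel_measurable_continuous_onI[OF ct]
 have "(LL t. J1 (t, x)) = (LL t. be' (ph (t, x)) * fst (grad ph (t, x)) * ind {0..T} t)"
 proof (rule integral_cong_AE)
  show "(%t. J1 (t, x)) : borel_measurable lborel" unfolding J1_def case_prod_conv by measurable
  show "(%t. be' (ph (t, x)) * fst (grad ph (t, x)) * ind {0..T} t) : borel_measurable lborel" by measurable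
  show "AL t. J1 (t, x) = be' (ph (t, x)) * fst (grad ph (t, x)) * ind {0..T} t"
  using AE_lborel_singleton[of 0] AE_lborel_singleton[of T] by eventually_elim (auto simp: J1_def indicator_def)
 qed
 also have "... = be (ph (T, x)) - be (ph (0, x))"
 proof (rule integral_FTC_Icc_real)
  show "DERIV (%t. be (ph (t, x))) t :> be' (ph (t, x)) * fst (grad ph (t, x))" for t by (rule DERIV_chain2[OF dbe sl(1)])
  from ct show "isCont (%t. be' (ph (t, x)) * fst (grad ph (t, x))) t" for t by (simp add: continuous_on_eq_continuous_at)
 qed (use T in simp)
 finally show "(LL t. J1 (t, x)) = - be (ph (0, x))" by (simp add: end0 be0)
 qed
 finally have e1: "(LL z. J1 z) = - (LL x. be (ph (0, x)))" by simp
 have e2: "(LL z. J2 z) = 0"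
 proof -
 have "integrable (lborel \<Otimes>\<^sub>M lborel) (%(t, x). J2 (t, x))" using iJ2 by (simp add: lborel_prod)
 from lborel_pair.integral_fst[OF this] have "(LL z. J2 z) = (LL t. LL x. J2 (t, x))" by (simp add: lborel_prod)
 also have "... = (LINT t|(lborel :: real measure). 0)"
 proof (rule integral_cong_AE)
  show "AL t. (LL x. J2 (t, x)) = 0" using div_ae
  proof eventually_elim
  case (elim t)
  show ?case
  proof (cases "t : {0<..<T}")
   case True
   have w: "wdiv (b t) (d t)" using elim True by blast
   have "C1c (%x. be (ph (t, x))) (%x. be' (ph (t, x)) *\<^sub>R snd (grad ph (t, x)))"
   by (rule C1cI[OF C1_compose[OF C1c_C1[OF C1c[OF True]] dbe cbe], of "real k"]) (use far[OF True] be0 in auto)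
   then have p: "(LL x. (be' (ph (t, x)) *\<^sub>R snd (grad ph (t, x))) \<bullet> b t x) = - (LL x. be (ph (t, x)) * d t x)" using w unfolding wdiv_def by blast
   have bl: "loc_int (b t)" "loc_int (d t)" using w by (auto simp: wdiv_def)
   have e: "norm ((be' (ph (t, x)) *\<^sub>R snd (grad ph (t, x))) \<bullet> b t x) <= A * norm (b t x)" "norm (be (ph (t, x)) * d t x) <= A * norm (d t x)" for x
   proof -
   have "norm (snd (grad ph (t, x))) <= A" using norm_components(2)[of "grad ph (t, x)"] bd[OF True, of x] by simp
   then have "\<bar>be' (ph (t, x))\<bar> * norm (snd (grad ph (t, x))) <= 1 * A" by (intro mult_mono be) auto
   then show "norm ((be' (ph (t, x)) *\<^sub>R snd (grad ph (t, x))) \<bullet> b t x) <= A * norm (b t x)"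
    by (intro order_trans[OF Cauchy_Schwarz_ineq2[folded real_norm_def] mult_right_mono]) auto
   show "norm (be (ph (t, x)) * d t x) <= A * norm (d t x)" using order_trans[OF be3, of "ph (t, x)" A] bd[OF True, of x] by (simp add: abs_mult mult_right_mono)
   qed
   have "ilb (%x. (be' (ph (t, x)) *\<^sub>R snd (grad ph (t, x))) \<bullet> b t x)"
   by (rule loc_int_integrable[OF bl(1) _ e(1), of "real k"], measurable) (use far[OF True] in auto)
   moreover have "ilb (%x. be (ph (t, x)) * d t x)"
   by (rule loc_int_integrable[OF bl(2) _ e(2), of "real k"], measurable) (use far[OF True] be0 in auto)
   ultimately show ?thesis using p True by (simp add: J2_def)
  qed (simp add: J2_def)
  qed
 qed (use mJ in \<open>simp_all add: borel_prod[symmetric]\<close>)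
 finally show ?thesis by simp
 qed
 have "(LL x. \<bar>ph (0, x)\<bar>) <= (LL x. be (ph (0, x)) + de * ib (real k) x)"
 proof (rule integral_mono)
 have c0: "C1c (%x. ph (0, x)) (%x. snd (grad ph (0, x)))" by (rule C1cI[OF sl(2), of "real k"]) (use far0 in auto)
 show i: "ilb (%x. \<bar>ph (0, x)\<bar>)" using C1c_integrable(1)[OF c0] by simp
 show "ilb (%x. be (ph (0, x)) + de * ib (real k) x)"
 proof (intro iadd imr)
  show "ilb (%x. be (ph (0, x)))" by (rule ibd[OF i]) (use be3 in auto)
  show "ilb (ind (ball (0::'a) (real k)) :: 'a => real)" using fv by (simp add: integrable_indicator_iff)
 qed
 show "\<bar>ph (0, x)\<bar> <= be (ph (0, x)) + de * ib (real k) x" for x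
  using be(1)[of "ph (0, x)"] far0[of x] be0 by (cases "x : ball 0 (real k)") auto
 qed
 also have "... = (LL x. be (ph (0, x))) + de * v"
 proof -
 have c0: "C1c (%x. ph (0, x)) (%x. snd (grad ph (0, x)))" by (rule C1cI[OF sl(2), of "real k"]) (use far0 in auto)
 have "ilb (%x. be (ph (0, x)))"
  by (rule ibd[OF C1c_integrable(1)[OF c0]]) (use be3 in auto)
 then show ?thesis using fv by (simp add: v_def integrable_indicator_iff)
 qed
 also have "(LL x. be (ph (0, x))) = - (LL z. J1 z + J2 z)" using e1 e2 iJ1 iJ2 by simp
 also have "... <= (LL z. \<bar>transport ph z\<bar> + de * (%(t, x). ?I t * (ib (real k) x * \<bar>d t x\<bar>)) z)"
 unfolding Bochner_Integration.integral_minus[symmetric]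
 proof (rule integral_mono)
 fix z :: "real \<times> 'a"
 obtain t x where z: "z = (t, x)" by (cases z)
 show "- (J1 z + J2 z) <= \<bar>transport ph z\<bar> + de * (%(t, x). ?I t * (ib (real k) x * \<bar>d t x\<bar>)) z"
 proof (cases "t : {0<..<T} & x : ball 0 (real k)")
  case True
  let ?y = "ph (t, x)"
  have "- (J1 z + J2 z) = - (be' ?y * transport ph z) - (be ?y - be' ?y * ?y) * d t x"
  using True by (simp add: z J1_def J2_def transport_def algebra_simps)
  also have "... <= \<bar>be' ?y * transport ph z\<bar> + \<bar>(be ?y - be' ?y * ?y) * d t x\<bar>" by linarith
  also have "... <= 1 * \<bar>transport ph z\<bar> + de * \<bar>d t x\<bar>" unfolding abs_mult by (intro add_mono mult_right_mono be be4) auto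
  finally show ?thesis using True by (simp add: z)
 qed (use far in \<open>auto simp: z J1_def J2_def indicator_def be0\<close>)
 qed (use iJ1 iJ2 iD transport_integrable[OF ph] in auto)
 also have "... = (LL z. \<bar>transport ph z\<bar>) + de * D" using iD transport_integrable[OF ph] by (simp add: D_def)
 finally show ?thesis by (simp add: algebra_simps)
 qed
 show ?thesis
 proof (rule field_le_epsilon)
 fix ep :: real assume ep: "ep > 0"
 have "ep / (D + v + 1) * (D + v) <= ep" using v0 ep by (simp add: field_simps)
 then show "(LL x. \<bar>ph (0, x)\<bar>) <= (LL z. \<bar>transport ph z\<bar>) + ep"
 using main[of "ep / (D + v + 1)"] v0 ep by (smt (verit) divide_pos_pos)
 qed
qed

text \<open>By \<open>initial_bound\<close> the functional on the range of the backward operator is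
  bounded by K times the L^1 norm, so the representing function inherits the bound K of
  \<open>u0\<close>.\<close>

theorem solution:
 fixes u0 :: "'a => real"
 assumes [measurable]: "u0 : bm" and K: "!!x. \<bar>u0 x\<bar> <= K"
 shows "\<exists>u\<in>bm. (ALL z. \<bar>u z\<bar> <= K) & (ALL ph. spacetime_test_function T ph -->
 (LL z. transport ph z * u z) = - (LL x. u0 x * ph (0, x)))"
proof -
 have K0: "K >= 0" using K[of 0] by linarith
 have sm: "smooth ph" if "spacetime_test_function T ph" for ph :: "real \<times> 'a => real" using that by (simp add: spacetime_test_function_def)
 have i0: "ilb (%x. ph (0, x))" if ph: "spacetime_test_function T ph" for ph :: "real \<times> 'a => real"
 proof -
 obtain A and k :: nat where ts: "A >= 0" "!!t x. t : {0<..<T} ==> x \<notin> ball 0 (real k) ==> ph (t, x) = 0 & grad ph (t, x) = 0"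
 "!!x. x \<notin> ball 0 (real k) ==> ph (0, x) = 0" "!!x. ph (T, x) = 0"
 "!!t x. t : {0<..<T} ==> \<bar>ph (t, x)\<bar> <= A & norm (grad ph (t, x)) <= A"
 "!!t. t : {0<..<T} ==> C1c (%x. ph (t, x)) (%x. snd (grad ph (t, x)))"
 by (rule test_support[OF ph]) (rule that; (assumption | blast | simp))
 have "C1c (%x. ph (0, x)) (%x. snd (grad ph (0, x)))" by (rule C1cI[OF smooth_slices(2)[OF sm[OF ph]], of "real k"]) (use ts(3) in auto)
 then show ?thesis by (rule C1c_integrable)
 qed
 have iu: "ilb (%x. u0 x * ph (0, x))" if ph: "spacetime_test_function T ph" for ph :: "real \<times> 'a => real"
 by (rule ibd[OF imr[OF i0[OF ph], of K]])
 (use K borel_measurable_integrable[OF i0[OF ph]] K0 in \<open>auto simp: abs_mult intro!: mult_right_mono\<close>)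
 define G where "G = {(%z. - transport ph z, LL x. u0 x * ph (0, x)) | ph. spacetime_test_function T ph}"
 have "lin_graph G" unfolding lin_graph_def
 proof (intro conjI allI impI)
 have z: "spacetime_test_function T (%_ :: real \<times> 'a. 0)" unfolding spacetime_test_function_iff[OF T] using smooth_const zero_less_one by blast
 have "grad (%_ :: real \<times> 'a. 0::real) z = 0" for z by (simp add: grad_def frechet_derivative_const)
 then have "(%_. 0, 0) = ((%z. - transport (%_. 0) z), LL x. u0 x * (%_ :: real \<times> 'a. 0) (0, x))" by (simp add: transport_def case_prod_unfold)
 then show "((%_. 0), 0) : G" using z unfolding G_def by blast
 fix f a g b' c assume "(f, a) : G" "(g, b') : G"
 then obtain ph ps where ph: "spacetime_test_function T ph" "f = (%z. - transport ph z)" "a = (LL x. u0 x * ph (0, x))"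
 and ps: "spacetime_test_function T ps" "g = (%z. - transport ps z)" "b' = (LL x. u0 x * ps (0, x))" unfolding G_def by blast
 let ?x = "%z. ph z + c * ps z"
 have "spacetime_test_function T ?x"
 proof -
 obtain r1 d1 where 1: "d1 > 0" "!!t x. t : {0..T} ==> norm x >= r1 \<or> t > T - d1 ==> ph (t, x) = 0" using ph(1) unfolding spacetime_test_function_iff[OF T] by blast
 obtain r2 d2 where 2: "d2 > 0" "!!t x. t : {0..T} ==> norm x >= r2 \<or> t > T - d2 ==> ps (t, x) = 0" using ps(1) unfolding spacetime_test_function_iff[OF T] by blast
 have "?x (t, x) = 0" if "t : {0..T}" "norm x >= max r1 r2 \<or> t > T - min d1 d2" for t x
  using 1(2)[OF that(1), of x] 2(2)[OF that(1), of x] that(2) by (auto simp: max_def min_def split: if_splits)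
 moreover have "min d1 d2 > 0" using 1 2 by simp
 moreover have "smooth ?x" by (intro smooth_add smooth_cmult sm ph ps)
 ultimately show ?thesis unfolding spacetime_test_function_iff[OF T] by blast
 qed
 moreover have "(%z. f z + c * g z) = (%z. - transport ?x z)"
 by (rule ext) (auto simp: ph(2) ps(2) transport_def grad_lincomb[OF sm[OF ph(1)] sm[OF ps(1)]] algebra_simps)
 moreover have "a + c * b' = (LL x. u0 x * ?x (0, x))"
 proof -
 have "(LL x. u0 x * ?x (0, x)) = (LL x. u0 x * ph (0, x) + c * (u0 x * ps (0, x)))" by (simp add: algebra_simps)
 then show ?thesis using iu[OF ph(1)] iu[OF ps(1)] ph(3) ps(3) by simp
 qed
 ultimately show "((%z. f z + c * g z), a + c * b') : G" unfolding G_def by blast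
 qed
 then have "\<exists>u\<in>bm. (ALL z. \<bar>u z\<bar> <= K) & (\<forall>(f, a)\<in>G. (LL z. f z * u z) = a)"
 proof (rule dominated_functional[OF _ K0])
 fix f a assume "(f, a) : G"
 then obtain ph where ph: "spacetime_test_function T ph" and f: "f = (%z. - transport ph z)" and a: "a = (LL x. u0 x * ph (0, x))" unfolding G_def by blast
 have "a <= (LL x. K * \<bar>ph (0, x)\<bar>)" unfolding a
 proof (rule integral_mono[OF iu[OF ph]])
 show "u0 x * ph (0, x) <= K * \<bar>ph (0, x)\<bar>" for x
  using mult_right_mono[OF K[of x], of "\<bar>ph (0, x)\<bar>"] abs_ge_self[of "u0 x * ph (0, x)"] by (simp add: abs_mult)
 qed (use i0[OF ph] in simp)
 also have "... <= K * (LL z. \<bar>transport ph z\<bar>)" using initial_bound[OF ph] K0 by (simp add: mult_left_mono)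
 finally show "ilb f & a <= K * (LL x. \<bar>f x\<bar>)" using transport_integrable[OF ph] by (simp add: f)
 qed
 then obtain u where u: "u : bm" "!!z. \<bar>u z\<bar> <= K" "\<forall>(f, a)\<in>G. (LL z. f z * u z) = a" by blast
 have "(LL z. transport ph z * u z) = - (LL x. u0 x * ph (0, x))" if "spacetime_test_function T ph" for ph
 proof -
 have "((%z. - transport ph z), LL x. u0 x * ph (0, x)) : G" using that unfolding G_def by blast
 from bspec[OF u(3) this] show ?thesis by simp
 qed
 then show ?thesis using u(1,2) by blast
qed

end

section \<open>Borel representatives of the data\<close>

lemma strip_borel [measurable]: "{0<..<T::real} \<times> (UNIV :: 'a::euclidean_space set) : sets borel"
 by (intro borel_open open_Times) auto

lemma space_rep:
 fixes f :: "real => 'a::euclidean_space => 'b::euclidean_space"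
 assumes "(%(t, x). f t x) : borel_measurable (spacetime T)"
 obtains f' where "f' : bm2" "AL z. z : {0<..<T} \<times> UNIV --> (%(t, x). f t x) z = f' z"
 "AL t. t : {0<..<T} --> (AL x. f t x = f' (t, x))"
proof -
 obtain f' where f': "f' : bm" and ae: "AL z. z : {0<..<T} \<times> UNIV --> (%(t, x). f t x) z = f' z"
 by (rule lebesgue_on_borel_rep[OF assms[unfolded spacetime_def] strip_borel]) (rule that; assumption)
 have "AL t. AL x. (t, x) : {0<..<T} \<times> UNIV --> f t x = f' (t, x)" using lborel_slices[OF ae] by simp
 then have "AL t. t : {0<..<T} --> (AL x. f t x = f' (t, x))" by eventually_elim auto
 with f' ae show thesis by (intro that) (auto simp: borel_prod)
qed

lemma time_rep:
 assumes "f : L1_time T N"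
 shows "EX n. n : bm & (ALL t. n t >= 0) & ilb (%t. iT T t * n t) &
 (AL t. t : {0<..<T} --> N (f t) = ennreal (n t))"
proof -
 have m: "(%t. N (f t)) : borel_measurable (lebesgue_on {0<..<T})" and fin: "(\<integral>\<^sup>+t. N (f t) \<partial>lebesgue_on {0<..<T}) < \<infinity>"
 using assms by (auto simp: L1_time_def)
 have "(%t. N (f t) * iT T t) : borel_measurable lebesgue" using m by (subst (asm) borel_measurable_restrict_space_iff_ennreal) auto
 then obtain h where [measurable]: "h : bm" and h: "AL t. N (f t) * iT T t = h t"
 using completion_ex_borel_measurable[of "%t. N (f t) * iT T t" lborel] by auto
 have I: "(NN t. h t) < \<infinity>" using fin unfolding nn_integral_lebesgue_on[OF borel_open[OF open_greaterThanLessThan]] nn_integral_cong_AE[OF h] .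
 then have "AL t. h t ~= \<infinity>" by (intro nn_integral_PInf_AE) auto
 with h have e: "AL t. t : {0<..<T} --> N (f t) = ennreal (enn2real (h t))" by eventually_elim (auto simp: top.not_eq_extremum)
 have "ilb (%t. iT T t * enn2real (h t))"
 proof (rule integrableI_bounded)
 have "(NN t. ennreal (norm (iT T t * enn2real (h t)))) <= (NN t. h t)"
 by (rule nn_integral_mono) (auto simp: indicator_def ennreal_enn2real_if)
 then show "(NN t. ennreal (norm (iT T t * enn2real (h t)))) < \<infinity>" using I by (rule le_less_trans)
 qed measurable
 with e show ?thesis by (intro exI[of _ "%t. enn2real (h t)"]) auto
qed

lemma Linf_norm_ae:
 fixes f :: "'a::euclidean_space => 'b::euclidean_space"
 assumes "Linf_norm f <= ennreal c" "c >= 0" shows "AL x. norm (f x) <= c"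
proof -
 have "f : borel_measurable lebesgue" using assms(1) by (auto simp: Linf_norm_def top_unique split: if_splits)
 then have "AE x in lebesgue. ennreal (norm (f x)) <= ennreal c"
 using esssup_AE[of "%x. ennreal (norm (f x))" lebesgue] assms(1) by (auto simp: Linf_norm_def elim!: eventually_mono intro: order_trans)
 then show ?thesis using assms(2) by (simp add: AE_completion_iff)
qed

section \<open>Weak solutions\<close>

lemma ae_on: "(AE t in lebesgue_on {0<..<T::real}. P t) \<longleftrightarrow> (AL t. t : {0<..<T} --> P t)"
 by (rule AE_lebesgue_on_iff) simp

text \<open>Exhibiting one jointly measurable divergence shows that the choice in
  \<open>weak_div\<close> is a proper one; uniqueness of weak divergences on almost every slice then
  identifies the two.\<close>

lemma weak_div_eq:
 fixes c :: "real => 'a::euclidean_space => 'a"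
 assumes d: "(%(t, x). d t x) : bm2" and ae: "AL t. t : {0<..<T} --> has_weak_div (c t) (d t)"
 shows "AL t. t : {0<..<T} --> (AL x. weak_div T c t x = d t x)"
proof -
 have "(%(t, x). d t x) : borel_measurable (spacetime T)" unfolding spacetime_def
 using d by (intro measurable_restrict_space1) (simp add: borel_prod measurable_completion)
 then have "EX d. (%(t, x). d t x) : borel_measurable (spacetime T) & (AE t in lebesgue_on {0<..<T}. has_weak_div (c t) (d t))" using ae unfolding ae_on by blast
 from someI_ex[OF this] have "AL t. t : {0<..<T} --> has_weak_div (c t) (weak_div T c t)" unfolding ae_on weak_div_def by blast
 with ae show ?thesis by eventually_elim (auto intro: has_weak_div_unique)
qed

lemma set_lebesgue_time:
 fixes f g :: "real => 'a::euclidean_space => real"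
 assumes [measurable]: "(%(t, x). g t x) : bm2"
 and ae: "AL t. t : {0<..<T} --> (AL x. f t x = g t x)"
 shows "(LINT t:{0<..<T}|lebesgue. LINT x|lebesgue. f t x) = (LL t. iT T t * (LL x. g t x))"
 unfolding set_lebesgue_integral_def
proof (rule lebesgue_integral_AE(1))
 show "(%t. iT T t * (LL x. g t x)) : bm" by measurable
 have [measurable]: "g t : bm" for t by measurable
 show "AL t. indicat_real {0<..<T} t *\<^sub>R (LINT x|lebesgue. f t x) = iT T t * (LL x. g t x)"
 using ae by eventually_elim (auto simp: indicator_def intro!: lebesgue_integral_AE(1))
qed

section \<open>The weak formulation in terms of the backward operator\<close>

context div_field
begin

lemma transport_split:
 fixes ph :: "real \<times> 'a => real"
 assumes ph: "spacetime_test_function T ph" and [measurable]: "u : bm2" and u: "!!z. \<bar>u z\<bar> <= K"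
 shows "(LL z. transport ph z * u z) = (LL t. iT T t * (LL x. u (t, x) * fst (grad ph (t, x))))
 + (LL t. iT T t * (LL x. u (t, x) * (ph (t, x) * d t x + snd (grad ph (t, x)) \<bullet> b t x)))"
 and "ilb (%z. transport ph z * u z)"
proof -
 have s: "smooth ph" using ph by (simp add: spacetime_test_function_def)
 note [measurable] = smooth_measurable[OF s]
 obtain A and k :: nat where ts: "A >= 0" "!!t x. t : {0<..<T} ==> x \<notin> ball 0 (real k) ==> ph (t, x) = 0 & grad ph (t, x) = 0"
 "!!t x. t : {0<..<T} ==> \<bar>ph (t, x)\<bar> <= A & norm (grad ph (t, x)) <= A"
 by (rule test_support[OF ph]) (rule that; (assumption | blast | simp))
 define A1 where "A1 = (%(t, x :: 'a). iT T t * fst (grad ph (t, x)))"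
 have i1: "ilb A1"
 proof (rule spacetime_integrable[OF _ ts(1)])
 show "A1 : bm" unfolding A1_def borel_prod[symmetric] by measurable
 fix t :: real and x :: 'a
 show "\<bar>A1 (t, x)\<bar> <= iT T t * (ib (real k) x * (A * (1 + norm (b t x) + \<bar>d t x\<bar>)))"
 proof (cases "t : {0<..<T} & x : ball 0 (real k)")
 case True
 have "\<bar>fst (grad ph (t, x))\<bar> <= A" using norm_components(1)[of "grad ph (t, x)"] ts(3)[of t x] True by simp
 also have "... <= A * (1 + norm (b t x) + \<bar>d t x\<bar>)" using ts(1) by (simp add: algebra_simps)
 finally show ?thesis using True by (simp add: A1_def)
 qed (use ts(2) in \<open>auto simp: A1_def indicator_def\<close>)
 qed
 have um: "u : borel_measurable lborel" using assms(2) by (simp add: borel_prod)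
 have bd: "ilb (%z. f z * u z)" if f: "ilb f" for f
 proof (rule ibd[OF imr[OF f, of K]])
 show "(%z. f z * u z) : borel_measurable lborel" using borel_measurable_integrable[OF f] um by (rule borel_measurable_times)
 have "norm (f z * u z) <= norm (K * f z)" for z
 using mult_left_mono[OF u[of z], of "\<bar>f z\<bar>"] u[of z] by (simp add: abs_mult mult.commute)
 then show "AL z. norm (f z * u z) <= norm (K * f z)" by simp
 qed
 note it = transport_integrable[OF ph]
 show "ilb (%z. transport ph z * u z)" by (rule bd[OF it])
 have i2: "ilb (%z. transport ph z - A1 z)" using it i1 by simp
 have fub: "(LL z. f z) = (LL t. LL x. f (t, x))" if "ilb f" for f :: "real \<times> 'a => real"
 proof -
 have "integrable (lborel \<Otimes>\<^sub>M lborel) (%(t, x). f (t, x))" using that by (simp add: lborel_prod)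
 from lborel_pair.integral_fst[OF this] show ?thesis by (simp add: lborel_prod)
 qed
 have "(LL z. transport ph z * u z) = (LL z. A1 z * u z + (transport ph z - A1 z) * u z)" by (simp add: algebra_simps)
 also have "... = (LL z. A1 z * u z) + (LL z. (transport ph z - A1 z) * u z)"
 by (rule ladd[OF bd[OF i1] bd[OF i2]])
 also have "(LL z. A1 z * u z) = (LL t. iT T t * (LL x. u (t, x) * fst (grad ph (t, x))))"
 proof -
 have "A1 (t, x) * u (t, x) = iT T t * (u (t, x) * fst (grad ph (t, x)))" for t x by (simp add: A1_def)
 then show ?thesis unfolding fub[OF bd[OF i1]] by (simp only: integral_mult_right_zero)
 qed
 also have "(LL z. (transport ph z - A1 z) * u z) = (LL t. iT T t * (LL x. u (t, x) * (ph (t, x) * d t x + snd (grad ph (t, x)) \<bullet> b t x)))"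
 proof -
 have "(transport ph (t, x) - A1 (t, x)) * u (t, x) = iT T t * (u (t, x) * (ph (t, x) * d t x + snd (grad ph (t, x)) \<bullet> b t x))" for t x
 by (simp add: transport_def A1_def algebra_simps)
 then show ?thesis unfolding fub[OF bd[OF i2]] by (simp only: integral_mult_right_zero)
 qed
 finally show "(LL z. transport ph z * u z) = (LL t. iT T t * (LL x. u (t, x) * fst (grad ph (t, x))))
 + (LL t. iT T t * (LL x. u (t, x) * (ph (t, x) * d t x + snd (grad ph (t, x)) \<bullet> b t x)))" .
qed

text \<open>Rewrites the two space-time integrals of \<open>weak_solution\<close>. Here
  \<open>v\<close> and \<open>c\<close> are the functions as given, \<open>u\<close> and
  \<open>b\<close> their Borel representatives.\<close>

lemma weak_identity:
 fixes ph :: "real \<times> 'a => real"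
 assumes ph: "spacetime_test_function T ph" and [measurable]: "u : bm2" and u: "!!z. \<bar>u z\<bar> <= K"
 and v: "AL t. t : {0<..<T} --> (AL x. v t x = u (t, x))"
 and c: "AL t. t : {0<..<T} --> (AL x. c t x = b t x)"
 shows "(LINT t:{0<..<T}|lebesgue. LINT x|lebesgue. v t x * deriv (%s. ph (s, x)) t)
 + (LINT t:{0<..<T}|lebesgue. LINT x|lebesgue. v t x * weak_div T (%t x. ph (t, x) *\<^sub>R c t x) t x) = (LL z. transport ph z * u z)"
proof -
 have s: "smooth ph" using ph by (simp add: spacetime_test_function_def)
 note [measurable] = smooth_measurable[OF s]
 obtain A and k :: nat where C: "!!t. t : {0<..<T} ==> C1c (%x. ph (t, x)) (%x. snd (grad ph (t, x)))"
 by (rule test_support[OF ph]) (rule that; (assumption | blast | simp))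
 have dv: "deriv (%s. ph (s, x)) t = fst (grad ph (t, x))" for t x by (rule DERIV_imp_deriv[OF smooth_slices(1)[OF s]])
 have 1: "(LINT t:{0<..<T}|lebesgue. LINT x|lebesgue. v t x * deriv (%s. ph (s, x)) t)
 = (LL t. iT T t * (LL x. u (t, x) * fst (grad ph (t, x))))" unfolding dv
 by (rule set_lebesgue_time, measurable) (use v in \<open>eventually_elim, auto elim!: eventually_mono\<close>)
 have w: "AL t. t : {0<..<T} --> has_weak_div (%x. ph (t, x) *\<^sub>R c t x) (%x. ph (t, x) * d t x + snd (grad ph (t, x)) \<bullet> b t x)"
 using div_ae c
 proof (eventually_elim, intro impI)
 fix t assume "t : {0<..<T} --> wdiv (b t) (d t) & (\<forall>k::nat. (NN x. ennreal (ib (real k) x * (norm (b t x) + \<bar>d t x\<bar>))) <= M k t)"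
 and ae: "t : {0<..<T} --> (AL x. c t x = b t x)" and t: "t : {0<..<T}"
 then have w: "wdiv (b t) (d t)" by blast
 show "has_weak_div (%x. ph (t, x) *\<^sub>R c t x) (%x. ph (t, x) * d t x + snd (grad ph (t, x)) \<bullet> b t x)"
 by (rule wdiv_has_weak_div[OF wdiv_mult[OF w C[OF t]]]) (use ae t in \<open>auto elim!: eventually_mono\<close>)
 qed
 have "AL t. t : {0<..<T} --> (AL x. weak_div T (%t x. ph (t, x) *\<^sub>R c t x) t x = ph (t, x) * d t x + snd (grad ph (t, x)) \<bullet> b t x)"
 by (rule weak_div_eq[OF _ w]) measurable
 then have 2: "(LINT t:{0<..<T}|lebesgue. LINT x|lebesgue. v t x * weak_div T (%t x. ph (t, x) *\<^sub>R c t x) t x)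
 = (LL t. iT T t * (LL x. u (t, x) * (ph (t, x) * d t x + snd (grad ph (t, x)) \<bullet> b t x)))"
 proof (intro set_lebesgue_time)
 assume "AL t. t : {0<..<T} --> (AL x. weak_div T (%t x. ph (t, x) *\<^sub>R c t x) t x = ph (t, x) * d t x + snd (grad ph (t, x)) \<bullet> b t x)"
 with v show "AL t. t : {0<..<T} --> (AL x. v t x * weak_div T (%t x. ph (t, x) *\<^sub>R c t x) t x = u (t, x) * (ph (t, x) * d t x + snd (grad ph (t, x)) \<bullet> b t x))"
 proof (eventually_elim, intro impI)
 fix t assume 1: "t : {0<..<T} --> (AL x. v t x = u (t, x))" and t: "t : {0<..<T}"
  and 2: "t : {0<..<T} --> (AL x. weak_div T (%t x. ph (t, x) *\<^sub>R c t x) t x = ph (t, x) * d t x + snd (grad ph (t, x)) \<bullet> b t x)"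
 show "AL x. v t x * weak_div T (%t x. ph (t, x) *\<^sub>R c t x) t x = u (t, x) * (ph (t, x) * d t x + snd (grad ph (t, x)) \<bullet> b t x)"
  using 1[rule_format, OF t] 2[rule_format, OF t] by eventually_elim simp
 qed
 qed measurable
 show ?thesis unfolding 1 2 transport_split(1)[OF ph assms(2) u] ..
qed

text \<open>Test with th(t) times the mollifier reflected about x: its t-derivative produces the
  mollified w, and its divergence term the flux.\<close>

lemma evolution_from_transport:
 assumes [measurable]: "w : bm2" and w: "!!z. \<bar>w z\<bar> <= K"
 and zero: "!!ph. spacetime_test_function T ph ==> (LL z. transport ph z * w z) = 0"
 and e: "e > 0" and th: "smooth th" "\<exists>de>0. \<forall>t>T - de. th t = (0::real)"
 shows "(LL t. iT T t * (frechet_derivative th (at t) 1 * conv (%x. w (t, x)) (moll e) x))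
 = - (LL t. th t * (iT T t * flux (%x. w (t, x)) (b t) (d t) e (x :: 'a)))"
proof -
 define ph where "ph z = th (fst z) * moll e (x + - snd z)" for z :: "real \<times> 'a"
 have s: "smooth ph" unfolding ph_def
 by (intro smooth_mult smooth_linear_compose[OF th(1)] smooth_affine[OF smooth_moll, where L="%z. - snd z" and c=x] bounded_linear_fst bounded_linear_minus bounded_linear_snd)
 obtain de where de: "de > 0" "!!t. t > T - de ==> th t = 0" using th(2) by blast
 have "ph (t, y) = 0" if "norm y >= norm x + e \<or> t > T - de" for t y
 proof (cases "t > T - de")
 case False
 then have "norm (x + - y) >= e" using that norm_triangle_ineq2[of y x] by (simp add: norm_minus_commute)
 then show ?thesis using moll_zero[OF e, of "x + - y"] by (simp add: ph_def)
 qed (simp add: ph_def de)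
 then have tf: "spacetime_test_function T ph" unfolding spacetime_test_function_iff[OF T] using s de(1) by blast
 have g1: "fst (grad ph (t, y)) = frechet_derivative th (at t) 1 * moll e (x - y)" for t y
 proof -
 have "(th has_real_derivative frechet_derivative th (at t) 1) (at t)"
 proof -
 have D: "(th has_derivative frechet_derivative th (at t)) (at t)" by (rule smooth_has_derivative[OF th(1)])
 have "frechet_derivative th (at t) h = frechet_derivative th (at t) 1 * h" for h
  using linear_cmul[OF has_derivative_linear[OF D], of h 1] by (simp add: mult.commute)
 then have "frechet_derivative th (at t) = (*) (frechet_derivative th (at t) 1)" by (rule ext)
 with D show ?thesis unfolding has_field_derivative_def by simp
 qed
 from DERIV_cmult_right[OF this, of "moll e (x - y)"] have "((%s. ph (s, y)) has_real_derivative frechet_derivative th (at t) 1 * moll e (x - y)) (at t)"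
 by (simp add: ph_def)
 from DERIV_unique[OF smooth_slices(1)[OF s] this] show ?thesis .
 qed
 have g2: "snd (grad ph (t, y)) = - (th t *\<^sub>R grad (moll e) (x - y))" for t y
 proof -
 have "C1 (%y. moll e (x - y)) (%y. - grad (moll e) (x - y))" by (rule C1_reflect[OF smooth_C1[OF smooth_moll]])
 from C1_cmult[OF this, of "th t"] have "C1 (%y. ph (t, y)) (%y. th t *\<^sub>R - grad (moll e) (x - y))" by (simp add: ph_def)
 from C1_grad[OF this] C1_grad[OF smooth_slices(2)[OF s, of t]] show ?thesis by (metis scaleR_minus_right)
 qed
 have "0 = (LL t. iT T t * (LL y. w (t, y) * (frechet_derivative th (at t) 1 * moll e (x - y))))
 + (LL t. iT T t * (LL y. w (t, y) * (ph (t, y) * d t y + - (th t *\<^sub>R grad (moll e) (x - y)) \<bullet> b t y)))"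
 using zero[OF tf] unfolding transport_split(1)[OF tf assms(1) w] g1 g2 by simp
 moreover have "(LL y. w (t, y) * (frechet_derivative th (at t) 1 * moll e (x - y))) = frechet_derivative th (at t) 1 * conv (%x. w (t, x)) (moll e) x" for t
 proof -
 have "w (t, y) * (frechet_derivative th (at t) 1 * moll e (x - y)) = frechet_derivative th (at t) 1 * (w (t, y) *\<^sub>R moll e (x - y))" for y by simp
 then show ?thesis unfolding conv_def by (simp only: integral_mult_right_zero)
 qed
 moreover have "(LL y. w (t, y) * (ph (t, y) * d t y + - (th t *\<^sub>R grad (moll e) (x - y)) \<bullet> b t y)) = th t * flux (%x. w (t, x)) (b t) (d t) e x" for t
 proof -
 have "w (t, y) * (ph (t, y) * d t y + - (th t *\<^sub>R grad (moll e) (x - y)) \<bullet> b t y) = th t * (w (t, y) * (d t y * moll e (x - y) - b t y \<bullet> grad (moll e) (x - y)))" for y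
 by (simp add: ph_def algebra_simps inner_commute)
 then show ?thesis unfolding flux_def by (simp only: integral_mult_right_zero)
 qed
 ultimately show ?thesis by (simp add: mult.left_commute)
qed

end

text \<open>The norm is an infimum that is not shown to be attained. Below n + 1 there is an
  admissible scale, and monotonicity of P makes every larger scale, in particular a,
  admissible.\<close>

lemma ExpL_rep:
 fixes f :: "'a::euclidean_space => real"
 assumes f: "ExpL_logL_norm f = ennreal n" and n: "n >= 0" "n + 1 <= a"
 shows "\<exists>de\<in>bm. (AL x. f x = de x) & (NN x. ennreal (orlicz_P (\<bar>de x\<bar> / a))) <= 1"
proof -
 have m: "f : borel_measurable lebesgue" using f by (auto simp: ExpL_logL_norm_def split: if_splits)
 have "Inf {ennreal l | l. l > 0 & (\<integral>\<^sup>+x. ennreal (orlicz_P (\<bar>f x\<bar> / l)) \<partial>lebesgue) <= 1} < ennreal (n + 1)"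
 using f m n by (simp add: ExpL_logL_norm_def ennreal_lessI)
 then obtain l where l: "l > 0" "(\<integral>\<^sup>+x. ennreal (orlicz_P (\<bar>f x\<bar> / l)) \<partial>lebesgue) <= 1" "ennreal l < ennreal (n + 1)" unfolding Inf_less_iff by auto
 have "l < n + 1" using l(3) unfolding ennreal_less_iff[OF less_imp_le[OF l(1)]] .
 then have la: "l <= a" using n by linarith
 obtain de where [measurable]: "de : bm" and ae: "AL x. f x = de x" using lebesgue_borel_rep[OF m] by blast
 have "(NN x. ennreal (orlicz_P (\<bar>de x\<bar> / a))) <= (NN x. ennreal (orlicz_P (\<bar>f x\<bar> / l)))"
 proof (rule nn_integral_mono_AE, use ae in eventually_elim)
 case (elim x)
 show ?case unfolding elim using l(1) la by (intro ennreal_leI orlicz_P_mono divide_left_mono) auto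
 qed
 also have "... = (\<integral>\<^sup>+x. ennreal (orlicz_P (\<bar>f x\<bar> / l)) \<partial>lebesgue)" by (rule nn_integral_completion[symmetric])
 finally show ?thesis using l(2) ae by (intro bexI[of _ de]) auto
qed

section \<open>Bounded functions and their norms in space and time\<close>

lemma clip_rep:
 fixes f f' :: "'x => real"
 assumes "\<bar>f x\<bar> <= K" "f x = f' x" shows "f x = max (- K) (min K (f' x))"
 using assms by auto

lemma bounded_spacetime:
 fixes u :: "real \<times> 'a::euclidean_space => real"
 assumes [measurable]: "u : bm" and u: "!!z. \<bar>u z\<bar> <= K"
 shows "(%t x. u (t, x)) : L1_time_loc T L1_norm" "(%t x. u (t, x)) : Linf_time T Linf_norm"
proof -
 have [measurable]: "u : bm2" by (simp add: borel_prod)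
 have K0: "K >= 0" using u[of undefined] by linarith
 have m: "(%(t, x). u (t, x)) : borel_measurable (spacetime T)" unfolding spacetime_def
 by (intro measurable_restrict_space1) (simp add: measurable_completion)
 have ml: "(%x. u (t, x)) : borel_measurable lebesgue" for t by (rule measurable_completion) measurable
 have tm: "f : borel_measurable (lebesgue_on {0<..<T})" if "f : bm" for f :: "real => ennreal"
 using that by (intro measurable_restrict_space1) (simp add: measurable_completion)
 show "(%t x. u (t, x)) : L1_time_loc T L1_norm"
 unfolding L1_time_loc_def L1_time_def
 proof (intro CollectI allI conjI m)
 fix c :: 'a and r
 have e: "L1_norm (ball c r) (%x. u (t, x)) = (\<integral>\<^sup>+x\<in>ball c r. ennreal \<bar>u (t, x)\<bar> \<partial>lborel)" for t
 unfolding L1_norm_def using measurable_restrict_space1[OF ml] by (simp add: nn_integral_lebesgue_on)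
 show "(%t. L1_norm (ball c r) (%x. u (t, x))) : borel_measurable (lebesgue_on {0<..<T})" unfolding e by (rule tm) measurable
 have "L1_norm (ball c r) (%x. u (t, x)) <= ennreal K * emeasure lborel (ball c r)" for t
 proof -
 have "L1_norm (ball c r) (%x. u (t, x)) <= (NN x. ennreal K * ind (ball c r) x)" unfolding e
  by (rule nn_integral_mono) (auto simp: indicator_def intro!: ennreal_leI u)
 then show ?thesis by (simp add: nn_integral_cmult_indicator)
 qed
 then have "(\<integral>\<^sup>+t. L1_norm (ball c r) (%x. u (t, x)) \<partial>lebesgue_on {0<..<T}) <= (\<integral>\<^sup>+t. ennreal K * emeasure lborel (ball c r) \<partial>lebesgue_on {0<..<T})"
 by (intro nn_integral_mono)
 also have "... = (ennreal K * emeasure lborel (ball c r)) * emeasure lborel {0<..<T}"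
 by (subst nn_integral_lebesgue_on) (simp_all add: nn_integral_cmult_indicator)
 also have "... < \<infinity>" using emeasure_bounded_finite[of "ball c r"] emeasure_bounded_finite[of "{0<..<T}"] by (simp add: ennreal_mult_less_top)
 finally show "(\<integral>\<^sup>+t. L1_norm (ball c r) (%x. u (t, x)) \<partial>lebesgue_on {0<..<T}) < \<infinity>" .
 qed
 have e: "Linf_norm (%x. u (t, x)) <= y \<longleftrightarrow> (AL x. ennreal \<bar>u (t, x)\<bar> <= y)" for t y
 proof
 assume "Linf_norm (%x. u (t, x)) <= y"
 then have "AE x in lebesgue. ennreal \<bar>u (t, x)\<bar> <= y" using esssup_AE[of "%x. ennreal \<bar>u (t, x)\<bar>" lebesgue] ml
 by (auto simp: Linf_norm_def elim!: eventually_mono intro: order_trans)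
 then show "AL x. ennreal \<bar>u (t, x)\<bar> <= y" by (simp add: AE_completion_iff)
 next
 assume "AL x. ennreal \<bar>u (t, x)\<bar> <= y"
 then have "AE x in lebesgue. ennreal \<bar>u (t, x)\<bar> <= y" by (simp add: AE_completion_iff)
 then show "Linf_norm (%x. u (t, x)) <= y" using ml by (auto simp: Linf_norm_def intro!: esssup_I)
 qed
 \<comment> \<open>The essential supremum of a slice is at most y exactly if the set where |u|
   exceeds y has a null slice, and the measure of slices is measurable in t.\<close>
 have Lm: "(%t. Linf_norm (%x. u (t, x))) : borel_measurable (borel :: real measure)"
 proof (rule borel_measurableI_le)
 fix y :: ennreal
 have "{t : space borel. Linf_norm (%x. u (t, x)) <= y} = {t : space borel. emeasure lborel {x : space lborel. ~ ennreal \<bar>u (t, x)\<bar> <= y} = 0}"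
 unfolding e by (intro Collect_cong conj_cong refl AE_iff_measurable[OF _ refl]) measurable
 also have "... : sets borel" by measurable
 finally show "{t : space (borel :: real measure). Linf_norm (%x. u (t, x)) <= y} : sets borel" .
 qed
 have "esssup (lebesgue_on {0<..<T}) (%t. Linf_norm (%x. u (t, x))) <= ennreal K"
 by (rule esssup_I[OF tm[OF Lm]]) (simp add: e ennreal_leI u)
 then show "(%t x. u (t, x)) : Linf_time T Linf_norm" unfolding Linf_time_def using m tm[OF Lm]
 by (auto intro: le_less_trans)
qed

lemma Linf_rep:
 fixes f :: "'a::euclidean_space => real"
 assumes "f : Linf"
 obtains f' K where "f' : bm" "ALL x. \<bar>f' x\<bar> <= K" "AL x. f x = f' x"
proof -
 have L: "Linf_norm f < \<infinity>" using assms by (simp add: Linf_def)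
 then have m: "f : borel_measurable lebesgue" by (auto simp: Linf_norm_def split: if_splits)
 define K where "K = enn2real (Linf_norm f)"
 have K: "K >= 0" "Linf_norm f <= ennreal K" using L by (auto simp: K_def top.not_eq_extremum)
 have b: "AL x. \<bar>f x\<bar> <= K" using Linf_norm_ae[OF K(2,1)] by simp
 obtain g where [measurable]: "g : bm" and g: "AL x. f x = g x" using lebesgue_borel_rep[OF m] by blast
 have "AL x. f x = max (- K) (min K (g x))" using b g by eventually_elim (rule clip_rep)
 then show thesis using K by (intro that[of "%x. max (- K) (min K (g x))" K]) auto
qed

section \<open>Reduction to Borel data, existence and uniqueness\<close>

lemma wellposed:
 fixes T :: real and b :: "real => 'a::euclidean_space => 'a"
 assumes T: "T > 0" and hW: "b : L1_time_loc T W11_norm"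
 and hG: "(%t x. norm (b t x) / (1 + norm x)) : sum_space (L1_time T (L1_norm UNIV)) (L1_time T Linf_norm)"
 and hD: "weak_div T b : sum_space (L1_time T Linf_norm) (L1_time T ExpL_logL_norm)"
 and u0: "u0 : Linf"
 shows "\<exists>u\<in>Linf_time T Linf_norm. weak_solution T b u0 u &
 (\<forall>v\<in>Linf_time T Linf_norm. weak_solution T b u0 v --> (AE (t, x) in spacetime T. v t x = u t x))"
proof -
 have bk: "b : L1_time T (W11_norm (ball 0 (real k)))" for k :: nat using hW by (auto simp: L1_time_loc_def)
 have "(%(t, x). b t x) : borel_measurable (spacetime T)" using bk[of 0] by (auto simp: L1_time_def)
 then obtain B where [measurable]: "B : bm2" and B: "AL t. t : {0<..<T} --> (AL x. b t x = B (t, x))"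
 by (rule space_rep) (rule that; assumption)
 define b' where "b' t x = B (t, x)" for t x
 have hb: "AL t. t : {0<..<T} --> (AL x. b t x = b' t x)" using B by (simp add: b'_def)
 have "\<forall>k::nat. EX n. n : bm & (ALL t. n t >= 0) & ilb (%t. iT T t * n t) &
 (AL t. t : {0<..<T} --> W11_norm (ball 0 (real k)) (b t) = ennreal (n t))" by (rule allI, rule time_rep[OF bk])
 from choice[OF this] obtain n where n: "\<forall>k::nat. n k : bm & (ALL t. n k t >= 0) & ilb (%t. iT T t * n k t) &
 (AL t. t : {0<..<T} --> W11_norm (ball 0 (real k)) (b t) = ennreal (n k t))" by (rule exE)
 have [measurable]: "n k : bm" for k using n by blast
 \<comment> \<open>This is the bound that \<open>W11_loc_gradient\<close> gives for the patched
   gradients.\<close>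
 define M where "M k t = ennreal (DIM('a)) * (ennreal (n k t) + 1)" for k t
 interpret field T b' M
 proof
 show "T > 0" by (rule T)
 show "(%(t, x). b' t x) : bm2" unfolding b'_def by measurable
 show "M k : bm" for k unfolding M_def by measurable
 show "(\<integral>\<^sup>+t\<in>{0<..<T}. M k t \<partial>lborel) < \<infinity>" for k
 proof -
 have i: "ilb (%t. iT T t * n k t)" using n by blast
 have "(\<integral>\<^sup>+t\<in>{0<..<T}. M k t \<partial>lborel) = (NN t. ennreal (DIM('a)) * (ennreal (iT T t * n k t) + iT T t))"
  by (rule nn_integral_cong) (auto simp: M_def indicator_def)
 also have "... = ennreal (DIM('a)) * ((NN t. ennreal (iT T t * n k t)) + ennreal T)"
  using T by (simp add: nn_integral_cmult nn_integral_add)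
 also have "... < \<infinity>" using n by (simp add: nn_integral_eq_integral[OF i] ennreal_mult_less_top)
 finally show ?thesis .
 qed
 have "AL t. \<forall>k::nat. t : {0<..<T} --> W11_norm (ball 0 (real k)) (b t) = ennreal (n k t)" unfolding AE_all_countable using n by blast
 then show "AL t. t : {0<..<T} --> (EX G. (\<forall>j\<in>Basis. weak_grad (%x. b' t x \<bullet> j) (G j)) &
  (ALL k. (NN x. ennreal (ib (real k) x * (norm (b' t x) + (\<Sum>j\<in>Basis. norm (G j x))))) <= M k t))" using hb
 proof (eventually_elim, intro impI)
 fix t assume 1: "\<forall>k::nat. t : {0<..<T} --> W11_norm (ball 0 (real k)) (b t) = ennreal (n k t)"
  and 2: "t : {0<..<T} --> (AL x. b t x = b' t x)" and t: "t : {0<..<T}"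
 have e: "W11_norm (ball 0 (real k)) (b t) = ennreal (n k t)" for k using 1 t by blast
 have m: "b' t : bm" unfolding b'_def by measurable
 from W11_loc_gradient[OF _ m 2[rule_format, OF t]] show "EX G. (\<forall>j\<in>Basis. weak_grad (%x. b' t x \<bullet> j) (G j)) &
  (ALL k. (NN x. ennreal (ib (real k) x * (norm (b' t x) + (\<Sum>j\<in>Basis. norm (G j x))))) <= M k t)" unfolding e M_def by simp
 qed
 qed
 obtain d where dd: "(%(t, x). d t x) : bm2"
 "AL t. t : {0<..<T} --> (ALL G. (\<forall>j\<in>Basis. weak_grad (%x. b' t x \<bullet> j) (G j)) --> (AL x. d t x = (\<Sum>i\<in>Basis. G i x \<bullet> i)))"
 using joint_div by (elim exE conjE)
 interpret div_field T b' M d by unfold_locales (fact dd)+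
 have "AL t. t : {0<..<T} --> has_weak_div (b t) (d t)" using div_ae hb
 proof (eventually_elim, intro impI)
 fix t assume "t : {0<..<T} --> wdiv (b' t) (d t) & (\<forall>k::nat. (NN x. ennreal (ib (real k) x * (norm (b' t x) + \<bar>d t x\<bar>))) <= M k t)"
 and ae: "t : {0<..<T} --> (AL x. b t x = b' t x)" and t: "t : {0<..<T}"
 then have w: "wdiv (b' t) (d t)" by blast
 show "has_weak_div (b t) (d t)" by (rule wdiv_has_weak_div[OF w]) (use ae t in auto)
 qed
 from weak_div_eq[OF dd(1) this] have wd: "AL t. t : {0<..<T} --> (AL x. weak_div T b t x = d t x)" .
 obtain f1 f2 where f: "(%t x. norm (b t x) / (1 + norm x)) = (%t x. f1 t x + f2 t x)" "f1 : L1_time T (L1_norm UNIV)" "f2 : L1_time T Linf_norm"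
 using hG unfolding sum_space_def by blast
 obtain d1 d2 where d: "weak_div T b = (%t x. d1 t x + d2 t x)" "d1 : L1_time T Linf_norm" "d2 : L1_time T ExpL_logL_norm"
 using hD unfolding sum_space_def by blast
 obtain n1 where n1: "ilb (%t. iT T t * n1 t)" "ALL t. n1 t >= 0"
 "AL t. t : {0<..<T} --> L1_norm UNIV (f1 t) = ennreal (n1 t)" using time_rep[OF f(2)] by blast
 obtain n2 where n2: "ilb (%t. iT T t * n2 t)" "ALL t. n2 t >= 0"
 "AL t. t : {0<..<T} --> Linf_norm (f2 t) = ennreal (n2 t)" using time_rep[OF f(3)] by blast
 obtain n3 where n3: "ilb (%t. iT T t * n3 t)" "ALL t. n3 t >= 0"
 "AL t. t : {0<..<T} --> Linf_norm (d1 t) = ennreal (n3 t)" using time_rep[OF d(2)] by blast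
 obtain n4 where n4: "ilb (%t. iT T t * n4 t)" "ALL t. n4 t >= 0"
 "AL t. t : {0<..<T} --> ExpL_logL_norm (d2 t) = ennreal (n4 t)" using time_rep[OF d(3)] by blast
 \<comment> \<open>A single majorant for the three norms; the summand 1 gives a >= 1 and places a
   strictly above the Orlicz norm, as \<open>ExpL_rep\<close> requires.\<close>
 define a where "a t = n2 t + n3 t + n4 t + 1" for t
 have a: "a t >= 1" "n2 t <= a t" "n3 t <= a t" "n4 t + 1 <= a t" for t using n2(2) n3(2) n4(2) by (auto simp: a_def add_increasing)
 have ia: "ilb (%t. iT T t * a t)"
 proof -
 have "ilb (%t. (iT T t * n2 t + iT T t * n3 t) + (iT T t * n4 t + iT T t :: real))"
 using n2(1) n3(1) n4(1) T by (intro iadd) (auto simp: integrable_indicator_iff)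
 then show ?thesis by (simp add: a_def algebra_simps)
 qed
 have "(%(t, x). f1 t x) : borel_measurable (spacetime T)" using f(2) by (auto simp: L1_time_def)
 then obtain be0 where [measurable]: "be0 : bm2" and be0: "AL t. t : {0<..<T} --> (AL x. f1 t x = be0 (t, x))"
 by (rule space_rep) (rule that; assumption)
 define be where "be t x = be0 (t, x)" for t x
 have bem: "(%(t, x). be t x) : bm2" unfolding be_def by measurable
 have beae: "AL t. t : {0<..<T} --> (AL x. f1 t x = be t x)" using be0 by (simp add: be_def)
 have bes: "be t : bm" for t unfolding be_def by measurable
 have befin: "(NN t. \<integral>\<^sup>+x. ennreal (iT T t * \<bar>be t x\<bar>) \<partial>lborel) < \<infinity>"
 proof -
 have "(NN t. \<integral>\<^sup>+x. ennreal (iT T t * \<bar>be t x\<bar>) \<partial>lborel) <= (NN t. ennreal (iT T t * n1 t))"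
 proof (rule nn_integral_mono_AE, use n1(3) beae in eventually_elim)
 case (elim t)
 show ?case
 proof (cases "t : {0<..<T}")
  case True
  then have ae: "AL x. f1 t x = be t x" using elim by blast
  have "ennreal (n1 t) = (NN x. ennreal \<bar>f1 t x\<bar>)"
  using elim(1) True lebesgue_measurable_AE[OF bes ae] by (simp add: L1_norm_def lebesgue_on_UNIV_eq nn_integral_completion)
  also have "... = (NN x. ennreal \<bar>be t x\<bar>)" by (rule nn_integral_cong_AE) (use ae in \<open>eventually_elim, simp\<close>)
  finally show ?thesis using True by simp
 qed simp
 qed
 also have "... < \<infinity>" using n1(2) by (simp add: nn_integral_eq_integral[OF n1(1)])
 finally show ?thesis .
 qed
 have gb: "AL t. t : {0<..<T} --> (AL x. norm (b' t x) <= (1 + norm x) * (\<bar>be t x\<bar> + a t))" using n2(3) beae hb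
 proof (eventually_elim, intro impI)
 fix t assume 1: "t : {0<..<T} --> Linf_norm (f2 t) = ennreal (n2 t)" and 2: "t : {0<..<T} --> (AL x. f1 t x = be t x)"
 and 3: "t : {0<..<T} --> (AL x. b t x = b' t x)" and t: "t : {0<..<T}"
 have "AL x. norm (f2 t x) <= n2 t" by (rule Linf_norm_ae) (use 1 t n2(2) in auto)
 with 2[rule_format, OF t] 3[rule_format, OF t] show "AL x. norm (b' t x) <= (1 + norm x) * (\<bar>be t x\<bar> + a t)"
 proof eventually_elim
 case (elim x)
 have p: "1 + norm x > 0" using norm_ge_zero[of x] by linarith
 have "norm (b t x) / (1 + norm x) = f1 t x + f2 t x" using fun_cong[OF fun_cong[OF f(1)], of t x] .
 then have "norm (b t x) = (1 + norm x) * (f1 t x + f2 t x)" using p by (simp add: field_simps)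
 also have "... <= (1 + norm x) * (\<bar>be t x\<bar> + a t)" using elim a(2)[of t] p by (intro mult_left_mono add_mono) auto
 finally show ?case using elim by simp
 qed
 qed
 have gd: "AL t. t : {0<..<T} --> (\<exists>de\<in>bm. (AL x. \<bar>d t x\<bar> <= a t + \<bar>de x\<bar>)
 & (NN x. ennreal (orlicz_P (\<bar>de x\<bar> / a t))) <= 1)" using n3(3) n4(3) wd
 proof (eventually_elim, intro impI)
 fix t assume 1: "t : {0<..<T} --> Linf_norm (d1 t) = ennreal (n3 t)" and 2: "t : {0<..<T} --> ExpL_logL_norm (d2 t) = ennreal (n4 t)"
 and 3: "t : {0<..<T} --> (AL x. weak_div T b t x = d t x)" and t: "t : {0<..<T}"
 have e1: "AL x. norm (d1 t x) <= n3 t" by (rule Linf_norm_ae) (use 1 t n3(2) in auto)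
 obtain de where de: "de : bm" "AL x. d2 t x = de x" "(NN x. ennreal (orlicz_P (\<bar>de x\<bar> / a t))) <= 1"
 using ExpL_rep[OF 2[rule_format, OF t] _ a(4)] n4(2) by blast
 have "AL x. \<bar>d t x\<bar> <= a t + \<bar>de x\<bar>" using e1 de(2) 3[rule_format, OF t]
 proof eventually_elim
 case (elim x)
 have "d t x = d1 t x + de x" using elim(2,3) fun_cong[OF fun_cong[OF d(1)], of t x] by simp
 then show ?case using elim(1) a(3)[of t] abs_triangle_ineq[of "d1 t x" "de x"] by simp
 qed
 with de show "\<exists>de\<in>bm. (AL x. \<bar>d t x\<bar> <= a t + \<bar>de x\<bar>) & (NN x. ennreal (orlicz_P (\<bar>de x\<bar> / a t))) <= 1" by blast
 qed
 obtain v0 K where v0: "v0 : bm" "ALL x. \<bar>v0 x\<bar> <= K" "AL x. u0 x = v0 x" using Linf_rep[OF u0] by blast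
 obtain u where u: "u : bm" "ALL z. \<bar>u z\<bar> <= K"
 "ALL ph. spacetime_test_function T ph --> (LL z. transport ph z * u z) = - (LL x. v0 x * ph (0, x))"
 using solution[OF v0(1) v0(2)[rule_format]] by blast
 have ub: "\<bar>u z\<bar> <= K" for z using u(2) by blast
 have um [measurable]: "u : bm2" using u(1) by (simp add: borel_prod)
 have init: "(LINT x|lebesgue. u0 x * ph (0, x)) = (LL x. v0 x * ph (0, x))" if ph: "spacetime_test_function T ph" for ph
 proof (rule lebesgue_integral_AE(1))
 have "smooth ph" using ph by (simp add: spacetime_test_function_def)
 note [measurable] = smooth_measurable(1)[OF this] v0(1)
 show "(%x. v0 x * ph (0, x)) : bm" by measurable
 qed (use v0(3) in \<open>eventually_elim, simp\<close>)
 have ws: "weak_solution T b u0 (%t x. u (t, x))" unfolding weak_solution_def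
 proof (intro conjI allI impI bounded_spacetime(1)[OF u(1) ub])
 fix ph :: "real \<times> 'a => real" assume ph: "spacetime_test_function T ph"
 have "(LINT t:{0<..<T}|lebesgue. LINT x|lebesgue. u (t, x) * deriv (%s. ph (s, x)) t)
 + (LINT t:{0<..<T}|lebesgue. LINT x|lebesgue. u (t, x) * weak_div T (%t x. ph (t, x) *\<^sub>R b t x) t x) = (LL z. transport ph z * u z)"
 by (rule weak_identity[OF ph um ub _ hb]) simp
 with u(3)[rule_format, OF ph] init[OF ph]
 show "- (LINT t:{0<..<T}|lebesgue. LINT x|lebesgue. u (t, x) * deriv (%s. ph (s, x)) t) - (LINT x|lebesgue. u0 x * ph (0, x))
 - (LINT t:{0<..<T}|lebesgue. LINT x|lebesgue. u (t, x) * weak_div T (%t x. ph (t, x) *\<^sub>R b t x) t x) = 0" by linarith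
 qed
 have "AE (t, x) in spacetime T. v t x = u (t, x)" if v: "v : Linf_time T Linf_norm" "weak_solution T b u0 v" for v
 proof -
 have "(%(t, x). v t x) : borel_measurable (spacetime T)" using v(1) by (auto simp: Linf_time_def)
 then obtain V where [measurable]: "V : bm2" and V: "AL z. z : {0<..<T} \<times> UNIV --> (%(t, x). v t x) z = V z"
 "AL t. t : {0<..<T} --> (AL x. v t x = V (t, x))" by (rule space_rep)
 define L where "L = enn2real (esssup (lebesgue_on {0<..<T}) (%t. Linf_norm (v t)))"
 have "esssup (lebesgue_on {0<..<T}) (%t. Linf_norm (v t)) = ennreal L" using v(1) by (simp add: L_def Linf_time_def top.not_eq_extremum)
 with esssup_AE[of "%t. Linf_norm (v t)" "lebesgue_on {0<..<T}"] have L: "AL t. t : {0<..<T} --> Linf_norm (v t) <= ennreal L" unfolding ae_on by simp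
 have L0: "L >= 0" by (simp add: L_def)
 \<comment> \<open>The representative is clipped to be bounded everywhere; for almost every t this
   changes the slice on a null set only.\<close>
 define V' where "V' z = max (- L) (min L (V z))" for z
 have [measurable]: "V' : bm2" unfolding V'_def by measurable
 have V'b: "\<bar>V' z\<bar> <= L" for z using L0 by (auto simp: V'_def)
 have V'ae: "AL t. t : {0<..<T} --> (AL x. v t x = V' (t, x))" using L V(2)
 proof (eventually_elim, intro impI)
 fix t assume 1: "t : {0<..<T} --> Linf_norm (v t) <= ennreal L" and 2: "t : {0<..<T} --> (AL x. v t x = V (t, x))" and t: "t : {0<..<T}"
 have "AL x. norm (v t x) <= L" by (rule Linf_norm_ae) (use 1 t L0 in auto)
 with 2[rule_format, OF t] show "AL x. v t x = V' (t, x)" by eventually_elim (auto simp: V'_def)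
 qed
 define w where "w z = u z - V' z" for z
 have wm [measurable]: "w : bm2" unfolding w_def by measurable
 have wb: "\<bar>w z\<bar> <= K + L" for z using ub[of z] V'b[of z] by (simp add: w_def)
 have zero: "(LL z. transport ph z * w z) = 0" if ph: "spacetime_test_function T ph" for ph
 proof -
 have "(LINT t:{0<..<T}|lebesgue. LINT x|lebesgue. v t x * deriv (%s. ph (s, x)) t)
  + (LINT t:{0<..<T}|lebesgue. LINT x|lebesgue. v t x * weak_div T (%t x. ph (t, x) *\<^sub>R b t x) t x) = (LL z. transport ph z * V' z)"
  by (rule weak_identity[OF ph _ V'b V'ae hb]) measurable
 moreover have "- (LINT t:{0<..<T}|lebesgue. LINT x|lebesgue. v t x * deriv (%s. ph (s, x)) t) - (LINT x|lebesgue. u0 x * ph (0, x))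
  - (LINT t:{0<..<T}|lebesgue. LINT x|lebesgue. v t x * weak_div T (%t x. ph (t, x) *\<^sub>R b t x) t x) = 0"
  using v(2) ph unfolding weak_solution_def by blast
 ultimately have "(LL z. transport ph z * V' z) = - (LL x. v0 x * ph (0, x))" using init[OF ph] by linarith
 moreover have "ilb (%z. transport ph z * u z)" "ilb (%z. transport ph z * V' z)"
  by (rule transport_split(2)[OF ph um ub], rule transport_split(2)[OF ph _ V'b], measurable)
 ultimately show ?thesis using u(3)[rule_format, OF ph] by (simp add: w_def right_diff_distrib)
 qed
 interpret transported_growth T b' M d "%t x. w (t, x)" "K + L" be a
 proof unfold_locales
 show "(%(t, x). w (t, x)) : bm2" by measurable
 show "(LL t. iT T t * (frechet_derivative th (at t) 1 * conv (%x. w (t, x)) (moll e) x))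
 = - (LL t. th t * (iT T t * flux (%x. w (t, x)) (b' t) (d t) e x))"
  if "e > 0" "smooth th" "\<exists>de>0. \<forall>t>T - de. th t = 0" for e x th
  by (rule evolution_from_transport[OF wm wb zero that])
 qed (fact wb dd bem befin a(1) ia gb gd)+
 \<comment> \<open>The claim is proved for the unclipped \<open>V\<close>, which agrees with v
   almost everywhere in space-time. Returning from almost every slice to almost every point uses
   that the exceptional set is measurable.\<close>
 have "AL t. AL x. t : {0<..<T} --> V (t, x) = u (t, x)" using vanish V'ae V(2)
 proof eventually_elim
 case (elim t)
 show ?case
 proof (cases "t : {0<..<T}")
  case True
  have "AL x. w (t, x) = 0" "AL x. v t x = V' (t, x)" "AL x. v t x = V (t, x)" using elim True by blast+
  then show ?thesis by eventually_elim (auto simp: w_def)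
 qed auto
 qed
 moreover have "{z : space (lborel \<Otimes>\<^sub>M lborel). fst z : {0<..<T} --> V z = u z} : sets (lborel \<Otimes>\<^sub>M (lborel :: 'a measure))" by measurable
 ultimately have "AE z in lborel \<Otimes>\<^sub>M lborel. fst z : {0<..<T} --> V z = u z" by (intro lborel_pair.AE_pair_measure) auto
 then have "AL z. fst z : {0<..<T} --> V z = u z" by (simp only: lborel_prod)
 with V(1) have "AL z. z : {0<..<T} \<times> UNIV --> (case z of (t, x) => v t x = u (t, x))" by eventually_elim auto
 then show ?thesis unfolding spacetime_def AE_lebesgue_on_iff[OF strip_borel] .
 qed
 then show ?thesis using ws bounded_spacetime(2)[OF u(1) ub] by (intro bexI[of _ "%t x. u (t, x)"]) auto
qed

theorem theorem1:
  fixes T :: real and b :: "real \<Rightarrow> real ^ 'n \<Rightarrow> real ^ 'n"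
  assumes "T > 0"
    and "b \<in> L1_time_loc T W11_norm"
    and "(\<lambda>t x. norm (b t x) / (1 + norm x))
           \<in> sum_space (L1_time T (L1_norm UNIV)) (L1_time T Linf_norm)"
    and "weak_div T b \<in> sum_space (L1_time T Linf_norm) (L1_time T ExpL_logL_norm)"
  shows "\<forall>u0 \<in> Linf. \<exists>u \<in> Linf_time T Linf_norm. weak_solution T b u0 u \<and>
           (\<forall>v \<in> Linf_time T Linf_norm. weak_solution T b u0 v \<longrightarrow>
              (AE (t, x) in spacetime T. v t x = u t x))"
  using wellposed[OF assms] by blast

end
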